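(* Let $K$ be an arbitrary field and let $(A,d,\pi)$ be any associative differential algebra over $K$, regarded as an $A_\infty$-algebra with $\pi_0=\pi$ and $\pi_n=0$ for $n>0$. Then the cyclic homology $HC(A)$ is isomorphic (as a graded $K$-module) to the cyclic homology $HC(H(A))$ of the $A_\infty$-algebra of homologies $(H(A),d=0,\pi_n)$ of $(A,d,\pi)$.
   Context: All modules are $K$-modules, all maps $K$-linear, $\otimes=\otimes_K$. Tensor products of graded maps follow the Koszul rule $(\varphi\otimes\psi)(a\otimes b)=(-1)^{|\psi||a|}\varphi(a)\otimes\psi(b)$, and $A^{\otimes n}$ carries the usual tensor differential. An associative differential algebra $(A,d,\pi)$ is a differential module $A=\{A_n\}_{n\ge0}$, $d:A_\bullet\to A_{\bullet-1}$, with an associative multiplication $\pi:A\otimes A\to A$ of degree $0$ that is a chain map (no unit is required). $A_\infty$-algebras. An $A_\infty$-algebra $(A,d,\pi_n)$ is a differential module $A=\{A_n\}_{n\ge 0}$, $d:A_\bullet\to A_{\bullet-1}$, with maps $\pi_n:(A^{\otimes(n+2)})_\bullet\to A_{\bullet+n}$, $n\ge 0$, satisfying for all $n\ge -1$ $$d(\pi_{n+1})=\sum_{m=0}^n\sum_{t=1}^{m+2}(-1)^{t(n-m+1)+n+1}\pi_m(1^{\otimes(t-1)}\otimes\pi_{n-m}\otimes 1^{\otimes(m-t+2)}),$$ where $d(\pi_{n+1})=d\pi_{n+1}+(-1)^n\pi_{n+1}d$. A morphism $f:(A,d,\pi_n)\to(A',d,\pi_n)$ is a family $f_n:(A^{\otimes(n+1)})_\bullet\to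 A'_{\bullet+n}$, $n\ge 0$, with, for all $n\ge -1$, $$d(f_{n+1})=\sum_{m=0}^n\sum_{t=1}^{m+1}(-1)^{t(n-m+1)+n+1}f_m(1^{\otimes(t-1)}\otimes\pi_{n-m}\otimes1^{\otimes(m-t+1)})-\sum_{m=0}^n\sum_{J_{n-m}}(-1)^{\varepsilon}\pi_m(f_{n_1}\otimes\dots\otimes f_{n_{m+2}}),$$ where $d(f_{n+1})=df_{n+1}+(-1)^nf_{n+1}d$, $J_{n-m}=\{n_1,\dots,n_{m+2}\ge 0\mid n_1+\dots+n_{m+2}=n-m\}$, $\varepsilon=\sum_{i=1}^{m+1}(n_i+1)(n_{i+1}+\dots+n_{m+2})$. Composition: $(gf)_{n+1}=\sum_{m=-1}^n\sum_{J_{n-m}}(-1)^\varepsilon g_{m+1}(f_{n_1}\otimes\dots\otimes f_{n_{m+2}})$, $n\ge -1$; the identity $1_A$ has $(1_A)_0=\mathrm{id}_A$, $(1_A)_n=0$ for $n\ge 1$. A homotopy between morphisms $f,g:(A,d,\pi_n)\to(A',d,\pi_n)$ is a family $h_n:(A^{\otimes(n+1)})_\bullet\to A'_{\bullet+n+1}$, $n\ge 0$, with, for all $n\ge -1$, $$d(h_{n+1})=f_{n+1}-g_{n+1}+\sum_{m=0}^n\sum_{t=1}^{m+1}(-1)^{t(n-m+1)+n}h_m(1^{\otimes(t-1)}\otimes\pi_{n-m}\otimes1^{\otimes(m-t+1)})+\sum_{m=0}^n\sum_{J_{n-m}}\sum_{i=1}^{m+2}(-1)^{\varrho}\pi_m(g_{n_1}\otimes\dots\otimes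 g_{n_{i-1}}\otimes h_{n_i}\otimes f_{n_{i+1}}\otimes\dots\otimes f_{n_{m+2}}),$$ where $d(h_{n+1})=dh_{n+1}+(-1)^{n+1}h_{n+1}d$, $\varrho=m+\sum_{k=1}^{m+1}(n_k+1)(n_{k+1}+\dots+n_{m+2})+\sum_{k=1}^{i-1}n_k$. A morphism $f:A\to A'$ is a homotopy equivalence if there is a morphism $g:A'\to A$ with $gf$ homotopic to $1_A$ and $fg$ homotopic to $1_{A'}$. The $A_\infty$-algebra of homologies. It is known (Kadeishvili) that for an $A_\infty$-algebra $(A,d,\pi_n)$ over a field, the homology $H(A)$ of the chain complex $(A,d)$ carries an $A_\infty$-algebra structure $(H(A),d=0,\pi_n)$ such that there is a homotopy equivalence of $A_\infty$-algebras $(A,d,\pi_n)\to(H(A),d=0,\pi_n)$; $H(A)$ with such a structure is the $A_\infty$-algebra of homologies. Cyclic homology $HC(A)$ of an $A_\infty$-algebra. Let $X_{n,m}=\mathcal L(A)_{n,m}=(A^{\otimes(n+1)})_m$ for $n,m\ge 0$, $d(a_0\otimes\dots\otimes a_n)=\sum_i(-1)^{|a_0|+\dots+|a_{i-1}|}a_0\otimes\dots\otimes d(a_i)\otimes\dots\otimes a_n$, $t_n(a_0\otimes\dots\otimes a_n)=(-1)^{|a_n|(|a_0|+\dots+|a_{n-1}|)}a_n\otimes a_0\otimes\dots\otimes a_{n-1}$. For $1\le k\le n$, $0\le i_1<\dots<i_k\le n$, let $\partial_{(i_1,\dots,i_k)}:X_{n,p}\to X_{n-k,p+k-1}$ be: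 $(-1)^{k(p-1)}1^{\otimes j}\otimes\pi_{k-1}\otimes1^{\otimes(n-k-j)}$ if $(i_1,\dots,i_k)=(j,j+1,\dots,j+k-1)$ with $0\le j\le n-k$; $(-1)^{q(k-1)}\partial_{(0,1,\dots,k-1)}t_n^q$ if $(i_1,\dots,i_k)=(0,1,\dots,k-q-1,n-q+1,n-q+2,\dots,n)$ with $1\le q\le k$; and $0$ otherwise. For $q\in\{0,1\}$ put $d_q^0=d$, $d_q^k=\sum_{0\le i_1<\dots<i_k\le n-q}(-1)^{i_1+\dots+i_k}\partial_{(i_1,\dots,i_k)}:X_{n,\bullet}\to X_{n-k,\bullet+k-1}$ for $k\ge 1$; $T_n=(-1)^nt_n$, $N_n=1+T_n+\dots+T_n^n$ on $X_{n,\bullet}$; $\overline X_n=\bigoplus_{k=0}^nX_{k,n-k}$, $b=\sum_id_0^i$, $b'=\sum_id_1^i:\overline X_n\to\overline X_{n-1}$; $\overline T_n,\overline N_n$ act on $X_{k,n-k}\subset\overline X_n$ by $T_k,N_k$. The chain bicomplex $C(\overline X)$ has $C(\overline X)_{n,m}=\overline X_n$ ($n,m\ge 0$), $D_1:C(\overline X)_{n,m}\to C(\overline X)_{n,m-1}$ equal to $1-\overline T_n$ for $m$ odd, $\overline N_n$ for $m$ even (zero for $m=0$), and $D_2:C(\overline X)_{n,m}\to C(\overline X)_{n-1,m}$ equal to $b$ for $m$ even, $-b'$ for $m$ odd. $HC(A)$ is the graded homology of the total complex $\mathrm{Tot}(C(\overline X))$ with differential $D=D_1+D_2$. *)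

theory Defs
  imports "HOL-Algebra.Module" "HOL-Algebra.AbelCoset"
begin

text \<open>
  Graded modules are families of modules indexed by the degree in \<^typ>\<open>nat\<close>.  A differential lowers
  the degree by one; as the index \<open>0 - 1\<close> is \<open>0\<close> on natural numbers, the component
  \<open>A\<^sub>0 \<rightarrow> A\<^sub>-\<^sub>1 = 0\<close> of a differential is represented by the zero map from \<open>A 0\<close> to \<open>A 0\<close>.
\<close>

section \<open>Modules\<close>

text \<open>\<open>signed M e x\<close> is \<open>(-1)^e x\<close> in \<open>M\<close>.\<close>

definition signed :: "('k, 'a) module \<Rightarrow> nat \<Rightarrow> 'a \<Rightarrow> 'a" where
  "signed M e x = (if even e then x else \<ominus>\<^bsub>M\<^esub> x)"

definition linear_maps ::
  "'k ring \<Rightarrow> ('k, 'a) module \<Rightarrow> ('k, 'b) module \<Rightarrow> ('a \<Rightarrow> 'b) set" where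
  "linear_maps K M N = {\<phi> \<in> carrier M \<rightarrow> carrier N.
     (\<forall>x \<in> carrier M. \<forall>y \<in> carrier M. \<phi> (x \<oplus>\<^bsub>M\<^esub> y) = \<phi> x \<oplus>\<^bsub>N\<^esub> \<phi> y) \<and>
     (\<forall>c \<in> carrier K. \<forall>x \<in> carrier M. \<phi> (c \<odot>\<^bsub>M\<^esub> x) = c \<odot>\<^bsub>N\<^esub> \<phi> x)}"

text \<open>
  The type \<^typ>\<open>('k, 'a) module\<close> extends the ring record, so it has multiplicative fields; these
  are irrelevant for modules and left unspecified in the constructions below.
\<close>

definition quotient_module :: "('k, 'a) module \<Rightarrow> 'a set \<Rightarrow> ('k, 'a set) module" where
  "quotient_module M N =
     \<lparr>carrier = a_rcosets\<^bsub>M\<^esub> N, mult = undefined, one = undefined,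
      zero = N, add = set_add M,
      smult = (\<lambda>c C. \<Union>x\<in>C. N +>\<^bsub>M\<^esub> (c \<odot>\<^bsub>M\<^esub> x))\<rparr>"

definition direct_sum :: "nat set \<Rightarrow> (nat \<Rightarrow> ('k, 'a) module) \<Rightarrow> ('k, nat \<Rightarrow> 'a) module" where
  "direct_sum I M =
     \<lparr>carrier = {x \<in> (\<Pi>\<^sub>E i\<in>I. carrier (M i)). finite {i \<in> I. x i \<noteq> \<zero>\<^bsub>M i\<^esub>}},
      mult = undefined, one = undefined,
      zero = (\<lambda>i\<in>I. \<zero>\<^bsub>M i\<^esub>), add = (\<lambda>x y. \<lambda>i\<in>I. x i \<oplus>\<^bsub>M i\<^esub> y i),
      smult = (\<lambda>c x. \<lambda>i\<in>I. c \<odot>\<^bsub>M i\<^esub> x i)\<rparr>"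

definition free_module :: "'k ring \<Rightarrow> 's set \<Rightarrow> ('k, 's \<Rightarrow> 'k) module" where
  "free_module K S =
     \<lparr>carrier = {u \<in> UNIV \<rightarrow> carrier K. finite {s. u s \<noteq> \<zero>\<^bsub>K\<^esub>} \<and> {s. u s \<noteq> \<zero>\<^bsub>K\<^esub>} \<subseteq> S},
      mult = undefined, one = undefined,
      zero = (\<lambda>s. \<zero>\<^bsub>K\<^esub>), add = (\<lambda>u v s. u s \<oplus>\<^bsub>K\<^esub> v s),
      smult = (\<lambda>c u s. c \<otimes>\<^bsub>K\<^esub> u s)\<rparr>"

definition basis_vector :: "'k ring \<Rightarrow> 's \<Rightarrow> ('s \<Rightarrow> 'k)" where
  "basis_vector K s = (\<lambda>t. if t = s then \<one>\<^bsub>K\<^esub> else \<zero>\<^bsub>K\<^esub>)"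

definition module_span :: "'k ring \<Rightarrow> ('k, 'a) module \<Rightarrow> 'a set \<Rightarrow> 'a set" where
  "module_span K M G = \<Inter>{N. submodule N K M \<and> G \<subseteq> N}"

type_synonym ('k, 'a) graded_module = "nat \<Rightarrow> ('k, 'a) module"

definition graded_isomorphic ::
  "'k ring \<Rightarrow> ('k, 'a) graded_module \<Rightarrow> ('k, 'b) graded_module \<Rightarrow> bool" where
  "graded_isomorphic K V W \<longleftrightarrow>
     (\<exists>\<phi>. \<forall>n. \<phi> n \<in> linear_maps K (V n) (W n) \<and> bij_betw (\<phi> n) (carrier (V n)) (carrier (W n)))"

definition differential_module ::
  "'k ring \<Rightarrow> ('k, 'a) graded_module \<Rightarrow> (nat \<Rightarrow> 'a \<Rightarrow> 'a) \<Rightarrow> bool" where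
  "differential_module K A d \<longleftrightarrow>
     (\<forall>n. module K (A n)) \<and>
     (\<forall>n. d n \<in> linear_maps K (A n) (A (n - 1))) \<and>
     (\<forall>a \<in> carrier (A 0). d 0 a = \<zero>\<^bsub>A 0\<^esub>) \<and>
     (\<forall>n. \<forall>a \<in> carrier (A n). d (n - 1) (d n a) = \<zero>\<^bsub>A (n - 1 - 1)\<^esub>)"

definition homology ::
  "('k, 'a) graded_module \<Rightarrow> (nat \<Rightarrow> 'a \<Rightarrow> 'a) \<Rightarrow> ('k, 'a set) graded_module" where
  "homology A d n =
     quotient_module
       ((A n)\<lparr>carrier := {a \<in> carrier (A n). d n a = \<zero>\<^bsub>A (n - 1)\<^esub>}\<rparr>)
       (d (n + 1) ` carrier (A (n + 1)))"

definition zero_differential :: "('k, 'a) graded_module \<Rightarrow> nat \<Rightarrow> 'a \<Rightarrow> 'a" where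
  "zero_differential A n a = \<zero>\<^bsub>A (n - 1)\<^esub>"


section \<open>Tensor powers of graded modules\<close>

text \<open>
  \<open>tensor_power K A r p\<close> is \<open>(A\<^sup>\<otimes>\<^sup>r)\<^sub>p\<close>, the direct sum of the \<open>A\<^sub>i\<^sub>1 \<otimes> \<dots> \<otimes> A\<^sub>i\<^sub>r\<close> over
  \<open>i\<^sub>1 + \<dots> + i\<^sub>r = p\<close>.  It is the free module on the words \<open>[(i\<^sub>1, a\<^sub>1), \<dots>, (i\<^sub>r, a\<^sub>r)]\<close> with
  \<open>a\<^sub>j \<in> A\<^sub>i\<^sub>j\<close> and total degree \<open>p\<close>, modulo the relations of multilinearity.
\<close>

type_synonym 'a hword = "(nat \<times> 'a) list"
type_synonym ('k, 'a) tensor = "('a hword \<Rightarrow> 'k) set"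

definition word_degree :: "'a hword \<Rightarrow> nat" where
  "word_degree xs = sum_list (map fst xs)"

definition homogeneous_words :: "('k, 'a) graded_module \<Rightarrow> nat \<Rightarrow> nat \<Rightarrow> 'a hword set" where
  "homogeneous_words A r p =
     {xs. length xs = r \<and> word_degree xs = p \<and> (\<forall>(i, a) \<in> set xs. a \<in> carrier (A i))}"

definition tensor_relations ::
  "'k ring \<Rightarrow> ('k, 'a) graded_module \<Rightarrow> nat \<Rightarrow> nat \<Rightarrow> ('a hword \<Rightarrow> 'k) set" where
  "tensor_relations K A r p =
     (let F = free_module K (homogeneous_words A r p); e = basis_vector K in
      {e (us @ (i, a \<oplus>\<^bsub>A i\<^esub> b) # vs) \<ominus>\<^bsub>F\<^esub> (e (us @ (i, a) # vs) \<oplus>\<^bsub>F\<^esub> e (us @ (i, b) # vs)) | us i a b vs.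
         us @ (i, a) # vs \<in> homogeneous_words A r p \<and> b \<in> carrier (A i)} \<union>
      {e (us @ (i, c \<odot>\<^bsub>A i\<^esub> a) # vs) \<ominus>\<^bsub>F\<^esub> (c \<odot>\<^bsub>F\<^esub> e (us @ (i, a) # vs)) | us i c a vs.
         us @ (i, a) # vs \<in> homogeneous_words A r p \<and> c \<in> carrier K})"

definition tensor_null ::
  "'k ring \<Rightarrow> ('k, 'a) graded_module \<Rightarrow> nat \<Rightarrow> nat \<Rightarrow> ('a hword \<Rightarrow> 'k) set" where
  "tensor_null K A r p =
     module_span K (free_module K (homogeneous_words A r p)) (tensor_relations K A r p)"

definition tensor_power ::
  "'k ring \<Rightarrow> ('k, 'a) graded_module \<Rightarrow> nat \<Rightarrow> ('k, ('k, 'a) tensor) graded_module" where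
  "tensor_power K A r p =
     quotient_module (free_module K (homogeneous_words A r p)) (tensor_null K A r p)"

text \<open>The class \<open>a\<^sub>1 \<otimes> \<dots> \<otimes> a\<^sub>r\<close> of the word \<open>[(i\<^sub>1, a\<^sub>1), \<dots>, (i\<^sub>r, a\<^sub>r)]\<close>:\<close>

definition pure_tensor ::
  "'k ring \<Rightarrow> ('k, 'a) graded_module \<Rightarrow> 'a hword \<Rightarrow> ('k, 'a) tensor" where
  "pure_tensor K A xs =
     tensor_null K A (length xs) (word_degree xs)
       +>\<^bsub>free_module K (homogeneous_words A (length xs) (word_degree xs))\<^esub> basis_vector K xs"

text \<open>
  The linear map into \<open>M\<close> that sends each pure tensor \<open>a\<^sub>1 \<otimes> \<dots> \<otimes> a\<^sub>r\<close> to
  \<open>F [(i\<^sub>1, a\<^sub>1), \<dots>, (i\<^sub>r, a\<^sub>r)]\<close>, computed on a representative.  It is used only for multilinear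
  \<open>F\<close>, for which the value does not depend on the representative.
\<close>

definition tensor_lift ::
  "'k ring \<Rightarrow> ('k, 'b) module \<Rightarrow> ('a hword \<Rightarrow> 'b) \<Rightarrow> ('k, 'a) tensor \<Rightarrow> 'b" where
  "tensor_lift K M F x =
     (let u = (SOME u. u \<in> x) in \<Oplus>\<^bsub>M\<^esub>xs\<in>{xs. u xs \<noteq> \<zero>\<^bsub>K\<^esub>}. u xs \<odot>\<^bsub>M\<^esub> F xs)"

text \<open>
  The differential \<open>(A\<^sup>\<otimes>\<^sup>r)\<^sub>p \<rightarrow> (A\<^sup>\<otimes>\<^sup>r)\<^sub>p\<^sub>-\<^sub>1\<close>.  Tensor factors of degree \<open>0\<close> are killed by \<open>d\<close>,
  hence contribute no summand.
\<close>

definition tensor_differential ::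
  "'k ring \<Rightarrow> ('k, 'a) graded_module \<Rightarrow> (nat \<Rightarrow> 'a \<Rightarrow> 'a) \<Rightarrow> nat \<Rightarrow> nat
     \<Rightarrow> ('k, 'a) tensor \<Rightarrow> ('k, 'a) tensor" where
  "tensor_differential K A d r p =
     (let T = tensor_power K A r (p - 1) in
      tensor_lift K T (\<lambda>xs. \<Oplus>\<^bsub>T\<^esub>i\<in>{i. i < length xs \<and> 0 < fst (xs ! i)}.
        signed T (word_degree (take i xs))
          (pure_tensor K A (xs[i := (fst (xs ! i) - 1, d (fst (xs ! i)) (snd (xs ! i)))]))))"

text \<open>
  A graded map \<open>(A\<^sup>\<otimes>\<^sup>k)\<^sub>\<bullet> \<rightarrow> B\<^sub>\<bullet>\<^sub>+\<^sub>e\<close> is given by its components \<open>\<phi> p\<close> on \<open>(A\<^sup>\<otimes>\<^sup>k)\<^sub>p\<close>.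
  A list of triples \<open>(k, e, \<phi>)\<close> stands for the tensor product \<open>\<phi>\<^sub>1 \<otimes> \<dots> \<otimes> \<phi>\<^sub>s\<close> of such maps.  By
  iteration of the Koszul rule, on a concatenation of blocks \<open>w\<^sub>1 \<dots> w\<^sub>s\<close> its sign exponent is the
  sum of the \<open>(|\<phi>\<^sub>j\<^sub>+\<^sub>1| + \<dots> + |\<phi>\<^sub>s|) |w\<^sub>j|\<close>.
\<close>

definition graded_maps ::
  "'k ring \<Rightarrow> ('k, 'a) graded_module \<Rightarrow> ('k, 'b) graded_module \<Rightarrow> nat \<Rightarrow> nat
     \<Rightarrow> (nat \<Rightarrow> ('k, 'a) tensor \<Rightarrow> 'b) set" where
  "graded_maps K A B k e =
     {\<phi>. \<forall>p. \<phi> p \<in> linear_maps K (tensor_power K A k p) (B (p + e))}"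

type_synonym ('k, 'a, 'b) factor = "nat \<times> nat \<times> (nat \<Rightarrow> ('k, 'a) tensor \<Rightarrow> 'b)"

definition factors_degree :: "('k, 'a, 'b) factor list \<Rightarrow> nat" where
  "factors_degree \<Phi> = sum_list (map (\<lambda>(k, e, \<phi>). e) \<Phi>)"

fun factors_apply ::
  "'k ring \<Rightarrow> ('k, 'a) graded_module \<Rightarrow> ('k, 'a, 'b) factor list \<Rightarrow> 'a hword \<Rightarrow> 'b hword" where
  "factors_apply K A [] xs = []"
| "factors_apply K A ((k, e, \<phi>) # \<Phi>) xs =
     (word_degree (take k xs) + e, \<phi> (word_degree (take k xs)) (pure_tensor K A (take k xs)))
       # factors_apply K A \<Phi> (drop k xs)"

fun koszul_exponent :: "('k, 'a, 'b) factor list \<Rightarrow> 'a hword \<Rightarrow> nat" where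
  "koszul_exponent [] xs = 0"
| "koszul_exponent ((k, e, \<phi>) # \<Phi>) xs =
     factors_degree \<Phi> * word_degree (take k xs) + koszul_exponent \<Phi> (drop k xs)"

definition tensor_map ::
  "'k ring \<Rightarrow> ('k, 'a) graded_module \<Rightarrow> ('k, 'b) graded_module \<Rightarrow> ('k, 'a, 'b) factor list
     \<Rightarrow> nat \<Rightarrow> ('k, 'a) tensor \<Rightarrow> ('k, 'b) tensor" where
  "tensor_map K A B \<Phi> p =
     (let T = tensor_power K B (length \<Phi>) (p + factors_degree \<Phi>) in
      tensor_lift K T
        (\<lambda>xs. signed T (koszul_exponent \<Phi> xs) (pure_tensor K B (factors_apply K A \<Phi> xs))))"

text \<open>The identification \<open>A\<^sup>\<otimes>\<^sup>1 = A\<close>:\<close>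

definition unary_id :: "'k ring \<Rightarrow> ('k, 'a) graded_module \<Rightarrow> nat \<Rightarrow> ('k, 'a) tensor \<Rightarrow> 'a" where
  "unary_id K A p = tensor_lift K (A p) (\<lambda>xs. snd (hd xs))"

text \<open>The factors of \<open>1\<^sup>\<otimes>\<^sup>i \<otimes> \<phi> \<otimes> 1\<^sup>\<otimes>\<^sup>j\<close>:\<close>

definition insert_factor ::
  "'k ring \<Rightarrow> ('k, 'a) graded_module \<Rightarrow> nat \<Rightarrow> ('k, 'a, 'a) factor \<Rightarrow> nat
     \<Rightarrow> ('k, 'a, 'a) factor list" where
  "insert_factor K A i \<phi> j =
     replicate i (1, 0, unary_id K A) @ \<phi> # replicate j (1, 0, unary_id K A)"


section \<open>Associative differential algebras and \<open>A\<^sub>\<infinity>\<close>-algebras\<close>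

definition assoc_differential_algebra ::
  "'k ring \<Rightarrow> ('k, 'a) graded_module \<Rightarrow> (nat \<Rightarrow> 'a \<Rightarrow> 'a)
     \<Rightarrow> (nat \<Rightarrow> ('k, 'a) tensor \<Rightarrow> 'a) \<Rightarrow> bool" where
  "assoc_differential_algebra K A d \<mu> \<longleftrightarrow>
     differential_module K A d \<and>
     \<mu> \<in> graded_maps K A A 2 0 \<and>
     (\<forall>p. \<forall>x \<in> carrier (tensor_power K A 2 p).
        d p (\<mu> p x) = \<mu> (p - 1) (tensor_differential K A d 2 p x)) \<and>
     (\<forall>p. \<forall>x \<in> carrier (tensor_power K A 3 p).
        \<mu> p (tensor_map K A A (insert_factor K A 0 (2, 0, \<mu>) 1) p x) =
        \<mu> p (tensor_map K A A (insert_factor K A 1 (2, 0, \<mu>) 0) p x))"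

text \<open>
  The relations for \<open>A\<^sub>\<infinity>\<close>-algebras, morphisms and homotopies are usually indexed by \<open>n \<ge> -1\<close>;
  below \<open>N = n + 1\<close>, so that \<open>n - m = N - 1 - m\<close> and \<open>0 \<le> m \<le> n\<close> becomes \<open>m < N\<close>.
  The case distinction on \<open>p = 0\<close> expresses that the differential of \<open>A\<^sup>\<otimes>\<^sup>r\<close> vanishes on
  degree \<open>0\<close>.
\<close>

definition A_infinity_algebra ::
  "'k ring \<Rightarrow> ('k, 'a) graded_module \<Rightarrow> (nat \<Rightarrow> 'a \<Rightarrow> 'a)
     \<Rightarrow> (nat \<Rightarrow> nat \<Rightarrow> ('k, 'a) tensor \<Rightarrow> 'a) \<Rightarrow> bool" where
  "A_infinity_algebra K A d \<pi> \<longleftrightarrow>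
     differential_module K A d \<and>
     (\<forall>n. \<pi> n \<in> graded_maps K A A (n + 2) n) \<and>
     (\<forall>N p. \<forall>x \<in> carrier (tensor_power K A (N + 2) p).
        let M = A (p + N - 1) in
        d (p + N) (\<pi> N p x) \<oplus>\<^bsub>M\<^esub>
          (if p = 0 then \<zero>\<^bsub>M\<^esub>
           else signed M (N + 1) (\<pi> N (p - 1) (tensor_differential K A d (N + 2) p x))) =
        (\<Oplus>\<^bsub>M\<^esub>m\<in>{..<N}. \<Oplus>\<^bsub>M\<^esub>t\<in>{1..m + 2}.
           signed M (t * (N - m) + N)
             (\<pi> m (p + (N - 1 - m))
               (tensor_map K A A
                 (insert_factor K A (t - 1) (N - 1 - m + 2, N - 1 - m, \<pi> (N - 1 - m)) (m + 2 - t))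
                 p x))))"

definition assoc_as_A_infinity ::
  "('k, 'a) graded_module \<Rightarrow> (nat \<Rightarrow> ('k, 'a) tensor \<Rightarrow> 'a)
     \<Rightarrow> nat \<Rightarrow> nat \<Rightarrow> ('k, 'a) tensor \<Rightarrow> 'a" where
  "assoc_as_A_infinity A \<mu> n p = (if n = 0 then \<mu> p else (\<lambda>x. \<zero>\<^bsub>A (p + n)\<^esub>))"

definition compositions :: "nat \<Rightarrow> nat \<Rightarrow> nat list set" where
  "compositions s r = {ns. length ns = r \<and> sum_list ns = s}"

definition eps :: "nat list \<Rightarrow> nat" where
  "eps ns = (\<Sum>i<length ns. (ns ! i + 1) * sum_list (drop (i + 1) ns))"

definition morphism_factors ::
  "(nat \<Rightarrow> nat \<Rightarrow> ('k, 'a) tensor \<Rightarrow> 'b) \<Rightarrow> nat list \<Rightarrow> ('k, 'a, 'b) factor list" where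
  "morphism_factors f ns = map (\<lambda>n. (n + 1, n, f n)) ns"

definition A_infinity_morphism ::
  "'k ring
     \<Rightarrow> ('k, 'a) graded_module \<Rightarrow> (nat \<Rightarrow> 'a \<Rightarrow> 'a) \<Rightarrow> (nat \<Rightarrow> nat \<Rightarrow> ('k, 'a) tensor \<Rightarrow> 'a)
     \<Rightarrow> ('k, 'b) graded_module \<Rightarrow> (nat \<Rightarrow> 'b \<Rightarrow> 'b) \<Rightarrow> (nat \<Rightarrow> nat \<Rightarrow> ('k, 'b) tensor \<Rightarrow> 'b)
     \<Rightarrow> (nat \<Rightarrow> nat \<Rightarrow> ('k, 'a) tensor \<Rightarrow> 'b) \<Rightarrow> bool" where
  "A_infinity_morphism K A d \<pi> A' d' \<pi>' f \<longleftrightarrow>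
     (\<forall>n. f n \<in> graded_maps K A A' (n + 1) n) \<and>
     (\<forall>N p. \<forall>x \<in> carrier (tensor_power K A (N + 1) p).
        let M = A' (p + N - 1) in
        d' (p + N) (f N p x) \<oplus>\<^bsub>M\<^esub>
          (if p = 0 then \<zero>\<^bsub>M\<^esub>
           else signed M (N + 1) (f N (p - 1) (tensor_differential K A d (N + 1) p x))) =
        (\<Oplus>\<^bsub>M\<^esub>m\<in>{..<N}. \<Oplus>\<^bsub>M\<^esub>t\<in>{1..m + 1}.
           signed M (t * (N - m) + N)
             (f m (p + (N - 1 - m))
               (tensor_map K A A
                 (insert_factor K A (t - 1) (N - 1 - m + 2, N - 1 - m, \<pi> (N - 1 - m)) (m + 1 - t))
                 p x))) \<ominus>\<^bsub>M\<^esub>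
        (\<Oplus>\<^bsub>M\<^esub>m\<in>{..<N}. \<Oplus>\<^bsub>M\<^esub>ns\<in>compositions (N - 1 - m) (m + 2).
           signed M (eps ns)
             (\<pi>' m (p + (N - 1 - m)) (tensor_map K A A' (morphism_factors f ns) p x))))"

definition A_infinity_comp ::
  "'k ring \<Rightarrow> ('k, 'a) graded_module \<Rightarrow> ('k, 'b) graded_module \<Rightarrow> ('k, 'c) graded_module
     \<Rightarrow> (nat \<Rightarrow> nat \<Rightarrow> ('k, 'b) tensor \<Rightarrow> 'c) \<Rightarrow> (nat \<Rightarrow> nat \<Rightarrow> ('k, 'a) tensor \<Rightarrow> 'b)
     \<Rightarrow> nat \<Rightarrow> nat \<Rightarrow> ('k, 'a) tensor \<Rightarrow> 'c" where
  "A_infinity_comp K A A' A'' g f N p x =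
     (let M = A'' (p + N) in
      \<Oplus>\<^bsub>M\<^esub>m\<in>{..N}. \<Oplus>\<^bsub>M\<^esub>ns\<in>compositions (N - m) (m + 1).
        signed M (eps ns) (g m (p + (N - m)) (tensor_map K A A' (morphism_factors f ns) p x)))"

definition A_infinity_id ::
  "'k ring \<Rightarrow> ('k, 'a) graded_module \<Rightarrow> nat \<Rightarrow> nat \<Rightarrow> ('k, 'a) tensor \<Rightarrow> 'a" where
  "A_infinity_id K A n p = (if n = 0 then unary_id K A p else (\<lambda>x. \<zero>\<^bsub>A (p + n)\<^esub>))"

definition A_infinity_homotopy ::
  "'k ring
     \<Rightarrow> ('k, 'a) graded_module \<Rightarrow> (nat \<Rightarrow> 'a \<Rightarrow> 'a) \<Rightarrow> (nat \<Rightarrow> nat \<Rightarrow> ('k, 'a) tensor \<Rightarrow> 'a)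
     \<Rightarrow> ('k, 'b) graded_module \<Rightarrow> (nat \<Rightarrow> 'b \<Rightarrow> 'b) \<Rightarrow> (nat \<Rightarrow> nat \<Rightarrow> ('k, 'b) tensor \<Rightarrow> 'b)
     \<Rightarrow> (nat \<Rightarrow> nat \<Rightarrow> ('k, 'a) tensor \<Rightarrow> 'b) \<Rightarrow> (nat \<Rightarrow> nat \<Rightarrow> ('k, 'a) tensor \<Rightarrow> 'b)
     \<Rightarrow> (nat \<Rightarrow> nat \<Rightarrow> ('k, 'a) tensor \<Rightarrow> 'b) \<Rightarrow> bool" where
  "A_infinity_homotopy K A d \<pi> A' d' \<pi>' f g h \<longleftrightarrow>
     (\<forall>n. h n \<in> graded_maps K A A' (n + 1) (n + 1)) \<and>
     (\<forall>N p. \<forall>x \<in> carrier (tensor_power K A (N + 1) p).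
        let M = A' (p + N) in
        d' (p + N + 1) (h N p x) \<oplus>\<^bsub>M\<^esub>
          (if p = 0 then \<zero>\<^bsub>M\<^esub>
           else signed M N (h N (p - 1) (tensor_differential K A d (N + 1) p x))) =
        f N p x \<ominus>\<^bsub>M\<^esub> g N p x \<oplus>\<^bsub>M\<^esub>
        (\<Oplus>\<^bsub>M\<^esub>m\<in>{..<N}. \<Oplus>\<^bsub>M\<^esub>t\<in>{1..m + 1}.
           signed M (t * (N - m) + (N - 1))
             (h m (p + (N - 1 - m))
               (tensor_map K A A
                 (insert_factor K A (t - 1) (N - 1 - m + 2, N - 1 - m, \<pi> (N - 1 - m)) (m + 1 - t))
                 p x))) \<oplus>\<^bsub>M\<^esub>
        (\<Oplus>\<^bsub>M\<^esub>m\<in>{..<N}. \<Oplus>\<^bsub>M\<^esub>ns\<in>compositions (N - 1 - m) (m + 2). \<Oplus>\<^bsub>M\<^esub>i\<in>{1..m + 2}.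
           signed M (m + eps ns + sum_list (take (i - 1) ns))
             (\<pi>' m (p + (N - m))
               (tensor_map K A A'
                 (morphism_factors g (take (i - 1) ns)
                    @ (ns ! (i - 1) + 1, ns ! (i - 1) + 1, h (ns ! (i - 1)))
                    # morphism_factors f (drop i ns))
                 p x))))"

definition A_infinity_homotopy_equivalence ::
  "'k ring
     \<Rightarrow> ('k, 'a) graded_module \<Rightarrow> (nat \<Rightarrow> 'a \<Rightarrow> 'a) \<Rightarrow> (nat \<Rightarrow> nat \<Rightarrow> ('k, 'a) tensor \<Rightarrow> 'a)
     \<Rightarrow> ('k, 'b) graded_module \<Rightarrow> (nat \<Rightarrow> 'b \<Rightarrow> 'b) \<Rightarrow> (nat \<Rightarrow> nat \<Rightarrow> ('k, 'b) tensor \<Rightarrow> 'b)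
     \<Rightarrow> (nat \<Rightarrow> nat \<Rightarrow> ('k, 'a) tensor \<Rightarrow> 'b) \<Rightarrow> bool" where
  "A_infinity_homotopy_equivalence K A d \<pi> A' d' \<pi>' f \<longleftrightarrow>
     A_infinity_morphism K A d \<pi> A' d' \<pi>' f \<and>
     (\<exists>g. A_infinity_morphism K A' d' \<pi>' A d \<pi> g \<and>
        (\<exists>h. A_infinity_homotopy K A d \<pi> A d \<pi>
               (A_infinity_comp K A A' A g f) (A_infinity_id K A) h) \<and>
        (\<exists>h. A_infinity_homotopy K A' d' \<pi>' A' d' \<pi>'
               (A_infinity_comp K A' A A' f g) (A_infinity_id K A') h))"

text \<open>\<open>(H(A), 0, \<rho>)\<close> is an \<open>A\<^sub>\<infinity>\<close>-algebra of homologies of \<open>(A, d, \<pi>)\<close>:\<close>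

definition A_infinity_algebra_of_homologies ::
  "'k ring \<Rightarrow> ('k, 'a) graded_module \<Rightarrow> (nat \<Rightarrow> 'a \<Rightarrow> 'a)
     \<Rightarrow> (nat \<Rightarrow> nat \<Rightarrow> ('k, 'a) tensor \<Rightarrow> 'a)
     \<Rightarrow> (nat \<Rightarrow> nat \<Rightarrow> ('k, 'a set) tensor \<Rightarrow> 'a set) \<Rightarrow> bool" where
  "A_infinity_algebra_of_homologies K A d \<pi> \<rho> \<longleftrightarrow>
     (let H = homology A d in
      A_infinity_algebra K H (zero_differential H) \<rho> \<and>
      (\<exists>f. A_infinity_homotopy_equivalence K A d \<pi> H (zero_differential H) \<rho> f))"


section \<open>Cyclic homology of \<open>A\<^sub>\<infinity>\<close>-algebras\<close>

definition cyc_X ::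
  "'k ring \<Rightarrow> ('k, 'a) graded_module \<Rightarrow> nat \<Rightarrow> ('k, ('k, 'a) tensor) graded_module" where
  "cyc_X K A n m = tensor_power K A (n + 1) m"

definition cyc_t ::
  "'k ring \<Rightarrow> ('k, 'a) graded_module \<Rightarrow> nat \<Rightarrow> nat \<Rightarrow> ('k, 'a) tensor \<Rightarrow> ('k, 'a) tensor" where
  "cyc_t K A n p =
     tensor_lift K (cyc_X K A n p)
       (\<lambda>xs. signed (cyc_X K A n p) (fst (last xs) * word_degree (butlast xs))
               (pure_tensor K A (last xs # butlast xs)))"

text \<open>
  \<open>\<partial>\<^sub>(\<^sub>j\<^sub>,\<^sub>\<dots>\<^sub>,\<^sub>j\<^sub>+\<^sub>k\<^sub>-\<^sub>1\<^sub>)\<close> on \<open>X\<^sub>n\<^sub>,\<^sub>p\<close>.  The exponent \<open>k (p + 1)\<close> has the parity of \<open>k (p - 1)\<close>.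
\<close>

definition face_block ::
  "'k ring \<Rightarrow> ('k, 'a) graded_module \<Rightarrow> (nat \<Rightarrow> nat \<Rightarrow> ('k, 'a) tensor \<Rightarrow> 'a)
     \<Rightarrow> nat \<Rightarrow> nat \<Rightarrow> nat \<Rightarrow> nat \<Rightarrow> ('k, 'a) tensor \<Rightarrow> ('k, 'a) tensor" where
  "face_block K A \<pi> n p k j x =
     signed (cyc_X K A (n - k) (p + k - 1)) (k * (p + 1))
       (tensor_map K A A (insert_factor K A j (k + 1, k - 1, \<pi> (k - 1)) (n - k - j)) p x)"

definition wrapped_tuple :: "nat \<Rightarrow> nat \<Rightarrow> nat \<Rightarrow> nat list" where
  "wrapped_tuple n k q = [0..<k - q] @ [n - q + 1..<n + 1]"

text \<open>\<open>\<partial>\<^sub>(\<^sub>i\<^sub>1\<^sub>,\<^sub>\<dots>\<^sub>,\<^sub>i\<^sub>k\<^sub>)\<close> on \<open>X\<^sub>n\<^sub>,\<^sub>p\<close>, where \<open>is = [i\<^sub>1, \<dots>, i\<^sub>k]\<close> and \<open>1 \<le> k \<le> n\<close>:\<close>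

definition face ::
  "'k ring \<Rightarrow> ('k, 'a) graded_module \<Rightarrow> (nat \<Rightarrow> nat \<Rightarrow> ('k, 'a) tensor \<Rightarrow> 'a)
     \<Rightarrow> nat \<Rightarrow> nat \<Rightarrow> nat list \<Rightarrow> ('k, 'a) tensor \<Rightarrow> ('k, 'a) tensor" where
  "face K A \<pi> n p is x =
     (let k = length is; Y = cyc_X K A (n - k) (p + k - 1) in
      if is = [hd is..<hd is + k] \<and> hd is + k \<le> n then face_block K A \<pi> n p k (hd is) x
      else if \<exists>q \<in> {1..k}. is = wrapped_tuple n k q then
        (let q = (THE q. q \<in> {1..k} \<and> is = wrapped_tuple n k q) in
         signed Y (q * (k - 1)) (face_block K A \<pi> n p k 0 ((cyc_t K A n p ^^ q) x)))
      else \<zero>\<^bsub>Y\<^esub>)"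

text \<open>\<open>d\<^sub>q\<^sup>k : X\<^sub>n\<^sub>,\<^sub>p \<rightarrow> X\<^sub>n\<^sub>-\<^sub>k\<^sub>,\<^sub>p\<^sub>+\<^sub>k\<^sub>-\<^sub>1\<close> for \<open>q \<in> {0, 1}\<close> and \<open>0 \<le> k \<le> n\<close>:\<close>

definition cyc_d ::
  "'k ring \<Rightarrow> ('k, 'a) graded_module \<Rightarrow> (nat \<Rightarrow> 'a \<Rightarrow> 'a)
     \<Rightarrow> (nat \<Rightarrow> nat \<Rightarrow> ('k, 'a) tensor \<Rightarrow> 'a)
     \<Rightarrow> nat \<Rightarrow> nat \<Rightarrow> nat \<Rightarrow> nat \<Rightarrow> ('k, 'a) tensor \<Rightarrow> ('k, 'a) tensor" where
  "cyc_d K A d \<pi> q k n p x =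
     (if k = 0 then tensor_differential K A d (n + 1) p x
      else (let Y = cyc_X K A (n - k) (p + k - 1) in
        \<Oplus>\<^bsub>Y\<^esub>is\<in>{is. length is = k \<and> sorted_wrt (<) is \<and> set is \<subseteq> {0..n - q}}.
          signed Y (sum_list is) (face K A \<pi> n p is x)))"

definition cyc_T ::
  "'k ring \<Rightarrow> ('k, 'a) graded_module \<Rightarrow> nat \<Rightarrow> nat \<Rightarrow> ('k, 'a) tensor \<Rightarrow> ('k, 'a) tensor" where
  "cyc_T K A n p x = signed (cyc_X K A n p) n (cyc_t K A n p x)"

definition cyc_N ::
  "'k ring \<Rightarrow> ('k, 'a) graded_module \<Rightarrow> nat \<Rightarrow> nat \<Rightarrow> ('k, 'a) tensor \<Rightarrow> ('k, 'a) tensor" where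
  "cyc_N K A n p x = (\<Oplus>\<^bsub>cyc_X K A n p\<^esub>i\<in>{0..n}. (cyc_T K A n p ^^ i) x)"

text \<open>\<open>Xbar\<^sub>n\<close> is the direct sum of the \<open>X\<^sub>k\<^sub>,\<^sub>n\<^sub>-\<^sub>k\<close>; the \<open>k\<close>-th component lies in \<open>X\<^sub>k\<^sub>,\<^sub>n\<^sub>-\<^sub>k\<close>.\<close>

definition Xbar ::
  "'k ring \<Rightarrow> ('k, 'a) graded_module \<Rightarrow> ('k, nat \<Rightarrow> ('k, 'a) tensor) graded_module" where
  "Xbar K A n = direct_sum {0..n} (\<lambda>k. cyc_X K A k (n - k))"

text \<open>
  \<open>Xbar_b \<dots> q n : Xbar\<^sub>n \<rightarrow> Xbar\<^sub>n\<^sub>-\<^sub>1\<close> is \<open>b\<close> for \<open>q = 0\<close> and \<open>b'\<close> for \<open>q = 1\<close>, where \<open>n \<ge> 1\<close>.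
  The component in \<open>X\<^sub>l\<^sub>,\<^sub>n\<^sub>-\<^sub>1\<^sub>-\<^sub>l\<close> collects the \<open>d\<^sub>q\<^sup>k\<^sup>-\<^sup>l\<close> of the components in \<open>X\<^sub>k\<^sub>,\<^sub>n\<^sub>-\<^sub>k\<close>.
\<close>

definition Xbar_b ::
  "'k ring \<Rightarrow> ('k, 'a) graded_module \<Rightarrow> (nat \<Rightarrow> 'a \<Rightarrow> 'a)
     \<Rightarrow> (nat \<Rightarrow> nat \<Rightarrow> ('k, 'a) tensor \<Rightarrow> 'a)
     \<Rightarrow> nat \<Rightarrow> nat \<Rightarrow> (nat \<Rightarrow> ('k, 'a) tensor) \<Rightarrow> nat \<Rightarrow> ('k, 'a) tensor" where
  "Xbar_b K A d \<pi> q n x =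
     (\<lambda>l\<in>{0..n - 1}. \<Oplus>\<^bsub>cyc_X K A l (n - 1 - l)\<^esub>k\<in>{l..n}. cyc_d K A d \<pi> q (k - l) k (n - k) (x k))"

definition Xbar_T ::
  "'k ring \<Rightarrow> ('k, 'a) graded_module
     \<Rightarrow> nat \<Rightarrow> (nat \<Rightarrow> ('k, 'a) tensor) \<Rightarrow> nat \<Rightarrow> ('k, 'a) tensor" where
  "Xbar_T K A n x = (\<lambda>k\<in>{0..n}. cyc_T K A k (n - k) (x k))"

definition Xbar_N ::
  "'k ring \<Rightarrow> ('k, 'a) graded_module
     \<Rightarrow> nat \<Rightarrow> (nat \<Rightarrow> ('k, 'a) tensor) \<Rightarrow> nat \<Rightarrow> ('k, 'a) tensor" where
  "Xbar_N K A n x = (\<lambda>k\<in>{0..n}. cyc_N K A k (n - k) (x k))"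

text \<open>
  The bicomplex has \<open>Xbar\<^sub>n\<close> at every place \<open>(n, m)\<close>.  \<open>cyc_D1 \<dots> n m\<close> maps place \<open>(n, m)\<close> to
  \<open>(n, m - 1)\<close> and is used for \<open>m \<ge> 1\<close>; \<open>cyc_D2 \<dots> n m\<close> maps \<open>(n, m)\<close> to \<open>(n - 1, m)\<close> and is used
  for \<open>n \<ge> 1\<close>.  Otherwise the target is \<open>0\<close>.
\<close>

definition cyc_D1 ::
  "'k ring \<Rightarrow> ('k, 'a) graded_module
     \<Rightarrow> nat \<Rightarrow> nat \<Rightarrow> (nat \<Rightarrow> ('k, 'a) tensor) \<Rightarrow> nat \<Rightarrow> ('k, 'a) tensor" where
  "cyc_D1 K A n m x =
     (if odd m then x \<ominus>\<^bsub>Xbar K A n\<^esub> Xbar_T K A n x else Xbar_N K A n x)"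

definition cyc_D2 ::
  "'k ring \<Rightarrow> ('k, 'a) graded_module \<Rightarrow> (nat \<Rightarrow> 'a \<Rightarrow> 'a)
     \<Rightarrow> (nat \<Rightarrow> nat \<Rightarrow> ('k, 'a) tensor \<Rightarrow> 'a)
     \<Rightarrow> nat \<Rightarrow> nat \<Rightarrow> (nat \<Rightarrow> ('k, 'a) tensor) \<Rightarrow> nat \<Rightarrow> ('k, 'a) tensor" where
  "cyc_D2 K A d \<pi> n m x =
     (if even m then Xbar_b K A d \<pi> 0 n x else \<ominus>\<^bsub>Xbar K A (n - 1)\<^esub> Xbar_b K A d \<pi> 1 n x)"

text \<open>The component \<open>n\<close> of \<open>cyc_Tot \<dots> s\<close> sits at the place \<open>(n, s - n)\<close> of the bicomplex.\<close>

definition cyc_Tot ::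
  "'k ring \<Rightarrow> ('k, 'a) graded_module \<Rightarrow> ('k, nat \<Rightarrow> nat \<Rightarrow> ('k, 'a) tensor) graded_module" where
  "cyc_Tot K A s = direct_sum {0..s} (Xbar K A)"

definition cyc_D ::
  "'k ring \<Rightarrow> ('k, 'a) graded_module \<Rightarrow> (nat \<Rightarrow> 'a \<Rightarrow> 'a)
     \<Rightarrow> (nat \<Rightarrow> nat \<Rightarrow> ('k, 'a) tensor \<Rightarrow> 'a)
     \<Rightarrow> nat \<Rightarrow> (nat \<Rightarrow> nat \<Rightarrow> ('k, 'a) tensor) \<Rightarrow> nat \<Rightarrow> nat \<Rightarrow> ('k, 'a) tensor" where
  "cyc_D K A d \<pi> s x =
     (if s = 0 then \<zero>\<^bsub>cyc_Tot K A 0\<^esub>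
      else (\<lambda>n\<in>{0..s - 1}.
        cyc_D1 K A n (s - n) (x n) \<oplus>\<^bsub>Xbar K A n\<^esub> cyc_D2 K A d \<pi> (n + 1) (s - 1 - n) (x (n + 1))))"

definition cyclic_homology ::
  "'k ring \<Rightarrow> ('k, 'a) graded_module \<Rightarrow> (nat \<Rightarrow> 'a \<Rightarrow> 'a)
     \<Rightarrow> (nat \<Rightarrow> nat \<Rightarrow> ('k, 'a) tensor \<Rightarrow> 'a)
     \<Rightarrow> ('k, (nat \<Rightarrow> nat \<Rightarrow> ('k, 'a) tensor) set) graded_module" where
  "cyclic_homology K A d \<pi> = homology (cyc_Tot K A) (cyc_D K A d \<pi>)"

end

theory Submission
  imports Defs "HOL-Algebra.Free_Abelian_Groups"
begin

text \<open>
  Signs are handled on the suspension: words in letters \<open>(i, a)\<close> of degree \<open>i + 1\<close>, where an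
  \<open>A\<^sub>\<infinity>\<close>-structure is a coderivation, a morphism \<open>g\<close> is a map \<open>bar\<close> of coalgebras, and \<open>b'\<close>, \<open>b\<close>, \<open>1 - T\<close>
  and \<open>N\<close> become \<open>delta\<close>, \<open>hoch\<close>, \<open>1 - rot\<close> and \<open>nrm\<close>.  The map induced on the columns of the
  bicomplex is \<open>bar\<close> in odd columns and its cyclic version \<open>cbar\<close> in even ones.  All identities hold
  for integral chains of words, modulo the ideal of the chains that vanish in all tensor powers.

  Let \<open>g\<close> be the morphism from the homologies to \<open>A\<close> in the given homotopy equivalence.  Filter the
  total complexes by the internal degree of the tensors.  The only part of the differential that lowers it is
  the tensor differential, and the only part of the induced map that preserves it is \<open>g\<^sub>0\<close> applied
  to every factor.  The degree \<open>0\<close> parts of the homotopies show that the latter is a quasi-isomorphism on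
  tensor powers, and an induction on the filtration, which is finite in each total degree, shows that
  the induced map of total complexes is one as well.
\<close>

section \<open>Chains of words\<close>

text \<open>Integral chains of words are free, so any function on words defines an operator, and the
  sign identities involve only parities of letters. Multilinearity is checked once per operator,
  when it descends to tensors. The price is that the defining relations hold only modulo an ideal.
  Since an operator need not visibly preserve that ideal, the identities are arranged so that a
  relation occurs as one factor of a product.

  Transporting the homotopies to the cyclic complexes would require formulas for their higher
  components. Their linear parts suffice: the differential of the homologies is zero, so one
  homotopy says \<open>f_0 g_0 = 1\<close> exactly, while the other makes \<open>g_0 f_0\<close>
  homotopic to 1 by a homotopy that extends to tensor powers by an explicit formula. No Kuenneth
  theorem enters. This also explains the direction of the comparison map: for \<open>g_0\<close>,
  the map \<open>f_0\<close> is a left inverse that kills boundaries.\<close>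

instantiation list :: (type) monoid_add
begin
definition zero_list :: "'a list" where "zero_list = []"
definition plus_list :: "'a list => 'a list => 'a list" where "plus_list = (@)"
instance by standard (simp_all add: zero_list_def plus_list_def)
end

text \<open>With concatenation as the addition of lists, the convolution product of polynomial
  mappings is concatenation. Chains thus form the free associative ring on the letters, with the
  empty word as unit.\<close>

type_synonym 'l chain = "'l list \<Rightarrow>\<^sub>0 int"

definition wd :: "'l list => 'l chain" where "wd w = frag_of w"

abbreviation wkeys :: "'l chain => 'l list set" where
 "wkeys \<equiv> Poly_Mapping.keys"

abbreviation ext :: "('l list => 'm chain) => 'l chain => 'm chain" where
 "ext \<equiv> frag_extend"

lemma wd_append: "wd (u @ v) = wd u * wd v"
 by (simp add: wd_def mult_single plus_list_def)

lemma wd_Cons: "NO_MATCH [] w ==> wd (l # w) = wd [l] * wd w"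
 using wd_append[of "[l]" w] by simp

lemma wd_Nil [simp]: "wd [] = 1"
 by (simp add: wd_def one_poly_mapping.abs_eq single.abs_eq zero_list_def when_def eq_commute)

text \<open>The sign \<open>(-1)^n\<close>. Exponents remain sums and products of natural numbers,
  and \<open>ks_cong\<close> turns every comparison of signs into a parity goal.\<close>

definition ks :: "nat => 'b::ab_group_add => 'b" where
 "ks n x = (if even n then x else - x)"

lemma ks_simps [simp]:
 "ks 0 x = x" "ks n 0 = 0" "ks n (ks m x) = ks (n + m) x" "ks (n + n) x = x"
 by (auto simp: ks_def)

lemma ks_arith:
 "ks n (x + y) = ks n x + ks n y" "ks n (x - y) = ks n x - ks n y"
 "ks n (- x) = - ks n x"
 by (auto simp: ks_def)

lemma ks_mult [simp]:
 fixes x y :: "'b::ring"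
 shows "ks n x * y = ks n (x * y)" "x * ks n y = ks n (x * y)"
 by (auto simp: ks_def)

lemma ks_sum: "ks n (sum f S) = (\<Sum>i\<in>S. ks n (f i))"
 by (simp add: ks_def sum_negf)

lemma ks_cong: "(even n \<longleftrightarrow> even m) ==> x = y ==> ks n x = ks m y"
 by (simp add: ks_def)

lemma ks_minus_cong: "(even n \<longleftrightarrow> odd m) ==> x = y ==> ks n x = - ks m y"
 by (simp add: ks_def)

section \<open>Additive extension of functions on words\<close>

lemma ext_wd [simp]: "ext f (wd w) = f w"
 by (simp add: wd_def)

lemma ext_ks [simp]: "ext f (ks n c) = ks n (ext f c)"
 by (simp add: ks_def frag_extend_minus)

lemma ext_sum: "ext f (sum g S) = (\<Sum>i\<in>S. ext f (g i))"
 by (induction S rule: infinite_finite_induct) (simp_all add: frag_extend_add)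

lemmas ext_arith = frag_extend_add frag_extend_diff frag_extend_minus

lemma chain_induct [case_names zero wd diff]:
 assumes "P 0" "!!w. P (wd w)" "!!a b. P a ==> P b ==> P (a - b)"
 shows "P (c :: 'l chain)"
proof -
 have "wkeys c \<subseteq> UNIV" by simp
 then show ?thesis
  by (induction c rule: frag_induction) (use assms in \<open>auto simp: wd_def\<close>)
qed

lemma ext_cong:
 "(!!w. w \<in> wkeys c ==> f w = g w) ==> ext f c = ext g c"
 by (rule frag_extend_eq)

lemma ext_fun_add: "ext (%w. f w + g w) c = ext f c + ext g c"
 by (induction c rule: chain_induct) (simp_all add: ext_arith)

lemma ext_fun_diff: "ext (%w. f w - g w) c = ext f c - ext g c"
 by (induction c rule: chain_induct) (simp_all add: ext_arith)

lemma ext_fun_ks: "ext (%w. ks n (f w)) c = ks n (ext f c)"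
 by (induction c rule: chain_induct) (simp_all add: ext_arith ks_arith)

lemma ext_fun_minus: "ext (%w. - f w) c = - ext f c"
 by (induction c rule: chain_induct) (simp_all add: ext_arith)

lemma ext_fun_zero [simp]: "ext (%w. 0) c = 0"
 by (induction c rule: chain_induct) (simp_all add: ext_arith)

lemma ext_fun_sum: "ext (%w. \<Sum>i\<in>S. f i w) c = (\<Sum>i\<in>S. ext (f i) c)"
 by (induction S rule: infinite_finite_induct) (simp_all add: ext_fun_add)

lemma ext_id [simp]: "ext wd c = c"
 by (induction c rule: chain_induct) (simp_all add: ext_arith)

lemma ext_fun_mult: "ext (%w. a * f w * b) c = a * ext f c * b"
 by (induction c rule: chain_induct) (simp_all add: ext_arith algebra_simps)

lemma ext_fun_multl: "ext (%w. a * f w) c = a * ext f c"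
 using ext_fun_mult[of a f 1 c] by simp

lemma ext_fun_multr: "ext (%w. f w * b) c = ext f c * b"
 using ext_fun_mult[of 1 f b c] by simp

lemma ext_ext: "ext f (ext g c) = ext (%w. ext f (g w)) c"
 by (induction c rule: chain_induct) (simp_all add: ext_arith)

lemma ext_ext_swap: "ext (%x. ext (%y. g x y) d) c = ext (%y. ext (%x. g x y) c) d"
proof (induction c rule: chain_induct)
 case (diff a b)
 then show ?case by (simp add: ext_arith ext_fun_diff)
qed (simp_all add: ext_arith)

lemma ext_append:
 "ext (%t. g (u @ t)) c = ext g (wd u * c)" "ext (%t. g (t @ u)) c = ext g (c * wd u)"
 "ext (%t. g (u @ t @ v)) c = ext g (wd u * c * wd v)"
 by (induction c rule: chain_induct)
  (simp_all add: ext_arith wd_append[symmetric] algebra_simps)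

section \<open>Sums over the cuts of a word\<close>

definition SS :: "'l list => ('l list => 'l list => 'b::ab_group_add) => 'b" where
 "SS w f = (\<Sum>(x, y) \<in> {(x, y). x @ y = w}. f x y)"

lemma finite_splits: "finite {(x, y). x @ y = w}"
proof -
 have "{(x, y). x @ y = w} \<subseteq> (%i. (take i w, drop i w)) ` {..length w}"
 proof clarify
  fix x y assume "w = x @ y"
  then show "(x, y) \<in> (%i. (take i (x @ y), drop i (x @ y))) ` {..length (x @ y)}"
   by (intro image_eqI[of _ _ "length x"]) auto
 qed
 then show ?thesis by (rule finite_subset) simp
qed

lemma SS_cong [fundef_cong]:
 "w = w' ==> (!!x y. x @ y = w' ==> f x y = g x y) ==> SS w f = SS w' g"
 unfolding SS_def by (rule sum.cong) auto

lemma SS_congI: "(!!x y. x @ y = w ==> f x y = g x y) ==> SS w f = SS w g"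
 by (rule SS_cong) auto

lemma SS_Nil [simp]: "SS [] f = f [] []"
proof -
 have "{(x, y). x @ y = ([] :: 'a list)} = {([], [])}" by auto
 then show ?thesis by (simp add: SS_def)
qed

lemma SS_Cons: "SS (l # w) f = f [] (l # w) + SS w (%x y. f (l # x) y)"
proof -
 have "{(x, y). x @ y = l # w} = insert ([], l # w) ((%(x, y). (l # x, y)) ` {(x, y). x @ y = w})"
  by (auto simp: append_eq_Cons_conv)
 moreover have "inj_on (%(x, y). (l # x, y)) S" for S :: "('b list \<times> 'b list) set" and l :: 'b
  by (auto simp: inj_on_def)
 moreover have "([], l # w) \<notin> (%(x, y). (l # x, y)) ` {(x, y). x @ y = w}"
  by auto
 ultimately show ?thesis
  using finite_splits[of w] by (simp add: SS_def sum.reindex case_prod_unfold)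
qed

lemma SS_add: "SS w (%x y. f x y + g x y) = SS w f + SS w g"
 by (simp add: SS_def sum.distrib case_prod_unfold)

lemma SS_diff: "SS w (%x y. f x y - g x y) = SS w f - SS w g"
 by (simp add: SS_def sum_subtractf case_prod_unfold)

lemma SS_minus: "SS w (%x y. - f x y) = - SS w f"
 by (simp add: SS_def sum_negf case_prod_unfold)

lemma SS_zero [simp]: "SS w (%x y. 0) = 0"
 by (simp add: SS_def)

lemma SS_ks: "ks n (SS w f) = SS w (%x y. ks n (f x y))"
 by (simp add: SS_def ks_sum case_prod_unfold)

lemma SS_mult_left: "(a :: 'b::ring) * SS w f = SS w (%x y. a * f x y)"
 by (simp add: SS_def sum_distrib_left case_prod_unfold)

lemma SS_mult_right: "SS w f * (a :: 'b::ring) = SS w (%x y. f x y * a)"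
 by (simp add: SS_def sum_distrib_right case_prod_unfold)

lemma ext_SS: "ext g (SS w f) = SS w (%x y. ext g (f x y))"
 by (simp add: SS_def ext_sum case_prod_unfold)

lemma ext_fun_SS: "ext (%t. SS w (f t)) c = SS w (%x y. ext (%t. f t x y) c)"
 by (simp add: SS_def ext_fun_sum case_prod_unfold)

lemma SS_if: "(if P then 0 else SS w f) = SS w (%x y. if P then 0 else f x y)"
 by auto

lemma SS_swap: "SS u (%a b. SS v (%c d. f a b c d)) = SS v (%c d. SS u (%a b. f a b c d))"
 unfolding SS_def case_prod_unfold by (rule sum.swap)

text \<open>The cut at the junction of \<open>u\<close> and \<open>v\<close> belongs to both ranges;
  the guard \<open>x = []\<close> lets it count only once.\<close>

lemma SS_append:
 "SS (u @ v) f = SS u (%x y. f x (y @ v)) + SS v (%x y. if x = [] then 0 else f (u @ x) y)"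
proof (induction u arbitrary: f)
 case Nil
 show ?case by (cases v) (simp_all add: SS_Cons cong: SS_cong)
next
 case (Cons l u)
 show ?case by (simp add: SS_Cons Cons.IH[of "%x y. f (l # x) y"] add_ac cong: if_cong)
qed

lemma SS_mid: "SS (u @ l # v) f = SS u (%x y. f x (y @ l # v)) + SS v (%x y. f (u @ l # x) y)"
 by (simp add: SS_append SS_Cons)

lemma SS_left_Nil: "SS w f = f [] w + SS w (%x y. if x = [] then 0 else f x y)"
 using SS_append[of "[]" w f] by (simp cong: if_cong)

lemma SS_right_Nil: "SS w f = f w [] + SS w (%x y. if y = [] then 0 else f x y)"
proof (induction w arbitrary: f)
 case (Cons l w)
 show ?case by (simp add: SS_Cons Cons.IH[of "%x y. f (l # x) y"] add_ac cong: if_cong)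
qed simp

text \<open>Coassociativity of deconcatenation: both sides run over the cuts of \<open>w\<close>
  into three pieces. Regrouping nested sums by this rule is the main move in the identities
  below.\<close>

lemma SS_assoc:
 "SS w (%p z. SS p (%x y. f x y p z)) = SS w (%x r. SS r (%y z. f x y (x @ y) z))"
proof (induction w arbitrary: f)
 case (Cons l w)
 show ?case
  by (simp add: SS_Cons SS_add Cons.IH[of "%x y p z. f (l # x) y (l # p) z"] add_ac)
qed simp

section \<open>Parity of words and chains\<close>

definition pw :: "('l => nat) => 'l list => nat" where "pw p w = sum_list (map p w)"

lemma pw_simps [simp]:
 "pw p [] = 0" "pw p (l # w) = p l + pw p w" "pw p (u @ v) = pw p u + pw p v"
 by (simp_all add: pw_def)

definition hmg :: "('l => nat) => nat => 'l chain => bool" where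
 "hmg p e c \<longleftrightarrow> (\<forall>w \<in> wkeys c. even (pw p w) \<longleftrightarrow> even e)"

text \<open>The structure maps send a word to a letter up to sign, or to zero. That the value is a
  single letter is what makes cuts of a word with such a value substituted into it
  predictable.\<close>

definition lett :: "('l => nat) => nat => 'l chain => bool" where
 "lett p e c \<longleftrightarrow> c = 0 \<or> (\<exists>l n. c = ks n (wd [l]) \<and> (even (p l) \<longleftrightarrow> even e))"

lemma hmg_0 [simp]: "hmg p e 0" by (simp add: hmg_def)
lemma hmg_wd: "(even (pw p w) \<longleftrightarrow> even e) ==> hmg p e (wd w)" by (simp add: hmg_def wd_def)
lemma hmg_add: "hmg p e a ==> hmg p e b ==> hmg p e (a + b)"
 using Poly_Mapping.keys_add[of a b] by (auto simp: hmg_def)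
lemma hmg_ks: "hmg p e a ==> hmg p e (ks n a)"
 by (auto simp: hmg_def ks_def)
lemma hmg_sum: "(!!i. i \<in> S ==> hmg p e (f i)) ==> hmg p e (sum f S)"
 by (induction S rule: infinite_finite_induct) (auto intro: hmg_add)
lemma hmg_SS: "(!!x y. x @ y = w ==> hmg p e (f x y)) ==> hmg p e (SS w f)"
 unfolding SS_def by (rule hmg_sum) auto
lemma hmg_mult:
 assumes "hmg p e a" "hmg p e' b"
 shows "hmg p (e + e') (a * b)"
 unfolding hmg_def
proof
 fix w assume "w \<in> wkeys (a * b)"
 then obtain u v where "w = u @ v" "u \<in> wkeys a" "v \<in> wkeys b"
  using keys_mult[of a b] by (auto simp: plus_list_def)
 then show "even (pw p w) \<longleftrightarrow> even (e + e')"
  using assms by (simp add: hmg_def)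
qed
lemma hmg_cong: "hmg p e a ==> (even e \<longleftrightarrow> even e') ==> hmg p e' a"
 by (simp add: hmg_def)
lemma hmg_lett: "lett p e c ==> hmg p e c"
 by (auto simp: lett_def intro!: hmg_ks hmg_wd)

lemma hmg_ext:
 "hmg p e c ==> (!!w. (even (pw p w) \<longleftrightarrow> even e) ==> f w = g w) ==> ext f c = ext g c"
 by (rule ext_cong) (auto simp: hmg_def)

text \<open>On a chain of one parity a sign that sees a word only through its parity is constant,
  and can be pulled out of the extension.\<close>

lemma hmg_ext_ks:
 assumes "hmg p e c"
 shows "ext (%w. ks (pw p w * n) (f w)) c = ks (e * n) (ext f c)"
proof -
 have "ext (%w. ks (pw p w * n) (f w)) c = ext (%w. ks (e * n) (f w)) c"
  by (rule hmg_ext[OF assms]) (rule ks_cong, simp_all)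
 then show ?thesis by (simp add: ext_fun_ks)
qed

lemma hmg_ext_ks_1: "hmg p e c ==> ext (%w. ks (pw p w) (f w)) c = ks e (ext f c)"
 using hmg_ext_ks[of p e c 1 f] by simp

text \<open>As \<open>c\<close> is a single letter, a cut of the product falls to one side of
  it.\<close>

lemma ext_SS_lett:
 assumes "lett p e c"
 shows "ext (%w. SS w g) (wd u * c * wd v) =
  SS u (%u1 u2. ext (g u1) (wd u2 * c * wd v)) + SS v (%v1 v2. ext (%t. g t v2) (wd u * c * wd v1))"
 using assms
 by (auto simp: lett_def wd_append[symmetric] SS_mid ks_arith SS_ks)

section \<open>Bar and cyclic operators on chains\<close>

definition delta :: "('l => nat) => ('l list => 'l chain) => 'l list => 'l chain" where
 "delta p m w = SS w (%u r. SS r (%x v. ks (pw p u) (wd u * m x * wd v)))"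

primrec tens_pow :: "('l list => 'm chain) => nat => 'l list => 'm chain" where
 "tens_pow Ph 0 w = (if w = [] then 1 else 0)"
| "tens_pow Ph (Suc r) w = SS w (%x y. Ph x * tens_pow Ph r y)"

text \<open>With \<open>Ph [] = 0\<close> all blocks are nonempty, so more than
  \<open>length w\<close> blocks contribute nothing and a sum over all numbers of blocks may stop
  here.\<close>

definition bar :: "('l list => 'm chain) => 'l list => 'm chain" where
 "bar Ph w = (\<Sum>r\<le>length w. tens_pow Ph r w)"

text \<open>A sum over cyclic windows. For \<open>w = x y z\<close> the window is
  \<open>z @ x\<close>, which may wrap around the end of the word; \<open>x ~= []\<close> says that
  it contains the first letter. The sign is the Koszul sign of moving \<open>z\<close> to the front.
  Both \<open>hoch\<close> and \<open>cbar\<close> turn out to be such sums.\<close>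

definition CY :: "('l => nat) => ('l list => 'l list => 'm chain) => 'l list => 'm chain" where
 "CY p g w = SS w (%x r. SS r (%y z.
   if x = [] then 0 else ks (pw p z * (pw p x + pw p y)) (g (z @ x) y)))"

text \<open>Only the windows that really cross the end of the word; those with \<open>z = []\<close>
  start at the first letter and are already terms of \<open>delta\<close>.\<close>

definition wrap :: "('l => nat) => ('l list => 'l chain) => 'l list => 'l chain" where
 "wrap p m w = SS w (%x r. SS r (%y z.
   if x = [] \<or> z = [] then 0 else ks (pw p z * (pw p x + pw p y)) (m (z @ x) * wd y)))"

definition hoch :: "('l => nat) => ('l list => 'l chain) => 'l list => 'l chain" where
 "hoch p m w = delta p m w + wrap p m w"

definition cbar :: "('l => nat) => ('l list => 'm chain) => 'l list => 'm chain" where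
 "cbar p Ph = CY p (%s y. Ph s * bar Ph y)"

definition rot :: "('l => nat) => 'l list => 'l chain" where
 "rot p w = (if w = [] then 1 else ks (p (last w) * pw p (butlast w)) (wd (last w # butlast w)))"

text \<open>Each rotation occurs once: the guard discards the cut that would repeat the trivial
  rotation.\<close>

definition nrm :: "('l => nat) => 'l list => 'l chain" where
 "nrm p w = SS w (%x y. if x = [] then 0 else ks (pw p x * pw p y) (wd y * wd x))"

text \<open>Odd operators with values in letters, the data of a coderivation on the suspension;
  \<open>mors\<close> is the even analogue, the data of a map of coalgebras.\<close>

definition ops :: "('l => nat) => ('l list => 'l chain) => bool" where
 "ops p m \<longleftrightarrow> m [] = 0 \<and> (\<forall>x. lett p (pw p x + 1) (m x))"

definition mors :: "('l => nat) => ('m => nat) => ('l list => 'm chain) => bool" where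
 "mors p q Ph \<longleftrightarrow> Ph [] = 0 \<and> (\<forall>x. lett q (pw p x) (Ph x))"

text \<open>The coderivation rule: the letter produced by the operation lies in exactly one of the
  two pieces of a cut, and an operation in the second piece has to pass \<open>x\<close>.\<close>

lemma delta_SS:
 assumes "ops p m"
 shows "ext (%w. SS w g) (delta p m w) =
  SS w (%x y. ext (%t. g t y) (delta p m x) + ks (pw p x) (ext (g x) (delta p m y)))"
proof -
 have *: "ext (%w. SS w g) (wd u * m x * wd v) =
  SS u (%u1 u2. ext (g u1) (wd u2 * m x * wd v)) + SS v (%v1 v2. ext (%t. g t v2) (wd u * m x * wd v1))" for u x v
  using assms by (intro ext_SS_lett[of p "pw p x + 1"]) (simp add: ops_def)
 have "ext (%w. SS w g) (delta p m w) =
  SS w (%u r. SS r (%x v. SS u (%u1 u2. ks (pw p u) (ext (g u1) (wd u2 * m x * wd v))))) +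
  SS w (%u r. SS r (%x v. SS v (%v1 v2. ks (pw p u) (ext (%t. g t v2) (wd u * m x * wd v1)))))"
  by (simp add: delta_def ext_SS * ks_arith SS_add SS_ks)
 also have "SS w (%u r. SS r (%x v. SS u (%u1 u2. ks (pw p u) (ext (g u1) (wd u2 * m x * wd v))))) =
   SS w (%u r. SS u (%u1 u2. SS r (%x v. ks (pw p u) (ext (g u1) (wd u2 * m x * wd v)))))"
  by (subst SS_swap) simp
 also have "... = SS w (%u1 s. ks (pw p u1) (ext (g u1) (delta p m s)))"
  by (simp add: SS_assoc delta_def ext_SS SS_ks)
 also have "SS w (%u r. SS r (%x v. SS v (%v1 v2. ks (pw p u) (ext (%t. g t v2) (wd u * m x * wd v1))))) =
  SS w (%x y. ext (%t. g t y) (delta p m x))"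
  by (simp add: SS_assoc delta_def ext_SS)
 finally show ?thesis by (simp add: SS_add add_ac)
qed

lemma delta_SS3:
 assumes "ops p m"
 shows "ext (%w. SS w (%x r. SS r (g x))) (delta p m w) =
  SS w (%x r. SS r (%y z. ext (%t. g t y z) (delta p m x) +
   ks (pw p x) (ext (%t. g x t z) (delta p m y)) +
   ks (pw p x + pw p y) (ext (%t. g x y t) (delta p m z))))"
 by (simp add: delta_SS[OF assms] ext_fun_SS SS_add SS_ks ks_arith)

lemma lett_Nil_mem: "lett p e c ==> w \<in> wkeys c ==> length w = 1"
 by (auto simp: lett_def ks_def wd_def split: if_splits)

lemma hmg_delta:
 assumes "ops p m"
 shows "hmg p (pw p w + 1) (delta p m w)"
 unfolding delta_def
proof (intro hmg_SS hmg_ks)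
 fix u r x v assume w: "u @ r = w" "x @ v = r"
 have "lett p (pw p x + 1) (m x)" using assms by (simp add: ops_def)
 from hmg_mult[OF hmg_mult[OF hmg_wd[OF refl] hmg_lett[OF this]] hmg_wd[OF refl]]
 have "hmg p (pw p u + (pw p x + 1) + pw p v) (wd u * m x * wd v)" .
 then show "hmg p (pw p w + 1) (wd u * m x * wd v)"
  by (rule hmg_cong) (use w in auto)
qed

lemma keys_SS:
 assumes "t \<in> wkeys (SS w f)"
 obtains x y where "x @ y = w" "t \<in> wkeys (f x y)"
proof -
 have "t \<in> (\<Union>i \<in> {(x, y). x @ y = w}. wkeys (case i of (x, y) => f x y))"
  using assms Poly_Mapping.keys_sum[of "%(x, y). f x y" "{(x, y). x @ y = w}"]
  unfolding SS_def by blast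
 then show thesis using that by auto
qed

lemma keys_ks [simp]: "wkeys (ks n c) = wkeys c"
 by (simp add: ks_def)

lemma keys_wd [simp]: "wkeys (wd w) = {w}"
 by (simp add: wd_def)

lemma keys_mult_append:
 assumes "t \<in> wkeys (c * d)"
 obtains u v where "t = u @ v" "u \<in> wkeys c" "v \<in> wkeys d"
 using assms keys_mult[of c d] by (auto simp: plus_list_def)

lemma keys_delta:
 assumes "t \<in> wkeys (delta p m w)" "ops p m"
 obtains u x v l where "w = u @ x @ v" "t = u @ l @ v" "l \<in> wkeys (m x)" "length l = 1"
proof -
 obtain u r where 1: "u @ r = w" "t \<in> wkeys (SS r (%x v. ks (pw p u) (wd u * m x * wd v)))"
  using assms(1) unfolding delta_def by (rule keys_SS)
 obtain x v where 2: "x @ v = r" "t \<in> wkeys (wd u * m x * wd v)"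
  using 1(2) by (rule keys_SS) simp
 obtain s v' where 3: "t = s @ v'" "s \<in> wkeys (wd u * m x)" "v' \<in> wkeys (wd v)"
  using 2(2) by (rule keys_mult_append)
 obtain u' l where 4: "s = u' @ l" "u' \<in> wkeys (wd u)" "l \<in> wkeys (m x)"
  using 3(2) by (rule keys_mult_append)
 have "lett p (pw p x + 1) (m x)" using assms(2) by (simp add: ops_def)
 then have "length l = 1" using 4(3) by (rule lett_Nil_mem)
 then show thesis using that[of u x v l] 1 2 3 4 by simp
qed

lemma delta_keys_Nil: "ops p m ==> [] \<notin> wkeys (delta p m w)"
 using keys_delta[of "[]" p m w] by force

lemma delta_Nil [simp]: "ops p m ==> delta p m [] = 0"
 by (simp add: delta_def ops_def)

text \<open>The square of an odd coderivation is again a coderivation: two operations at disjoint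
  places occur in both orders with opposite signs, so only nested ones survive, and these are
  \<open>m\<close> after \<open>delta\<close>.\<close>

lemma delta_delta:
 assumes "ops p m"
 shows "ext (delta p m) (delta p m w) =
  SS w (%u r. SS r (%x v. wd u * ext m (delta p m x) * wd v))"
proof -
 have "ext (delta p m) (delta p m w) = ext (%w. SS w (%u r. SS r ((%u x v. ks (pw p u) (wd u * m x * wd v)) u))) (delta p m w)"
  by (simp add: delta_def[abs_def])
 also have "... = SS w (%x r. SS r (%y z.
   - ks (pw p x) (delta p m x * m y * wd z)
   + ks (pw p x) (ks (pw p x) (wd x * ext m (delta p m y) * wd z))
   + ks (pw p x + pw p y) (ks (pw p x) (wd x * m y * delta p m z))))"
  unfolding delta_SS3[OF assms]
 proof (intro SS_congI)
  fix x r y z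
  have 1: "ext (%t. ks (pw p t) (wd t * m y * wd z)) (delta p m x) = - ks (pw p x) (delta p m x * m y * wd z)"
   unfolding hmg_ext_ks_1[OF hmg_delta[OF assms]] mult.assoc ext_fun_multr ext_id
   by (rule ks_minus_cong) auto
  show "ext (%t. ks (pw p t) (wd t * m y * wd z)) (delta p m x) +
    ks (pw p x) (ext (%t. ks (pw p x) (wd x * m t * wd z)) (delta p m y)) +
    ks (pw p x + pw p y) (ext (%t. ks (pw p x) (wd x * m y * wd t)) (delta p m z)) =
    - ks (pw p x) (delta p m x * m y * wd z) +
    ks (pw p x) (ks (pw p x) (wd x * ext m (delta p m y) * wd z)) +
    ks (pw p x + pw p y) (ks (pw p x) (wd x * m y * delta p m z))"
   unfolding 1 ext_fun_ks ext_fun_mult ext_fun_multl ext_id ..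
 qed
 also have "... = SS w (%u r. SS r (%x v. wd u * ext m (delta p m x) * wd v))
   + (SS w (%x r. SS r (%y z. ks (pw p x + pw p y) (ks (pw p x) (wd x * m y * delta p m z))))
    - SS w (%x r. SS r (%y z. ks (pw p x) (delta p m x * m y * wd z))))"
  by (simp add: SS_add SS_diff SS_minus)
 \<comment> \<open>Both leftover sums run over cuts of \<open>w\<close> into five pieces with
   operations on the second and the fourth; they are brought into the same form and cancel.\<close>
 also have "SS w (%x r. SS r (%y z. ks (pw p x) (delta p m x * m y * wd z))) =
  SS w (%x r. SS x (%u s. SS s (%t v. SS r (%y z. ks (pw p x + pw p u) (wd u * m t * wd v * m y * wd z)))))"
  unfolding delta_def SS_mult_right SS_ks
  apply (intro SS_congI)
  apply (subst SS_swap)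
  apply (intro SS_congI)
  apply (subst SS_swap)
  apply simp
  done
 also have "... = SS w (%u s. SS s (%t r. SS r (%v z. SS z (%y z. ks (pw p t + pw p v) (wd u * m t * wd v * m y * wd z)))))"
  by (simp add: SS_assoc) (intro SS_congI ks_cong; auto)
 also have "... = SS w (%x r. SS r (%y z. ks (pw p x + pw p y) (ks (pw p x) (wd x * m y * delta p m z))))"
  unfolding delta_def SS_mult_left SS_ks
  by (intro SS_congI) (simp add: mult.assoc, intro ks_cong; auto)
 finally show ?thesis
  by simp
qed

section \<open>Maps of tensor coalgebras\<close>

lemma tens_pow_eq_0: "Ph [] = 0 ==> length w < r ==> tens_pow Ph r w = 0"
proof (induction r arbitrary: w)
 case (Suc r)
 have "Ph x * tens_pow Ph r y = 0" if "x @ y = w" for x y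
 proof (cases "x = []")
  case False
  then have "length y < r" using that Suc.prems by (cases x) auto
  then show ?thesis using Suc.IH Suc.prems by simp
 qed (simp add: Suc.prems)
 then show ?case by (simp cong: SS_cong)
qed simp

lemma bar_Nil [simp]: "bar Ph [] = 1"
 by (simp add: bar_def)

text \<open>Splitting off the first block. The inductions below use this recursion instead of the
  sum over numbers of blocks.\<close>

lemma bar_rec:
 assumes "Ph [] = 0" "w ~= []"
 shows "bar Ph w = SS w (%x y. Ph x * bar Ph y)"
proof -
 obtain n where n: "length w = Suc n" using assms(2) by (cases w) auto
 have "bar Ph w = (\<Sum>r\<le>n. tens_pow Ph (Suc r) w)"
  unfolding bar_def n using assms(2) by (subst sum.atMost_Suc_shift) simp
 also have "... = SS w (%x y. \<Sum>r\<le>n. Ph x * tens_pow Ph r y)"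
  by (simp add: SS_def case_prod_unfold) (rule sum.swap)
 also have "... = SS w (%x y. Ph x * bar Ph y)"
 proof (rule SS_congI)
  fix x y assume xy: "x @ y = w"
  show "(\<Sum>r\<le>n. Ph x * tens_pow Ph r y) = Ph x * bar Ph y"
  proof (cases "x = []")
   case False
   with xy n have "length y \<le> n" by (cases x) auto
   then have "(\<Sum>r\<le>n. tens_pow Ph r y) = bar Ph y"
    unfolding bar_def
    by (intro sum.mono_neutral_right) (auto intro!: tens_pow_eq_0 assms)
   then show ?thesis by (simp add: sum_distrib_left[symmetric])
  qed (simp add: assms)
 qed
 finally show ?thesis .
qed

lemma hmg_bar:
 assumes "mors p q Ph"
 shows "hmg q (pw p w) (bar Ph w)"
proof (induction w rule: length_induct)
 case (1 w)
 show ?case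
 proof (cases "w = []")
  case True
  then show ?thesis using hmg_wd[of q "[]" 0] by simp
 next
  case False
  show ?thesis
   unfolding bar_rec[where Ph = Ph, OF assms[unfolded mors_def, THEN conjunct1] False]
  proof (rule hmg_SS)
   fix x y assume xy: "x @ y = w"
   show "hmg q (pw p w) (Ph x * bar Ph y)"
   proof (cases "x = []")
    case False
    with xy 1 have "hmg q (pw p y) (bar Ph y)" by auto
    moreover have "hmg q (pw p x) (Ph x)"
     using assms by (intro hmg_lett) (auto simp: mors_def)
    ultimately show ?thesis using hmg_mult xy by fastforce
   qed (use assms in \<open>simp add: mors_def\<close>)
  qed
 qed
qed

text \<open>\<open>bar\<close> commutes with deconcatenation, because a cut of an image word falls
  between two blocks and so comes from a cut of \<open>w\<close>.\<close>

lemma bar_SS: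
 assumes "mors p q Ph"
 shows "ext (%w. SS w g) (bar Ph w) = SS w (%x y. ext (%s. ext (g s) (bar Ph y)) (bar Ph x))"
proof (induction w arbitrary: g rule: length_induct)
 case (1 w)
 have Ph0: "Ph [] = 0" using assms by (simp add: mors_def)
 show ?case
 proof (cases "w = []")
  case True
  then show ?thesis by (simp add: wd_Nil[symmetric] del: wd_Nil)
 next
  case False
  have step: "ext (%w. SS w g) (Ph x * bar Ph y) = ext (g []) (Ph x * bar Ph y) +
    SS y (%y1 y2. ext (%s. ext (g s) (bar Ph y2)) (Ph x * bar Ph y1))"
   if "x @ y = w" for x y
  proof (cases "x = []")
   case False
   have "lett q (pw p x) (Ph x)" using assms by (simp add: mors_def)
   then consider "Ph x = 0" | l n where "Ph x = ks n (wd [l])" by (auto simp: lett_def)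
   then show ?thesis
   proof cases
    case 2
    have "length y < length w" using that False by auto
    then have "ext (%w. SS w (%s. g (l # s))) (bar Ph y) =
      SS y (%x y. ext (%s. ext (g (l # s)) (bar Ph y)) (bar Ph x))"
     using 1 by blast
    moreover have "ext (%w. SS w g) (wd [l] * bar Ph y) = ext (%w. SS (l # w) g) (bar Ph y)"
     using ext_append(1)[of "%w. SS w g" "[l]"] by simp
    moreover have "... = ext (g []) (wd [l] * bar Ph y) + ext (%w. SS w (%s. g (l # s))) (bar Ph y)"
     using ext_append(1)[of "g []" "[l]"] by (simp add: SS_Cons ext_fun_add)
    moreover have "ext (%s. ext (g (l # s)) d) c = ext (%s. ext (g s) d) (wd [l] * c)" for c d
     using ext_append(1)[of "%s. ext (g s) d" "[l]" c] by simp
    ultimately show ?thesis by (simp add: 2 ks_arith SS_ks)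
   qed simp
  qed (simp add: Ph0)
  have "ext (%w. SS w g) (bar Ph w) = SS w (%x y. ext (%w. SS w g) (Ph x * bar Ph y))"
   by (simp add: bar_rec[where Ph = Ph, OF Ph0 False] ext_SS)
  also have "... = SS w (%x y. ext (g []) (Ph x * bar Ph y)) +
   SS w (%x y. SS y (%y1 y2. ext (%s. ext (g s) (bar Ph y2)) (Ph x * bar Ph y1)))"
   unfolding SS_add[symmetric] by (rule SS_congI) (rule step)
  also have "SS w (%x y. ext (g []) (Ph x * bar Ph y)) = ext (g []) (bar Ph w)"
   by (simp add: bar_rec[where Ph = Ph, OF Ph0 False] ext_SS)
  also have "SS w (%x y. SS y (%y1 y2. ext (%s. ext (g s) (bar Ph y2)) (Ph x * bar Ph y1))) =
   SS w (%u y2. SS u (%x y1. ext (%s. ext (g s) (bar Ph y2)) (Ph x * bar Ph y1)))"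
   by (simp add: SS_assoc)
  also have "... = SS w (%u y2. if u = [] then 0 else ext (%s. ext (g s) (bar Ph y2)) (bar Ph u))"
   by (intro SS_congI) (simp add: Ph0 bar_rec[where Ph = Ph, OF Ph0] ext_SS)
  also have "ext (g []) (bar Ph w) + ... = SS w (%x y. ext (%s. ext (g s) (bar Ph y)) (bar Ph x))"
   by (subst (2) SS_left_Nil) (simp add: wd_Nil[symmetric] del: wd_Nil)
  finally show ?thesis .
 qed
qed

lemma bar_SS3:
 assumes "mors p q Ph"
 shows "ext (%w. SS w (%x r. SS r (g x))) (bar Ph w) =
  SS w (%x r. SS r (%y z.
   ext (%s. ext (%t. ext (g s t) (bar Ph z)) (bar Ph y)) (bar Ph x)))"
 by (simp add: bar_SS[OF assms] ext_fun_SS)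

lemma delta_bar:
 assumes "mors p q Ph"
 shows "ext (delta q m) (bar Ph w) =
  SS w (%u r. SS r (%x v. ks (pw p u) (bar Ph u * ext m (bar Ph x) * bar Ph v)))"
 unfolding delta_def[abs_def] bar_SS3[OF assms]
 by (simp add: ext_fun_ks ext_fun_multl ext_fun_multr hmg_ext_ks_1[OF hmg_bar[OF assms]])

text \<open>Together with \<open>delta_bar\<close> this writes both composites as sums over
  \<open>w = u x v\<close> with \<open>bar\<close> on \<open>u\<close> and \<open>v\<close>. They
  differ only in the middle factor, where the morphism relation for \<open>x\<close> compares
  them.\<close>

lemma bar_delta:
 assumes "mors p q Ph" "ops p m"
 shows "ext (bar Ph) (delta p m w) =
  SS w (%u r. SS r (%x v. ks (pw p u) (bar Ph u * ext Ph (delta p m x) * bar Ph v)))"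
proof (induction w rule: length_induct)
 case (1 w)
 have Ph0: "Ph [] = 0" using assms by (simp add: mors_def)
 let ?d = "delta p m" and ?b = "bar Ph"
 let ?Y = "%w. SS w (%u r. SS r (%x v. ks (pw p u) (?b u * ext Ph (?d x) * ?b v)))"
 show ?case
 proof (cases "w = []")
  case False
  have "ext ?b (?d w) = ext (%w. SS w (%x y. Ph x * ?b y)) (?d w)"
  \<comment> \<open>The recursion for \<open>bar\<close> needs nonempty words, and
    \<open>delta\<close> produces no others.\<close>
  proof (rule ext_cong)
   fix t assume "t \<in> wkeys (?d w)"
   then have "t ~= []"
    using delta_keys_Nil assms by metis
   then show "?b t = SS t (%x y. Ph x * ?b y)" by (rule bar_rec[where Ph = Ph, OF Ph0])
  qed
  also have "... = SS w (%x y. ext Ph (?d x) * ?b y + ks (pw p x) (Ph x * ext ?b (?d y)))"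
   by (simp add: delta_SS[OF assms(2)] ext_fun_multl ext_fun_multr)
  also have "... = SS w (%x y. ext Ph (?d x) * ?b y + ks (pw p x) (Ph x * ?Y y))"
  proof (intro SS_congI)
   fix x y assume "x @ y = w"
   then show "ext Ph (?d x) * ?b y + ks (pw p x) (Ph x * ext ?b (?d y)) =
    ext Ph (?d x) * ?b y + ks (pw p x) (Ph x * ?Y y)"
    using 1 by (cases "x = []") (auto simp: Ph0)
  qed
  also have "... = SS w (%x y. ext Ph (?d x) * ?b y) +
    SS w (%x y. SS y (%u r. SS r (%z v. ks (pw p x + pw p u) (Ph x * ?b u * ext Ph (?d z) * ?b v))))"
   by (simp add: SS_add SS_ks SS_mult_left mult.assoc)
  also have "SS w (%x y. SS y (%u r. SS r (%z v. ks (pw p x + pw p u) (Ph x * ?b u * ext Ph (?d z) * ?b v)))) =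
    SS w (%s r. SS s (%x u. SS r (%z v. ks (pw p x + pw p u) (Ph x * ?b u * ext Ph (?d z) * ?b v))))"
   by (simp add: SS_assoc)
  also have "... = SS w (%s r. if s = [] then 0 else SS r (%z v. ks (pw p s) (?b s * ext Ph (?d z) * ?b v)))"
  proof (intro SS_congI)
   fix s r assume "s @ r = w"
   have *: "SS s (%x u. ks (pw p x + pw p u) (Ph x * ?b u * ext Ph (?d z) * ?b v)) =
    ks (pw p s) (SS s (%x u. Ph x * ?b u) * ext Ph (?d z) * ?b v)" for z v
    unfolding SS_mult_right SS_ks by (intro SS_congI) auto
   show "SS s (%x u. SS r (%z v. ks (pw p x + pw p u) (Ph x * ?b u * ext Ph (?d z) * ?b v))) =
    (if s = [] then 0 else SS r (%z v. ks (pw p s) (?b s * ext Ph (?d z) * ?b v)))"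
    by (subst SS_swap) (simp add: * Ph0 bar_rec[where Ph = Ph, OF Ph0])
  qed
  also have "SS w (%x y. ext Ph (?d x) * ?b y) + ... = ?Y w"
   by (subst (2) SS_left_Nil) simp
  finally show ?thesis .
 qed (simp add: assms)
qed

text \<open>The three kinds of operations on a concatenation: inside \<open>z\<close>, inside
  \<open>x\<close>, and across the junction. The guards keep in the last sum only blocks that meet
  both parts.\<close>

lemma delta_append:
 assumes "ops p m"
 shows "delta p m (z @ x) = delta p m z * wd x + ks (pw p z) (wd z * delta p m x) +
  SS z (%z1 z2. SS x (%x1 x2. if z2 = [] \<or> x1 = [] then 0
   else ks (pw p z1) (wd z1 * m (z2 @ x1) * wd x2)))"
proof -
 have m0: "m [] = 0" using assms by (simp add: ops_def)
 let ?h = "%a b. SS x (%x1 x2. if x1 = [] then 0 else ks (pw p a) (wd a * m (b @ x1) * wd x2))"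
 have 1: "SS z (%a b. SS (b @ x) (%y v. ks (pw p a) (wd a * m y * wd v))) =
  delta p m z * wd x + SS z ?h"
  by (simp add: SS_append SS_add delta_def SS_mult_right wd_append mult.assoc cong: if_cong)
 have 2: "SS x (%a b. if a = [] then 0 else SS b (%y v. ks (pw p (z @ a)) (wd (z @ a) * m y * wd v))) + ?h z [] =
   ks (pw p z) (wd z * delta p m x)"
  unfolding delta_def SS_mult_left SS_ks
  by (subst (3) SS_left_Nil) (simp add: wd_append mult.assoc m0 SS_left_Nil[of x "%x1 x2. ks (pw p z) (wd z * (m x1 * wd x2))"] add_ac cong: if_cong)
 have 3: "SS z ?h = ?h z [] + SS z (%z1 z2. SS x (%x1 x2. if z2 = [] \<or> x1 = [] then 0
   else ks (pw p z1) (wd z1 * m (z2 @ x1) * wd x2)))"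
  by (subst SS_right_Nil) (simp add: SS_if, intro SS_congI, simp)
 show ?thesis
  unfolding delta_def[of p m "z @ x"] SS_append[of z x] 1 2[symmetric] 3 by (simp add: add_ac)
qed

text \<open>The summands are sorted by the block that contains the first letter of \<open>x\<close>.
  It may reach back into \<open>z\<close>; \<open>z2 = []\<close> means that it starts at the
  junction.\<close>

lemma bar_append:
 assumes "mors p q Ph" "x ~= []"
 shows "bar Ph (z @ x) = SS z (%z1 z2. SS x (%x1 x2.
  if x1 = [] then 0 else bar Ph z1 * Ph (z2 @ x1) * bar Ph x2))"
proof (induction z rule: length_induct)
 case (1 z)
 have Ph0: "Ph [] = 0" using assms by (simp add: mors_def)
 note rec = bar_rec[where Ph = Ph, OF Ph0]
 let ?X = "%z1 z2. SS x (%x1 x2. if x1 = [] then 0 else bar Ph z1 * Ph (z2 @ x1) * bar Ph x2)"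
 have "bar Ph (z @ x) = SS z (%a b. Ph a * bar Ph (b @ x)) + ?X [] z"
  using assms(2) by (subst rec) (simp_all add: SS_append cong: if_cong)
 also have "SS z (%a b. Ph a * bar Ph (b @ x)) = SS z (%a b. Ph a * SS b ?X)"
 proof (rule SS_congI)
  fix a b assume "a @ b = z"
  then show "Ph a * bar Ph (b @ x) = Ph a * SS b ?X"
   using 1 by (cases "a = []") (auto simp: Ph0)
 qed
 also have "... = SS z (%s z2. SS s (%a z1. Ph a * ?X z1 z2))"
  by (simp add: SS_assoc SS_mult_left)
 also have "... = SS z (%s z2. if s = [] then 0 else ?X s z2)"
 proof (rule SS_congI)
  fix s z2
  have "SS s (%a z1. Ph a * ?X z1 z2) = SS x (%x1 x2. if x1 = [] then 0 else SS s (%a z1. Ph a * bar Ph z1) * Ph (z2 @ x1) * bar Ph x2)"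
   unfolding SS_mult_left SS_mult_right SS_if
   by (subst SS_swap) (intro SS_congI, simp add: mult.assoc)
  then show "SS s (%a z1. Ph a * ?X z1 z2) = (if s = [] then 0 else ?X s z2)"
   using rec[of s] by (cases "s = []") (simp_all add: Ph0 cong: if_cong)
 qed
 also have "... + ?X [] z = SS z ?X"
  by (subst (2) SS_left_Nil) (simp add: add_ac)
 finally show ?case .
qed

lemma bar_snoc:
 assumes "mors p q Ph"
 shows "bar Ph (y @ [l]) = SS y (%u z. bar Ph u * Ph (z @ [l]))"
 by (simp add: bar_append[OF assms] SS_Cons)

section \<open>Cyclic windows\<close>

lemma rot_snoc: "rot p (y @ [l]) = ks (p l * pw p y) (wd (l # y))"
 by (simp add: rot_def)

lemma CY_Cons:
 "CY p g (l # y) = SS y (%x r. SS r (%u z. ks (pw p z * (p l + pw p x + pw p u)) (g (z @ l # x) u)))"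
 by (simp add: CY_def SS_Cons)

text \<open>Windows of \<open>w\<close> contain its first letter, windows of the rotated word
  contain the last letter of \<open>w\<close>. Windows that wrap around contain both and cancel.
  What remains starts at the first letter or ends at the last one, the full window being in both
  sums.\<close>

lemma CY_rot:
 assumes "w ~= []"
 shows "CY p g w - ext (CY p g) (rot p w) =
  SS w (%x r. if x = [] then 0 else g x r) -
  SS w (%u z. if z = [] then 0 else ks (pw p u * pw p z) (g z u))"
proof -
 obtain y l where w: "w = y @ [l]" using assms by (metis rev_exhaust)
 have 1: "CY p g w = SS w (%x r. if x = [] then 0 else g x r) +
  SS y (%x r. SS r (%u z. if x = [] then 0 else ks ((pw p z + p l) * (pw p x + pw p u)) (g (z @ l # x) u)))"
  unfolding CY_def w
  by (simp add: SS_append SS_Cons SS_add cong: if_cong)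
 have 2: "ext (CY p g) (rot p w) =
  SS y (%x r. SS r (%u z. ks ((pw p z + p l) * (pw p x + pw p u)) (g (z @ l # x) u)))"
  unfolding w rot_snoc ext_ks ext_wd CY_Cons SS_ks
  by (intro SS_congI) (auto intro!: ks_cong)
 have 3: "SS w (%u z. if z = [] then 0 else ks (pw p u * pw p z) (g z u)) =
   SS y (%u z. ks ((pw p z + p l) * pw p u) (g (z @ [l]) u))"
  unfolding w by (simp add: SS_append SS_Cons algebra_simps)
 show ?thesis
  unfolding 1 2 3
  by (subst (3) SS_left_Nil) (simp add: SS_if cong: if_cong)
qed

lemma SS_eq_0: "(!!x y. x @ y = w ==> f x y = 0) ==> SS w f = 0"
 using SS_congI[of w f "%x y. 0"] by simp

lemma CY_congI:
 "(!!x y z. x @ y @ z = w ==> x ~= [] ==> f (z @ x) y = g (z @ x) y) ==> CY p f w = CY p g w"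
 unfolding CY_def by (intro SS_congI) auto

lemma CY_add: "CY p (%s y. f s y + g s y) w = CY p f w + CY p g w"
 unfolding CY_def SS_add[symmetric] by (intro SS_congI) (simp add: ks_arith)

lemma ext_CY: "ext h (CY p g w) = CY p (%s y. ext h (g s y)) w"
 unfolding CY_def ext_SS by (intro SS_congI) simp

lemma CY_Nil [simp]: "CY p g [] = 0"
 by (simp add: CY_def)

lemma ext_CY_lett:
 assumes "lett p e c"
 shows "ext (CY p g) (c * wd d) = SS d (%x r. SS r (%u z.
  ks (pw p z * (e + pw p x + pw p u)) (ext (%t. g t u) (wd z * c * wd x))))"
proof -
 consider "c = 0" | l n where "c = ks n (wd [l])" "even (p l) \<longleftrightarrow> even e"
  using assms by (auto simp: lett_def)
 then show ?thesis
 proof cases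
  case 2
  have *: "wd z * wd [l] * wd x = wd (z @ l # x)" for z x
   by (simp add: wd_append[symmetric])
  show ?thesis
   unfolding 2 ks_mult ext_ks wd_append[symmetric] append.simps ext_wd CY_Cons SS_ks *
   by (intro SS_congI) (auto intro!: ks_cong simp: 2)
 qed simp
qed

text \<open>The terms of \<open>hoch\<close> are sorted by the fate of the first letter of
  \<open>w\<close>: either an operation consumes it, possibly wrapping around, or it is left alone,
  a window of length 1, and \<open>delta\<close> acts on the rest.\<close>

lemma hoch_CY:
 assumes "ops p m" "w ~= []"
 shows "hoch p m w = CY p (%s y. m s * wd y + (if length s = 1 then ks (pw p s) (wd s * delta p m y) else 0)) w"
proof -
 have m0: "m [] = 0" using assms by (simp add: ops_def)
 obtain l w' where w: "w = l # w'" using assms(2) by (cases w) auto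
 have 1: "delta p m w = SS w (%x v. m x * wd v) + ks (p l) (wd [l] * delta p m w')"
  unfolding w delta_def[of p m "l # w'"] SS_Cons[of l w' "%u r. SS r (F u r)" for F]
  by (simp add: delta_def SS_mult_left SS_ks wd_Cons mult.assoc)
 have 2: "CY p (%s y. m s * wd y) w = SS w (%x v. m x * wd v) + wrap p m w"
 proof -
  have "CY p (%s y. m s * wd y) w = SS w (%x r. if x = [] then 0 else m x * wd r) + wrap p m w"
   unfolding CY_def wrap_def SS_add[symmetric]
  proof (rule SS_congI)
   fix x r
   show "SS r (%y z. if x = [] then 0 else ks (pw p z * (pw p x + pw p y)) (m (z @ x) * wd y)) =
    (if x = [] then 0 else m x * wd r) +
    SS r (%y z. if x = [] \<or> z = [] then 0 else ks (pw p z * (pw p x + pw p y)) (m (z @ x) * wd y))"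
    by (cases "x = []") (simp, subst SS_right_Nil, simp cong: if_cong)
  qed
  also have "SS w (%x r. if x = [] then 0 else m x * wd r) = SS w (%x v. m x * wd v)"
   by (intro SS_congI) (simp add: m0)
  finally show ?thesis .
 qed
 have 3: "CY p (%s y. if length s = 1 then ks (pw p s) (wd s * delta p m y) else 0) w =
   ks (p l) (wd [l] * delta p m w')"
 proof -
  have *: "length (z @ l # x) = 1 \<longleftrightarrow> x = [] \<and> z = []" for x z by auto
  have "CY p (%s y. if length s = 1 then ks (pw p s) (wd s * delta p m y) else 0) w =
   SS w' (%x r. if x = [] then SS r (%u z. if z = [] then ks (p l) (wd [l] * delta p m u) else 0) else 0)"
   unfolding w CY_Cons *
   by (intro SS_congI) (auto intro!: SS_congI SS_eq_0)
  also have "... = ks (p l) (wd [l] * delta p m w')"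
   by (subst SS_left_Nil, subst SS_right_Nil) (simp add: SS_eq_0)
  finally show ?thesis .
 qed
 show ?thesis unfolding hoch_def CY_add 1 2 3 by simp
qed

lemma wrap_Nil [simp]: "wrap p m [] = 0"
 by (simp add: wrap_def)

lemma CY_wrap:
 assumes "ops p m"
 shows "ext (CY p g) (wrap p m w) = SS w (%x1 r. SS r (%x2 r. SS r (%y r. SS r (%z1 z2.
  if x1 = [] \<or> z2 = [] then 0 else
   ks ((pw p z1 + pw p z2) * (pw p x1 + pw p x2 + pw p y)) (ks (pw p z1)
    (ext (%t. g t y) (wd z1 * m (z2 @ x1) * wd x2)))))))"
proof -
 have *: "lett p (pw p x + 1) (m x)" for x using assms by (simp add: ops_def)
 have "ext (CY p g) (wrap p m w) = SS w (%x1 r. SS r (%Y z2. SS Y (%x2 r. SS r (%y z1.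
  if x1 = [] \<or> z2 = [] then 0 else
   ks ((pw p z1 + pw p z2) * (pw p x1 + pw p x2 + pw p y)) (ks (pw p z1)
    (ext (%t. g t y) (wd z1 * m (z2 @ x1) * wd x2)))))))"
  unfolding wrap_def ext_SS
  by (intro SS_congI) (auto simp: ext_CY_lett[OF *] SS_ks intro!: SS_congI ks_cong)
 then show ?thesis by (simp add: SS_assoc)
qed

text \<open>\<open>hoch\<close> is a coderivation with respect to cyclic windows: an operation acts
  inside the window or inside its complement. Operations across the junction of \<open>z\<close> and
  \<open>x\<close> within a window come from \<open>wrap\<close>, all others from
  \<open>delta\<close>.\<close>

lemma CY_hoch:
 assumes "ops p m"
 shows "ext (CY p g) (hoch p m w) =
  CY p (%s y. ext (%t. g t y) (delta p m s) + ks (pw p s) (ext (g s) (delta p m y))) w"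
proof -
 let ?d = "delta p m"
 note hm = hmg_ext_ks[OF hmg_delta[OF assms]]
 \<comment> \<open>The operations across the junction in \<open>delta_append\<close>.\<close>
 let ?S = "%x y z. SS z (%z1 z2. SS x (%x1 x2. if z2 = [] \<or> x1 = [] then 0
   else ks (pw p z1) (ext (%t. g t y) (wd z1 * m (z2 @ x1) * wd x2))))"
 have 1: "ext (CY p g) (?d w) = SS w (%x r. SS r (%y z. if x = [] then 0 else
   ks (pw p z * (pw p x + 1 + pw p y)) (ext (%t. g t y) (wd z * ?d x)) +
   ks (pw p x) (ks (pw p z * (pw p x + (pw p y + 1))) (ext (g (z @ x)) (?d y))) +
   ks (pw p x + pw p y) (ks ((pw p z + 1) * (pw p x + pw p y)) (ext (%t. g t y) (?d z * wd x)))))"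
  unfolding CY_def delta_SS3[OF assms]
 proof (intro SS_congI)
  fix x r y z assume "x @ r = w" "y @ z = r"
  have a: "ext (%t. if t = [] then 0 else ks (pw p z * (pw p t + pw p y)) (g (z @ t) y)) (?d x) =
   ks (pw p z * (pw p x + 1 + pw p y)) (ext (%t. g t y) (wd z * ?d x))"
  proof -
   have "ext (%t. if t = [] then 0 else ks (pw p z * (pw p t + pw p y)) (g (z @ t) y)) (?d x) =
    ext (%t. ks (pw p z * (pw p x + 1 + pw p y)) (g (z @ t) y)) (?d x)"
    by (rule ext_cong) (use delta_keys_Nil[OF assms] hmg_delta[OF assms, of x] in
     \<open>auto simp: hmg_def intro!: ks_cong\<close>)
   then show ?thesis by (simp add: ext_fun_ks ext_append(1)[of "%t. g t y"])
  qed
  have b: "ext (%t. ks (pw p z * (pw p x + pw p t)) (g (z @ x) t)) (?d y) =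
   ks (pw p z * (pw p x + (pw p y + 1))) (ext (g (z @ x)) (?d y))"
  proof -
   have "ext (%t. ks (pw p z * (pw p x + pw p t)) (g (z @ x) t)) (?d y) =
    ext (%t. ks (pw p z * (pw p x + (pw p y + 1))) (g (z @ x) t)) (?d y)"
    by (rule hmg_ext[OF hmg_delta[OF assms]]) (auto intro!: ks_cong)
   then show ?thesis by (simp add: ext_fun_ks)
  qed
  have c: "ext (%t. ks (pw p t * (pw p x + pw p y)) (g (t @ x) y)) (?d z) =
   ks ((pw p z + 1) * (pw p x + pw p y)) (ext (%t. g t y) (?d z * wd x))"
   unfolding hm by (simp add: ext_append(2)[of "%t. g t y"])
  show "ext (%t. if t = [] then 0 else ks (pw p z * (pw p t + pw p y)) (g (z @ t) y)) (?d x) +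
    ks (pw p x) (ext (%t. if x = [] then 0 else ks (pw p z * (pw p x + pw p t)) (g (z @ x) t)) (?d y)) +
    ks (pw p x + pw p y) (ext (%t. if x = [] then 0 else ks (pw p t * (pw p x + pw p y)) (g (t @ x) y)) (?d z)) =
    (if x = [] then 0 else
   ks (pw p z * (pw p x + 1 + pw p y)) (ext (%t. g t y) (wd z * ?d x)) +
   ks (pw p x) (ks (pw p z * (pw p x + (pw p y + 1))) (ext (g (z @ x)) (?d y))) +
   ks (pw p x + pw p y) (ks ((pw p z + 1) * (pw p x + pw p y)) (ext (%t. g t y) (?d z * wd x))))"
   using a b c assms by (cases "x = []") simp_all
 qed
 have 2: "ext (CY p g) (wrap p m w) = SS w (%x r. SS r (%y z. if x = [] then 0 else
   ks (pw p z * (pw p x + pw p y)) (?S x y z)))"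
 proof -
  have "SS w (%x r. SS r (%y z. if x = [] then 0 else ks (pw p z * (pw p x + pw p y)) (?S x y z))) =
   SS w (%x r. SS r (%y z. SS z (%z1 z2. SS x (%x1 x2. if x1 = [] \<or> z2 = [] then 0 else
    ks ((pw p z1 + pw p z2) * (pw p x1 + pw p x2 + pw p y)) (ks (pw p z1)
     (ext (%t. g t y) (wd z1 * m (z2 @ x1) * wd x2)))))))"
   unfolding SS_ks SS_if by (intro SS_congI) (auto intro!: ks_cong)
  also have "... = SS w (%x r. SS x (%x1 x2. SS r (%y z. SS z (%z1 z2. if x1 = [] \<or> z2 = [] then 0 else
    ks ((pw p z1 + pw p z2) * (pw p x1 + pw p x2 + pw p y)) (ks (pw p z1)
     (ext (%t. g t y) (wd z1 * m (z2 @ x1) * wd x2)))))))"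
   apply (intro SS_congI)
   apply (subst (2) SS_swap)
   apply (subst SS_swap)
   apply (rule refl)
   done
  also have "... = ext (CY p g) (wrap p m w)"
   by (simp add: SS_assoc CY_wrap[OF assms])
  finally show ?thesis ..
 qed
 show ?thesis
  unfolding hoch_def frag_extend_add 1 2 SS_add[symmetric] unfolding CY_def
 proof (intro SS_congI)
  fix x r y z assume "x @ r = w" "y @ z = r"
  have *: "ks (pw p z * (pw p x + 1 + pw p y)) X = ks (pw p z * (pw p x + pw p y)) (ks (pw p z) X)"
   "ks (pw p x) (ks (pw p z * (pw p x + (pw p y + 1))) X) = ks (pw p z * (pw p x + pw p y)) (ks (pw p z + pw p x) X)"
   "ks (pw p x + pw p y) (ks ((pw p z + 1) * (pw p x + pw p y)) X) = ks (pw p z * (pw p x + pw p y)) X"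
   for X :: "'b chain"
   by (auto intro!: ks_cong)
  show "(if x = [] then 0
    else ks (pw p z * (pw p x + 1 + pw p y)) (ext (%t. g t y) (wd z * ?d x)) +
       ks (pw p x) (ks (pw p z * (pw p x + (pw p y + 1))) (ext (g (z @ x)) (?d y))) +
       ks (pw p x + pw p y) (ks ((pw p z + 1) * (pw p x + pw p y)) (ext (%t. g t y) (?d z * wd x)))) +
    (if x = [] then 0 else ks (pw p z * (pw p x + pw p y)) (?S x y z)) =
    (if x = [] then 0
    else ks (pw p z * (pw p x + pw p y))
       (ext (%t. g t y) (?d (z @ x)) + ks (pw p (z @ x)) (ext (g (z @ x)) (?d y))))"
   unfolding * by (cases "x = []")
    (simp_all add: delta_append[OF assms] ext_arith ext_SS ks_arith if_distrib[of "ext h" for h] add_ac cong: if_cong)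
 qed
qed

lemma ext_mult_left: "ext h (c * d) = ext (%t. ext h (c * wd t)) d"
 by (induction d rule: chain_induct) (simp_all add: ext_arith algebra_simps)

lemma opsD: "ops p m ==> lett p (pw p x + 1) (m x)"
 by (simp add: ops_def)

lemma morsD: "mors p q Ph ==> lett q (pw p x) (Ph x)"
 by (simp add: mors_def)

lemma hoch_Nil [simp]: "ops p m ==> hoch p m [] = 0"
 by (simp add: hoch_def)

definition hoch_kernel :: "('l => nat) => ('l list => 'l chain) => 'l list => 'l list => 'l chain" where
 "hoch_kernel p m s y = m s * wd y + (if length s = 1 then ks (pw p s) (wd s * delta p m y) else 0)"

lemma hoch_eq_CY: "ops p m ==> hoch p m = CY p (hoch_kernel p m)"
proof
 fix w assume "ops p m"
 then show "hoch p m w = CY p (hoch_kernel p m) w"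
  by (cases "w = []") (simp_all add: hoch_CY hoch_kernel_def[abs_def])
qed

text \<open>Projection to single letters recovers an operator from its coderivation: a term survives
  only if the operation consumes the whole word.\<close>

lemma ext_length_one_delta:
 assumes "ops p m"
 shows "ext (%t. if length t = 1 then f t else 0) (delta p m w) = ext f (m w)"
proof -
 have m0: "m [] = 0" and lm: "!!x. lett p (pw p x + 1) (m x)" using assms by (auto simp: ops_def)
 let ?g = "%t. if length t = 1 then f t else 0"
 have *: "ext ?g (wd u * m x * wd v) = (if u = [] \<and> v = [] then ext f (m x) else 0)" for u x v
 proof -
  consider "m x = 0" | l n where "m x = ks n (wd [l])" using lm[of x] by (auto simp: lett_def)
  then show ?thesis
  proof cases
   case 2
   then show ?thesis by (simp add: wd_append[symmetric])
  qed simp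
 qed
 have "ext ?g (delta p m w) = SS w (%u r. if u = [] then SS r (%x v. if v = [] then ext f (m x) else 0) else 0)"
  unfolding delta_def ext_SS ext_ks *
  by (intro SS_congI) (auto intro!: SS_congI SS_eq_0)
 also have "... = ext f (m w)"
  by (subst SS_left_Nil, subst SS_right_Nil) (simp add: SS_eq_0)
 finally show ?thesis .
qed

text \<open>By \<open>CY_hoch\<close> the two operations are distributed over a window and its
  complement. Mixed terms, with one operation on each, cancel because the operator is odd; the two
  squares remain.\<close>

lemma hoch_hoch:
 assumes "ops p m"
 shows "ext (hoch p m) (hoch p m w) =
  CY p (%s y. ext m (delta p m s) * wd y +
   (if length s = 1 then wd s * ext (delta p m) (delta p m y) else 0)) w"
proof -
 let ?d = "delta p m"
 have "ext (hoch p m) (hoch p m w) =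
  CY p (%s y. ext (%t. hoch_kernel p m t y) (?d s) + ks (pw p s) (ext (hoch_kernel p m s) (?d y))) w"
  unfolding hoch_eq_CY[OF assms] CY_hoch[OF assms, unfolded hoch_eq_CY[OF assms]] ..
 also have "... = CY p (%s y. ext m (?d s) * wd y +
   (if length s = 1 then wd s * ext ?d (?d y) else 0)) w"
 proof (rule CY_congI)
  fix x y z :: "'a list"
  let ?s = "z @ x"
  \<comment> \<open>Here an operation has turned the whole window into one letter before
    \<open>delta\<close> acts on the complement. The opposite order yields the same term with the
    opposite sign.\<close>
  have 1: "ext (%t. if length t = 1 then ks (pw p t) (wd t * ?d y) else 0) (?d ?s) = - ks (pw p ?s) (m ?s * ?d y)"
  proof -
   have "ext (%t. ks (pw p t) (wd t * ?d y)) (m ?s) = ks (pw p ?s + 1) (m ?s * ?d y)"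
    by (subst hmg_ext_ks_1[OF hmg_lett[OF opsD[OF assms]]]) (simp add: ext_fun_multr)
   then show ?thesis
    by (subst ext_length_one_delta[OF assms]) (simp add: ks_def)
  qed
  have 2: "ext (%t. if P then ks n (wd ?s * f t) else 0) c = (if P then ks n (wd ?s * ext f c) else 0)"
   for P n f and c :: "'a chain"
   by (simp add: ext_fun_ks ext_fun_multl)
  show "ext (%t. hoch_kernel p m t y) (?d ?s) + ks (pw p ?s) (ext (hoch_kernel p m ?s) (?d y)) =
   ext m (?d ?s) * wd y + (if length ?s = 1 then wd ?s * ext ?d (?d y) else 0)"
   unfolding hoch_kernel_def[abs_def] ext_fun_add 1 2 ext_fun_multr ext_fun_multl ext_id ks_arith
   by (simp del: pw_simps)
 qed
 finally show ?thesis .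
qed

lemma ext_CY_lett_bar:
 assumes "mors p q Ph" "lett q e c"
 shows "ext (CY q g) (c * bar Ph d) = SS d (%x r. SS r (%u z.
  ks (pw p z * (e + pw p x + pw p u)) (ext (%t. ext (g t) (bar Ph u)) (bar Ph z * c * bar Ph x))))"
proof -
 note hb = hmg_bar[OF assms(1)]
 have sw: "ext (%x. ext (%t. g t u) (b * wd x)) X = ext (%t. g t u) (b * X)" for b X u
  by (rule ext_mult_left[symmetric])
 have sw': "ext (%z. ext h (wd z * b)) X = ext h (X * b)" for h :: "'b list => 'c chain" and b X
  by (induction X rule: chain_induct) (simp_all add: ext_arith algebra_simps)
 have "ext (CY q g) (c * bar Ph d) = ext (%d. SS d (%x r. SS r (%u z.
   ks (pw q z * (e + pw q x + pw q u)) (ext (%t. g t u) (wd z * c * wd x))))) (bar Ph d)"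
  by (subst ext_mult_left) (simp add: ext_CY_lett[OF assms(2)])
 also have "... = SS d (%x r. SS r (%u z.
  ks (pw p z * (e + pw p x + pw p u)) (ext (%t. ext (g t) (bar Ph u)) (bar Ph z * c * bar Ph x))))"
  unfolding bar_SS3[OF assms(1)]
 proof (intro SS_congI)
  fix x r u z
  have "ext (%s. ext (%t. ext (%z. ks (pw q z * (e + pw q s + pw q t)) (ext (%ta. g ta t) (wd z * c * wd s))) (bar Ph z)) (bar Ph u)) (bar Ph x) =
   ext (%s. ext (%t. ks (pw p z * (e + pw p x + pw p u)) (ext (%ta. g ta t) (bar Ph z * c * wd s))) (bar Ph u)) (bar Ph x)"
  proof (rule hmg_ext[OF hb], rule hmg_ext[OF hb])
   fix s t :: "'b list" assume par: "even (pw q s) \<longleftrightarrow> even (pw p x)" "even (pw q t) \<longleftrightarrow> even (pw p u)"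
   show "ext (%z. ks (pw q z * (e + pw q s + pw q t)) (ext (%ta. g ta t) (wd z * c * wd s))) (bar Ph z) =
    ks (pw p z * (e + pw p x + pw p u)) (ext (%ta. g ta t) (bar Ph z * c * wd s))"
    unfolding hmg_ext_ks[OF hb] mult.assoc sw' by (rule ks_cong) (use par in auto)
  qed
  also have "... = ks (pw p z * (e + pw p x + pw p u)) (ext (%t. ext (g t) (bar Ph u)) (bar Ph z * c * bar Ph x))"
   unfolding ext_fun_ks
   by (subst ext_ext_swap) (simp add: sw ext_ext_swap[of g])
  finally show "ext (%s. ext (%t. ext (%z. ks (pw q z * (e + pw q s + pw q t)) (ext (%ta. g ta t) (wd z * c * wd s))) (bar Ph z)) (bar Ph u)) (bar Ph x) =
   ks (pw p z * (e + pw p x + pw p u)) (ext (%t. ext (g t) (bar Ph u)) (bar Ph z * c * bar Ph x))" .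
 qed
 finally show ?thesis .
qed

text \<open>A window of the image that contains its first letter is the \<open>bar\<close> of a
  window of \<open>w\<close>. The first letter of the image is the value of the block that contains
  the first letter of \<open>w\<close>, and \<open>bar_append\<close> isolates this block inside the
  window.\<close>

lemma CY_cbar:
 assumes "mors p q Ph"
 shows "ext (CY q g) (cbar p Ph w) = CY p (%s y. ext (%t. ext (g t) (bar Ph y)) (bar Ph s)) w"
proof -
 have lm: "lett q (pw p x) (Ph x)" for x using assms by (simp add: mors_def)
 let ?K = "%x1 x2 y z1 z2. if x1 = [] then 0 else
   ks ((pw p z1 + pw p z2) * (pw p x1 + pw p x2 + pw p y))
    (ext (%t. ext (g t) (bar Ph y)) (bar Ph z1 * Ph (z2 @ x1) * bar Ph x2))"
 have "ext (CY q g) (cbar p Ph w) = SS w (%x1 r. SS r (%Y z2. SS Y (%x2 r. SS r (%y z1. ?K x1 x2 y z1 z2))))"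
  unfolding cbar_def ext_CY unfolding CY_def ext_CY_lett_bar[OF assms lm] SS_ks SS_if
  by (intro SS_congI) (auto intro!: ks_cong)
 also have "... = SS w (%x1 r. SS r (%x2 r. SS r (%y r. SS r (%z1 z2. ?K x1 x2 y z1 z2))))"
  by (simp add: SS_assoc)
 also have "... = SS w (%x r. SS x (%x1 x2. SS r (%y z. SS z (%z1 z2. ?K x1 x2 y z1 z2))))"
  by (simp add: SS_assoc)
 also have "... = SS w (%x r. SS r (%y z. SS z (%z1 z2. SS x (%x1 x2. ?K x1 x2 y z1 z2))))"
  apply (intro SS_congI)
  apply (subst SS_swap)
  apply (intro SS_congI)
  apply (rule SS_swap)
  done
 also have "... = CY p (%s y. ext (%t. ext (g t) (bar Ph y)) (bar Ph s)) w"
  unfolding CY_def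
 proof (intro SS_congI)
  fix x r y z
  show "SS z (%z1 z2. SS x (%x1 x2. ?K x1 x2 y z1 z2)) =
    (if x = [] then 0 else ks (pw p z * (pw p x + pw p y)) (ext (%t. ext (g t) (bar Ph y)) (bar Ph (z @ x))))"
  proof (cases "x = []")
   case False
   then show ?thesis
    unfolding bar_append[OF assms False] ext_SS SS_ks
    by simp (intro SS_congI, auto)
  qed simp
 qed
 finally show ?thesis .
qed

lemma ext_length_one_bar:
 assumes "mors p q Ph"
 shows "ext (%t. if length t = 1 then f t else 0) (bar Ph w) = ext f (Ph w)"
proof (cases "w = []")
 case True
 then show ?thesis using assms by (simp add: mors_def wd_Nil[symmetric] del: wd_Nil)
next
 case False
 have Ph0: "Ph [] = 0" using assms by (simp add: mors_def)
 let ?g = "%t. if length t = 1 then f t else 0"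
 have *: "ext ?g (Ph x * bar Ph y) = (if y = [] then ext f (Ph x) else 0)" for x y
 proof -
  consider "Ph x = 0" | l n where "Ph x = ks n (wd [l])" using morsD[OF assms, of x] by (auto simp: lett_def)
  then show ?thesis
  proof cases
   case 2
   have "ext ?g (wd [l] * bar Ph y) = ext (%t. if t = [] then f [l] else 0) (bar Ph y)"
    by (subst ext_mult_left) (simp add: wd_append[symmetric] cong: if_cong)
   also have "... = (if y = [] then f [l] else 0)"
   proof (cases "y = []")
    case False
    have "[] \<notin> wkeys (Ph u * bar Ph v)" for u v
     using lett_Nil_mem[OF morsD[OF assms, of u]] by (force elim!: keys_mult_append)
    then have "[] \<notin> wkeys (bar Ph y)"
     unfolding bar_rec[where Ph = Ph, OF Ph0 False] by (auto elim!: keys_SS)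
    then have "ext (%t. if t = [] then f [l] else 0) (bar Ph y) = 0"
     by (intro frag_extend_eq_0) auto
    then show ?thesis using False by simp
   qed (simp add: wd_Nil[symmetric] del: wd_Nil)
   finally show ?thesis using 2 by simp
  qed simp
 qed
 have "ext ?g (bar Ph w) = SS w (%x y. if y = [] then ext f (Ph x) else 0)"
  unfolding bar_rec[where Ph = Ph, OF Ph0 False] ext_SS * ..
 also have "... = ext f (Ph w)"
  by (subst SS_right_Nil) (simp add: SS_eq_0)
 finally show ?thesis .
qed

text \<open>Together with \<open>cbar_hoch\<close> this presents both composites as cyclic sums.
  Their kernels differ by the morphism relation on the window and by its consequence for
  \<open>bar\<close> on the complement.\<close>

lemma hoch_cbar:
 assumes "mors p q Ph" "ops q m"
 shows "ext (hoch q m) (cbar p Ph w) =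
  CY p (%s y. ext m (bar Ph s) * bar Ph y + ks (pw p s) (Ph s * ext (delta q m) (bar Ph y))) w"
 unfolding hoch_eq_CY[OF assms(2)] CY_cbar[OF assms(1)]
proof (rule CY_congI)
 fix x y z :: "'a list"
 let ?s = "z @ x"
 have 1: "ext (%t. ext (%y. if length t = 1 then ks (pw q t) (wd t * delta q m y) else 0) c) (bar Ph ?s) =
   ks (pw p ?s) (Ph ?s * ext (delta q m) c)" for c
 proof -
  have "ext (%t. ext (%y. if length t = 1 then ks (pw q t) (wd t * delta q m y) else 0) c) (bar Ph ?s) =
   ext (%t. if length t = 1 then ks (pw q t) (wd t * ext (delta q m) c) else 0) (bar Ph ?s)"
   by (intro ext_cong) (simp add: ext_fun_ks ext_fun_multl)
  also have "... = ks (pw p ?s) (Ph ?s * ext (delta q m) c)"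
   by (subst ext_length_one_bar[OF assms(1)], subst hmg_ext_ks_1[OF hmg_lett[OF morsD[OF assms(1)]]])
    (simp add: ext_fun_multr)
  finally show ?thesis .
 qed
 show "ext (%t. ext (hoch_kernel q m t) (bar Ph y)) (bar Ph ?s) =
  ext m (bar Ph ?s) * bar Ph y + ks (pw p ?s) (Ph ?s * ext (delta q m) (bar Ph y))"
  unfolding hoch_kernel_def[abs_def] ext_fun_add 1 by (simp add: ext_fun_multl ext_fun_multr)
qed

lemma cbar_hoch:
 assumes "mors p q Ph" "ops p m"
 shows "ext (cbar p Ph) (hoch p m w) =
  CY p (%s y. ext Ph (delta p m s) * bar Ph y + ks (pw p s) (Ph s * ext (bar Ph) (delta p m y))) w"
 unfolding cbar_def CY_hoch[OF assms(2)] by (simp add: ext_fun_multl ext_fun_multr)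

section \<open>Rotation and norm\<close>

lemma delta_snoc:
 assumes "ops p m"
 shows "delta p m (y @ [l]) = delta p m y * wd [l] + SS y (%u z. ks (pw p u) (wd u * m (z @ [l])))"
proof -
 have "SS y (%u z. ks (pw p u) (wd u * m (z @ [l]))) = ks (pw p y) (wd y * m [l]) +
   SS y (%u z. if z = [] then 0 else ks (pw p u) (wd u * m (z @ [l])))"
  by (subst SS_right_Nil) simp
 moreover have "delta p m [l] = m [l]"
  using assms by (simp add: delta_def SS_Cons ops_def)
 ultimately show ?thesis
  by (simp add: delta_append[OF assms] SS_Cons cong: if_cong)
qed

lemma ext_rot_lett:
 assumes "lett p e c"
 shows "ext (rot p) (wd u * c) = ks (e * pw p u) (c * wd u)"
proof -
 consider "c = 0" | l n where "c = ks n (wd [l])" "even (p l) \<longleftrightarrow> even e"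
  using assms by (auto simp: lett_def)
 then show ?thesis
  by cases (auto simp: wd_append[symmetric] rot_snoc intro!: ks_cong)
qed

lemma ext_rot_lett':
 assumes "lett p e c" "hmg p e' d"
 shows "ext (rot p) (d * c) = ks (e * e') (c * d)"
proof -
 have "ext (rot p) (d * c) = ext (%u. ext (rot p) (wd u * c)) d"
  by (induction d rule: chain_induct) (simp_all add: ext_arith algebra_simps)
 also have "... = ext (%u. ks (pw p u * e) (c * wd u)) d"
  by (simp add: ext_rot_lett[OF assms(1)] mult.commute)
 also have "... = ks (e * e') (c * d)"
  using hmg_ext_ks[OF assms(2), of e "%u. c * wd u"] by (simp add: ext_fun_multl mult.commute)
 finally show ?thesis .
qed

text \<open>The identity b(1 - T) = (1 - T)b'. In \<open>CY_rot\<close> for the kernel of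
  \<open>hoch\<close>, the windows starting at the first letter add up to \<open>delta\<close> and
  those ending at the last letter to its rotation.\<close>

lemma hoch_rot:
 assumes "ops p m" "w ~= []"
 shows "hoch p m w - ext (hoch p m) (rot p w) = delta p m w - ext (rot p) (delta p m w)"
proof -
 obtain y l where w: "w = y @ [l]" using assms by (metis rev_exhaust)
 obtain l' w' where w': "w = l' # w'" using assms(2) by (cases w) auto
 have m0: "m [] = 0" using assms by (simp add: ops_def)
 let ?G = "hoch_kernel p m"
 have 1: "SS w (%x r. if x = [] then 0 else ?G x r) = delta p m w"
 proof -
  have "SS w (%x r. if x = [] then 0 else ?G x r) = SS w (%x r. m x * wd r) +
    SS w (%x r. if length x = 1 then ks (pw p x) (wd x * delta p m r) else 0)"
   unfolding SS_add[symmetric] by (intro SS_congI) (simp add: hoch_kernel_def m0)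
  moreover have "SS w (%x r. if length x = 1 then ks (pw p x) (wd x * delta p m r) else 0) =
    ks (p l') (wd [l'] * delta p m w')"
   unfolding w' SS_Cons by (simp, subst SS_left_Nil) (simp add: SS_eq_0 cong: if_cong)
  moreover have "delta p m w = SS w (%x v. m x * wd v) + ks (p l') (wd [l'] * delta p m w')"
   unfolding w' delta_def[of p m "l' # w'"] SS_Cons[of l' w' "%u r. SS r (F u r)" for F]
   by (simp add: delta_def SS_mult_left SS_ks wd_Cons mult.assoc)
  ultimately show ?thesis by simp
 qed
 have 2: "SS w (%u z. if z = [] then 0 else ks (pw p u * pw p z) (?G z u)) = ext (rot p) (delta p m w)"
 proof -
  have "SS w (%u z. if z = [] then 0 else ks (pw p u * pw p z) (?G z u)) =
    SS y (%u z. ks (pw p u * (pw p z + p l)) (m (z @ [l]) * wd u)) +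
    SS y (%u z. if z = [] then ks (pw p u * p l + p l) (wd [l] * delta p m u) else 0)"
   unfolding w SS_append SS_add[symmetric]
   by (simp add: SS_Cons hoch_kernel_def ks_arith) (intro SS_congI, simp)
  also have "SS y (%u z. if z = [] then ks (pw p u * p l + p l) (wd [l] * delta p m u) else 0) =
    ext (rot p) (delta p m y * wd [l])"
  proof -
   have "lett p (p l) (wd [l])" by (auto simp: lett_def intro!: exI[of _ l] exI[of _ 0])
   from ext_rot_lett'[OF this hmg_delta[OF assms(1)]] show ?thesis
    by (subst SS_right_Nil) (simp add: SS_eq_0 algebra_simps cong: if_cong)
  qed
  also have "SS y (%u z. ks (pw p u * (pw p z + p l)) (m (z @ [l]) * wd u)) =
    ext (rot p) (SS y (%u z. ks (pw p u) (wd u * m (z @ [l]))))"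
   unfolding ext_SS ext_ks ext_rot_lett[OF opsD[OF assms(1)]]
   by (intro SS_congI) (auto intro!: ks_cong)
  finally show ?thesis
   by (simp add: w delta_snoc[OF assms(1)] frag_extend_add add_ac)
 qed
 show ?thesis
  unfolding hoch_eq_CY[OF assms(1)] CY_rot[OF assms(2)] 1 2 ..
qed

text \<open>The analogue of \<open>hoch_rot\<close> for the induced map; it dictates
  \<open>cbar\<close> on the even columns once \<open>bar\<close> is used on the odd ones.\<close>

lemma cbar_rot:
 assumes "mors p q Ph" "w ~= []"
 shows "cbar p Ph w - ext (cbar p Ph) (rot p w) = bar Ph w - ext (rot q) (bar Ph w)"
proof -
 obtain y l where w: "w = y @ [l]" using assms by (metis rev_exhaust)
 have Ph0: "Ph [] = 0" using assms by (simp add: mors_def)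
 have 1: "SS w (%x r. if x = [] then 0 else Ph x * bar Ph r) = bar Ph w"
  unfolding bar_rec[where Ph = Ph, OF Ph0 assms(2)] by (intro SS_congI) (simp add: Ph0)
 have 2: "SS w (%u z. if z = [] then 0 else ks (pw p u * pw p z) (Ph z * bar Ph u)) = ext (rot q) (bar Ph w)"
  unfolding w bar_snoc[OF assms(1)] ext_SS ext_rot_lett'[OF morsD[OF assms(1)] hmg_bar[OF assms(1)]]
  by (simp add: SS_append SS_Cons mult.commute cong: if_cong)
 show ?thesis
  unfolding cbar_def CY_rot[OF assms(2)] 1 2 ..
qed

lemma nrm_Cons: "nrm p (l # d) = SS d (%x z. ks ((p l + pw p x) * pw p z) (wd z * wd [l] * wd x))"
 by (simp add: nrm_def SS_Cons wd_Cons mult.assoc cong: if_cong)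

lemma ext_nrm_lett:
 assumes "lett p e c"
 shows "ext (nrm p) (c * wd d) = SS d (%x z. ks ((e + pw p x) * pw p z) (wd z * c * wd x))"
proof -
 consider "c = 0" | l n where "c = ks n (wd [l])" "even (p l) \<longleftrightarrow> even e"
  using assms by (auto simp: lett_def)
 then show ?thesis
 proof cases
  case 2
  show ?thesis
   unfolding 2 ks_mult ext_ks wd_append[symmetric] append.simps ext_wd nrm_Cons SS_ks
   by (intro SS_congI) (auto intro!: ks_cong simp: 2 wd_append[symmetric])
 qed simp
qed

lemma ext_nrm_lett_bar:
 assumes "mors p q Ph" "lett q e c"
 shows "ext (nrm q) (c * bar Ph d) = SS d (%x z. ks ((e + pw p x) * pw p z) (bar Ph z * c * bar Ph x))"
proof -
 note hb = hmg_bar[OF assms(1)]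
 have "ext (nrm q) (c * bar Ph d) = ext (%d. SS d (%x z. ks ((e + pw q x) * pw q z) (wd z * c * wd x))) (bar Ph d)"
  by (subst ext_mult_left) (simp add: ext_nrm_lett[OF assms(2)])
 also have "... = SS d (%x z. ks ((e + pw p x) * pw p z) (bar Ph z * c * bar Ph x))"
  unfolding bar_SS[OF assms(1)]
 proof (intro SS_congI)
  fix x z
  have "ext (%s. ext (%z. ks ((e + pw q s) * pw q z) (wd z * c * wd s)) (bar Ph z)) (bar Ph x) =
   ext (%s. ks ((e + pw p x) * pw p z) (bar Ph z * c * wd s)) (bar Ph x)"
  proof (rule hmg_ext[OF hb])
   fix s :: "'b list" assume par: "even (pw q s) \<longleftrightarrow> even (pw p x)"
   show "ext (%z. ks ((e + pw q s) * pw q z) (wd z * c * wd s)) (bar Ph z) =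
    ks ((e + pw p x) * pw p z) (bar Ph z * c * wd s)"
    unfolding mult.commute[of "e + pw q s"] hmg_ext_ks[OF hb] mult.assoc ext_fun_multr ext_id
    by (rule ks_cong) (use par in auto)
  qed
  then show "ext (%s. ext (%z. ks ((e + pw q s) * pw q z) (wd z * c * wd s)) (bar Ph z)) (bar Ph x) =
   ks ((e + pw p x) * pw p z) (bar Ph z * c * bar Ph x)"
   by (simp add: ext_fun_ks ext_fun_multl)
 qed
 finally show ?thesis .
qed

text \<open>Both sides run over the cyclic decompositions of \<open>w\<close> into blocks together
  with a choice of the block that is written first.\<close>

lemma nrm_cbar:
 assumes "mors p q Ph"
 shows "ext (nrm q) (cbar p Ph w) = ext (bar Ph) (nrm p w)"
proof -
 let ?K = "%x1 x2 z1 z2. if x1 = [] then 0 else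
   ks ((pw p x1 + pw p x2) * (pw p z1 + pw p z2)) (bar Ph z1 * Ph (z2 @ x1) * bar Ph x2)"
 have "ext (nrm q) (cbar p Ph w) = SS w (%x1 r. SS r (%Y z2. SS Y (%x2 z1. ?K x1 x2 z1 z2)))"
  unfolding cbar_def ext_CY unfolding CY_def ext_nrm_lett_bar[OF assms morsD[OF assms]] SS_ks SS_if
  by (intro SS_congI) (auto intro!: ks_cong)
 also have "... = SS w (%x z. SS x (%x1 x2. SS z (%z1 z2. ?K x1 x2 z1 z2)))"
  by (simp add: SS_assoc)
 also have "... = ext (bar Ph) (nrm p w)"
  unfolding nrm_def ext_SS
 proof (rule SS_congI)
  fix x z
  show "SS x (%x1 x2. SS z (%z1 z2. ?K x1 x2 z1 z2)) =
   ext (bar Ph) (if x = [] then 0 else ks (pw p x * pw p z) (wd z * wd x))"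
  proof (cases "x = []")
   case False
   show ?thesis
    unfolding wd_append[symmetric]
    by (subst SS_swap) (simp add: False bar_append[OF assms False] SS_ks, intro SS_congI, auto)
  qed simp
 qed
 finally show ?thesis .
qed

text \<open>The identity N b = b' N: both sides run over the cyclic positions of one operation
  together with a rotation of the result.\<close>

lemma nrm_hoch:
 assumes "ops p m"
 shows "ext (nrm p) (hoch p m w) = ext (delta p m) (nrm p w)"
proof -
 let ?d = "delta p m"
 note hd = hmg_delta[OF assms]
 let ?S = "%x z. SS z (%z1 z2. SS x (%x1 x2. if z2 = [] \<or> x1 = [] then 0
   else ks (pw p z1) (wd z1 * m (z2 @ x1) * wd x2)))"
 have 1: "ext (nrm p) (?d w) = SS w (%x y. if x = [] then 0 else ks (pw p x * pw p y)
   (?d y * wd x + ks (pw p y) (wd y * ?d x)))"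
  unfolding nrm_def delta_SS[OF assms]
 proof (rule SS_congI)
  fix x y
  have a: "ext (%t. if t = [] then 0 else ks (pw p t * pw p y) (wd y * wd t)) (?d x) =
   ks ((pw p x + 1) * pw p y) (wd y * ?d x)"
  proof -
   have "ext (%t. if t = [] then 0 else ks (pw p t * pw p y) (wd y * wd t)) (?d x) =
    ext (%t. ks (pw p t * pw p y) (wd y * wd t)) (?d x)"
    by (rule ext_cong) (use delta_keys_Nil[OF assms] in auto)
   then show ?thesis by (simp only: hmg_ext_ks[OF hd] ext_fun_multl ext_id)
  qed
  have b: "ext (%t. ks (pw p x * pw p t) (wd t * wd x)) (?d y) = ks ((pw p y + 1) * pw p x) (?d y * wd x)"
   unfolding mult.commute[of "pw p x"] hmg_ext_ks[OF hd] ext_fun_multr ext_id ..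
  show "ext (%t. if t = [] then 0 else ks (pw p t * pw p y) (wd y * wd t)) (?d x) +
    ks (pw p x) (ext (%t. if x = [] then 0 else ks (pw p x * pw p t) (wd t * wd x)) (?d y)) =
    (if x = [] then 0 else ks (pw p x * pw p y) (?d y * wd x + ks (pw p y) (wd y * ?d x)))"
  proof (cases "x = []")
   case False
   then show ?thesis unfolding a using b
    by (simp add: ks_arith add.commute[of "ks _ (wd y * _)"]) (intro arg_cong2[of _ _ _ _ "(+)"] ks_cong; auto)
  qed (simp add: assms)
 qed
 have 2: "ext (nrm p) (wrap p m w) = SS w (%x z. if x = [] then 0 else ks (pw p x * pw p z) (?S x z))"
 proof -
  let ?K = "%x1 x2 z1 z2. if z2 = [] \<or> x1 = [] then 0 else
   ks ((pw p x1 + pw p x2) * (pw p z1 + pw p z2)) (ks (pw p z1) (wd z1 * m (z2 @ x1) * wd x2))"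
  have "ext (nrm p) (wrap p m w) = SS w (%x1 r. SS r (%Y z2. SS Y (%x2 z1. ?K x1 x2 z1 z2)))"
   unfolding wrap_def ext_SS
   by (intro SS_congI) (auto simp: ext_nrm_lett[OF opsD[OF assms]] SS_ks intro!: SS_congI ks_cong)
  also have "... = SS w (%x z. SS x (%x1 x2. SS z (%z1 z2. ?K x1 x2 z1 z2)))"
   by (simp add: SS_assoc)
  also have "... = SS w (%x z. if x = [] then 0 else ks (pw p x * pw p z) (?S x z))"
   unfolding SS_ks SS_if
   apply (rule SS_congI)
   apply (subst SS_swap)
   apply (intro SS_congI)
   apply auto
   done
  finally show ?thesis .
 qed
 show ?thesis
  unfolding hoch_def frag_extend_add 1 2 SS_add[symmetric] unfolding nrm_def ext_SS
  by (intro SS_congI) (simp add: wd_append[symmetric] delta_append[OF assms] ks_arith add_ac)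
qed

lemma funpow_ext_ks:
 fixes f :: "'l list => 'l chain"
 shows "(ext f ^^ i) (ks n c) = ks n ((ext f ^^ i) c)"
 by (induction i) simp_all

lemma rot_pow:
 "(ext (rot p) ^^ length z) (wd (y @ z)) = ks (pw p y * pw p z) (wd (z @ y))"
proof (induction z arbitrary: y rule: rev_induct)
 case (snoc l z)
 have "(ext (rot p) ^^ length (z @ [l])) (wd (y @ z @ [l])) =
  (ext (rot p) ^^ length z) (ks (p l * pw p (y @ z)) (wd (l # y @ z)))"
  using rot_snoc[of p "y @ z" l] by (simp add: funpow_swap1 del: pw_simps)
 also have "... = ks (p l * pw p (y @ z)) (ks ((p l + pw p y) * pw p z) (wd (z @ l # y)))"
  using snoc.IH[of "l # y"] by (simp add: funpow_ext_ks del: ks_simps)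
 also have "... = ks (pw p y * pw p (z @ [l])) (wd ((z @ [l]) @ y))"
  by (auto intro!: ks_cong)
 finally show ?case .
qed simp

lemma nrm_eq_sum: "nrm p w = (\<Sum>i<length w. (ext (rot p) ^^ i) (wd w))"
proof -
 have "nrm p w = (\<Sum>(x, y)\<in>{(x, y). x @ y = w} - {([], w)}. ks (pw p x * pw p y) (wd y * wd x))"
  unfolding nrm_def SS_def
  by (rule sum.mono_neutral_cong_right) (use finite_splits in \<open>auto split: if_splits\<close>)
 also have "... = (\<Sum>i<length w. (ext (rot p) ^^ i) (wd w))"
 proof (rule sum.reindex_bij_witness[of _ "%i. (take (length w - i) w, drop (length w - i) w)" "%(x, y). length y"])
  fix a assume "a \<in> {(x, y). x @ y = w} - {([], w)}"
  then obtain x y where a: "a = (x, y)" "x @ y = w" "x ~= []" by auto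
  show "(ext (rot p) ^^ (case a of (x, y) => length y)) (wd w) = (case a of (x, y) => ks (pw p x * pw p y) (wd y * wd x))"
   using a rot_pow[where p = p and y = x and z = y] by (auto simp: wd_append)
 qed auto
 finally show ?thesis .
qed

text \<open>Rotating \<open>length w\<close> times gives \<open>w\<close> back with sign 1, so
  shifting the summation index leaves the norm unchanged. These are N(1 - T) = 0 and (1 - T)N =
  0.\<close>

lemma nrm_rot: "ext (nrm p) (rot p w) = nrm p w" "ext (rot p) (nrm p w) = (if w = [] then 0 else nrm p w)"
proof -
 have len: "(ext (rot p) ^^ length w) (wd w) = wd w"
  using rot_pow[where p = p and z = w and y = "[]"] by simp
 have shift: "(\<Sum>i<length w. (ext (rot p) ^^ Suc i) (wd w)) = nrm p w"
  unfolding nrm_eq_sum using sum.lessThan_Suc_shift[of "%i. (ext (rot p) ^^ i) (wd w)" "length w"] len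
  by simp
 show "ext (rot p) (nrm p w) = (if w = [] then 0 else nrm p w)"
  using shift by (simp add: nrm_eq_sum ext_sum)
 have "ext (nrm p) (rot p w) = (\<Sum>i<length w. (ext (rot p) ^^ i) (rot p w))"
 proof (cases "w = []")
  case True
  then show ?thesis by (simp add: rot_def nrm_eq_sum wd_Nil[symmetric] del: wd_Nil)
 next
  case False
  then show ?thesis by (simp add: rot_def nrm_eq_sum ks_sum funpow_ext_ks)
 qed
 also have "... = (\<Sum>i<length w. (ext (rot p) ^^ Suc i) (wd w))"
  by (intro sum.cong) (simp_all add: funpow_swap1)
 finally show "ext (nrm p) (rot p w) = nrm p w" using shift by simp
qed

section \<open>Identities modulo an ideal of chains\<close>

definition chain_ideal :: "'l chain set => bool" where
 "chain_ideal I \<longleftrightarrow> 0 \<in> I \<and> (\<forall>a\<in>I. \<forall>b\<in>I. a + b \<in> I \<and> a - b \<in> I) \<and> (\<forall>a\<in>I. \<forall>u v. wd u * a * wd v \<in> I)"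

lemma chain_idealD:
 assumes "chain_ideal I"
 shows "0 \<in> I" "a \<in> I ==> b \<in> I ==> a + b \<in> I" "a \<in> I ==> b \<in> I ==> a - b \<in> I"
  "a \<in> I ==> - a \<in> I" "a \<in> I ==> ks n a \<in> I"
  "a \<in> I ==> wd u * a * wd v \<in> I" "a \<in> I ==> c * a \<in> I" "a \<in> I ==> a * c \<in> I"
proof -
 note * = assms[unfolded chain_ideal_def]
 show 0: "0 \<in> I" and "a \<in> I ==> b \<in> I ==> a + b \<in> I" and d: "!!a b. a \<in> I ==> b \<in> I ==> a - b \<in> I"
  and m: "!!u v a. a \<in> I ==> wd u * a * wd v \<in> I"
  using * by auto
 show n: "a \<in> I ==> - a \<in> I" using d[OF 0, of a] by simp
 then show "a \<in> I ==> ks n a \<in> I" by (simp add: ks_def)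
 show "a \<in> I ==> c * a \<in> I"
  by (induction c rule: chain_induct) (use 0 d m[of a _ "[]"] in \<open>auto simp: algebra_simps\<close>)
 show "a \<in> I ==> a * c \<in> I"
  by (induction c rule: chain_induct) (use 0 d m[of a "[]"] in \<open>auto simp: algebra_simps\<close>)
qed

lemma chain_ideal_sum: "chain_ideal I ==> (!!i. i \<in> S ==> f i \<in> I) ==> sum f S \<in> I"
 by (induction S rule: infinite_finite_induct) (auto intro: chain_idealD)

lemma chain_ideal_SS: "chain_ideal I ==> (!!x y. x @ y = w ==> f x y \<in> I) ==> SS w f \<in> I"
 unfolding SS_def by (rule chain_ideal_sum) auto

lemma chain_ideal_CY:
 "chain_ideal I ==> (!!x y z. x @ y @ z = w ==> g (z @ x) y \<in> I) ==> CY p g w \<in> I"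
 unfolding CY_def by (intro chain_ideal_SS) (auto intro!: chain_idealD)

text \<open>The relation is assumed for all words in the letters of \<open>w\<close>. The same form
  serves the cyclic case, where windows are not subwords, and it is enough to inherit the validity
  of letters.\<close>

lemma delta_delta_ideal:
 assumes "ops p m" "chain_ideal I" "!!x. x ~= [] ==> set x \<subseteq> set w ==> ext m (delta p m x) \<in> I"
 shows "ext (delta p m) (delta p m w) \<in> I"
 unfolding delta_delta[OF assms(1)]
proof (intro chain_ideal_SS[OF assms(2)] chain_idealD[OF assms(2)])
 fix u r x v assume "u @ r = w" "x @ v = r"
 then show "ext m (delta p m x) \<in> I"
  by (cases "x = []") (auto simp: assms(1) intro!: assms(3) chain_idealD(1)[OF assms(2)])
qed

lemma hoch_hoch_ideal:
 assumes "ops p m" "chain_ideal I" "!!x. x ~= [] ==> set x \<subseteq> set w ==> ext m (delta p m x) \<in> I"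
 shows "ext (hoch p m) (hoch p m w) \<in> I"
 unfolding hoch_hoch[OF assms(1)]
proof (intro chain_ideal_CY[OF assms(2)] chain_idealD(2)[OF assms(2)])
 fix x y z assume w: "x @ y @ z = w"
 show "ext m (delta p m (z @ x)) * wd y \<in> I"
  by (rule chain_idealD(8)[OF assms(2)], cases "z @ x = []")
   (use w in \<open>auto simp: assms(1) intro!: assms(3) chain_idealD(1)[OF assms(2)]\<close>)
 have "ext (delta p m) (delta p m y) \<in> I"
  by (rule delta_delta_ideal[OF assms(1,2)]) (use w in \<open>auto intro!: assms(3)\<close>)
 then show "(if length (z @ x) = 1 then wd (z @ x) * ext (delta p m) (delta p m y) else 0) \<in> I"
  using assms(2) by (auto intro: chain_idealD)
qed

lemma delta_bar_ideal:
 assumes "mors p q Ph" "ops p m" "ops q m'" "chain_ideal I"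
  "!!x. x ~= [] ==> set x \<subseteq> set w ==> ext m' (bar Ph x) - ext Ph (delta p m x) \<in> I"
 shows "ext (delta q m') (bar Ph w) - ext (bar Ph) (delta p m w) \<in> I"
 unfolding delta_bar[OF assms(1)] bar_delta[OF assms(1,2)] SS_diff[symmetric]
proof (intro chain_ideal_SS[OF assms(4)])
 fix u r x v assume w: "u @ r = w" "x @ v = r"
 have "ext m' (bar Ph x) - ext Ph (delta p m x) \<in> I"
 proof (cases "x = []")
  case True
  then show ?thesis using assms(2,3,4)
   by (auto simp: wd_Nil[symmetric] ops_def simp del: wd_Nil intro: chain_idealD)
 qed (use w in \<open>auto intro!: assms(5)\<close>)
 then have "ks (pw p u) (bar Ph u * (ext m' (bar Ph x) - ext Ph (delta p m x)) * bar Ph v) \<in> I"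
  by (intro chain_idealD(5)[OF assms(4)] chain_idealD(8)[OF assms(4)] chain_idealD(7)[OF assms(4)])
 then show "ks (pw p u) (bar Ph u * ext m' (bar Ph x) * bar Ph v) -
  ks (pw p u) (bar Ph u * ext Ph (delta p m x) * bar Ph v) \<in> I"
  by (simp add: algebra_simps ks_arith)
qed

lemma hoch_cbar_ideal:
 assumes "mors p q Ph" "ops p m" "ops q m'" "chain_ideal I"
  "!!x. x ~= [] ==> set x \<subseteq> set w ==> ext m' (bar Ph x) - ext Ph (delta p m x) \<in> I"
 shows "ext (hoch q m') (cbar p Ph w) - ext (cbar p Ph) (hoch p m w) \<in> I"
proof -
 have "ext (hoch q m') (cbar p Ph w) - ext (cbar p Ph) (hoch p m w) =
  CY p (%s y. (ext m' (bar Ph s) - ext Ph (delta p m s)) * bar Ph y +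
   ks (pw p s) (Ph s * (ext (delta q m') (bar Ph y) - ext (bar Ph) (delta p m y)))) w"
  unfolding hoch_cbar[OF assms(1,3)] cbar_hoch[OF assms(1,2)]
  by (simp add: CY_def SS_diff[symmetric]) (intro SS_congI, simp add: algebra_simps ks_arith)
 also have "... \<in> I"
 proof (intro chain_ideal_CY[OF assms(4)])
  fix x y z assume w: "x @ y @ z = w"
  have 1: "ext m' (bar Ph (z @ x)) - ext Ph (delta p m (z @ x)) \<in> I"
  proof (cases "z @ x = []")
   case True
   then show ?thesis using assms(2,3,4)
    by (auto simp: wd_Nil[symmetric] ops_def simp del: wd_Nil intro: chain_idealD)
  qed (use w in \<open>auto intro!: assms(5)\<close>)
  have 2: "ext (delta q m') (bar Ph y) - ext (bar Ph) (delta p m y) \<in> I"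
   by (rule delta_bar_ideal[OF assms(1-4)]) (use w in \<open>auto intro!: assms(5)\<close>)
  show "(ext m' (bar Ph (z @ x)) - ext Ph (delta p m (z @ x))) * bar Ph y +
   ks (pw p (z @ x)) (Ph (z @ x) * (ext (delta q m') (bar Ph y) - ext (bar Ph) (delta p m y))) \<in> I"
   using chain_idealD(8)[OF assms(4) 1, of "bar Ph y"] chain_idealD(7)[OF assms(4) 2, of "Ph (z @ x)"]
    chain_idealD(2,5)[OF assms(4)] by blast
 qed
 finally show ?thesis .
qed

section \<open>Homotopies on tensor powers, letter by letter\<close>

primrec letter_diff :: "('l => nat) => ('l => 'l chain) => 'l list => 'l chain" where
 "letter_diff p D [] = 0"
| "letter_diff p D (l # w) = D l * wd w + ks (p l) (wd [l] * letter_diff p D w)"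

text \<open>The usual homotopy on a tensor power: \<open>P\<close> on the letters to the left of
  \<open>H\<close>, the identity on those to its right.\<close>

primrec letter_htpy :: "('l => nat) => ('l => 'l) => ('l => 'l) => 'l list => 'l chain" where
 "letter_htpy p P H [] = 0"
| "letter_htpy p P H (l # w) = wd (H l # w) + ks (p l) (wd [P l] * letter_htpy p P H w)"

text \<open>Terms with \<open>D\<close> and \<open>H\<close> on different letters cancel, because
  both are odd and \<open>D\<close> commutes with \<open>P\<close>. Terms with both on one letter
  are governed by \<open>DH\<close>, and the resulting differences of \<open>P\<close> and 1
  telescope along the word.\<close>

lemma letter_htpy:
 assumes I: "chain_ideal I"
  and D: "!!l. lett p (p l + 1) (D l)"
  and H: "!!l. even (p (H l)) \<longleftrightarrow> odd (p l)"
  and P: "!!l. even (p (P l)) \<longleftrightarrow> even (p l)"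
  and DP: "!!l. l \<in> set w ==> D (P l) = ext (%t. wd (map P t)) (D l)"
  and DH: "!!l. l \<in> set w ==> D (H l) + ext (%t. wd (map H t)) (D l) - (wd [P l] - wd [l]) \<in> I"
 shows "ext (letter_diff p D) (letter_htpy p P H w) + ext (letter_htpy p P H) (letter_diff p D w)
  - (wd (map P w) - wd w) \<in> I"
 using DP DH
proof (induction w)
 case (Cons l w)
 let ?d = "letter_diff p D" and ?h = "letter_htpy p P H"
 have cons: "wd [k] * wd t = wd (k # t)" for k :: 'a and t
  by (simp add: wd_append[symmetric])
 have h_cons: "?h (k # t) = wd [H k] * wd t + ks (p k) (wd [P k] * ?h t)" for k t
  unfolding cons by simp
 have 1: "ext ?d (wd [H l] * wd w) = D (H l) * wd w - ks (p l) (wd [H l] * ?d w)"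
  unfolding cons using H[of l] by (simp add: ks_def)
 have 2: "ext ?d (wd [P l] * X) = D (P l) * X + ks (p l) (wd [P l] * ext ?d X)" for X
 proof -
  have "ext ?d (wd [P l] * X) = ext (%t. ?d (P l # t)) X"
   by (subst ext_mult_left) (simp add: wd_append[symmetric])
  then show ?thesis
   using P[of l] by (simp add: ext_fun_add ext_fun_multl ext_fun_minus ks_def)
 qed
 have 3: "ext ?h (D l * wd w) = ext (%t. wd (map H t)) (D l) * wd w - ks (p l) (ext (%t. wd (map P t)) (D l) * ?h w)"
 proof -
  consider "D l = 0" | k n where "D l = ks n (wd [k])" "even (p k) \<longleftrightarrow> odd (p l)"
   using D[of l] by (auto simp: lett_def)
  then show ?thesis
  proof cases
   case 2
   have "ext ?h (wd [k] * wd w) = wd [H k] * wd w + ks (p k) (wd [P k] * ?h w)"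
    unfolding cons by simp
   moreover have "ks (p k) (wd [P k] * ?h w) = - ks (p l) (wd [P k] * ?h w)"
    using 2(2) by (simp add: ks_def)
   ultimately show ?thesis by (simp add: 2(1) ks_arith add.commute)
  qed simp
 qed
 have 4: "ext ?h (wd [l] * X) = wd [H l] * X + ks (p l) (wd [P l] * ext ?h X)" for X
 proof -
  have "ext ?h (wd [l] * X) = ext (%t. ?h (l # t)) X"
   by (subst ext_mult_left) (simp add: cons)
  also have "... = wd [H l] * X + ks (p l) (wd [P l] * ext ?h X)"
   unfolding h_cons by (simp add: ext_fun_add ext_fun_multl ext_fun_ks)
  finally show ?thesis .
 qed
 have 5: "ext ?d (?h (l # w)) = D (H l) * wd w - ks (p l) (wd [H l] * ?d w) +
   ks (p l) (D (P l) * ?h w) + wd [P l] * ext ?d (?h w)"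
  unfolding h_cons by (simp add: frag_extend_add 1 2 ks_arith add.assoc)
 have 6: "ext ?h (?d (l # w)) = ext (%t. wd (map H t)) (D l) * wd w - ks (p l) (D (P l) * ?h w) +
   ks (p l) (wd [H l] * ?d w) + wd [P l] * ext ?h (?d w)"
  using Cons.prems(1)[of l] by (simp add: frag_extend_add 3 4 ks_arith add.assoc)
 have "ext ?d (?h (l # w)) + ext ?h (?d (l # w)) - (wd (map P (l # w)) - wd (l # w)) =
  (D (H l) + ext (%t. wd (map H t)) (D l) - (wd [P l] - wd [l])) * wd w +
  wd [P l] * (ext ?d (?h w) + ext ?h (?d w) - (wd (map P w) - wd w))"
  unfolding 5 6 list.map cons[of "P l" "map P w", symmetric] cons[of l w, symmetric]
  by (simp add: algebra_simps)
 also have "... \<in> I"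
 proof (intro chain_idealD(2)[OF I])
  show "(D (H l) + ext (%t. wd (map H t)) (D l) - (wd [P l] - wd [l])) * wd w \<in> I"
   using Cons.prems by (intro chain_idealD(8)[OF I]) auto
  show "wd [P l] * (ext ?d (?h w) + ext ?h (?d w) - (wd (map P w) - wd w)) \<in> I"
   using Cons by (intro chain_idealD(7)[OF I]) auto
 qed
 finally show ?case .
qed (use I in \<open>simp add: chain_idealD\<close>)

section \<open>Linear maps, quotients and tensor powers\<close>

lemma linearI:
 assumes "!!x. x \<in> carrier M ==> \<phi> x \<in> carrier N"
  "!!x y. x \<in> carrier M ==> y \<in> carrier M ==> \<phi> (x \<oplus>\<^bsub>M\<^esub> y) = \<phi> x \<oplus>\<^bsub>N\<^esub> \<phi> y"
  "!!c x. c \<in> carrier K ==> x \<in> carrier M ==> \<phi> (c \<odot>\<^bsub>M\<^esub> x) = c \<odot>\<^bsub>N\<^esub> \<phi> x"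
 shows "\<phi> \<in> linear_maps K M N"
 using assms by (auto simp: linear_maps_def)

lemma linearD:
 assumes "\<phi> \<in> linear_maps K M N"
 shows "x \<in> carrier M ==> \<phi> x \<in> carrier N"
  "x \<in> carrier M ==> y \<in> carrier M ==> \<phi> (x \<oplus>\<^bsub>M\<^esub> y) = \<phi> x \<oplus>\<^bsub>N\<^esub> \<phi> y"
  "c \<in> carrier K ==> x \<in> carrier M ==> \<phi> (c \<odot>\<^bsub>M\<^esub> x) = c \<odot>\<^bsub>N\<^esub> \<phi> x"
 using assms by (auto simp: linear_maps_def)

lemma linear_maps_hom:
 assumes "\<phi> \<in> linear_maps K M N" "module K M" "module K N"
 shows "abelian_group_hom M N \<phi>"
proof (rule abelian_group_homI)
 interpret M: module K M by fact
 interpret N: module K N by fact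
 show M: "abelian_group M" and N: "abelian_group N" by unfold_locales
 show "group_hom (add_monoid M) (add_monoid N) \<phi>"
  by (intro group_hom.intro group_hom_axioms.intro homI)
   (auto simp: linearD[OF assms(1)] intro: M.a_group N.a_group)
qed

lemma linear_zero:
 "\<phi> \<in> linear_maps K M N ==> module K M ==> module K N ==> \<phi> \<zero>\<^bsub>M\<^esub> = \<zero>\<^bsub>N\<^esub>"
 using abelian_group_hom.hom_zero[OF linear_maps_hom] .

lemma linear_neg:
 "\<phi> \<in> linear_maps K M N ==> module K M ==> module K N ==> x \<in> carrier M ==> \<phi> (\<ominus>\<^bsub>M\<^esub> x) = \<ominus>\<^bsub>N\<^esub> \<phi> x"
 using abelian_group_hom.hom_a_inv[OF linear_maps_hom] .

lemma signed_closed: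
 "module K M ==> x \<in> carrier M ==> signed M e x \<in> carrier M"
 by (simp add: signed_def abelian_group.a_inv_closed module.axioms)

lemma linear_signed:
 "\<phi> \<in> linear_maps K M N ==> module K M ==> module K N ==> x \<in> carrier M ==> \<phi> (signed M e x) = signed N e (\<phi> x)"
 by (simp add: signed_def linear_neg)

lemma linear_finsum:
 assumes "\<phi> \<in> linear_maps K M N" "module K M" "module K N" "!!i. i \<in> S ==> f i \<in> carrier M"
 shows "\<phi> (\<Oplus>\<^bsub>M\<^esub>i\<in>S. f i) = (\<Oplus>\<^bsub>N\<^esub>i\<in>S. \<phi> (f i))"
 using assms(4)
proof (induction S rule: infinite_finite_induct)
 interpret M: module K M by fact
 interpret N: module K N by fact
 {
  case (infinite S)
  then show ?case by (simp add: linear_zero[OF assms(1-3)])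
 next
  case empty
  then show ?case by (simp add: linear_zero[OF assms(1-3)])
 next
  case (insert x F)
  then have f: "f \<in> F \<rightarrow> carrier M" "f x \<in> carrier M" by auto
  then show ?case
   using insert linearD[OF assms(1)] by (simp add: Pi_iff)
 }
qed

lemma linear_comp:
 assumes "\<phi> \<in> linear_maps K M N" "\<psi> \<in> linear_maps K N P"
 shows "(%x. \<psi> (\<phi> x)) \<in> linear_maps K M P"
 using linearD[OF assms(1)] linearD[OF assms(2)] by (intro linearI) auto

lemma signed_add:
 assumes "module K M" "x \<in> carrier M" "y \<in> carrier M"
 shows "signed M e (x \<oplus>\<^bsub>M\<^esub> y) = signed M e x \<oplus>\<^bsub>M\<^esub> signed M e y"
proof -
 interpret M: module K M by fact
 show ?thesis using assms by (simp add: signed_def M.minus_add)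
qed

lemma signed_signed:
 assumes "module K M" "x \<in> carrier M"
 shows "signed M e (signed M e' x) = signed M (e + e') x"
proof -
 interpret M: module K M by fact
 show ?thesis using assms by (auto simp: signed_def)
qed

lemma signed_zero:
 assumes "module K M"
 shows "signed M e \<zero>\<^bsub>M\<^esub> = \<zero>\<^bsub>M\<^esub>"
proof -
 interpret M: module K M by fact
 show ?thesis using assms by (auto simp: signed_def)
qed

lemma signed_smult:
 assumes "module K M" "x \<in> carrier M" "c \<in> carrier K"
 shows "signed M e (c \<odot>\<^bsub>M\<^esub> x) = c \<odot>\<^bsub>M\<^esub> signed M e x"
proof -
 interpret M: module K M by fact
 show ?thesis using assms by (auto simp: signed_def M.smult_r_minus)
qed

lemma signed_cong: "(even e \<longleftrightarrow> even e') ==> x = y ==> signed M e x = signed M e' y"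
 by (simp add: signed_def)

lemma signed_linear: "module K M ==> (%x. signed M e x) \<in> linear_maps K M M"
 by (intro linearI) (auto simp: signed_add signed_closed signed_smult)

lemma finsum_linear:
 assumes "module K M" "module K N" "!!i. i \<in> S ==> \<phi> i \<in> linear_maps K M N"
 shows "(%x. \<Oplus>\<^bsub>N\<^esub>i\<in>S. \<phi> i x) \<in> linear_maps K M N"
proof -
 interpret M: module K M by fact
 interpret N: module K N by fact
 note D = linearD[OF assms(3)]
 show ?thesis
 proof (rule linearI)
  fix x y assume "x \<in> carrier M" "y \<in> carrier M"
  then have "(\<Oplus>\<^bsub>N\<^esub>i\<in>S. \<phi> i (x \<oplus>\<^bsub>M\<^esub> y)) = (\<Oplus>\<^bsub>N\<^esub>i\<in>S. \<phi> i x \<oplus>\<^bsub>N\<^esub> \<phi> i y)"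
   by (intro N.finsum_cong') (auto simp: D)
  then show "(\<Oplus>\<^bsub>N\<^esub>i\<in>S. \<phi> i (x \<oplus>\<^bsub>M\<^esub> y)) = (\<Oplus>\<^bsub>N\<^esub>i\<in>S. \<phi> i x) \<oplus>\<^bsub>N\<^esub> (\<Oplus>\<^bsub>N\<^esub>i\<in>S. \<phi> i y)"
   using \<open>x \<in> _\<close> \<open>y \<in> _\<close> by (simp add: N.finsum_addf Pi_iff D)
 next
  fix c x assume cx: "c \<in> carrier K" "x \<in> carrier M"
  then have 1: "(\<Oplus>\<^bsub>N\<^esub>i\<in>S. \<phi> i (c \<odot>\<^bsub>M\<^esub> x)) = (\<Oplus>\<^bsub>N\<^esub>i\<in>S. c \<odot>\<^bsub>N\<^esub> \<phi> i x)"
   by (intro N.finsum_cong') (auto simp: D)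
  show "(\<Oplus>\<^bsub>N\<^esub>i\<in>S. \<phi> i (c \<odot>\<^bsub>M\<^esub> x)) = c \<odot>\<^bsub>N\<^esub> (\<Oplus>\<^bsub>N\<^esub>i\<in>S. \<phi> i x)"
  proof (cases "finite S")
   case True
   then show ?thesis unfolding 1 using cx by (subst N.finsum_smult_ldistr) (auto simp: D)
  qed (use cx in \<open>simp add: 1\<close>)
 qed (auto intro!: N.finsum_closed simp: D)
qed

lemma add_linear:
 assumes "module K N" "\<phi> \<in> linear_maps K M N" "\<psi> \<in> linear_maps K M N"
 shows "(%x. \<phi> x \<oplus>\<^bsub>N\<^esub> \<psi> x) \<in> linear_maps K M N"
proof -
 interpret N: module K N by fact
 show ?thesis
  using linearD[OF assms(2)] linearD[OF assms(3)]
  by (intro linearI) (auto simp: N.smult_r_distr N.a_ac)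
qed

lemma neg_linear:
 assumes "module K N" "\<phi> \<in> linear_maps K M N"
 shows "(%x. \<ominus>\<^bsub>N\<^esub> \<phi> x) \<in> linear_maps K M N"
proof -
 interpret N: module K N by fact
 show ?thesis
  using linearD[OF assms(2)]
  by (intro linearI) (auto simp: N.smult_r_minus N.minus_add)
qed

lemma minus_linear:
 assumes "module K N" "\<phi> \<in> linear_maps K M N" "\<psi> \<in> linear_maps K M N"
 shows "(%x. \<phi> x \<ominus>\<^bsub>N\<^esub> \<psi> x) \<in> linear_maps K M N"
 unfolding a_minus_def by (intro add_linear neg_linear assms)

lemma zero_linear: "module K N ==> (%x. \<zero>\<^bsub>N\<^esub>) \<in> linear_maps K M N"
proof -
 assume "module K N"
 then interpret N: module K N .
 show ?thesis by (intro linearI) auto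
qed

lemma id_linear: "(%x. x) \<in> linear_maps K M M"
 by (auto simp: linear_maps_def)

section \<open>Quotient modules\<close>

lemma UN_eq_const: "(!!y. y \<in> X ==> f y = C) ==> x \<in> X ==> (\<Union>y\<in>X. f y) = C"
 by blast

lemma submodule_abelian_subgroup:
 assumes "module K M" "submodule N K M"
 shows "abelian_subgroup N M"
proof -
 interpret M: module K M by fact
 show ?thesis
  by (intro abelian_subgroupI3 additive_subgroupI submodule.axioms(1)[OF assms(2)]) unfold_locales
qed

context
 fixes K :: "'k ring" and M :: "('k, 'a) module" and N
 assumes M: "module K M" and N: "submodule N K M"
begin

interpretation M: module K M by (rule M)
interpretation N: abelian_subgroup N M by (rule submodule_abelian_subgroup[OF M N])

lemma quotient_carrier: "X \<in> carrier (quotient_module M N) \<longleftrightarrow> (\<exists>x\<in>carrier M. X = N +>\<^bsub>M\<^esub> x)"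
 by (auto simp: quotient_module_def A_RCOSETS_def')

lemma quotient_zero: "\<zero>\<^bsub>quotient_module M N\<^esub> = N +>\<^bsub>M\<^esub> \<zero>\<^bsub>M\<^esub>"
 by (simp add: quotient_module_def N.a_subset)

lemma quotient_add:
 "x \<in> carrier M ==> y \<in> carrier M ==>
  (N +>\<^bsub>M\<^esub> x) \<oplus>\<^bsub>quotient_module M N\<^esub> (N +>\<^bsub>M\<^esub> y) = N +>\<^bsub>M\<^esub> (x \<oplus>\<^bsub>M\<^esub> y)"
 by (simp add: quotient_module_def N.a_rcos_sum)

lemma quotient_eq_iff:
 "x \<in> carrier M ==> y \<in> carrier M ==> N +>\<^bsub>M\<^esub> x = N +>\<^bsub>M\<^esub> y \<longleftrightarrow> x \<ominus>\<^bsub>M\<^esub> y \<in> N"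
proof
 assume xy: "x \<in> carrier M" "y \<in> carrier M"
 show "x \<ominus>\<^bsub>M\<^esub> y \<in> N" if "N +>\<^bsub>M\<^esub> x = N +>\<^bsub>M\<^esub> y"
  using N.a_rcos_module_imp[OF xy(2), of x] N.a_rcos_self[OF xy(1)] that by (simp add: a_minus_def)
 show "N +>\<^bsub>M\<^esub> x = N +>\<^bsub>M\<^esub> y" if "x \<ominus>\<^bsub>M\<^esub> y \<in> N"
  using N.a_rcos_module_rev[OF xy(2,1)] that N.a_repr_independence'[of x y] xy by (simp add: a_minus_def)
qed

text \<open>The scalar multiple of a coset is a union over its elements; all members of this union
  are the same coset.\<close>

lemma quotient_smult:
 assumes "c \<in> carrier K" "x \<in> carrier M"
 shows "c \<odot>\<^bsub>quotient_module M N\<^esub> (N +>\<^bsub>M\<^esub> x) = N +>\<^bsub>M\<^esub> (c \<odot>\<^bsub>M\<^esub> x)"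
proof -
 have "N +>\<^bsub>M\<^esub> (c \<odot>\<^bsub>M\<^esub> y) = N +>\<^bsub>M\<^esub> (c \<odot>\<^bsub>M\<^esub> x)" if y: "y \<in> N +>\<^bsub>M\<^esub> x" for y
 proof -
  have yc: "y \<in> carrier M" using N.a_elemrcos_carrier[OF assms(2) y] .
  have "y \<oplus>\<^bsub>M\<^esub> \<ominus>\<^bsub>M\<^esub> x \<in> N" using N.a_rcos_module_imp[OF assms(2) y] .
  then have "c \<odot>\<^bsub>M\<^esub> (y \<oplus>\<^bsub>M\<^esub> \<ominus>\<^bsub>M\<^esub> x) \<in> N" by (rule submodule.smult_closed[OF N assms(1)])
  then have "c \<odot>\<^bsub>M\<^esub> y \<ominus>\<^bsub>M\<^esub> c \<odot>\<^bsub>M\<^esub> x \<in> N"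
   unfolding a_minus_def
   using assms yc M.smult_r_distr[of c y "\<ominus>\<^bsub>M\<^esub> x"] M.smult_r_minus[of c x] by simp
  then show ?thesis using quotient_eq_iff[of "c \<odot>\<^bsub>M\<^esub> y" "c \<odot>\<^bsub>M\<^esub> x"] assms yc by blast
 qed
 moreover have "x \<in> N +>\<^bsub>M\<^esub> x" using N.a_rcos_self[OF assms(2)] .
 ultimately have "(\<Union>y\<in>N +>\<^bsub>M\<^esub> x. N +>\<^bsub>M\<^esub> (c \<odot>\<^bsub>M\<^esub> y)) = N +>\<^bsub>M\<^esub> (c \<odot>\<^bsub>M\<^esub> x)"
  by (intro UN_eq_const)
 then show ?thesis by (simp add: quotient_module_def)
qed

lemma quotient_module_module: "module K (quotient_module M N)"
proof (rule moduleI)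
 let ?Q = "quotient_module M N"
 show "cring K" by (rule M.is_cring)
 show "abelian_group ?Q"
 proof (rule abelian_groupI)
  fix X assume "X \<in> carrier ?Q"
  then obtain x where x: "x \<in> carrier M" "X = N +>\<^bsub>M\<^esub> x" by (auto simp: quotient_carrier)
  then show "\<exists>Y\<in>carrier ?Q. Y \<oplus>\<^bsub>?Q\<^esub> X = \<zero>\<^bsub>?Q\<^esub>"
   by (intro bexI[of _ "N +>\<^bsub>M\<^esub> (\<ominus>\<^bsub>M\<^esub> x)"])
    (auto simp: quotient_add quotient_zero M.l_neg quotient_carrier)
 qed (auto simp: quotient_carrier quotient_zero quotient_add M.a_ac; blast)+
qed (auto simp: quotient_carrier quotient_add quotient_smult M.smult_l_distr M.smult_r_distr M.smult_assoc1)

lemma quotient_proj_linear: "(%x. N +>\<^bsub>M\<^esub> x) \<in> linear_maps K M (quotient_module M N)"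
 by (intro linearI) (auto simp: quotient_carrier quotient_add quotient_smult)

end

section \<open>Free modules\<close>

lemma free_module_module:
 assumes "cring K"
 shows "module K (free_module K S)"
proof -
 interpret K: cring K by fact
 let ?F = "free_module K S"
 have supp: "finite {s. u s ~= \<zero>\<^bsub>K\<^esub>} \<and> {s. u s ~= \<zero>\<^bsub>K\<^esub>} \<subseteq> S" and val: "u s \<in> carrier K"
  if "u \<in> carrier ?F" for u s
  using that by (auto simp: free_module_def)
 have I: "(%s. f (u s) (v s)) \<in> carrier ?F"
  if "u \<in> carrier ?F" "v \<in> carrier ?F" "!!x y. x \<in> carrier K ==> y \<in> carrier K ==> f x y \<in> carrier K"
   "f \<zero>\<^bsub>K\<^esub> \<zero>\<^bsub>K\<^esub> = \<zero>\<^bsub>K\<^esub>" for u v f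
 proof -
  have "{s. f (u s) (v s) ~= \<zero>\<^bsub>K\<^esub>} \<subseteq> {s. u s ~= \<zero>\<^bsub>K\<^esub>} \<union> {s. v s ~= \<zero>\<^bsub>K\<^esub>}"
   using that(4) by auto
  then show ?thesis
   using supp[OF that(1)] supp[OF that(2)] val[OF that(1)] val[OF that(2)] that(3)
   by (auto simp: free_module_def intro: finite_subset)
 qed
 have ops: "u \<oplus>\<^bsub>?F\<^esub> v = (%s. u s \<oplus>\<^bsub>K\<^esub> v s)" "\<zero>\<^bsub>?F\<^esub> = (%s. \<zero>\<^bsub>K\<^esub>)" "c \<odot>\<^bsub>?F\<^esub> u = (%s. c \<otimes>\<^bsub>K\<^esub> u s)"
  for u v c by (simp_all add: free_module_def)
 have add: "u \<oplus>\<^bsub>?F\<^esub> v \<in> carrier ?F" if "u \<in> carrier ?F" "v \<in> carrier ?F" for u v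
  unfolding ops by (rule I[OF that]) simp_all
 have smult: "c \<odot>\<^bsub>?F\<^esub> u \<in> carrier ?F" if "c \<in> carrier K" "u \<in> carrier ?F" for c u
  unfolding ops by (rule I[OF that(2,2), of "%x y. c \<otimes>\<^bsub>K\<^esub> x"]) (simp_all add: that)
 have grp: "abelian_group ?F"
 proof (rule abelian_groupI)
  show "\<zero>\<^bsub>?F\<^esub> \<in> carrier ?F" by (simp add: free_module_def)
 next
  fix u assume u: "u \<in> carrier ?F"
  have "(%s. \<ominus>\<^bsub>K\<^esub> u s) \<in> carrier ?F"
   by (rule I[OF u u, of "%x y. \<ominus>\<^bsub>K\<^esub> x"]) simp_all
  moreover have "(%s. \<ominus>\<^bsub>K\<^esub> u s) \<oplus>\<^bsub>?F\<^esub> u = \<zero>\<^bsub>?F\<^esub>"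
   unfolding ops by (simp add: val[OF u] K.l_neg)
  ultimately show "\<exists>v\<in>carrier ?F. v \<oplus>\<^bsub>?F\<^esub> u = \<zero>\<^bsub>?F\<^esub>" by blast
 next
  fix u assume u: "u \<in> carrier ?F"
  show "\<zero>\<^bsub>?F\<^esub> \<oplus>\<^bsub>?F\<^esub> u = u" unfolding ops by (simp add: val[OF u])
 next
  fix u v assume uv: "u \<in> carrier ?F" "v \<in> carrier ?F"
  show "u \<oplus>\<^bsub>?F\<^esub> v = v \<oplus>\<^bsub>?F\<^esub> u" unfolding ops by (intro HOL.ext K.a_comm val uv)
 next
  fix u v w assume uv: "u \<in> carrier ?F" "v \<in> carrier ?F" "w \<in> carrier ?F"
  show "u \<oplus>\<^bsub>?F\<^esub> v \<oplus>\<^bsub>?F\<^esub> w = u \<oplus>\<^bsub>?F\<^esub> (v \<oplus>\<^bsub>?F\<^esub> w)"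
   unfolding ops by (simp add: val[OF uv(1)] val[OF uv(2)] val[OF uv(3)] K.a_assoc)
 qed (rule add)
 show ?thesis
 proof (rule moduleI[OF assms grp smult])
  fix a b u assume ab: "a \<in> carrier K" "b \<in> carrier K" and u: "u \<in> carrier ?F"
  show "(a \<oplus>\<^bsub>K\<^esub> b) \<odot>\<^bsub>?F\<^esub> u = a \<odot>\<^bsub>?F\<^esub> u \<oplus>\<^bsub>?F\<^esub> b \<odot>\<^bsub>?F\<^esub> u"
   "(a \<otimes>\<^bsub>K\<^esub> b) \<odot>\<^bsub>?F\<^esub> u = a \<odot>\<^bsub>?F\<^esub> (b \<odot>\<^bsub>?F\<^esub> u)"
   unfolding ops by (simp_all add: ab val[OF u] K.l_distr K.m_assoc)
 next
  fix a u v assume a: "a \<in> carrier K" and u: "u \<in> carrier ?F" and v: "v \<in> carrier ?F"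
  show "a \<odot>\<^bsub>?F\<^esub> (u \<oplus>\<^bsub>?F\<^esub> v) = a \<odot>\<^bsub>?F\<^esub> u \<oplus>\<^bsub>?F\<^esub> a \<odot>\<^bsub>?F\<^esub> v"
   unfolding ops by (simp add: a val[OF u] val[OF v] K.r_distr)
 next
  fix u assume u: "u \<in> carrier ?F"
  show "\<one>\<^bsub>K\<^esub> \<odot>\<^bsub>?F\<^esub> u = u"
   unfolding ops by (simp add: val[OF u])
 qed
qed

lemma basis_vector_closed:
 assumes "cring K" "s \<in> S"
 shows "basis_vector K s \<in> carrier (free_module K S)"
proof -
 interpret K: cring K by fact
 show ?thesis
  using assms(2) by (auto simp: free_module_def basis_vector_def intro: finite_subset[of _ "{s}"])
qed

text \<open>The formula of \<open>tensor_lift\<close> on a fixed representative.\<close>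

definition free_lift :: "'k ring => ('k, 'b) module => ('s => 'b) => ('s => 'k) => 'b" where
 "free_lift K M F u = (\<Oplus>\<^bsub>M\<^esub>s\<in>{s. u s ~= \<zero>\<^bsub>K\<^esub>}. u s \<odot>\<^bsub>M\<^esub> F s)"

lemma free_lift_superset:
 assumes M: "module K M" and u: "u \<in> carrier (free_module K S)" and F: "F \<in> S \<rightarrow> carrier M"
  and T: "finite T" "T \<subseteq> S" "{s. u s ~= \<zero>\<^bsub>K\<^esub>} \<subseteq> T"
 shows "free_lift K M F u = (\<Oplus>\<^bsub>M\<^esub>s\<in>T. u s \<odot>\<^bsub>M\<^esub> F s)"
proof -
 interpret M: module K M by fact
 show ?thesis
  unfolding free_lift_def
 proof (rule M.add.finprod_mono_neutral_cong_left)
  have "u s \<in> carrier K" for s using u by (auto simp: free_module_def)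
  moreover have "F s \<in> carrier M" if "s \<in> T" for s using that F T by auto
  ultimately show "(%s. u s \<odot>\<^bsub>M\<^esub> F s) \<in> T \<rightarrow> carrier M"
   "!!i. i \<in> T - {s. u s ~= \<zero>\<^bsub>K\<^esub>} ==> u i \<odot>\<^bsub>M\<^esub> F i = \<zero>\<^bsub>M\<^esub>" by auto
 qed (use T in auto)
qed

lemma free_lift_linear:
 assumes M: "module K M" and F: "F \<in> S \<rightarrow> carrier M"
 shows "free_lift K M F \<in> linear_maps K (free_module K S) M"
proof -
 interpret M: module K M by fact
 let ?F = "free_module K S"
 have supp: "finite {s. u s ~= \<zero>\<^bsub>K\<^esub>}" "{s. u s ~= \<zero>\<^bsub>K\<^esub>} \<subseteq> S" and val: "u s \<in> carrier K"
  if "u \<in> carrier ?F" for u s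
  using that by (auto simp: free_module_def)
 interpret FM: module K ?F using free_module_module M.is_cring by blast
 show ?thesis
 proof (rule linearI)
  fix u assume "u \<in> carrier ?F"
  then show "free_lift K M F u \<in> carrier M"
   unfolding free_lift_def
   by (intro M.finsum_closed Pi_I M.smult_closed val) (use F supp in auto)
 next
  fix u v assume u: "u \<in> carrier ?F" and v: "v \<in> carrier ?F"
  let ?T = "{s. u s ~= \<zero>\<^bsub>K\<^esub>} \<union> {s. v s ~= \<zero>\<^bsub>K\<^esub>}"
  have T: "finite ?T" "?T \<subseteq> S" using supp[OF u] supp[OF v] by auto
  have FT: "!!s. s \<in> ?T ==> F s \<in> carrier M" using F T(2) by blast
  have uv: "u \<oplus>\<^bsub>?F\<^esub> v = (%s. u s \<oplus>\<^bsub>K\<^esub> v s)" by (simp add: free_module_def)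
  have "free_lift K M F (u \<oplus>\<^bsub>?F\<^esub> v) = (\<Oplus>\<^bsub>M\<^esub>s\<in>?T. (u s \<oplus>\<^bsub>K\<^esub> v s) \<odot>\<^bsub>M\<^esub> F s)"
   by (subst free_lift_superset[OF M FM.a_closed[OF u v] F T]) (auto simp: uv)
  also have "... = (\<Oplus>\<^bsub>M\<^esub>s\<in>?T. u s \<odot>\<^bsub>M\<^esub> F s \<oplus>\<^bsub>M\<^esub> v s \<odot>\<^bsub>M\<^esub> F s)"
   by (intro M.finsum_cong') (use FT val[OF u] val[OF v] in \<open>auto intro!: M.smult_l_distr\<close>)
  also have "... = free_lift K M F u \<oplus>\<^bsub>M\<^esub> free_lift K M F v"
   using free_lift_superset[OF M u F T] free_lift_superset[OF M v F T] FT val[OF u] val[OF v]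
   by (subst M.finsum_addf) auto
  finally show "free_lift K M F (u \<oplus>\<^bsub>?F\<^esub> v) = free_lift K M F u \<oplus>\<^bsub>M\<^esub> free_lift K M F v" .
 next
  fix c u assume c: "c \<in> carrier K" and u: "u \<in> carrier ?F"
  have FT: "!!s. u s ~= \<zero>\<^bsub>K\<^esub> ==> F s \<in> carrier M" using F supp(2)[OF u] by blast
  have cu: "c \<odot>\<^bsub>?F\<^esub> u = (%s. c \<otimes>\<^bsub>K\<^esub> u s)" by (simp add: free_module_def)
  have "free_lift K M F (c \<odot>\<^bsub>?F\<^esub> u) = (\<Oplus>\<^bsub>M\<^esub>s\<in>{s. u s ~= \<zero>\<^bsub>K\<^esub>}. (c \<otimes>\<^bsub>K\<^esub> u s) \<odot>\<^bsub>M\<^esub> F s)"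
   using c by (subst free_lift_superset[OF M FM.smult_closed[OF c u] F supp[OF u]]) (auto simp: cu)
  also have "... = (\<Oplus>\<^bsub>M\<^esub>s\<in>{s. u s ~= \<zero>\<^bsub>K\<^esub>}. c \<odot>\<^bsub>M\<^esub> (u s \<odot>\<^bsub>M\<^esub> F s))"
   by (intro M.finsum_cong') (use FT val[OF u] c in \<open>auto intro!: M.smult_assoc1\<close>)
  also have "... = c \<odot>\<^bsub>M\<^esub> free_lift K M F u"
   unfolding free_lift_def using FT val[OF u] supp(1)[OF u] c
   by (subst M.finsum_smult_ldistr) auto
  finally show "free_lift K M F (c \<odot>\<^bsub>?F\<^esub> u) = c \<odot>\<^bsub>M\<^esub> free_lift K M F u" .
 qed
qed

lemma free_lift_basis:
 assumes M: "module K M" and F: "F s \<in> carrier M"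
 shows "free_lift K M F (basis_vector K s) = F s"
proof -
 interpret M: module K M by fact
 show ?thesis
 \<comment> \<open>In the zero ring the support of \<open>basis_vector\<close> is empty, but then
   every module is zero as well.\<close>
 proof (cases "\<one>\<^bsub>K\<^esub> = \<zero>\<^bsub>K\<^esub>")
  case True
  then have "F s = \<zero>\<^bsub>M\<^esub>" using M.smult_l_null[OF F] M.smult_one[OF F] by simp
  then show ?thesis using True by (simp add: free_lift_def basis_vector_def)
 next
  case False
  then have "{t. basis_vector K s t ~= \<zero>\<^bsub>K\<^esub>} = {s}" by (auto simp: basis_vector_def)
  then show ?thesis using F by (simp add: free_lift_def basis_vector_def)
 qed
qed

lemma free_module_expand:
 assumes K: "cring K" and u: "u \<in> carrier (free_module K S)"
 shows "u = free_lift K (free_module K S) (basis_vector K) u"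
proof -
 interpret K: cring K by fact
 let ?F = "free_module K S"
 interpret FM: module K ?F using free_module_module K by blast
 have supp: "finite {s. u s ~= \<zero>\<^bsub>K\<^esub>}" "{s. u s ~= \<zero>\<^bsub>K\<^esub>} \<subseteq> S" and val: "!!s. u s \<in> carrier K"
  using u by (auto simp: free_module_def)
 have *: "(\<Oplus>\<^bsub>?F\<^esub>s\<in>T. u s \<odot>\<^bsub>?F\<^esub> basis_vector K s) = (%s. if s \<in> T then u s else \<zero>\<^bsub>K\<^esub>)"
  if "finite T" "T \<subseteq> S" for T
  using that
 proof (induction T)
  case empty
  then show ?case by (simp, simp add: free_module_def)
 next
  case (insert t T)
  have "(%s. u s \<odot>\<^bsub>?F\<^esub> basis_vector K s) \<in> T \<rightarrow> carrier ?F" "u t \<odot>\<^bsub>?F\<^esub> basis_vector K t \<in> carrier ?F"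
   using insert.prems val by (auto intro!: FM.smult_closed basis_vector_closed[OF K])
  with insert show ?case
   by (simp add: FM.finsum_insert) (auto simp: free_module_def basis_vector_def fun_eq_iff val)
 qed
 show ?thesis
  unfolding free_lift_def *[OF supp] by auto
qed

lemma (in abelian_group) diff_zero_iff:
 "x \<in> carrier G ==> y \<in> carrier G ==> x \<oplus> \<ominus> y = \<zero> \<longleftrightarrow> x = y"
 using minus_equality[of x "\<ominus> y"] by (auto simp: r_neg a_comm)

section \<open>Spans and kernels\<close>

lemma submodule_Inter:
 assumes M: "module K M" and S: "S ~= {}" "!!N. N \<in> S ==> submodule N K M"
 shows "submodule (\<Inter>S) K M"
proof -
 interpret M: module K M by fact
 have ne: "N ~= {}" if "N \<in> S" for N using M.submoduleE(2)[OF S(2)[OF that]] .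
 have zero: "\<zero>\<^bsub>M\<^esub> \<in> N" if N: "N \<in> S" for N
 proof -
  obtain x where "x \<in> N" using ne[OF N] by blast
  then show ?thesis using M.submoduleE(1,4)[OF S(2)[OF N]] M.smult_l_null[of x] by fastforce
 qed
 have sub: "!!N. N \<in> S ==> N \<subseteq> carrier M" using M.submoduleE(1)[OF S(2)] by blast
 have inv: "!!N a. N \<in> S ==> a \<in> N ==> \<ominus>\<^bsub>M\<^esub> a \<in> N" using M.submoduleE(3)[OF S(2)] by blast
 have add: "!!N a b. N \<in> S ==> a \<in> N ==> b \<in> N ==> a \<oplus>\<^bsub>M\<^esub> b \<in> N" using M.submoduleE(5)[OF S(2)] by blast
 have smult: "!!N c b. N \<in> S ==> c \<in> carrier K ==> b \<in> N ==> c \<odot>\<^bsub>M\<^esub> b \<in> N" using M.submoduleE(4)[OF S(2)] by blast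
 show ?thesis
 proof (rule M.submoduleI)
  show "\<Inter>S \<subseteq> carrier M" using S(1) sub by blast
 qed (simp_all add: zero inv add smult)
qed

lemma module_span_submodule:
 assumes M: "module K M" and G: "G \<subseteq> carrier M"
 shows "submodule (module_span K M G) K M"
 unfolding module_span_def
 by (rule submodule_Inter[OF M]) (use module.carrier_is_submodule[OF M] G in auto)

lemma module_span_least: "submodule N K M ==> G \<subseteq> N ==> module_span K M G \<subseteq> N"
 unfolding module_span_def by blast

lemma module_span_superset: "G \<subseteq> module_span K M G"
 unfolding module_span_def by blast

lemma linear_kernel_submodule:
 assumes "\<phi> \<in> linear_maps K M N" "module K M" "module K N"
 shows "submodule {x \<in> carrier M. \<phi> x = \<zero>\<^bsub>N\<^esub>} K M"
proof -
 interpret M: module K M by fact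
 interpret N: module K N by fact
 show ?thesis
  by (rule M.submoduleI)
   (auto simp: linearD[OF assms(1)] linear_zero[OF assms] linear_neg[OF assms])
qed

section \<open>Tensor powers by generators and relations\<close>

definition graded :: "'k ring => ('k, 'a) graded_module => bool" where
 "graded K A \<longleftrightarrow> cring K \<and> (\<forall>n. module K (A n))"

lemma gradedD: "graded K A ==> module K (A n)" "graded K A ==> cring K"
 by (auto simp: graded_def)

abbreviation (input) hw :: "('k, 'a) graded_module => nat => nat => 'a hword set" where
 "hw \<equiv> homogeneous_words"

lemma word_degree_simps [simp]:
 "word_degree [] = 0" "word_degree (l # w) = fst l + word_degree w"
 "word_degree (u @ v) = word_degree u + word_degree v"
 by (simp_all add: word_degree_def)

definition valid :: "('k, 'a) graded_module => 'a hword => bool" where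
 "valid A w \<longleftrightarrow> (\<forall>(i, a) \<in> set w. a \<in> carrier (A i))"

lemma valid_simps [simp]:
 "valid A []" "valid A (l # w) \<longleftrightarrow> snd l \<in> carrier (A (fst l)) \<and> valid A w"
 "valid A (u @ v) \<longleftrightarrow> valid A u \<and> valid A v"
 by (auto simp: valid_def)

lemma hw_iff: "w \<in> hw A r p \<longleftrightarrow> length w = r \<and> word_degree w = p \<and> valid A w"
 by (auto simp: homogeneous_words_def valid_def)

definition multilinear ::
 "'k ring => ('k, 'a) graded_module => nat => nat => ('k, 'b) module => ('a hword => 'b) => bool" where
 "multilinear K A r p M F \<longleftrightarrow> (\<forall>w \<in> hw A r p. F w \<in> carrier M) \<and>
  (\<forall>us i a b vs. us @ (i, a) # vs \<in> hw A r p --> b \<in> carrier (A i) -->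
   F (us @ (i, a \<oplus>\<^bsub>A i\<^esub> b) # vs) = F (us @ (i, a) # vs) \<oplus>\<^bsub>M\<^esub> F (us @ (i, b) # vs)) \<and>
  (\<forall>us i a c vs. us @ (i, a) # vs \<in> hw A r p --> c \<in> carrier K -->
   F (us @ (i, c \<odot>\<^bsub>A i\<^esub> a) # vs) = c \<odot>\<^bsub>M\<^esub> F (us @ (i, a) # vs))"

lemma multilinearI:
 assumes "!!w. w \<in> hw A r p ==> F w \<in> carrier M"
  "!!us i a b vs. us @ (i, a) # vs \<in> hw A r p ==> b \<in> carrier (A i) ==>
   F (us @ (i, a \<oplus>\<^bsub>A i\<^esub> b) # vs) = F (us @ (i, a) # vs) \<oplus>\<^bsub>M\<^esub> F (us @ (i, b) # vs)"
  "!!us i a c vs. us @ (i, a) # vs \<in> hw A r p ==> c \<in> carrier K ==>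
   F (us @ (i, c \<odot>\<^bsub>A i\<^esub> a) # vs) = c \<odot>\<^bsub>M\<^esub> F (us @ (i, a) # vs)"
 shows "multilinear K A r p M F"
 using assms unfolding multilinear_def by blast

lemma multilinearD:
 assumes "multilinear K A r p M F"
 shows "w \<in> hw A r p ==> F w \<in> carrier M"
  "us @ (i, a) # vs \<in> hw A r p ==> b \<in> carrier (A i) ==>
   F (us @ (i, a \<oplus>\<^bsub>A i\<^esub> b) # vs) = F (us @ (i, a) # vs) \<oplus>\<^bsub>M\<^esub> F (us @ (i, b) # vs)"
  "us @ (i, a) # vs \<in> hw A r p ==> c \<in> carrier K ==>
   F (us @ (i, c \<odot>\<^bsub>A i\<^esub> a) # vs) = c \<odot>\<^bsub>M\<^esub> F (us @ (i, a) # vs)"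
 using assms unfolding multilinear_def by blast+

context
 fixes K :: "'k ring" and A :: "('k, 'a) graded_module"
 assumes A: "graded K A"
begin

lemma hw_add: "us @ (i, a) # vs \<in> hw A r p ==> b \<in> carrier (A i) ==>
  us @ (i, b) # vs \<in> hw A r p \<and> us @ (i, a \<oplus>\<^bsub>A i\<^esub> b) # vs \<in> hw A r p"
proof -
 assume *: "us @ (i, a) # vs \<in> hw A r p" "b \<in> carrier (A i)"
 interpret M: module K "A i" using A by (rule gradedD)
 show ?thesis using * by (auto simp: hw_iff)
qed

lemma hw_smult: "us @ (i, a) # vs \<in> hw A r p ==> c \<in> carrier K ==>
  us @ (i, c \<odot>\<^bsub>A i\<^esub> a) # vs \<in> hw A r p"
proof -
 assume *: "us @ (i, a) # vs \<in> hw A r p" "c \<in> carrier K"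
 interpret M: module K "A i" using A by (rule gradedD)
 show ?thesis using * by (auto simp: hw_iff)
qed

lemma free_hw_module: "module K (free_module K (hw A r p))"
 by (rule free_module_module[OF gradedD(2)[OF A]])

lemma tensor_relations_closed: "tensor_relations K A r p \<subseteq> carrier (free_module K (hw A r p))"
proof -
 interpret F: module K "free_module K (hw A r p)" by (rule free_hw_module)
 note bc = basis_vector_closed[OF gradedD(2)[OF A]]
 show ?thesis
  unfolding tensor_relations_def Let_def
  by (auto intro!: F.minus_closed F.a_closed F.smult_closed bc simp: hw_add hw_smult)
qed

lemma tensor_null_submodule: "submodule (tensor_null K A r p) K (free_module K (hw A r p))"
 unfolding tensor_null_def by (rule module_span_submodule[OF free_hw_module tensor_relations_closed])

lemma tensor_module: "module K (tensor_power K A r p)"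
 unfolding tensor_power_def by (rule quotient_module_module[OF free_hw_module tensor_null_submodule])

text \<open>The kernel of the lift is a submodule that contains the relations, hence contains their
  span.\<close>

lemma free_lift_null:
 assumes M: "module K M" and F: "multilinear K A r p M F" and u: "u \<in> tensor_null K A r p"
 shows "free_lift K M F u = \<zero>\<^bsub>M\<^esub>"
proof -
 interpret M: module K M by fact
 let ?F = "free_module K (hw A r p)"
 interpret F: module K ?F by (rule free_hw_module)
 note bc = basis_vector_closed[OF gradedD(2)[OF A]]
 note FD = multilinearD[OF F]
 have FP: "F \<in> hw A r p \<rightarrow> carrier M" using FD(1) by blast
 note lin = free_lift_linear[OF M FP]
 note L = linearD[OF lin] linear_neg[OF lin F.module_axioms M]
 have LB: "free_lift K M F (basis_vector K w) = F w" if "w \<in> hw A r p" for w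
  by (rule free_lift_basis[where F = F, OF M FD(1)[OF that]])
 have "tensor_null K A r p \<subseteq> {u \<in> carrier ?F. free_lift K M F u = \<zero>\<^bsub>M\<^esub>}"
  unfolding tensor_null_def
 proof (rule module_span_least[OF linear_kernel_submodule[OF lin F.module_axioms M]], rule subsetI)
  fix t assume t: "t \<in> tensor_relations K A r p"
  then have tc: "t \<in> carrier ?F" using tensor_relations_closed by blast
  from t have "free_lift K M F t = \<zero>\<^bsub>M\<^esub>"
   unfolding tensor_relations_def Let_def
  proof (elim UnE CollectE exE conjE)
   fix us i a b vs
   assume *: "t = basis_vector K (us @ (i, a \<oplus>\<^bsub>A i\<^esub> b) # vs) \<ominus>\<^bsub>?F\<^esub>
    (basis_vector K (us @ (i, a) # vs) \<oplus>\<^bsub>?F\<^esub> basis_vector K (us @ (i, b) # vs))"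
    "us @ (i, a) # vs \<in> hw A r p" "b \<in> carrier (A i)"
   note hws = hw_add[OF *(2,3)]
   show ?thesis
    unfolding *(1) a_minus_def using hws *(2) FD(2)[OF *(2,3)]
    by (simp add: L LB bc FD(1) M.r_neg)
  next
   fix us i c a vs
   assume *: "t = basis_vector K (us @ (i, c \<odot>\<^bsub>A i\<^esub> a) # vs) \<ominus>\<^bsub>?F\<^esub> c \<odot>\<^bsub>?F\<^esub> basis_vector K (us @ (i, a) # vs)"
    "us @ (i, a) # vs \<in> hw A r p" "c \<in> carrier K"
   show ?thesis
    unfolding *(1) a_minus_def using hw_smult[OF *(2,3)] * FD(3)[OF *(2,3)]
    by (simp add: L LB bc FD(1) M.r_neg)
  qed
  with tc show "t \<in> {u \<in> carrier ?F. free_lift K M F u = \<zero>\<^bsub>M\<^esub>}" by blast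
 qed
 then show ?thesis using u by blast
qed

text \<open>Two representatives differ by an element of the span of the relations, so the one picked
  by \<open>SOME\<close> may be replaced by any other.\<close>

lemma tensor_lift_coset:
 assumes M: "module K M" and F: "multilinear K A r p M F" and u: "u \<in> carrier (free_module K (hw A r p))"
 shows "tensor_lift K M F (tensor_null K A r p +>\<^bsub>free_module K (hw A r p)\<^esub> u) = free_lift K M F u"
proof -
 let ?F = "free_module K (hw A r p)" and ?N = "tensor_null K A r p"
 interpret M: module K M by fact
 interpret F: module K ?F by (rule free_hw_module)
 interpret N: abelian_subgroup ?N ?F
  by (rule submodule_abelian_subgroup[OF free_hw_module tensor_null_submodule])
 have FP: "F \<in> hw A r p \<rightarrow> carrier M" using multilinearD(1)[OF F] by blast
 note lin = free_lift_linear[OF M FP]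
 define v where "v = (SOME v. v \<in> ?N +>\<^bsub>?F\<^esub> u)"
 have v: "v \<in> ?N +>\<^bsub>?F\<^esub> u" unfolding v_def some_in_eq using N.a_rcos_self[OF u] by blast
 then have vc: "v \<in> carrier ?F" by (rule N.a_elemrcos_carrier[OF u])
 have "free_lift K M F (v \<oplus>\<^bsub>?F\<^esub> \<ominus>\<^bsub>?F\<^esub> u) = \<zero>\<^bsub>M\<^esub>"
  by (rule free_lift_null[OF M F N.a_rcos_module_imp[OF u v]])
 then have "free_lift K M F v \<oplus>\<^bsub>M\<^esub> \<ominus>\<^bsub>M\<^esub> free_lift K M F u = \<zero>\<^bsub>M\<^esub>"
  using u vc by (simp add: linearD[OF lin] linear_neg[OF lin F.module_axioms M])
 then have "free_lift K M F v = free_lift K M F u"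
  using linearD(1)[OF lin] u vc M.diff_zero_iff by blast
 then show ?thesis unfolding tensor_lift_def Let_def v_def free_lift_def .
qed

lemma tensor_power_carrier:
 "x \<in> carrier (tensor_power K A r p) \<longleftrightarrow>
  (\<exists>u\<in>carrier (free_module K (hw A r p)). x = tensor_null K A r p +>\<^bsub>free_module K (hw A r p)\<^esub> u)"
 unfolding tensor_power_def by (rule quotient_carrier[OF free_hw_module tensor_null_submodule])

lemma tensor_lift_linear:
 assumes M: "module K M" and F: "multilinear K A r p M F"
 shows "tensor_lift K M F \<in> linear_maps K (tensor_power K A r p) M"
proof -
 let ?F = "free_module K (hw A r p)" and ?N = "tensor_null K A r p"
 interpret F: module K ?F by (rule free_hw_module)
 have FP: "F \<in> hw A r p \<rightarrow> carrier M" using multilinearD(1)[OF F] by blast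
 note lin = linearD[OF free_lift_linear[OF M FP]]
 note TL = tensor_lift_coset[OF M F]
 note Q = quotient_add[OF free_hw_module tensor_null_submodule, folded tensor_power_def]
  quotient_smult[OF free_hw_module tensor_null_submodule, folded tensor_power_def]
 show ?thesis
  by (rule linearI) (auto simp: tensor_power_carrier TL lin Q)
qed

lemma pure_tensor_eq:
 "w \<in> hw A r p ==> pure_tensor K A w = tensor_null K A r p +>\<^bsub>free_module K (hw A r p)\<^esub> basis_vector K w"
 by (auto simp: pure_tensor_def hw_iff)

lemma pure_closed: "w \<in> hw A r p ==> pure_tensor K A w \<in> carrier (tensor_power K A r p)"
 unfolding tensor_power_carrier
 by (rule bexI[of _ "basis_vector K w"]) (rule pure_tensor_eq basis_vector_closed[OF gradedD(2)[OF A]], assumption)+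

lemma tensor_lift_pure:
 assumes M: "module K M" and F: "multilinear K A r p M F" and w: "w \<in> hw A r p"
 shows "tensor_lift K M F (pure_tensor K A w) = F w"
 unfolding pure_tensor_eq[OF w]
 by (subst tensor_lift_coset[OF M F basis_vector_closed[OF gradedD(2)[OF A] w]])
  (rule free_lift_basis[where F = F, OF M multilinearD(1)[OF F w]])

lemma pure_tensor_multilinear: "multilinear K A r p (tensor_power K A r p) (pure_tensor K A)"
proof (rule multilinearI)
 let ?F = "free_module K (hw A r p)" and ?N = "tensor_null K A r p"
 interpret F: module K ?F by (rule free_hw_module)
 note bc = basis_vector_closed[OF gradedD(2)[OF A]]
 have rel: "tensor_relations K A r p \<subseteq> ?N"
  unfolding tensor_null_def by (rule module_span_superset)
 {
  fix us i a b vs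
  assume *: "us @ (i, a) # vs \<in> hw A r p" "b \<in> carrier (A i)"
  note hws = hw_add[OF *]
  have "basis_vector K (us @ (i, a \<oplus>\<^bsub>A i\<^esub> b) # vs) \<ominus>\<^bsub>?F\<^esub>
    (basis_vector K (us @ (i, a) # vs) \<oplus>\<^bsub>?F\<^esub> basis_vector K (us @ (i, b) # vs)) \<in> ?N"
   by (rule subsetD[OF rel]) (use * in \<open>auto simp: tensor_relations_def Let_def\<close>)
  then show "pure_tensor K A (us @ (i, a \<oplus>\<^bsub>A i\<^esub> b) # vs) =
   pure_tensor K A (us @ (i, a) # vs) \<oplus>\<^bsub>tensor_power K A r p\<^esub> pure_tensor K A (us @ (i, b) # vs)"
   using hws *(1)
   by (simp add: pure_tensor_eq[where r = r and p = p] quotient_add[OF free_hw_module tensor_null_submodule, folded tensor_power_def]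
    quotient_eq_iff[OF free_hw_module tensor_null_submodule] bc)
 next
  fix us i a c vs
  assume *: "us @ (i, a) # vs \<in> hw A r p" "c \<in> carrier K"
  note hws = hw_smult[OF *]
  have "basis_vector K (us @ (i, c \<odot>\<^bsub>A i\<^esub> a) # vs) \<ominus>\<^bsub>?F\<^esub> c \<odot>\<^bsub>?F\<^esub> basis_vector K (us @ (i, a) # vs) \<in> ?N"
   by (rule subsetD[OF rel]) (use * in \<open>auto simp: tensor_relations_def Let_def\<close>)
  then show "pure_tensor K A (us @ (i, c \<odot>\<^bsub>A i\<^esub> a) # vs) =
   c \<odot>\<^bsub>tensor_power K A r p\<^esub> pure_tensor K A (us @ (i, a) # vs)"
   using hws *
   by (simp add: pure_tensor_eq[where r = r and p = p] quotient_smult[OF free_hw_module tensor_null_submodule, folded tensor_power_def]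
    quotient_eq_iff[OF free_hw_module tensor_null_submodule] bc)
 }
qed (rule pure_closed)

lemma tensor_power_induct [consumes 1, case_names pure zero add smult]:
 assumes x: "x \<in> carrier (tensor_power K A r p)"
  and pure: "!!w. w \<in> hw A r p ==> P (pure_tensor K A w)"
  and zero: "P \<zero>\<^bsub>tensor_power K A r p\<^esub>"
  and add: "!!x y. x \<in> carrier (tensor_power K A r p) ==> y \<in> carrier (tensor_power K A r p) ==> P x ==> P y ==>
   P (x \<oplus>\<^bsub>tensor_power K A r p\<^esub> y)"
  and smult: "!!c x. c \<in> carrier K ==> x \<in> carrier (tensor_power K A r p) ==> P x ==> P (c \<odot>\<^bsub>tensor_power K A r p\<^esub> x)"
 shows "P x"
proof -
 let ?F = "free_module K (hw A r p)" and ?N = "tensor_null K A r p" and ?T = "tensor_power K A r p"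
 interpret F: module K ?F by (rule free_hw_module)
 interpret T: module K ?T by (rule tensor_module)
 note bc = basis_vector_closed[OF gradedD(2)[OF A]]
 obtain u where u: "u \<in> carrier ?F" "x = ?N +>\<^bsub>?F\<^esub> u" using x by (auto simp: tensor_power_carrier)
 have supp: "finite {s. u s ~= \<zero>\<^bsub>K\<^esub>}" "{s. u s ~= \<zero>\<^bsub>K\<^esub>} \<subseteq> hw A r p" and val: "!!s. u s \<in> carrier K"
  using u by (auto simp: free_module_def)
 have hwu: "!!s. u s ~= \<zero>\<^bsub>K\<^esub> ==> s \<in> hw A r p" using supp(2) by blast
 note ql = quotient_proj_linear[OF free_hw_module tensor_null_submodule, of r p, folded tensor_power_def]
 have "x = (\<Oplus>\<^bsub>?T\<^esub>s\<in>{s. u s ~= \<zero>\<^bsub>K\<^esub>}. ?N +>\<^bsub>?F\<^esub> (u s \<odot>\<^bsub>?F\<^esub> basis_vector K s))"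
  unfolding u(2)
  by (subst free_module_expand[OF gradedD(2)[OF A] u(1)], unfold free_lift_def,
    rule linear_finsum[OF ql free_hw_module tensor_module])
   (rule F.smult_closed[OF val bc], rule hwu, simp)
 also have "... = (\<Oplus>\<^bsub>?T\<^esub>s\<in>{s. u s ~= \<zero>\<^bsub>K\<^esub>}. u s \<odot>\<^bsub>?T\<^esub> pure_tensor K A s)"
 proof (rule T.finsum_cong'[OF refl])
  fix s assume "s \<in> {s. u s ~= \<zero>\<^bsub>K\<^esub>}"
  then have s: "s \<in> hw A r p" using supp by blast
  show "?N +>\<^bsub>?F\<^esub> (u s \<odot>\<^bsub>?F\<^esub> basis_vector K s) = u s \<odot>\<^bsub>?T\<^esub> pure_tensor K A s"
   unfolding pure_tensor_eq[OF s] by (rule linearD(3)[OF ql val bc[OF s]])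
 qed (rule Pi_I, rule T.smult_closed[OF val pure_closed], rule hwu, simp)
 finally have x_eq: "x = (\<Oplus>\<^bsub>?T\<^esub>s\<in>{s. u s ~= \<zero>\<^bsub>K\<^esub>}. u s \<odot>\<^bsub>?T\<^esub> pure_tensor K A s)" .
 have "P (\<Oplus>\<^bsub>?T\<^esub>s\<in>S. u s \<odot>\<^bsub>?T\<^esub> pure_tensor K A s)" if "finite S" "S \<subseteq> hw A r p" for S
  using that
 proof (induction S)
  case (insert s S)
  have "(%s. u s \<odot>\<^bsub>?T\<^esub> pure_tensor K A s) \<in> S \<rightarrow> carrier ?T" "u s \<odot>\<^bsub>?T\<^esub> pure_tensor K A s \<in> carrier ?T"
   using insert.prems by (auto intro!: T.smult_closed val pure_closed)
  with insert show ?case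
   by (simp add: T.finsum_insert) (auto intro!: add smult pure T.finsum_closed val pure_closed)
 qed (simp add: zero)
 then show ?thesis unfolding x_eq using supp by blast
qed

lemma tensor_linear_eqI:
 assumes M: "module K M" and fg: "f \<in> linear_maps K (tensor_power K A r p) M" "g \<in> linear_maps K (tensor_power K A r p) M"
  and eq: "!!w. w \<in> hw A r p ==> f (pure_tensor K A w) = g (pure_tensor K A w)"
  and x: "x \<in> carrier (tensor_power K A r p)"
 shows "f x = g x"
 using x
 by (induction rule: tensor_power_induct)
  (simp_all add: eq linearD[OF fg(1)] linearD[OF fg(2)]
   linear_zero[OF fg(1) tensor_module M] linear_zero[OF fg(2) tensor_module M])

end

text \<open>The target is a module with an explicit carrier, whereas \<open>frag_extend\<close>
  takes values in chains. The universal property of the free abelian group provides the additive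
  extension.\<close>

definition gext :: "('k, 'b) module => ('l list => 'b) => 'l chain => 'b" where
 "gext M f = (SOME h. h \<in> hom (free_Abelian_group UNIV) (add_monoid M) \<and> (\<forall>w. h (wd w) = f w))"

context
 fixes K :: "'k ring" and M :: "('k, 'b) module" and f :: "'l list => 'b"
 assumes M: "module K M" and f: "!!w. f w \<in> carrier M"
begin

interpretation M: module K M by (rule M)

lemma gext_hom: "gext M f \<in> hom (free_Abelian_group UNIV) (add_monoid M)"
 and gext_wd: "gext M f (wd w) = f w"
proof -
 have "f ` UNIV \<subseteq> carrier (add_monoid M)" using f by auto
 from comm_group.free_Abelian_group_universal[OF M.a_comm_group this]
 obtain h where "h \<in> hom (free_Abelian_group UNIV) (add_monoid M)" "!!x. h (frag_of x) = f x" by auto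
 then have "\<exists>h. h \<in> hom (free_Abelian_group UNIV) (add_monoid M) \<and> (\<forall>w. h (wd w) = f w)"
  by (auto simp: wd_def)
 from someI_ex[OF this] show "gext M f \<in> hom (free_Abelian_group UNIV) (add_monoid M)" "gext M f (wd w) = f w"
  unfolding gext_def by blast+
qed

lemma gext_closed: "gext M f c \<in> carrier M"
 using hom_in_carrier[OF gext_hom, of c] by simp

lemma gext_add: "gext M f (c + d) = gext M f c \<oplus>\<^bsub>M\<^esub> gext M f d"
 using hom_mult[OF gext_hom, of c d] by simp

lemma gext_zero: "gext M f 0 = \<zero>\<^bsub>M\<^esub>"
 using gext_add[of 0 0] gext_closed[of 0] by simp

lemma gext_minus: "gext M f (- c) = \<ominus>\<^bsub>M\<^esub> gext M f c"
 using gext_add[of "- c" c] gext_closed[of c] gext_closed[of "- c"] gext_zero M.minus_equality[of "gext M f (- c)" "gext M f c"]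
 by simp

lemma gext_diff: "gext M f (c - d) = gext M f c \<ominus>\<^bsub>M\<^esub> gext M f d"
 using gext_add[of c "- d"] by (simp add: gext_minus a_minus_def)

lemma gext_ks: "gext M f (ks n c) = signed M n (gext M f c)"
 by (simp add: ks_def signed_def gext_minus)

lemma gext_sum: "gext M f (sum g S) = (\<Oplus>\<^bsub>M\<^esub>i\<in>S. gext M f (g i))"
 by (induction S rule: infinite_finite_induct) (simp_all add: gext_zero gext_add M.finsum_insert gext_closed)

lemma gext_eq_0:
 assumes "!!w. w \<in> wkeys c ==> f w = \<zero>\<^bsub>M\<^esub>"
 shows "gext M f c = \<zero>\<^bsub>M\<^esub>"
proof -
 have "wkeys c \<subseteq> {w. f w = \<zero>\<^bsub>M\<^esub>}" using assms by auto
 then show ?thesis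
  by (induction c rule: frag_induction)
   (auto simp: gext_zero gext_diff a_minus_def gext_wd[unfolded wd_def])
qed

end

section \<open>Evaluation of chains in tensor powers\<close>

text \<open>
  \<open>par\<close> is the degree in the suspension.  \<open>sgx\<close> and \<open>thx\<close> are the exponents of the suspension
  isomorphism, which differ by a function of length and degree.
\<close>

primrec sgx :: "'a hword => nat" where
 "sgx [] = 0"
| "sgx (l # w) = sgx w + word_degree w"

primrec thx :: "'a hword => nat" where
 "thx [] = 0"
| "thx (l # w) = length w * (fst l + 1) + thx w"

definition par :: "nat \<times> 'a => nat" where "par l = fst l + 1"

lemma pw_par [simp]: "pw par w = word_degree w + length w"
 by (induction w) (auto simp: par_def)

lemma sgx_append: "sgx (u @ v) = sgx u + sgx v + length u * word_degree v"
 by (induction u) auto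

lemma thx_append: "thx (u @ v) = thx u + thx v + length v * (word_degree u + length u)"
 by (induction u) (auto simp: algebra_simps)

text \<open>\<open>sgx\<close> governs evaluation and \<open>thx\<close> the structure maps, so this
  parity is used when the two meet. The triangular number matches the constant part of the sums
  \<open>i_1 + ... + i_k\<close> that sign the faces.\<close>

lemma thx_sgx: "even (thx w + sgx w + word_degree w + length w * word_degree w + (\<Sum>i<length w. i))"
 by (induction w) (auto simp: algebra_simps)

text \<open>The value 0 on words of another length or degree lets \<open>ev\<close> read off one
  homogeneous component of a chain, so that a chain of mixed length can stand for an element of a
  direct sum.\<close>

definition evw :: "'k ring => ('k, 'a) graded_module => nat => nat => 'a hword => ('k, 'a) tensor" where
 "evw K A r p w = (if w \<in> hw A r p then signed (tensor_power K A r p) (sgx w) (pure_tensor K A w)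
   else \<zero>\<^bsub>tensor_power K A r p\<^esub>)"

definition ev :: "'k ring => ('k, 'a) graded_module => nat => nat => (nat \<times> 'a) chain => ('k, 'a) tensor" where
 "ev K A r p = gext (tensor_power K A r p) (evw K A r p)"

text \<open>The test in all contexts \<open>u\<close>, \<open>v\<close> and in all components makes
  this a two-sided ideal.\<close>

definition Null :: "'k ring => ('k, 'a) graded_module => ((nat \<times> 'a) chain) set" where
 "Null K A = {c. \<forall>u v r p. ev K A r p (wd u * c * wd v) = \<zero>\<^bsub>tensor_power K A r p\<^esub>}"

context
 fixes K :: "'k ring" and A :: "('k, 'a) graded_module"
 assumes A: "graded K A"
begin

lemma evw_closed: "evw K A r p w \<in> carrier (tensor_power K A r p)"
proof -
 interpret T: module K "tensor_power K A r p" by (rule tensor_module[OF A])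
 show ?thesis
  by (simp add: evw_def signed_closed[OF tensor_module[OF A]] pure_closed[OF A])
qed

lemma ev_closed: "ev K A r p c \<in> carrier (tensor_power K A r p)"
 unfolding ev_def by (rule gext_closed[OF tensor_module[OF A] evw_closed])

lemma ev_wd: "ev K A r p (wd w) = evw K A r p w"
 unfolding ev_def by (rule gext_wd[OF tensor_module[OF A] evw_closed])

lemma ev_add: "ev K A r p (c + d) = ev K A r p c \<oplus>\<^bsub>tensor_power K A r p\<^esub> ev K A r p d"
 unfolding ev_def by (rule gext_add[OF tensor_module[OF A] evw_closed])

lemma ev_zero: "ev K A r p 0 = \<zero>\<^bsub>tensor_power K A r p\<^esub>"
 unfolding ev_def by (rule gext_zero[OF tensor_module[OF A] evw_closed])

lemma ev_minus: "ev K A r p (- c) = \<ominus>\<^bsub>tensor_power K A r p\<^esub> ev K A r p c"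
 unfolding ev_def by (rule gext_minus[OF tensor_module[OF A] evw_closed])

lemma ev_diff: "ev K A r p (c - d) = ev K A r p c \<ominus>\<^bsub>tensor_power K A r p\<^esub> ev K A r p d"
 unfolding ev_def by (rule gext_diff[OF tensor_module[OF A] evw_closed])

lemma ev_ks: "ev K A r p (ks n c) = signed (tensor_power K A r p) n (ev K A r p c)"
 unfolding ev_def by (rule gext_ks[OF tensor_module[OF A] evw_closed])

lemma ev_sum: "ev K A r p (sum g S) = (\<Oplus>\<^bsub>tensor_power K A r p\<^esub>i\<in>S. ev K A r p (g i))"
 unfolding ev_def by (rule gext_sum[OF tensor_module[OF A] evw_closed])

lemma ev_eq_0:
 assumes "!!w. w \<in> wkeys c ==> w \<notin> hw A r p"
 shows "ev K A r p c = \<zero>\<^bsub>tensor_power K A r p\<^esub>"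
 unfolding ev_def
 by (rule gext_eq_0[OF tensor_module[OF A] evw_closed]) (simp add: evw_def assms)

lemma Null_ideal: "chain_ideal (Null K A)"
proof -
 have *: "\<zero>\<^bsub>tensor_power K A r p\<^esub> \<oplus>\<^bsub>tensor_power K A r p\<^esub> \<zero>\<^bsub>tensor_power K A r p\<^esub> = \<zero>\<^bsub>tensor_power K A r p\<^esub>"
  "\<ominus>\<^bsub>tensor_power K A r p\<^esub> \<zero>\<^bsub>tensor_power K A r p\<^esub> = \<zero>\<^bsub>tensor_power K A r p\<^esub>" for r p
 proof -
  interpret T: module K "tensor_power K A r p" by (rule tensor_module[OF A])
  show "\<zero>\<^bsub>tensor_power K A r p\<^esub> \<oplus>\<^bsub>tensor_power K A r p\<^esub> \<zero>\<^bsub>tensor_power K A r p\<^esub> = \<zero>\<^bsub>tensor_power K A r p\<^esub>"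
   "\<ominus>\<^bsub>tensor_power K A r p\<^esub> \<zero>\<^bsub>tensor_power K A r p\<^esub> = \<zero>\<^bsub>tensor_power K A r p\<^esub>" by simp_all
 qed
 have assoc: "wd u' * (wd u * a * wd v) * wd v' = wd (u' @ u) * a * wd (v @ v')" for u' u v v' :: "'a hword" and a
  by (simp add: wd_append mult.assoc)
 show ?thesis
  unfolding chain_ideal_def Null_def mem_Collect_eq
 proof (intro conjI ballI allI)
  fix a b u v r p
  assume ab: "a \<in> {c. \<forall>u v r p. ev K A r p (wd u * c * wd v) = \<zero>\<^bsub>tensor_power K A r p\<^esub>}"
   "b \<in> {c. \<forall>u v r p. ev K A r p (wd u * c * wd v) = \<zero>\<^bsub>tensor_power K A r p\<^esub>}"
  show "ev K A r p (wd u * (a + b) * wd v) = \<zero>\<^bsub>tensor_power K A r p\<^esub>"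
   using ab by (simp add: distrib_left distrib_right ev_add *)
  show "ev K A r p (wd u * (a - b) * wd v) = \<zero>\<^bsub>tensor_power K A r p\<^esub>"
   using ab by (simp add: left_diff_distrib right_diff_distrib ev_diff a_minus_def *)
 qed (auto simp: ev_zero assoc)
qed

lemma Null_ev: "c \<in> Null K A ==> ev K A r p c = \<zero>\<^bsub>tensor_power K A r p\<^esub>"
 unfolding Null_def using wd_Nil by (metis (mono_tags, lifting) mem_Collect_eq mult_1 mult.right_neutral)

lemma ev_cong_Null:
 assumes "c - d \<in> Null K A"
 shows "ev K A r p c = ev K A r p d"
proof -
 interpret T: module K "tensor_power K A r p" by (rule tensor_module[OF A])
 have "ev K A r p c \<ominus>\<^bsub>tensor_power K A r p\<^esub> ev K A r p d = \<zero>\<^bsub>tensor_power K A r p\<^esub>"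
  using Null_ev[OF assms, of r p] by (simp add: ev_diff)
 then show ?thesis
  unfolding a_minus_def using T.diff_zero_iff[OF ev_closed ev_closed] by simp
qed

text \<open>The source of the congruences \<open>letter_add\<close>, \<open>letter_zero\<close> and
  their companions, by which linear algebra inside a letter becomes arithmetic of chains.\<close>

lemma ev_letter_linear:
 "(%a. ev K A r p (wd u * wd [(q, a)] * wd v)) \<in> linear_maps K (A q) (tensor_power K A r p)"
proof (rule linearI)
 interpret M: module K "A q" by (rule gradedD(1)[OF A])
 interpret T: module K "tensor_power K A r p" by (rule tensor_module[OF A])
 let ?T = "tensor_power K A r p"
 note P = pure_tensor_multilinear[OF A, of r p]
 have ev: "ev K A r p (wd u * wd [(q, a)] * wd v) = evw K A r p (u @ (q, a) # v)" for a
  by (simp add: wd_append[symmetric] ev_wd)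
 have hw: "u @ (q, a) # v \<in> hw A r p \<longleftrightarrow> u @ (q, b) # v \<in> hw A r p" if "a \<in> carrier (A q)" "b \<in> carrier (A q)" for a b
  using that by (simp add: hw_iff)
 have sg: "sgx (u @ (q, a) # v) = sgx (u @ (q, b) # v)" for a b by (simp add: sgx_append)
 {
  fix a b assume ab: "a \<in> carrier (A q)" "b \<in> carrier (A q)"
  show "ev K A r p (wd u * wd [(q, a \<oplus>\<^bsub>A q\<^esub> b)] * wd v) =
   ev K A r p (wd u * wd [(q, a)] * wd v) \<oplus>\<^bsub>?T\<^esub> ev K A r p (wd u * wd [(q, b)] * wd v)"
  proof (cases "u @ (q, a) # v \<in> hw A r p")
   case True
   then have "u @ (q, b) # v \<in> hw A r p" "u @ (q, a \<oplus>\<^bsub>A q\<^esub> b) # v \<in> hw A r p"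
    using hw_add[OF A True ab(2)] by auto
   then show ?thesis
    using True unfolding ev evw_def sg[of "a \<oplus>\<^bsub>A q\<^esub> b" a] sg[of b a]
    by (simp add: multilinearD(2)[OF P True ab(2)] signed_add[OF tensor_module[OF A]] pure_closed[OF A])
  next
   case False
   then show ?thesis using hw[OF ab(2,1)] hw[OF M.a_closed[OF ab] ab(1)] by (simp add: ev evw_def)
  qed
 next
  fix c a assume ab: "c \<in> carrier K" "a \<in> carrier (A q)"
  show "ev K A r p (wd u * wd [(q, c \<odot>\<^bsub>A q\<^esub> a)] * wd v) = c \<odot>\<^bsub>?T\<^esub> ev K A r p (wd u * wd [(q, a)] * wd v)"
  proof (cases "u @ (q, a) # v \<in> hw A r p")
   case True
   then show ?thesis
    using hw_smult[OF A True ab(1)] ab unfolding ev evw_def sg[of "c \<odot>\<^bsub>A q\<^esub> a" a]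
    by (simp add: multilinearD(3)[OF P True ab(1)] signed_smult[OF tensor_module[OF A]] pure_closed[OF A])
  next
   case False
   then show ?thesis using hw[OF M.smult_closed[OF ab] ab(2)] ab(1) by (simp add: ev evw_def)
  qed
 }
qed (rule ev_closed)

end

section \<open>Multilinearity slot by slot, and tensor products of graded maps\<close>

lemma multilinear_slotI:
 assumes A: "graded K A" and closed: "!!w. w \<in> hw A r p ==> F w \<in> carrier M"
  and slot: "!!us i vs. length us + length vs + 1 = r ==> word_degree us + i + word_degree vs = p ==>
   valid A us ==> valid A vs ==>
   \<exists>\<beta> \<in> linear_maps K (A i) M. \<forall>a \<in> carrier (A i). F (us @ (i, a) # vs) = \<beta> a"
 shows "multilinear K A r p M F"
proof (rule multilinearI[OF closed])
 fix us i a b vs assume *: "us @ (i, a) # vs \<in> hw A r p" "b \<in> carrier (A i)"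
 then have a: "a \<in> carrier (A i)" by (simp add: hw_iff)
 interpret M: module K "A i" by (rule gradedD(1)[OF A])
 obtain \<beta> where \<beta>: "\<beta> \<in> linear_maps K (A i) M" "\<forall>a \<in> carrier (A i). F (us @ (i, a) # vs) = \<beta> a"
  using slot[of us vs i] * by (auto simp: hw_iff)
 show "F (us @ (i, a \<oplus>\<^bsub>A i\<^esub> b) # vs) = F (us @ (i, a) # vs) \<oplus>\<^bsub>M\<^esub> F (us @ (i, b) # vs)"
  using \<beta>(2) linearD(2)[OF \<beta>(1) a *(2)] a *(2) M.a_closed[OF a *(2)] by simp
next
 fix us i a c vs assume *: "us @ (i, a) # vs \<in> hw A r p" "c \<in> carrier K"
 then have a: "a \<in> carrier (A i)" by (simp add: hw_iff)
 interpret M: module K "A i" by (rule gradedD(1)[OF A])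
 obtain \<beta> where \<beta>: "\<beta> \<in> linear_maps K (A i) M" "\<forall>a \<in> carrier (A i). F (us @ (i, a) # vs) = \<beta> a"
  using slot[of us vs i] * by (auto simp: hw_iff)
 show "F (us @ (i, c \<odot>\<^bsub>A i\<^esub> a) # vs) = c \<odot>\<^bsub>M\<^esub> F (us @ (i, a) # vs)"
  using \<beta>(2) linearD(3)[OF \<beta>(1) *(2) a] a *(2) M.smult_closed[OF *(2) a] by simp
qed

lemma pure_slot_linear:
 assumes B: "graded K B" and "length us + length vs + 1 = r" "word_degree us + i + word_degree vs = p"
  "valid B us" "valid B vs"
 shows "(%b. pure_tensor K B (us @ (i, b) # vs)) \<in> linear_maps K (B i) (tensor_power K B r p)"
proof -
 have hw: "us @ (i, b) # vs \<in> hw B r p" if "b \<in> carrier (B i)" for b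
  using assms that by (simp add: hw_iff)
 note P = pure_tensor_multilinear[OF B, of r p]
 show ?thesis
  by (rule linearI) (simp_all add: pure_closed[OF B] hw multilinearD(2,3)[OF P])
qed

lemma signed_slot_linear:
 assumes B: "graded K B" and "length us + length vs + 1 = r" "word_degree us + i + word_degree vs = p"
  "valid B us" "valid B vs" and \<alpha>: "\<alpha> \<in> linear_maps K X (B i)"
 shows "(%a. signed (tensor_power K B r p) s (pure_tensor K B (us @ (i, \<alpha> a) # vs)))
  \<in> linear_maps K X (tensor_power K B r p)"
 by (rule linear_comp[OF linear_comp[OF \<alpha> pure_slot_linear[OF assms(1-5)]]
  signed_linear[OF tensor_module[OF B]]])

definition factors_arity :: "('k, 'a, 'b) factor list => nat" where
 "factors_arity Ph = sum_list (map fst Ph)"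

lemma factors_simps [simp]:
 "factors_arity [] = 0" "factors_arity (f # Ph) = fst f + factors_arity Ph"
 "factors_arity (Ph @ \<Psi>) = factors_arity Ph + factors_arity \<Psi>"
 "factors_degree [] = 0" "factors_degree (f # Ph) = fst (snd f) + factors_degree Ph"
 "factors_degree (Ph @ \<Psi>) = factors_degree Ph + factors_degree \<Psi>"
 by (simp_all add: factors_arity_def factors_degree_def case_prod_unfold)

definition factors_ok :: "'k ring => ('k, 'a) graded_module => ('k, 'b) graded_module => ('k, 'a, 'b) factor list => bool" where
 "factors_ok K A B Ph \<longleftrightarrow> (\<forall>(k, e, \<phi>) \<in> set Ph. \<phi> \<in> graded_maps K A B k e)"

lemma factors_ok_simps [simp]:
 "factors_ok K A B []" "factors_ok K A B ((k, e, \<phi>) # Ph) \<longleftrightarrow> \<phi> \<in> graded_maps K A B k e \<and> factors_ok K A B Ph"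
 "factors_ok K A B (Ph @ \<Psi>) \<longleftrightarrow> factors_ok K A B Ph \<and> factors_ok K A B \<Psi>"
 unfolding factors_ok_def by (simp, simp, simp add: ball_Un)

lemma graded_mapsD: "\<phi> \<in> graded_maps K A B k e ==> \<phi> p \<in> linear_maps K (tensor_power K A k p) (B (p + e))"
 by (auto simp: graded_maps_def)

lemma graded_pure_closed:
 assumes "graded K A" "\<phi> \<in> graded_maps K A B k e" "w \<in> hw A k p"
 shows "\<phi> p (pure_tensor K A w) \<in> carrier (B (p + e))"
 by (rule linearD(1)[OF graded_mapsD[OF assms(2)] pure_closed[OF assms(1,3)]])

lemma valid_take: "valid A w ==> valid A (take k w)" and valid_drop: "valid A w ==> valid A (drop k w)"
 by (auto simp: valid_def dest: in_set_takeD in_set_dropD)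

lemma word_degree_take_drop: "word_degree (take k w) + word_degree (drop k w) = word_degree w"
 by (metis append_take_drop_id word_degree_simps(3))

lemma factors_apply_hw:
 assumes A: "graded K A"
 shows "factors_ok K A B Ph ==> length w = factors_arity Ph ==> valid A w ==>
  factors_apply K A Ph w \<in> hw B (length Ph) (word_degree w + factors_degree Ph)"
proof (induction Ph arbitrary: w)
 case (Cons f Ph)
 obtain k e \<phi> where f: "f = (k, e, \<phi>)" by (cases f)
 have t: "take k w \<in> hw A k (word_degree (take k w))"
  using Cons.prems f by (simp add: hw_iff valid_take)
 have "factors_apply K A Ph (drop k w) \<in> hw B (length Ph) (word_degree (drop k w) + factors_degree Ph)"
  by (rule Cons.IH) (use Cons.prems f in \<open>simp_all add: valid_drop\<close>)
 moreover have "\<phi> (word_degree (take k w)) (pure_tensor K A (take k w)) \<in> carrier (B (word_degree (take k w) + e))"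
  by (rule graded_pure_closed[OF A _ t]) (use Cons.prems f in simp)
 ultimately show ?case
  using word_degree_take_drop[of k w] by (simp add: f hw_iff)
qed (simp add: hw_iff)

lemma koszul_exponent_cong: "map fst w = map fst w' ==> koszul_exponent Ph w = koszul_exponent Ph w'"
proof (induction Ph arbitrary: w w')
 case (Cons f Ph)
 obtain k e \<phi> where f: "f = (k, e, \<phi>)" by (cases f)
 have "map fst (drop k w) = map fst (drop k w')" using Cons.prems by (metis drop_map)
 from Cons.IH[OF this] have "koszul_exponent Ph (drop k w) = koszul_exponent Ph (drop k w')" .
 moreover have "word_degree (take k w) = word_degree (take k w')"
  using Cons.prems unfolding word_degree_def by (metis take_map)
 ultimately show ?case by (simp add: f)
qed simp

text \<open>The varied letter enters exactly one factor, so exactly one letter of the result varies,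
  and it does so linearly.\<close>

lemma factors_apply_slot:
 assumes A: "graded K A"
 shows "factors_ok K A B Ph ==> length us + length vs + 1 = factors_arity Ph ==> valid A us ==> valid A vs ==>
  \<exists>U j V \<alpha>. \<alpha> \<in> linear_maps K (A i) (B j) \<and>
   (\<forall>a \<in> carrier (A i). factors_apply K A Ph (us @ (i, a) # vs) = U @ (j, \<alpha> a) # V)"
proof (induction Ph arbitrary: us)
 case (Cons f Ph)
 obtain k e \<phi> where f: "f = (k, e, \<phi>)" by (cases f)
 have ok: "\<phi> \<in> graded_maps K A B k e" using Cons.prems f by simp
 show ?case
 proof (cases "length us < k")
  case True
  define vs1 where "vs1 = take (k - length us - 1) vs"
  define vs2 where "vs2 = drop (k - length us - 1) vs"
  have td: "take k (us @ (i, a) # vs) = us @ (i, a) # vs1" "drop k (us @ (i, a) # vs) = vs2" for a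
   using True by (simp_all add: vs1_def vs2_def take_Cons' drop_Cons')
  let ?q = "word_degree us + i + word_degree vs1"
  have "length us + length vs1 + 1 = k" "valid A vs1"
   using True Cons.prems f by (auto simp: vs1_def valid_take)
  then have "(%a. \<phi> ?q (pure_tensor K A (us @ (i, a) # vs1))) \<in> linear_maps K (A i) (B (?q + e))"
   using Cons.prems by (intro linear_comp[OF pure_slot_linear[OF A] graded_mapsD[OF ok]]) auto
  moreover have "factors_apply K A (f # Ph) (us @ (i, a) # vs) =
    [] @ (?q + e, \<phi> ?q (pure_tensor K A (us @ (i, a) # vs1))) # factors_apply K A Ph vs2" for a
   by (simp only: f factors_apply.simps td) (simp add: add.assoc)
  ultimately show ?thesis by blast
 next
  case False
  have "length (drop k us) + length vs + 1 = factors_arity Ph" using Cons.prems False f by simp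
  from Cons.IH[OF _ this valid_drop] obtain U j V \<alpha> where
   *: "\<alpha> \<in> linear_maps K (A i) (B j)"
   "!!a. a \<in> carrier (A i) ==> factors_apply K A Ph (drop k us @ (i, a) # vs) = U @ (j, \<alpha> a) # V"
   using Cons.prems f by fastforce
  have "factors_apply K A (f # Ph) (us @ (i, a) # vs) =
    ((word_degree (take k us) + e, \<phi> (word_degree (take k us)) (pure_tensor K A (take k us))) # U) @ (j, \<alpha> a) # V"
   if "a \<in> carrier (A i)" for a
   using False *(2)[OF that] by (simp add: f)
  with *(1) show ?thesis by blast
 qed
qed simp

text \<open>The common pattern of tensor products of maps and of the cyclic permutation: the varied
  letter reappears in one slot of the result, and the sign depends on degrees only.\<close>

lemma multilinear_factorwise:
 assumes A: "graded K A" and B: "graded K B"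
  and G: "!!w. w \<in> hw A r p ==> G w \<in> hw B r' p'"
  and s: "!!w w'. map fst w = map fst w' ==> s w = s w'"
  and slot: "!!us i vs. length us + length vs + 1 = r ==> word_degree us + i + word_degree vs = p ==>
   valid A us ==> valid A vs ==>
   \<exists>U j V \<alpha>. \<alpha> \<in> linear_maps K (A i) (B j) \<and> (\<forall>a \<in> carrier (A i). G (us @ (i, a) # vs) = U @ (j, \<alpha> a) # V)"
 shows "multilinear K A r p (tensor_power K B r' p')
  (%w. signed (tensor_power K B r' p') (s w) (pure_tensor K B (G w)))"
proof (rule multilinear_slotI[OF A])
 fix w assume "w \<in> hw A r p"
 then show "signed (tensor_power K B r' p') (s w) (pure_tensor K B (G w)) \<in> carrier (tensor_power K B r' p')"
  by (intro signed_closed[OF tensor_module[OF B]] pure_closed[OF B] G)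
next
 fix us i vs
 assume *: "length us + length vs + 1 = r" "word_degree us + i + word_degree vs = p" "valid A us" "valid A vs"
 obtain U j V \<alpha> where \<alpha>: "\<alpha> \<in> linear_maps K (A i) (B j)"
  "!!a. a \<in> carrier (A i) ==> G (us @ (i, a) # vs) = U @ (j, \<alpha> a) # V"
  using slot[OF *] by blast
 interpret M: module K "A i" by (rule gradedD(1)[OF A])
 \<comment> \<open>One admissible word suffices to read off length, degree and validity of the
   unvaried letters \<open>U\<close> and \<open>V\<close>; the zero vector supplies it.\<close>
 have "us @ (i, \<zero>\<^bsub>A i\<^esub>) # vs \<in> hw A r p" using * by (simp add: hw_iff)
 from G[OF this] have "U @ (j, \<alpha> \<zero>\<^bsub>A i\<^esub>) # V \<in> hw B r' p'" by (simp add: \<alpha>(2))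
 then have hw: "length U + length V + 1 = r'" "word_degree U + j + word_degree V = p'" "valid B U" "valid B V"
  by (simp_all add: hw_iff)
 show "\<exists>\<beta>\<in>linear_maps K (A i) (tensor_power K B r' p'). \<forall>a\<in>carrier (A i).
  signed (tensor_power K B r' p') (s (us @ (i, a) # vs)) (pure_tensor K B (G (us @ (i, a) # vs))) = \<beta> a"
  by (rule bexI[OF _ signed_slot_linear[OF B hw \<alpha>(1), of "s (us @ (i, \<zero>\<^bsub>A i\<^esub>) # vs)"]])
   (auto simp: \<alpha>(2) intro!: arg_cong2[where f = "signed _"] s)
qed

lemma tensor_map_multilinear:
 assumes "graded K A" "graded K B" "factors_ok K A B Ph"
 shows "multilinear K A (factors_arity Ph) p (tensor_power K B (length Ph) (p + factors_degree Ph))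
  (%xs. signed (tensor_power K B (length Ph) (p + factors_degree Ph)) (koszul_exponent Ph xs)
   (pure_tensor K B (factors_apply K A Ph xs)))"
proof (rule multilinear_factorwise[OF assms(1,2)])
 fix w assume "w \<in> hw A (factors_arity Ph) p"
 then show "factors_apply K A Ph w \<in> hw B (length Ph) (p + factors_degree Ph)"
  using factors_apply_hw[OF assms(1,3), of w] by (auto simp: hw_iff)
qed (use koszul_exponent_cong factors_apply_slot[OF assms(1,3)] in blast)+

lemma tensor_map_linear:
 assumes "graded K A" "graded K B" "factors_ok K A B Ph"
 shows "tensor_map K A B Ph p \<in> linear_maps K (tensor_power K A (factors_arity Ph) p)
  (tensor_power K B (length Ph) (p + factors_degree Ph))"
 unfolding tensor_map_def Let_def
 by (rule tensor_lift_linear[OF assms(1) tensor_module[OF assms(2)] tensor_map_multilinear[OF assms]])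

lemma tensor_map_pure:
 assumes "graded K A" "graded K B" "factors_ok K A B Ph" "w \<in> hw A (factors_arity Ph) p"
 shows "tensor_map K A B Ph p (pure_tensor K A w) =
  signed (tensor_power K B (length Ph) (p + factors_degree Ph)) (koszul_exponent Ph w)
   (pure_tensor K B (factors_apply K A Ph w))"
 unfolding tensor_map_def Let_def
 by (rule tensor_lift_pure[OF assms(1) tensor_module[OF assms(2)] tensor_map_multilinear[OF assms(1-3)] assms(4)])

lemma hw_1: "w \<in> hw A 1 p \<longleftrightarrow> (\<exists>a \<in> carrier (A p). w = [(p, a)])"
 by (auto simp: hw_iff length_Suc_conv)

lemma unary_id_multilinear:
 fixes A :: "('k, 'a) graded_module"
 assumes A: "graded K A"
 shows "multilinear K A 1 p (A p) (%xs. snd (hd xs))"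
proof (rule multilinear_slotI[OF A])
 fix us vs :: "'a hword" and i
 assume "length us + length vs + 1 = 1" "word_degree us + i + word_degree vs = p"
 then have "us = []" "vs = []" "i = p" by auto
 then show "\<exists>\<beta>\<in>linear_maps K (A i) (A p). \<forall>a\<in>carrier (A i). snd (hd (us @ (i, a) # vs)) = \<beta> a"
  by (auto intro!: bexI[of _ "%a. a"] id_linear)
qed (auto simp: hw_1[unfolded One_nat_def])

lemma unary_id_linear: "graded K A ==> unary_id K A \<in> graded_maps K A A 1 0"
 unfolding graded_maps_def unary_id_def
 by (auto intro!: tensor_lift_linear unary_id_multilinear[unfolded One_nat_def] gradedD)

lemma unary_id_pure: "graded K A ==> a \<in> carrier (A p) ==> unary_id K A p (pure_tensor K A [(p, a)]) = a"
 unfolding unary_id_def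
 by (subst tensor_lift_pure[OF _ _ unary_id_multilinear]) (auto simp: hw_iff gradedD)

lemma factors_replicate [simp]:
 "factors_arity (replicate n (k, e, \<phi>)) = n * k" "factors_degree (replicate n (k, e, \<phi>)) = n * e"
 "factors_ok K A B (replicate n (k, e, \<phi>)) \<longleftrightarrow> n = 0 \<or> \<phi> \<in> graded_maps K A B k e"
 by (induction n) auto

lemma factors_apply_unary:
 assumes A: "graded K A" and "valid A u"
 shows "factors_apply K A (replicate (length u) (1, 0, unary_id K A) @ Ph) (u @ w) = u @ factors_apply K A Ph w"
  "koszul_exponent (replicate (length u) (1, 0, unary_id K A) @ Ph) (u @ w) =
   factors_degree Ph * word_degree u + koszul_exponent Ph w"
 using assms(2) by (induction u) (auto simp: unary_id_pure[OF A] algebra_simps)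

lemma insert_factor_simps [simp]:
 "length (insert_factor K A i (k, e, \<phi>) j) = i + j + 1"
 "factors_arity (insert_factor K A i (k, e, \<phi>) j) = i + j + k"
 "factors_degree (insert_factor K A i (k, e, \<phi>) j) = e"
 by (simp_all add: insert_factor_def)

lemma insert_factor_ok: "graded K A ==> \<phi> \<in> graded_maps K A A k e ==> factors_ok K A A (insert_factor K A i (k, e, \<phi>) j)"
 by (simp add: insert_factor_def unary_id_linear[unfolded One_nat_def])

lemma insert_factor_apply:
 assumes A: "graded K A" and "valid A u" "valid A v"
 shows "factors_apply K A (insert_factor K A (length u) (length x, e, \<phi>) (length v)) (u @ x @ v) =
   u @ (word_degree x + e, \<phi> (word_degree x) (pure_tensor K A x)) # v"
  "koszul_exponent (insert_factor K A (length u) (length x, e, \<phi>) (length v)) (u @ x @ v) = e * word_degree u"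
 using factors_apply_unary[OF A assms(3), of "[]" "[]"]
 by (simp_all add: insert_factor_def factors_apply_unary[OF A assms(2), unfolded One_nat_def])

lemma tensor_map_insert:
 assumes A: "graded K A" and \<phi>: "\<phi> \<in> graded_maps K A A (length x) e" and "valid A u" "valid A v" "valid A x"
  and p: "word_degree (u @ x @ v) = p" and r: "r = length u + length v + 1"
 shows "tensor_map K A A (insert_factor K A (length u) (length x, e, \<phi>) (length v)) p (pure_tensor K A (u @ x @ v)) =
  signed (tensor_power K A r (p + e)) (e * word_degree u)
   (pure_tensor K A (u @ (word_degree x + e, \<phi> (word_degree x) (pure_tensor K A x)) # v))"
proof -
 let ?Ph = "insert_factor K A (length u) (length x, e, \<phi>) (length v)"
 have "u @ x @ v \<in> hw A (factors_arity ?Ph) p"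
  using assms by (simp add: hw_iff)
 from tensor_map_pure[OF A A insert_factor_ok[OF A \<phi>] this] show ?thesis
  by (simp only: insert_factor_apply[OF A assms(3,4)] insert_factor_simps r)
qed

text \<open>In degree 0 the truncated difference would give a letter of degree 0 again, which has
  the wrong parity; the value 0 represents the map to the zero module in degree -1.\<close>

definition dletter :: "(nat => 'a => 'a) => nat \<times> 'a => (nat \<times> 'a) chain" where
 "dletter d l = (if fst l = 0 then 0 else wd [(fst l - 1, d (fst l) (snd l))])"

definition hch :: "('k, 'a) graded_module => nat => nat => (nat \<times> 'a) chain => bool" where
 "hch A r p c \<longleftrightarrow> wkeys c \<subseteq> hw A r p"

lemma hch_simps [simp]: "hch A r p 0" "hch A r p (wd w) \<longleftrightarrow> w \<in> hw A r p" "hch A r p (ks n c) \<longleftrightarrow> hch A r p c"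
 by (simp_all add: hch_def)

lemma hch_induct [consumes 1, case_names zero wd diff]:
 assumes "hch A r p c" "P 0" "!!w. w \<in> hw A r p ==> P (wd w)"
  "!!a b. P a ==> P b ==> P (a - b)"
 shows "P c"
 using assms(1) unfolding hch_def
 by (induction c rule: frag_induction) (use assms(2-4) in \<open>auto simp: wd_def\<close>)

lemma hch_ext:
 assumes "hch A r p c" "!!w. w \<in> hw A r p ==> hch B r' p' (f w)"
 shows "hch B r' p' (ext f c)"
proof -
 have "wkeys (ext f c) \<subseteq> (\<Union>x\<in>wkeys c. wkeys (f x))"
  by (rule keys_frag_extend)
 with assms show ?thesis unfolding hch_def by blast
qed

text \<open>The passage from words to tensors. Multilinearity is carried by the linear map
  \<open>F\<close>; the function \<open>f\<close> only has to give its values on evaluated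
  words.\<close>

lemma operator_ev:
 assumes A: "graded K A" and B: "graded K B"
  and lin: "F \<in> linear_maps K (tensor_power K A r p) (tensor_power K B r' p')"
  and word: "!!w. w \<in> hw A r p ==> F (evw K A r p w) = ev K B r' p' (f w)"
  and c: "hch A r p c"
 shows "F (ev K A r p c) = ev K B r' p' (ext f c)"
proof -
 note M = tensor_module[OF A, of r p] and N = tensor_module[OF B, of r' p']
 show ?thesis
  using c
 proof (induction rule: hch_induct)
  case zero
  then show ?case by (simp add: ev_zero[OF A] ev_zero[OF B] linear_zero[OF lin M N])
 next
  case (wd w)
  then show ?case by (simp add: ev_wd[OF A] word)
 next
  case (diff a b)
  interpret M: module K "tensor_power K A r p" by (rule M)
  have "F (ev K A r p (a - b)) = F (ev K A r p a) \<ominus>\<^bsub>tensor_power K B r' p'\<^esub> F (ev K A r p b)"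
   unfolding ev_diff[OF A] a_minus_def
   using linearD(2)[OF lin ev_closed[OF A] M.a_inv_closed[OF ev_closed[OF A]]]
    linear_neg[OF lin M N ev_closed[OF A]] by simp
  with diff show ?case by (simp add: ext_arith ev_diff[OF B])
 qed
qed

lemma letter_diff_sum_if:
 "letter_diff par (dletter d) w = (\<Sum>i<length w. if 0 < fst (w ! i) then
   ks (pw par (take i w)) (wd (w[i := (fst (w ! i) - 1, d (fst (w ! i)) (snd (w ! i)))])) else 0)"
proof (induction w)
 case (Cons l w)
 let ?f = "%w i. if 0 < fst (w ! i) then
   ks (pw par (take i w)) (wd (w[i := (fst (w ! i) - 1, d (fst (w ! i)) (snd (w ! i)))])) else 0"
 have cons: "wd [k] * wd t = wd (k # t)" for k :: "nat \<times> 'b" and t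
  by (simp add: wd_append[symmetric])
 have "(\<Sum>i<length (l # w). ?f (l # w) i) = ?f (l # w) 0 + (\<Sum>i<length w. ?f (l # w) (Suc i))"
  by (simp only: list.size add_Suc_right add_0_right sum.lessThan_Suc_shift)
 also have "?f (l # w) 0 = dletter d l * wd w"
  by (simp add: dletter_def cons)
 also have "(\<Sum>i<length w. ?f (l # w) (Suc i)) = ks (par l) (wd [l] * letter_diff par (dletter d) w)"
  unfolding Cons ks_sum sum_distrib_left
  by (intro sum.cong) (simp_all add: cons par_def add_ac)
 finally show ?case by simp
qed simp

lemma letter_diff_sum:
 "letter_diff par (dletter d) w = (\<Sum>i\<in>{i. i < length w \<and> 0 < fst (w ! i)}.
   ks (pw par (take i w)) (wd (w[i := (fst (w ! i) - 1, d (fst (w ! i)) (snd (w ! i)))])))"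
 unfolding letter_diff_sum_if by (rule sum.mono_neutral_cong_right) auto

lemma upd_split: "i < length w ==> w[i := l] = take i w @ l # drop (Suc i) w"
 by (rule upd_conv_take_nth_drop)

text \<open>In \<open>sgx\<close> the degree at position \<open>i\<close> is counted by the
  \<open>i\<close> letters to its left. This accounts for the summand \<open>i\<close> by which the
  suspended sign \<open>pw par (take i w)\<close> exceeds the Koszul sign.\<close>

lemma sgx_update:
 assumes "i < length w" "0 < fst (w ! i)"
 shows "sgx (w[i := (fst (w ! i) - 1, a)]) + i = sgx w"
  "word_degree (w[i := (fst (w ! i) - 1, a)]) + 1 = word_degree w"
proof -
 have w: "w = take i w @ w ! i # drop (Suc i) w" using assms by (simp add: id_take_nth_drop)
 have l: "length (take i w) = i" using assms by simp
 have "sgx w = sgx (take i w @ w ! i # drop (Suc i) w)" "word_degree w = word_degree (take i w @ w ! i # drop (Suc i) w)"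
  using w by simp_all
 moreover obtain f b where f: "w ! i = (Suc f, b)" using assms(2) by (cases "w ! i") (auto simp: gr0_conv_Suc)
 ultimately show "sgx (w[i := (fst (w ! i) - 1, a)]) + i = sgx w"
  "word_degree (w[i := (fst (w ! i) - 1, a)]) + 1 = word_degree w"
  unfolding upd_split[OF assms(1)] using l by (simp_all add: sgx_append add_ac distrib_left)
qed

context
 fixes K :: "'k ring" and A :: "('k, 'a) graded_module"
 assumes A: "graded K A"
begin

lemma evw_hw: "w \<in> hw A r p ==> evw K A r p w = signed (tensor_power K A r p) (sgx w) (pure_tensor K A w)"
 by (simp add: evw_def)

lemma evw_ks: "w \<in> hw A r p ==> even (n + sgx w) = even m ==>
  ev K A r p (ks n (wd w)) = signed (tensor_power K A r p) m (pure_tensor K A w)"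
 using signed_signed[OF tensor_module[OF A] pure_closed[OF A], of w r p n "sgx w"]
 by (simp add: ev_ks[OF A] ev_wd[OF A] evw_hw signed_def)

lemma ev_wd_pure: "w \<in> hw A r p ==> pure_tensor K A w = ev K A r p (ks (sgx w) (wd w))"
 using evw_ks[of w r p "sgx w" 0] by (simp add: signed_def)

context
 fixes d :: "nat => 'a => 'a"
 assumes d: "differential_module K A d"
begin

lemma d_linear: "d n \<in> linear_maps K (A n) (A (n - 1))"
 using d by (simp add: differential_module_def)

lemma d_update_hw:
 assumes "w \<in> hw A r p" "i < length w" "0 < fst (w ! i)"
 shows "w[i := (fst (w ! i) - 1, d (fst (w ! i)) (snd (w ! i)))] \<in> hw A r (p - 1)"
proof -
 have w: "w = take i w @ w ! i # drop (Suc i) w" using assms by (simp add: id_take_nth_drop)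
 have v: "valid A w" using assms by (simp add: hw_iff)
 then have "valid A (take i w)" "valid A (drop (Suc i) w)" "snd (w ! i) \<in> carrier (A (fst (w ! i)))"
  using w by (auto simp: valid_take valid_drop) (metis valid_simps(2,3))
 then have "valid A (w[i := (fst (w ! i) - 1, d (fst (w ! i)) (snd (w ! i)))])"
  unfolding upd_split[OF assms(2)] using linearD(1)[OF d_linear] by simp
 then show ?thesis
  using sgx_update(2)[OF assms(2,3), of "d (fst (w ! i)) (snd (w ! i))"] assms(1) by (simp add: hw_iff)
qed

lemma tensor_differential_multilinear:
 "multilinear K A r p (tensor_power K A r (p - 1)) (%xs. \<Oplus>\<^bsub>tensor_power K A r (p - 1)\<^esub>i\<in>{i. i < length xs \<and> 0 < fst (xs ! i)}.
    signed (tensor_power K A r (p - 1)) (word_degree (take i xs))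
     (pure_tensor K A (xs[i := (fst (xs ! i) - 1, d (fst (xs ! i)) (snd (xs ! i)))])))"
proof (rule multilinear_slotI[OF A])
 let ?T = "tensor_power K A r (p - 1)"
 note T = tensor_module[OF A, of r "p - 1"]
 interpret T: module K ?T by (rule T)
 let ?g = "%xs i. signed ?T (word_degree (take i xs))
     (pure_tensor K A (xs[i := (fst (xs ! i) - 1, d (fst (xs ! i)) (snd (xs ! i)))]))"
 {
  fix w assume w: "w \<in> hw A r p"
  then show "(\<Oplus>\<^bsub>?T\<^esub>i\<in>{i. i < length w \<and> 0 < fst (w ! i)}. ?g w i) \<in> carrier ?T"
   by (intro T.finsum_closed Pi_I signed_closed[OF T] pure_closed[OF A] d_update_hw[OF w]) simp_all
 next
  fix us i vs
  assume *: "length us + length vs + 1 = r" "word_degree us + i + word_degree vs = p" "valid A us" "valid A vs"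
  interpret Ai: module K "A i" by (rule gradedD(1)[OF A])
  let ?w = "%a. us @ (i, a) # vs"
  have hw: "?w a \<in> hw A r p" if "a \<in> carrier (A i)" for a using * that by (simp add: hw_iff)
  \<comment> \<open>The positions of positive degree are determined by the degrees of the letters
    and do not depend on the varied vector \<open>a\<close>.\<close>
  define S where "S = {k. k < r \<and> 0 < fst (?w \<zero>\<^bsub>A i\<^esub> ! k)}"
  have fst_eq: "fst (?w a ! k) = fst (?w b ! k)" if "k < r" for a b k
   using that * by (cases "k = length us") (auto simp: nth_append nth_Cons split: nat.splits)
  have S: "{k. k < length (?w a) \<and> 0 < fst (?w a ! k)} = S" for a
   unfolding S_def using *(1) fst_eq[of _ a "\<zero>\<^bsub>A i\<^esub>"] by auto
  have "\<exists>\<beta>\<in>linear_maps K (A i) ?T. \<forall>a\<in>carrier (A i). ?g (?w a) k = \<beta> a" if k: "k \<in> S" for k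
  proof -
   have kr: "k < r" "0 < fst (?w a ! k)" for a using k fst_eq[of k a "\<zero>\<^bsub>A i\<^esub>"] by (auto simp: S_def)
   have deg: "word_degree (take k (?w a)) = word_degree (take k (?w \<zero>\<^bsub>A i\<^esub>))" for a
    by (auto simp: take_append take_Cons' )
   have "\<exists>U j V \<alpha>. \<alpha> \<in> linear_maps K (A i) (A j) \<and>
    (\<forall>a\<in>carrier (A i). (?w a)[k := (fst (?w a ! k) - 1, d (fst (?w a ! k)) (snd (?w a ! k)))] = U @ (j, \<alpha> a) # V)"
   proof -
    \<comment> \<open>The differentiated position lies before, at or after the varied slot; only in
      the second case is the varied letter itself differentiated.\<close>
    consider "k < length us" | "k = length us" | m where "k = length us + Suc m"
     by (metis add_Suc_right less_imp_Suc_add linorder_neqE_nat)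
    then show ?thesis
    proof cases
     case 1
     then have "(?w a)[k := (fst (?w a ! k) - 1, d (fst (?w a ! k)) (snd (?w a ! k)))] =
      us[k := (fst (us ! k) - 1, d (fst (us ! k)) (snd (us ! k)))] @ (i, a) # vs" for a
      by (simp add: nth_append list_update_append)
     then show ?thesis using id_linear by blast
    next
     case 2
     then have "(?w a)[k := (fst (?w a ! k) - 1, d (fst (?w a ! k)) (snd (?w a ! k)))] = us @ (i - 1, d i a) # vs" for a
      by simp
     then show ?thesis using d_linear by blast
    next
     case 3
     then have "(?w a)[k := (fst (?w a ! k) - 1, d (fst (?w a ! k)) (snd (?w a ! k)))] =
      us @ (i, a) # vs[m := (fst (vs ! m) - 1, d (fst (vs ! m)) (snd (vs ! m)))]" for a
      by (simp add: nth_append list_update_append)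
     then show ?thesis using id_linear by blast
    qed
   qed
   then obtain U j V \<alpha> where \<alpha>: "\<alpha> \<in> linear_maps K (A i) (A j)"
    "!!a. a \<in> carrier (A i) ==> (?w a)[k := (fst (?w a ! k) - 1, d (fst (?w a ! k)) (snd (?w a ! k)))] = U @ (j, \<alpha> a) # V"
    by blast
   have "U @ (j, \<alpha> \<zero>\<^bsub>A i\<^esub>) # V \<in> hw A r (p - 1)"
    using d_update_hw[OF hw[OF Ai.zero_closed], of k] kr *(1) \<alpha>(2)[OF Ai.zero_closed] by simp
   then have h: "length U + length V + 1 = r" "word_degree U + j + word_degree V = p - 1" "valid A U" "valid A V"
    by (simp_all add: hw_iff)
   show ?thesis
   proof (rule bexI[OF _ signed_slot_linear[OF A h \<alpha>(1), of "word_degree (take k (?w \<zero>\<^bsub>A i\<^esub>))"]], intro ballI)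
    fix a assume "a \<in> carrier (A i)"
    then show "?g (?w a) k = signed ?T (word_degree (take k (?w \<zero>\<^bsub>A i\<^esub>))) (pure_tensor K A (U @ (j, \<alpha> a) # V))"
     by (simp only: \<alpha>(2) deg[of a])
   qed
  qed
  then obtain \<beta> where \<beta>: "!!k. k \<in> S ==> \<beta> k \<in> linear_maps K (A i) ?T"
   "!!k a. k \<in> S ==> a \<in> carrier (A i) ==> ?g (?w a) k = \<beta> k a" by metis
  show "\<exists>\<beta>\<in>linear_maps K (A i) ?T. \<forall>a\<in>carrier (A i).
   (\<Oplus>\<^bsub>?T\<^esub>k\<in>{k. k < length (?w a) \<and> 0 < fst (?w a ! k)}. ?g (?w a) k) = \<beta> a"
  proof (rule bexI[OF _ finsum_linear[OF Ai.module_axioms T \<beta>(1)]], intro ballI)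
   fix a assume a: "a \<in> carrier (A i)"
   show "(\<Oplus>\<^bsub>?T\<^esub>k\<in>{k. k < length (?w a) \<and> 0 < fst (?w a ! k)}. ?g (?w a) k) = (\<Oplus>\<^bsub>?T\<^esub>k\<in>S. \<beta> k a)"
    unfolding S
    by (rule T.finsum_cong'[OF refl]) (rule Pi_I, rule linearD(1)[OF \<beta>(1) a], assumption, rule \<beta>(2)[OF _ a])
  qed
 }
qed

lemma tensor_diff_linear:
 "tensor_differential K A d r p \<in> linear_maps K (tensor_power K A r p) (tensor_power K A r (p - 1))"
 unfolding tensor_differential_def Let_def
 by (rule tensor_lift_linear[OF A tensor_module[OF A] tensor_differential_multilinear])

lemma tensor_differential_evw:
 assumes w: "w \<in> hw A r p"
 shows "tensor_differential K A d r p (evw K A r p w) = ev K A r (p - 1) (letter_diff par (dletter d) w)"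
proof -
 let ?T = "tensor_power K A r (p - 1)"
 note T = tensor_module[OF A]
 interpret T: module K ?T by (rule T)
 let ?u = "%i. w[i := (fst (w ! i) - 1, d (fst (w ! i)) (snd (w ! i)))]"
 let ?S = "{i. i < length w \<and> 0 < fst (w ! i)}"
 have hw: "?u i \<in> hw A r (p - 1)" if "i \<in> ?S" for i using that d_update_hw[OF w] by blast
 have "tensor_differential K A d r p (pure_tensor K A w) =
  (\<Oplus>\<^bsub>?T\<^esub>i\<in>?S. signed ?T (word_degree (take i w)) (pure_tensor K A (?u i)))"
  unfolding tensor_differential_def Let_def
  by (rule tensor_lift_pure[OF A T tensor_differential_multilinear w])
 then have "tensor_differential K A d r p (evw K A r p w) =
  signed ?T (sgx w) (\<Oplus>\<^bsub>?T\<^esub>i\<in>?S. signed ?T (word_degree (take i w)) (pure_tensor K A (?u i)))"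
  unfolding evw_hw[OF w] by (simp add: linear_signed[OF tensor_diff_linear T T pure_closed[OF A w]])
 also have "... = (\<Oplus>\<^bsub>?T\<^esub>i\<in>?S. signed ?T (sgx w) (signed ?T (word_degree (take i w)) (pure_tensor K A (?u i))))"
  by (rule linear_finsum[OF signed_linear[OF T] T T])
   (intro signed_closed[OF T] pure_closed[OF A] hw)
 also have "... = (\<Oplus>\<^bsub>?T\<^esub>i\<in>?S. ev K A r (p - 1) (ks (pw par (take i w)) (wd (?u i))))"
 proof (rule T.finsum_cong'[OF refl])
  fix i assume i: "i \<in> ?S"
  have "sgx (?u i) + i = sgx w" "length (take i w) = i" using i sgx_update(1)[of i w] by auto
  then have "even (pw par (take i w) + sgx (?u i)) = even (sgx w + word_degree (take i w))"
   by simp presburger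
  from evw_ks[OF hw[OF i] this, symmetric]
  show "signed ?T (sgx w) (signed ?T (word_degree (take i w)) (pure_tensor K A (?u i))) =
   ev K A r (p - 1) (ks (pw par (take i w)) (wd (?u i)))"
   unfolding signed_signed[OF T pure_closed[OF A hw[OF i]]] .
 qed (auto intro: ev_closed[OF A])
 also have "... = ev K A r (p - 1) (letter_diff par (dletter d) w)"
  unfolding letter_diff_sum by (rule ev_sum[OF A, symmetric])
 finally show ?thesis .
qed

end

section \<open>Cyclic permutation and norm on words\<close>

lemma rot_hw: "w \<in> hw A r p ==> hch A r p (rot par w)"
proof (cases "w = []")
 case True
 then show "w \<in> hw A r p ==> hch A r p (rot par w)"
  using hch_simps(2)[of A r p "[]"] by (simp add: rot_def)
next
 case False
 then obtain y l where "w = y @ [l]" by (metis rev_exhaust)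
 then show "w \<in> hw A r p ==> hch A r p (rot par w)" by (auto simp: rot_snoc hw_iff)
qed

lemma cyc_t_multilinear:
 "multilinear K A (n + 1) p (cyc_X K A n p)
    (%xs. signed (cyc_X K A n p) (fst (last xs) * word_degree (butlast xs))
        (pure_tensor K A (last xs # butlast xs)))"
 unfolding cyc_X_def
proof (rule multilinear_factorwise[OF A A])
 fix w assume w: "w \<in> hw A (n + 1) p"
 then obtain y l where "w = y @ [l]" by (metis hw_iff add_is_0 list.size(3) one_neq_zero rev_exhaust)
 then show "last w # butlast w \<in> hw A (n + 1) p" using w by (auto simp: hw_iff)
next
 fix w w' :: "'a hword" assume eq: "map fst w = map fst w'"
 then have "fst (last w) = fst (last w') \<or> w = []"
  by (metis last_map map_is_Nil_conv)
 moreover have "map fst (butlast w) = map fst (butlast w')" using eq by (metis map_butlast)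
 ultimately show "fst (last w) * word_degree (butlast w) = fst (last w') * word_degree (butlast w')"
  using eq by (auto simp: word_degree_def)
next
 fix us :: "'a hword" and i vs
 show "\<exists>U j V \<alpha>. \<alpha> \<in> linear_maps K (A i) (A j) \<and>
  (\<forall>a\<in>carrier (A i). last (us @ (i, a) # vs) # butlast (us @ (i, a) # vs) = U @ (j, \<alpha> a) # V)"
 proof (cases "vs = []")
  case True
  then have "last (us @ (i, a) # vs) # butlast (us @ (i, a) # vs) = [] @ (i, a) # us" for a by simp
  then show ?thesis using id_linear by blast
 next
  case False
  then have "last (us @ (i, a) # vs) # butlast (us @ (i, a) # vs) = (last vs # us) @ (i, a) # butlast vs" for a
   by (simp add: butlast_append)
  then show ?thesis using id_linear by blast
 qed
qed

lemma cyc_t_linear: "cyc_t K A n p \<in> linear_maps K (cyc_X K A n p) (cyc_X K A n p)"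
 unfolding cyc_t_def cyc_X_def
 by (rule tensor_lift_linear[OF A tensor_module[OF A] cyc_t_multilinear[unfolded cyc_X_def]])

lemma cyc_T_linear: "cyc_T K A n p \<in> linear_maps K (cyc_X K A n p) (cyc_X K A n p)"
 unfolding cyc_T_def[abs_def]
 using linear_comp[OF cyc_t_linear signed_linear[of K "cyc_X K A n p"]] tensor_module[OF A]
 by (simp add: cyc_X_def)

text \<open>The Koszul sign of the suspended letters and the change of \<open>sgx\<close> under
  rotation together give the Koszul sign of \<open>t\<close> times the factor \<open>(-1)^n\<close>
  of \<open>T\<close>.\<close>

lemma cyc_T_ev:
 assumes "hch A (n + 1) p c"
 shows "cyc_T K A n p (ev K A (n + 1) p c) = ev K A (n + 1) p (ext (rot par) c)"
proof (rule operator_ev[OF A A cyc_T_linear[unfolded cyc_X_def] _ assms])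
 fix w assume w: "w \<in> hw A (n + 1) p"
 then obtain y l where wy: "w = y @ [l]" by (metis hw_iff add_is_0 list.size(3) one_neq_zero rev_exhaust)
 let ?T = "tensor_power K A (n + 1) p"
 note T = tensor_module[OF A, of "n + 1" p]
 have hw': "l # y \<in> hw A (n + 1) p" using w wy by (auto simp: hw_iff)
 have len: "length y = n" using w wy by (simp add: hw_iff)
 have "cyc_t K A n p (pure_tensor K A w) = signed ?T (fst l * word_degree y) (pure_tensor K A (l # y))"
  unfolding cyc_t_def cyc_X_def
  by (subst tensor_lift_pure[OF A T cyc_t_multilinear[unfolded cyc_X_def] w]) (simp add: wy)
 then have "cyc_T K A n p (evw K A (n + 1) p w) =
   signed ?T n (signed ?T (sgx w) (signed ?T (fst l * word_degree y) (pure_tensor K A (l # y))))"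
  unfolding cyc_T_def cyc_X_def evw_hw[OF w]
   linear_signed[OF cyc_t_linear[unfolded cyc_X_def] T T pure_closed[OF A w]] by simp
 also have "... = signed ?T (n + (sgx w + fst l * word_degree y)) (pure_tensor K A (l # y))"
  unfolding signed_signed[OF T pure_closed[OF A hw']] ..
 also have "... = ev K A (n + 1) p (rot par w)"
  unfolding wy rot_snoc
  by (rule evw_ks[OF hw', symmetric]) (auto simp: sgx_append par_def len algebra_simps)
 finally show "cyc_T K A n p (evw K A (n + 1) p w) = ev K A (n + 1) p (rot par w)" .
qed

lemma cyc_T_pow_ev:
 assumes "hch A (n + 1) p c"
 shows "(cyc_T K A n p ^^ i) (ev K A (n + 1) p c) = ev K A (n + 1) p ((ext (rot par) ^^ i) c) \<and>
  hch A (n + 1) p ((ext (rot par) ^^ i) c)"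
 by (induction i) (use assms cyc_T_ev rot_hw in \<open>auto intro!: hch_ext\<close>)

lemma cyc_N_evw:
 assumes "w \<in> hw A (n + 1) p"
 shows "cyc_N K A n p (evw K A (n + 1) p w) = ev K A (n + 1) p (nrm par w)"
proof -
 interpret T: module K "tensor_power K A (n + 1) p" by (rule tensor_module[OF A])
 have "(cyc_T K A n p ^^ i) (evw K A (n + 1) p w) = ev K A (n + 1) p ((ext (rot par) ^^ i) (wd w))" for i
  using cyc_T_pow_ev[of n p "wd w" i] assms by (simp add: ev_wd[OF A])
 moreover have "{0..n} = {..<length w}" using assms by (auto simp: hw_iff)
 ultimately show ?thesis
  unfolding cyc_N_def nrm_eq_sum ev_sum[OF A] cyc_X_def by simp
qed

lemma cyc_N_linear: "cyc_N K A n p \<in> linear_maps K (cyc_X K A n p) (cyc_X K A n p)"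
proof -
 note T = tensor_module[OF A, of "n + 1" p, folded cyc_X_def]
 have "cyc_T K A n p ^^ i \<in> linear_maps K (cyc_X K A n p) (cyc_X K A n p)" for i
 proof (induction i)
  case (Suc i)
  from linear_comp[OF this cyc_T_linear] show ?case by (simp add: comp_def)
 qed (simp add: id_linear id_def)
 then show ?thesis unfolding cyc_N_def[abs_def] by (intro finsum_linear T)
qed

end

section \<open>The structure maps on words\<close>

text \<open>The differential is the operation on one letter and \<open>\<pi> n\<close> the one on
  \<open>n + 2\<close> letters. The sign \<open>thx\<close> combines them into a single odd operator
  on the suspension, so that all the relations become one: this operator after its coderivation is
  null.\<close>

definition opm :: "'k ring => ('k, 'a) graded_module => (nat => 'a => 'a)
   => (nat => nat => ('k, 'a) tensor => 'a) => 'a hword => (nat \<times> 'a) chain" where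
 "opm K A d \<pi> w = (if w = [] then 0 else if length w = 1 then dletter d (hd w) else
   ks (thx w) (wd [(word_degree w + (length w - 2), \<pi> (length w - 2) (word_degree w) (pure_tensor K A w))]))"

definition mop :: "'k ring => ('k, 'a) graded_module
   => (nat => nat => ('k, 'a) tensor => 'b) => 'a hword => (nat \<times> 'b) chain" where
 "mop K A f w = (if w = [] then 0 else
   ks (thx w) (wd [(word_degree w + (length w - 1), f (length w - 1) (word_degree w) (pure_tensor K A w))]))"

lemma lett_ksI: "(even (p l) \<longleftrightarrow> even e) ==> lett p e (ks n (wd [l]))"
 by (auto simp: lett_def)

lemma lett_wdI: "(even (p l) \<longleftrightarrow> even e) ==> lett p e (wd [l])"
 using lett_ksI[of p l e 0] by simp

lemma lett_0 [simp]: "lett p e 0"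
 by (simp add: lett_def)

lemma ops_opm:
 fixes A :: "('k, 'a) graded_module"
 shows "ops par (opm K A d \<pi>)"
 unfolding ops_def
proof (intro conjI allI)
 show "opm K A d \<pi> [] = 0" by (simp add: opm_def)
 fix x :: "'a hword"
 consider "x = []" | l where "x = [l]" | l l' y where "x = l # l' # y" by (metis list.exhaust)
 then show "lett par (pw par x + 1) (opm K A d \<pi> x)"
 proof cases
  case 2
  then show ?thesis
   by (auto simp: opm_def dletter_def par_def intro!: lett_wdI)
 next
  case 3
  then show ?thesis
   by (auto simp: opm_def par_def intro!: lett_ksI)
 qed (simp add: opm_def lett_def)
qed

lemma mors_mop:
 fixes A :: "('k, 'a) graded_module"
 shows "mors par par (mop K A f)"
 unfolding mors_def
proof (intro conjI allI)
 show "mop K A f [] = 0" by (simp add: mop_def)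
 fix x :: "'a hword"
 show "lett par (pw par x) (mop K A f x)"
 proof (cases x)
  case (Cons l y)
  then show ?thesis by (auto simp: mop_def par_def intro!: lett_ksI)
 qed (simp add: mop_def lett_def)
qed

section \<open>Faces as single operations on a word\<close>

lemma SS_sum: "SS w f = (\<Sum>i\<le>length w. f (take i w) (drop i w))"
 unfolding SS_def
 by (rule sum.reindex_bij_witness[of _ "%i. (take i w, drop i w)" "%(x, y). length x"]) auto

lemma SS_SS_sum: "SS w (%x r. SS r (f x)) =
  (\<Sum>(i, j)\<in>{(i, j). i + j \<le> length w}. f (take i w) (take j (drop i w)) (drop (i + j) w))"
proof -
 have "SS w (%x r. SS r (f x)) = (\<Sum>i\<le>length w. \<Sum>j\<le>length w - i. f (take i w) (take j (drop i w)) (drop (i + j) w))"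
  by (simp add: SS_sum add.commute)
 also have "... = (\<Sum>(i, j)\<in>(SIGMA i:{..length w}. {..length w - i}). f (take i w) (take j (drop i w)) (drop (i + j) w))"
  by (rule sum.Sigma) auto
 also have "(SIGMA i:{..length w}. {..length w - i}) = {(i, j). i + j \<le> length w}" by auto
 finally show ?thesis .
qed

lemma finite_pairs_le: "finite {(i, j). i + j \<le> (n :: nat)}"
 by (rule finite_subset[of _ "{..n} \<times> {..n}"]) auto

context
 fixes K :: "'k ring" and A :: "('k, 'a) graded_module" and d :: "nat => 'a => 'a"
  and \<pi> :: "nat => nat => ('k, 'a) tensor => 'a"
 assumes A: "graded K A" and \<pi>: "!!n. \<pi> n \<in> graded_maps K A A (n + 2) n"
begin

lemma ev_sum_subset:
 assumes "finite S" "S' \<subseteq> S" "!!s. s \<in> S - S' ==> ev K A r p (g s) = \<zero>\<^bsub>tensor_power K A r p\<^esub>"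
 shows "ev K A r p (sum g S) = ev K A r p (sum g S')"
proof -
 interpret T: module K "tensor_power K A r p" by (rule tensor_module[OF A])
 show ?thesis
  unfolding ev_sum[OF A]
  by (rule T.add.finprod_mono_neutral_cong_right) (use assms in \<open>auto intro: ev_closed[OF A]\<close>)
qed

lemma ev_length_0:
 assumes "!!w. w \<in> wkeys c ==> length w ~= r"
 shows "ev K A r p c = \<zero>\<^bsub>tensor_power K A r p\<^esub>"
 by (rule ev_eq_0[OF A]) (use assms in \<open>auto simp: hw_iff\<close>)

lemma opm_keys: "w \<in> wkeys (opm K A d \<pi> x) ==> length w = 1"
 using lett_Nil_mem[OF opsD[OF ops_opm]] .

text \<open>The terms of \<open>delta\<close> whose operation takes \<open>k + 1\<close> letters,
  indexed by their starting position like the interior faces.\<close>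

definition blocks where
 "blocks n k w = (\<Sum>j\<in>{0..n - k}. ks (pw par (take j w))
   (wd (take j w) * opm K A d \<pi> (take (k + 1) (drop j w)) * wd (drop (j + (k + 1)) w)))"

text \<open>The corresponding terms of \<open>wrap\<close>; \<open>q\<close> counts the letters
  taken from the end of the word, as in \<open>wrapped_tuple\<close>.\<close>

definition wblocks where
 "wblocks n k w = (\<Sum>q\<in>{1..k}. let z = drop (n + 1 - q) w; x = take (k + 1 - q) w; y = take (n - k) (drop (k + 1 - q) w)
   in ks (pw par z * (pw par x + pw par y)) (opm K A d \<pi> (z @ x) * wd y))"

text \<open>An operation on \<open>k + 1\<close> letters shortens the word by \<open>k\<close>, so
  evaluation at length \<open>n - k + 1\<close> selects these operations.\<close>

lemma ev_delta_blocks: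
 assumes "length w = n + 1" "k \<le> n"
 shows "ev K A (n - k + 1) p (delta par (opm K A d \<pi>) w) = ev K A (n - k + 1) p (blocks n k w)"
proof -
 let ?g = "%(i, j). ks (pw par (take i w)) (wd (take i w) * opm K A d \<pi> (take j (drop i w)) * wd (drop (i + j) w))"
 let ?S' = "(%j. (j, k + 1)) ` {0..n - k}"
 have "ev K A (n - k + 1) p (delta par (opm K A d \<pi>) w) = ev K A (n - k + 1) p (sum ?g {(i, j). i + j \<le> length w})"
  unfolding delta_def SS_SS_sum ..
 also have "... = ev K A (n - k + 1) p (sum ?g ?S')"
 proof (rule ev_sum_subset[OF finite_pairs_le])
  show "?S' \<subseteq> {(i, j). i + j \<le> length w}" using assms by auto
  fix s assume s: "s \<in> {(i, j). i + j \<le> length w} - ?S'"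
  obtain i j where ij: "s = (i, j)" by (cases s)
  then have le: "i + j \<le> n + 1" and ne: "j ~= k + 1" using s assms by (auto simp: image_iff)
  show "ev K A (n - k + 1) p (?g s) = \<zero>\<^bsub>tensor_power K A (n - k + 1) p\<^esub>"
  proof (rule ev_length_0)
   fix t assume "t \<in> wkeys (?g s)"
   then have "length t = i + 1 + (n + 1 - (i + j))"
    using ij le assms(1) by (auto elim!: keys_mult_append dest!: opm_keys)
   then show "length t ~= n - k + 1" using le ne assms(2) by auto
  qed
 qed
 also have "sum ?g ?S' = blocks n k w"
  unfolding blocks_def by (subst sum.reindex) (auto simp: inj_on_def)
 finally show ?thesis .
qed

lemma ev_wrap_blocks:
 assumes "length w = n + 1" "k \<le> n"
 shows "ev K A (n - k + 1) p (wrap par (opm K A d \<pi>) w) = ev K A (n - k + 1) p (wblocks n k w)"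
proof -
 let ?h = "%x y z. if x = [] \<or> z = [] then 0 else ks (pw par z * (pw par x + pw par y)) (opm K A d \<pi> (z @ x) * wd y)"
 let ?g = "%(i, j). ?h (take i w) (take j (drop i w)) (drop (i + j) w)"
 let ?S' = "(%q. (k + 1 - q, n - k)) ` {1..k}"
 have "ev K A (n - k + 1) p (wrap par (opm K A d \<pi>) w) = ev K A (n - k + 1) p (sum ?g {(i, j). i + j \<le> length w})"
  unfolding wrap_def SS_SS_sum ..
 also have "... = ev K A (n - k + 1) p (sum ?g ?S')"
 proof (rule ev_sum_subset[OF finite_pairs_le])
  show "?S' \<subseteq> {(i, j). i + j \<le> length w}" using assms by auto
  fix s assume s: "s \<in> {(i, j). i + j \<le> length w} - ?S'"
  obtain i j where ij: "s = (i, j)" by (cases s)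
  then have le: "i + j \<le> n + 1" and ne: "(i, j) \<notin> ?S'" using s assms by auto
  show "ev K A (n - k + 1) p (?g s) = \<zero>\<^bsub>tensor_power K A (n - k + 1) p\<^esub>"
  proof (cases "take i w = [] \<or> drop (i + j) w = []")
   case False
   then have nz: "0 < i" "i + j < n + 1" using assms(1) by auto
   have "j ~= n - k"
   proof
    assume "j = n - k"
    then have "(i, j) = (k + 1 - (k + 1 - i), n - k)" "k + 1 - i \<in> {1..k}" using nz assms(2) by auto
    then show False using ne by blast
   qed
   show ?thesis
   proof (rule ev_length_0)
    fix t assume "t \<in> wkeys (?g s)"
    then have "length t = 1 + j"
     using ij le assms(1) False by (auto elim!: keys_mult_append dest!: opm_keys)
    then show "length t ~= n - k + 1" using \<open>j ~= n - k\<close> by auto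
   qed
  qed (auto simp: ij ev_zero[OF A])
 qed
 also have "sum ?g ?S' = wblocks n k w"
 proof -
  have "inj_on (%q. (k + 1 - q, n - k)) {1..k}" by (auto simp: inj_on_def)
  then have "sum ?g ?S' = (\<Sum>q\<in>{1..k}. ?g (k + 1 - q, n - k))" by (simp add: sum.reindex)
  also have "... = wblocks n k w"
   unfolding wblocks_def Let_def
  proof (rule sum.cong[OF refl])
   fix q assume q: "q \<in> {1..k}"
   then have "k + 1 - q + (n - k) = n + 1 - q" using assms(2) by auto
   then show "?g (k + 1 - q, n - k) = ks (pw par (drop (n + 1 - q) w) * (pw par (take (k + 1 - q) w) +
     pw par (take (n - k) (drop (k + 1 - q) w)))) (opm K A d \<pi> (drop (n + 1 - q) w @ take (k + 1 - q) w) * wd (take (n - k) (drop (k + 1 - q) w)))"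
    using q assms by (auto simp del: pw_par)
  qed
  finally show ?thesis .
 qed
 finally show ?thesis .
qed

lemma blocks_0:
 assumes n: "length w = n + 1"
 shows "blocks n 0 w = letter_diff par (dletter d) w"
 unfolding blocks_def letter_diff_sum_if
proof (rule sum.cong)
 show "{0..n - 0} = {..<length w}" using n by auto
 fix i assume "i \<in> {..<length w}"
 then have i: "i < length w" by simp
 then have t: "take (0 + 1) (drop i w) = [w ! i]" by (simp add: take_Suc_conv_app_nth hd_drop_conv_nth take_Suc)
 show "ks (pw par (take i w)) (wd (take i w) * opm K A d \<pi> (take (0 + 1) (drop i w)) * wd (drop (i + (0 + 1)) w)) =
  (if 0 < fst (w ! i) then ks (pw par (take i w)) (wd (w[i := (fst (w ! i) - 1, d (fst (w ! i)) (snd (w ! i)))])) else 0)"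
  unfolding t by (simp add: opm_def dletter_def upd_split[OF i] wd_append[symmetric])
qed

lemma pi_hw:
 assumes "valid A x" "length x = k + 1" "1 \<le> k"
 shows "\<pi> (k - 1) (word_degree x) (pure_tensor K A x) \<in> carrier (A (word_degree x + (k - 1)))"
proof -
 have "x \<in> hw A (k - 1 + 2) (word_degree x)" using assms by (simp add: hw_iff)
 from graded_pure_closed[OF A \<pi> this] show ?thesis .
qed

lemma face_block_linear:
 assumes "1 \<le> k" "j + k \<le> n"
 shows "face_block K A \<pi> n p k j \<in> linear_maps K (cyc_X K A n p) (cyc_X K A (n - k) (p + k - 1))"
proof -
 have ok: "factors_ok K A A (insert_factor K A j (k + 1, k - 1, \<pi> (k - 1)) (n - k - j))"
  using \<pi>[of "k - 1"] assms by (intro insert_factor_ok[OF A]) simp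
 have "tensor_map K A A (insert_factor K A j (k + 1, k - 1, \<pi> (k - 1)) (n - k - j)) p \<in>
  linear_maps K (tensor_power K A (n + 1) p) (tensor_power K A (n - k + 1) (p + k - 1))"
  using tensor_map_linear[OF A A ok, of p] assms by (simp add: add.commute)
 from linear_comp[OF this signed_linear[OF tensor_module[OF A]]]
 show ?thesis unfolding face_block_def[abs_def] cyc_X_def by simp
qed

text \<open>The comparison of the signs of a face with suspended signs. The exponent in front is the
  sum of the entries of \<open>[j..<j + k]\<close> for \<open>j = length u\<close>, see
  \<open>sum_list_upt\<close>.\<close>

lemma face_block_evw:
 assumes w: "w \<in> hw A (n + 1) p" and wx: "w = u @ x @ v" and x: "length x = k + 1" and k: "1 \<le> k"
 shows "signed (cyc_X K A (n - k) (p + k - 1)) (length u * k + (\<Sum>i<k. i)) (face_block K A \<pi> n p k (length u) (evw K A (n + 1) p w)) =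
  ev K A (n - k + 1) (p + k - 1) (ks (pw par u) (wd u * opm K A d \<pi> x * wd v))"
proof -
 let ?T = "tensor_power K A (n - k + 1) (p + k - 1)"
 note T = tensor_module[OF A]
 have len: "n = length u + k + length v" and val: "valid A u" "valid A x" "valid A v"
  and deg: "p = word_degree u + word_degree x + word_degree v"
  using w wx x by (auto simp: hw_iff)
 let ?l = "(word_degree x + (k - 1), \<pi> (k - 1) (word_degree x) (pure_tensor K A x))"
 let ?w' = "u @ ?l # v"
 have hw': "?w' \<in> hw A (n - k + 1) (p + k - 1)"
  using len val deg k pi_hw[OF val(2) x k] by (auto simp: hw_iff)
 have r: "n - k + 1 = length u + length v + 1" "p + (k - 1) = p + k - 1" "n - k - length u = length v" using len k by auto
 have \<pi>': "\<pi> (k - 1) \<in> graded_maps K A A (length x) (k - 1)" using \<pi>[of "k - 1"] x k by simp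
 have "tensor_map K A A (insert_factor K A (length u) (k + 1, k - 1, \<pi> (k - 1)) (n - k - length u)) p (pure_tensor K A w) =
  signed ?T ((k - 1) * word_degree u) (pure_tensor K A ?w')"
  using tensor_map_insert[OF A \<pi>' val(1,3,2) _ r(1), of p] deg unfolding wx x r by simp
 then have "face_block K A \<pi> n p k (length u) (pure_tensor K A w) =
   signed ?T (k * (p + 1)) (signed ?T ((k - 1) * word_degree u) (pure_tensor K A ?w'))"
  unfolding face_block_def cyc_X_def by simp
 then have "signed ?T (length u * k + (\<Sum>i<k. i)) (face_block K A \<pi> n p k (length u) (evw K A (n + 1) p w)) =
  signed ?T (length u * k + (\<Sum>i<k. i)) (signed ?T (sgx w) (signed ?T (k * (p + 1)) (signed ?T ((k - 1) * word_degree u) (pure_tensor K A ?w'))))"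
  unfolding evw_hw[OF A w]
  using linear_signed[OF face_block_linear[OF k, of "length u" n p, unfolded cyc_X_def] T T pure_closed[OF A w]] len by simp
 also have "... = signed ?T (length u * k + (\<Sum>i<k. i) + (sgx w + (k * (p + 1) + (k - 1) * word_degree u))) (pure_tensor K A ?w')"
  unfolding signed_signed[OF T pure_closed[OF A hw']] ..
 also have "... = ev K A (n - k + 1) (p + k - 1) (ks (pw par u + thx x) (wd ?w'))"
 proof (rule evw_ks[OF A hw', symmetric])
  obtain k' where k': "k = Suc k'" using k by (cases k) auto
  \<comment> \<open>The operation carries \<open>thx x\<close>, the evaluation of its inputs
    \<open>sgx x\<close>; their difference contains the triangular part of the sum over the
    tuple.\<close>
  have th: "even (thx x + sgx x + word_degree x + (k + 1) * word_degree x + ((\<Sum>i<k. i) + k))"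
   using thx_sgx[of x] x by simp
  show "even (pw par u + thx x + sgx ?w') = even (length u * k + (\<Sum>i<k. i) + (sgx w + (k * (p + 1) + (k - 1) * word_degree u)))"
   using th unfolding wx deg sgx_append pw_par x k' by (simp add: sgx_append even_mult_iff) argo
 qed
 also have "ks (pw par u + thx x) (wd ?w') = ks (pw par u) (wd u * opm K A d \<pi> x * wd v)"
  using x k by (auto simp: opm_def wd_append[symmetric])
 finally show ?thesis unfolding cyc_X_def .
qed

definition tuples :: "nat => nat => nat => nat list set" where
 "tuples n q k = {is. length is = k \<and> sorted_wrt (<) is \<and> set is \<subseteq> {0..n - q}}"

lemma finite_tuples: "finite (tuples n q k)"
 by (rule finite_subset[OF _ finite_lists_length_eq[of "{0..n - q}" k]]) (auto simp: tuples_def)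

lemma face_block_tuple:
 assumes "1 \<le> k" "j + k \<le> n"
 shows "face K A \<pi> n p [j..<j + k] = face_block K A \<pi> n p k j"
proof -
 have "hd [j..<j + k] = j" using assms by (simp add: upt_rec)
 then show ?thesis using assms by (simp add: face_def Let_def fun_eq_iff)
qed

lemma wrapped_tuple_mem: "i \<in> set (wrapped_tuple n k q) \<longleftrightarrow> i < k - q \<or> (n - q < i \<and> i \<le> n)"
 by (auto simp: wrapped_tuple_def)

text \<open>If \<open>q < q'\<close>, the entry \<open>n - q\<close> occurs in the tuple of
  \<open>q'\<close> only. Hence the \<open>THE\<close> in \<open>face\<close> picks the intended
  number.\<close>

lemma wrapped_tuple_inj:
 assumes "wrapped_tuple n k q = wrapped_tuple n k q'" "q \<in> {1..k}" "q' \<in> {1..k}" "k \<le> n"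
 shows "q = q'"
proof (rule ccontr)
 have *: "n - a \<in> set (wrapped_tuple n k b)" "n - a \<notin> set (wrapped_tuple n k a)" if "a < b" "b \<le> k" for a b
  using that assms(4) by (auto simp: wrapped_tuple_mem)
 assume "q ~= q'"
 then consider "q < q'" | "q' < q" by linarith
 then show False using *[of q q'] *[of q' q] assms by cases auto
qed

lemma wrapped_tuple_props:
 assumes "q \<in> {1..k}" "k \<le> n"
 shows "length (wrapped_tuple n k q) = k" "n \<in> set (wrapped_tuple n k q)"
  "sorted_wrt (<) (wrapped_tuple n k q)" "set (wrapped_tuple n k q) \<subseteq> {0..n}"
 using assms by (auto simp: wrapped_tuple_def sorted_wrt_append)

lemma face_wrapped:
 assumes q: "q \<in> {1..k}" and k: "k \<le> n"
 shows "face K A \<pi> n p (wrapped_tuple n k q) x =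
  signed (cyc_X K A (n - k) (p + k - 1)) (q * (k - 1)) (face_block K A \<pi> n p k 0 ((cyc_t K A n p ^^ q) x))"
proof -
 let ?w = "wrapped_tuple n k q"
 have len: "length ?w = k" using wrapped_tuple_props(1)[OF q k] .
 have 1: "\<not> (?w = [hd ?w..<hd ?w + k] \<and> hd ?w + k \<le> n)"
 proof
  assume *: "?w = [hd ?w..<hd ?w + k] \<and> hd ?w + k \<le> n"
  then have "set ?w = {hd ?w..<hd ?w + k}" by (metis set_upt)
  then have "n < hd ?w + k" using wrapped_tuple_props(2)[OF q k] by (metis atLeastLessThan_iff)
  then show False using * by simp
 qed
 have 2: "(THE q'. q' \<in> {1..k} \<and> ?w = wrapped_tuple n k q') = q"
  by (rule the_equality) (use q k wrapped_tuple_inj in blast)+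
 have 3: "\<exists>q'\<in>{1..k}. ?w = wrapped_tuple n k q'" using q by blast
 show ?thesis
  unfolding face_def Let_def len using 1 3 by (simp only: 2 if_False if_True)
qed

lemma face_other:
 assumes "length is = k" "!!j. j + k \<le> n ==> is ~= [j..<j + k]" "!!q. q \<in> {1..k} ==> is ~= wrapped_tuple n k q"
 shows "face K A \<pi> n p is x = \<zero>\<^bsub>cyc_X K A (n - k) (p + k - 1)\<^esub>"
 using assms by (auto simp: face_def Let_def)

lemma cyc_X_module: "module K (cyc_X K A n p)"
 unfolding cyc_X_def by (rule tensor_module[OF A])

lemma funpow_linear:
 assumes "\<phi> \<in> linear_maps K M M"
 shows "\<phi> ^^ i \<in> linear_maps K M M"
proof (induction i)
 case (Suc i)
 from linear_comp[OF this assms] show ?case by (simp add: comp_def)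
qed (simp add: id_linear id_def)

lemma face_linear:
 assumes "length is = k" "1 \<le> k" "k \<le> n"
 shows "face K A \<pi> n p is \<in> linear_maps K (cyc_X K A n p) (cyc_X K A (n - k) (p + k - 1))"
proof -
 consider j where "j + k \<le> n" "is = [j..<j + k]" | q where "q \<in> {1..k}" "is = wrapped_tuple n k q"
  | "!!j. j + k \<le> n ==> is ~= [j..<j + k]" "!!q. q \<in> {1..k} ==> is ~= wrapped_tuple n k q"
  by blast
 then show ?thesis
 proof cases
  case 1
  then show ?thesis using face_block_tuple[of k j n p] face_block_linear[of k j n p] assms by simp
 next
  case 2
  have "(%x. signed (cyc_X K A (n - k) (p + k - 1)) (q * (k - 1)) (face_block K A \<pi> n p k 0 ((cyc_t K A n p ^^ q) x)))
   \<in> linear_maps K (cyc_X K A n p) (cyc_X K A (n - k) (p + k - 1))"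
   using assms by (intro linear_comp[OF linear_comp[OF funpow_linear[OF cyc_t_linear[OF A]] face_block_linear]
    signed_linear[OF cyc_X_module]]) auto
  moreover have "face K A \<pi> n p is = (%x. signed (cyc_X K A (n - k) (p + k - 1)) (q * (k - 1))
    (face_block K A \<pi> n p k 0 ((cyc_t K A n p ^^ q) x)))"
   unfolding 2(2) by (intro HOL.ext face_wrapped 2(1) assms(3))
  ultimately show ?thesis by (simp only:)
 next
  case 3
  have "face K A \<pi> n p is = (%x. \<zero>\<^bsub>cyc_X K A (n - k) (p + k - 1)\<^esub>)"
   using face_other[OF assms(1) 3] by (intro HOL.ext) blast
  then show ?thesis using zero_linear[OF cyc_X_module] by simp
 qed
qed

lemma cyc_d_linear:
 assumes d: "differential_module K A d" and k: "k \<le> n"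
 shows "cyc_d K A d \<pi> q k n p \<in> linear_maps K (cyc_X K A n p) (cyc_X K A (n - k) (p + k - 1))"
proof (cases "k = 0")
 case True
 then show ?thesis
  using tensor_diff_linear[OF A d, of "n + 1" p] by (simp add: cyc_d_def[abs_def] cyc_X_def)
next
 case False
 have "(%x. \<Oplus>\<^bsub>cyc_X K A (n - k) (p + k - 1)\<^esub>is\<in>tuples n q k.
   signed (cyc_X K A (n - k) (p + k - 1)) (sum_list is) (face K A \<pi> n p is x))
   \<in> linear_maps K (cyc_X K A n p) (cyc_X K A (n - k) (p + k - 1))"
  by (intro finsum_linear[OF cyc_X_module cyc_X_module] linear_comp[OF face_linear signed_linear[OF cyc_X_module]])
   (use False k in \<open>auto simp: tuples_def\<close>)
 then show ?thesis using False by (simp add: cyc_d_def[abs_def] Let_def tuples_def)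
qed

lemma sum_list_upt: "sum_list [j..<j + k] = j * k + (\<Sum>i<k. i)"
 by (induction k) (auto simp: algebra_simps)

text \<open>The parity that makes wrapped faces fit the suspended signs: the summand
  \<open>n * q\<close> cancels the sign between powers of \<open>t\<close> and of \<open>T\<close>
  in \<open>cyc_t_pow\<close>, and the triangular number is the one in \<open>face_block_evw\<close>
  for the block at the start.\<close>

lemma sum_list_wrapped:
 assumes "q \<in> {1..k}" "k \<le> n"
 shows "even (sum_list (wrapped_tuple n k q) + q * (k - 1)) = even (n * q + (\<Sum>i<k. i))"
proof -
 obtain a where k: "k = a + q" using assms by (metis atLeastAtMost_iff le_add_diff_inverse2)
 obtain b where n: "n = b + q" using assms by (metis atLeastAtMost_iff le_add_diff_inverse2 order_trans)
 obtain q' where q: "q = Suc q'" using assms(1) by (cases q) auto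
 have tri: "(\<Sum>i<a + q. i) = (\<Sum>i<a. i) + (a * q + (\<Sum>i<q. i))"
  by (induction q) (auto simp: algebra_simps)
 have "sum_list (wrapped_tuple n k q) = (\<Sum>i<a. i) + ((b + 1) * q + (\<Sum>i<q. i))"
  using sum_list_upt[of 0 a] sum_list_upt[of "b + 1" q] by (simp add: wrapped_tuple_def k n add_ac)
 then show ?thesis unfolding k n tri by (simp add: q even_mult_iff) argo
qed

lemma cyc_t_pow:
 assumes w: "w \<in> hw A (n + 1) p"
 shows "(cyc_t K A n p ^^ q) (evw K A (n + 1) p w) =
  signed (cyc_X K A n p) (n * q) (ev K A (n + 1) p ((ext (rot par) ^^ q) (wd w)))"
proof -
 note X = cyc_X_module
 have c: "(cyc_t K A n p ^^ i) (evw K A (n + 1) p w) \<in> carrier (cyc_X K A n p)" for i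
  using linearD(1)[OF funpow_linear[OF cyc_t_linear[OF A]]] evw_closed[OF A] by (simp add: cyc_X_def)
 have e: "(cyc_T K A n p ^^ i) (evw K A (n + 1) p w) = ev K A (n + 1) p ((ext (rot par) ^^ i) (wd w))" for i
  using cyc_T_pow_ev[OF A, of n p "wd w" i] w by (simp add: ev_wd[OF A])
 show ?thesis
  unfolding e[symmetric]
 proof (induction q)
  case 0
  then show ?case by (simp add: signed_def)
 next
  case (Suc q)
  have ec: "(cyc_T K A n p ^^ q) (evw K A (n + 1) p w) \<in> carrier (cyc_X K A n p)"
   unfolding e cyc_X_def by (rule ev_closed[OF A])
  have tc: "cyc_t K A n p ((cyc_T K A n p ^^ q) (evw K A (n + 1) p w)) \<in> carrier (cyc_X K A n p)"
   by (rule linearD(1)[OF cyc_t_linear[OF A] ec])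
  have "(cyc_t K A n p ^^ Suc q) (evw K A (n + 1) p w) =
   signed (cyc_X K A n p) (n * q) (cyc_t K A n p ((cyc_T K A n p ^^ q) (evw K A (n + 1) p w)))"
   by (simp only: funpow.simps comp_def Suc linear_signed[OF cyc_t_linear[OF A] X X ec])
  also have "... = signed (cyc_X K A n p) (n * Suc q + n) (cyc_t K A n p ((cyc_T K A n p ^^ q) (evw K A (n + 1) p w)))"
   by (rule signed_cong) auto
  also have "... = signed (cyc_X K A n p) (n * Suc q) ((cyc_T K A n p ^^ Suc q) (evw K A (n + 1) p w))"
   by (simp only: funpow.simps comp_def cyc_T_def signed_signed[OF X tc])
  finally show ?case .
 qed
qed

text \<open>Among increasing tuples only intervals and wrapped tuples have nonzero faces. Intervals
  give the terms of \<open>delta\<close> and wrapped tuples those of \<open>wrap\<close>. A wrapped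
  tuple contains \<open>n\<close>, so it is excluded from the range for
  \<open>q = 1\<close>.\<close>

lemma cyc_d_evw:
 assumes d: "differential_module K A d" and w: "w \<in> hw A (n + 1) p" and k: "k \<le> n" and q: "q \<le> 1"
 shows "cyc_d K A d \<pi> q k n p (evw K A (n + 1) p w) =
  ev K A (n - k + 1) (p + k - 1) ((if q = 0 then hoch par (opm K A d \<pi>) else delta par (opm K A d \<pi>)) w)"
proof -
 let ?Y = "cyc_X K A (n - k) (p + k - 1)"
 interpret Y: module K ?Y by (rule cyc_X_module)
 have len: "length w = n + 1" using w by (simp add: hw_iff)
 have rhs: "ev K A (n - k + 1) (p + k - 1) ((if q = 0 then hoch par (opm K A d \<pi>) else delta par (opm K A d \<pi>)) w) =
  ev K A (n - k + 1) (p + k - 1) (blocks n k w) \<oplus>\<^bsub>?Y\<^esub> (if q = 0 then ev K A (n - k + 1) (p + k - 1) (wblocks n k w) else \<zero>\<^bsub>?Y\<^esub>)"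
 proof -
  have "ev K A (n - k + 1) (p + k - 1) (blocks n k w) \<in> carrier ?Y" unfolding cyc_X_def by (rule ev_closed[OF A])
  then have 0: "ev K A (n - k + 1) (p + k - 1) (blocks n k w) \<oplus>\<^bsub>?Y\<^esub> \<zero>\<^bsub>?Y\<^esub> = ev K A (n - k + 1) (p + k - 1) (blocks n k w)"
   by (rule Y.r_zero)
  show ?thesis
  proof (cases "q = 0")
   case True
   show ?thesis
    by (simp only: True if_True refl hoch_def ev_add[OF A] ev_delta_blocks[OF len k] ev_wrap_blocks[OF len k] cyc_X_def)
  next
   case False
   show ?thesis by (simp only: False if_False 0 ev_delta_blocks[OF len k])
  qed
 qed
 show ?thesis
 proof (cases "k = 0")
  case True
  have "wblocks n 0 w = 0" by (simp add: wblocks_def)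
  moreover have "ev K A (n - k + 1) (p + k - 1) (blocks n k w) \<in> carrier ?Y" unfolding cyc_X_def by (rule ev_closed[OF A])
  moreover have "cyc_d K A d \<pi> q k n p (evw K A (n + 1) p w) = ev K A (n - k + 1) (p + k - 1) (blocks n k w)"
   using True tensor_differential_evw[OF A d w] blocks_0[OF len] by (simp add: cyc_d_def)
  moreover have "ev K A (n - k + 1) (p + k - 1) 0 = \<zero>\<^bsub>?Y\<^esub>" unfolding cyc_X_def by (rule ev_zero[OF A])
  ultimately show ?thesis
   unfolding rhs using Y.r_zero[OF \<open>ev K A (n - k + 1) (p + k - 1) (blocks n k w) \<in> carrier ?Y\<close>] True by (simp only: if_cancel)
 next
  case False
  then have k1: "1 \<le> k" by simp
  let ?f = "%is. signed ?Y (sum_list is) (face K A \<pi> n p is (evw K A (n + 1) p w))"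
  let ?B = "(%j. [j..<j + k]) ` {0..n - k}" and ?W = "if q = 0 then (%q. wrapped_tuple n k q) ` {1..k} else {}"
  have ec: "evw K A (n + 1) p w \<in> carrier (cyc_X K A n p)" unfolding cyc_X_def by (rule evw_closed[OF A])
  have fc: "?f is \<in> carrier ?Y" if "length is = k" for "is"
   by (rule signed_closed[OF cyc_X_module linearD(1)[OF face_linear[OF that k1 k] ec]])
  have BS: "?B \<subseteq> tuples n q k"
  proof
   fix t assume "t \<in> ?B"
   then obtain j where "j \<le> n - k" "t = [j..<j + k]" by auto
   then show "t \<in> tuples n q k" using k k1 q by (auto simp: tuples_def)
  qed
  have WS: "?W \<subseteq> tuples n q k"
  proof
   fix t assume "t \<in> ?W"
   then obtain q' where "q = 0" "q' \<in> {1..k}" "t = wrapped_tuple n k q'" by (auto split: if_splits)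
   then show "t \<in> tuples n q k" using wrapped_tuple_props[OF _ k, of q'] by (simp add: tuples_def)
  qed
  have disj: "?B \<inter> ?W = {}"
  proof -
   have "n \<notin> set t" if "t \<in> ?B" for t using that k1 k by auto
   moreover have "n \<in> set t" if "t \<in> ?W" for t
    using that wrapped_tuple_props(2)[OF _ k] by (auto split: if_splits simp del: atLeastAtMost_iff)
   ultimately show ?thesis by blast
  qed
  have "cyc_d K A d \<pi> q k n p (evw K A (n + 1) p w) = (\<Oplus>\<^bsub>?Y\<^esub>is\<in>tuples n q k. ?f is)"
   using False by (simp add: cyc_d_def Let_def tuples_def)
  also have "... = (\<Oplus>\<^bsub>?Y\<^esub>is\<in>?B \<union> ?W. ?f is)"
  proof (rule Y.add.finprod_mono_neutral_cong_right[OF finite_tuples])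
   show "?B \<union> ?W \<subseteq> tuples n q k" using BS WS by blast
   show "?f \<in> tuples n q k \<rightarrow> carrier ?Y" using fc by (auto simp: tuples_def)
   fix t assume t: "t \<in> tuples n q k - (?B \<union> ?W)"
   have "t ~= [j..<j + k]" if "j + k \<le> n" for j
   proof
    assume "t = [j..<j + k]"
    moreover have "j \<in> {0..n - k}" using that by auto
    ultimately show False using t by blast
   qed
   moreover have "t ~= wrapped_tuple n k q'" if q': "q' \<in> {1..k}" for q'
   proof
    assume *: "t = wrapped_tuple n k q'"
    then have "n \<in> set t" using wrapped_tuple_props(2)[OF q' k] by simp
    then have "q = 0" using t q k k1 by (auto simp: tuples_def)
    then show False using t * q' by auto
   qed
   ultimately have "face K A \<pi> n p t (evw K A (n + 1) p w) = \<zero>\<^bsub>?Y\<^esub>"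
    using t by (intro face_other) (auto simp: tuples_def)
   then show "?f t = \<zero>\<^bsub>?Y\<^esub>" by (simp only: signed_zero[OF cyc_X_module])
  qed simp
  also have "... = (\<Oplus>\<^bsub>?Y\<^esub>is\<in>?B. ?f is) \<oplus>\<^bsub>?Y\<^esub> (\<Oplus>\<^bsub>?Y\<^esub>is\<in>?W. ?f is)"
  proof (rule Y.finsum_Un_disjoint[OF _ _ disj])
   show "?f \<in> ?B \<rightarrow> carrier ?Y" by (rule Pi_I, rule fc) auto
   show "?f \<in> ?W \<rightarrow> carrier ?Y" using WS fc unfolding tuples_def by blast
  qed simp_all
  also have "(\<Oplus>\<^bsub>?Y\<^esub>is\<in>?B. ?f is) = ev K A (n - k + 1) (p + k - 1) (blocks n k w)"
  proof -
   have inj: "inj_on (%j. [j..<j + k]) {0..n - k}"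
    using k1 by (intro inj_onI) (metis add_gr_0 hd_upt less_add_same_cancel1 less_numeral_extra(1) order_less_le_trans)
   have "(\<Oplus>\<^bsub>?Y\<^esub>is\<in>?B. ?f is) = (\<Oplus>\<^bsub>?Y\<^esub>j\<in>{0..n - k}. ?f [j..<j + k])"
    by (rule Y.finsum_reindex[OF _ inj], rule Pi_I, rule fc) auto
   also have "... = (\<Oplus>\<^bsub>?Y\<^esub>j\<in>{0..n - k}. ev K A (n - k + 1) (p + k - 1) (ks (pw par (take j w))
     (wd (take j w) * opm K A d \<pi> (take (k + 1) (drop j w)) * wd (drop (j + (k + 1)) w))))"
   proof (rule Y.finsum_cong'[OF refl])
    fix j assume j: "j \<in> {0..n - k}"
    then have jk: "j + k \<le> n" using k by auto
    have split: "w = take j w @ take (k + 1) (drop j w) @ drop (j + (k + 1)) w"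
     by (metis add.commute append_take_drop_id drop_drop)
    have l: "length (take (k + 1) (drop j w)) = k + 1" "length (take j w) = j" using jk len by auto
    from face_block_evw[OF w split l(1) k1, unfolded l(2)]
    show "?f [j..<j + k] = ev K A (n - k + 1) (p + k - 1) (ks (pw par (take j w))
     (wd (take j w) * opm K A d \<pi> (take (k + 1) (drop j w)) * wd (drop (j + (k + 1)) w)))"
     unfolding face_block_tuple[OF k1 jk] sum_list_upt .
   qed (auto simp: cyc_X_def intro: ev_closed[OF A])
   finally show ?thesis unfolding blocks_def ev_sum[OF A] cyc_X_def .
  qed
  also have "(\<Oplus>\<^bsub>?Y\<^esub>is\<in>?W. ?f is) = (if q = 0 then ev K A (n - k + 1) (p + k - 1) (wblocks n k w) else \<zero>\<^bsub>?Y\<^esub>)"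
  proof (cases "q = 0")
   case True
   have inj: "inj_on (wrapped_tuple n k) {1..k}"
    using wrapped_tuple_inj k by (intro inj_onI) blast
   have "(\<Oplus>\<^bsub>?Y\<^esub>is\<in>wrapped_tuple n k ` {1..k}. ?f is) = (\<Oplus>\<^bsub>?Y\<^esub>q\<in>{1..k}. ?f (wrapped_tuple n k q))"
    by (rule Y.finsum_reindex[OF _ inj]) (use wrapped_tuple_props(1)[OF _ k] fc in blast)
   also have "... = (\<Oplus>\<^bsub>?Y\<^esub>q\<in>{1..k}. ev K A (n - k + 1) (p + k - 1) (let z = drop (n + 1 - q) w; x = take (k + 1 - q) w; y = take (n - k) (drop (k + 1 - q) w)
   in ks (pw par z * (pw par x + pw par y)) (opm K A d \<pi> (z @ x) * wd y)))"
   proof (rule Y.finsum_cong'[OF refl])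
    fix q assume q: "q \<in> {1..k}"
    \<comment> \<open>The word is \<open>x y z\<close>, where \<open>z\<close> consists of the last
      \<open>q\<close> letters, which the power of \<open>t\<close> moves to the front; the
      operation then takes the \<open>k + 1\<close> letters of \<open>z @ x\<close>.\<close>
    define x where "x = take (k + 1 - q) w"
    define y where "y = take (n - k) (drop (k + 1 - q) w)"
    define z where "z = drop (n + 1 - q) w"
    have e: "k + 1 - q + (n - k) = n + 1 - q" using q k by auto
    have "drop (n - k) (drop (k + 1 - q) w) = z" unfolding z_def drop_drop using e by (simp add: add.commute)
    then have wxyz: "w = (x @ y) @ z"
     unfolding x_def y_def by (metis append.assoc append_take_drop_id)
    have lz: "length z = q" "length (z @ x) = k + 1" using len q k by (auto simp: z_def x_def)
    have zxy: "z @ x @ y \<in> hw A (n + 1) p" using w unfolding wxyz by (auto simp: hw_iff)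
    have zc: "evw K A (n + 1) p (z @ x @ y) \<in> carrier (cyc_X K A n p)" unfolding cyc_X_def by (rule evw_closed[OF A])
    have "(cyc_t K A n p ^^ q) (evw K A (n + 1) p w) =
     signed (cyc_X K A n p) (n * q) (signed (cyc_X K A n p) (pw par (x @ y) * pw par z) (evw K A (n + 1) p (z @ x @ y)))"
     unfolding cyc_t_pow[OF w] using rot_pow[where p = par and z = z and y = "x @ y"]
     unfolding lz(1) wxyz[symmetric] by (simp only: ev_ks[OF A] ev_wd[OF A] cyc_X_def)
    also have "... = signed (cyc_X K A n p) (n * q + pw par (x @ y) * pw par z) (evw K A (n + 1) p (z @ x @ y))"
     by (rule signed_signed[OF cyc_X_module zc])
    finally have t: "(cyc_t K A n p ^^ q) (evw K A (n + 1) p w) =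
     signed (cyc_X K A n p) (n * q + pw par (x @ y) * pw par z) (evw K A (n + 1) p (z @ x @ y))" .
    let ?b = "face_block K A \<pi> n p k 0 (evw K A (n + 1) p (z @ x @ y))"
    have bl: "face_block K A \<pi> n p k 0 \<in> linear_maps K (cyc_X K A n p) ?Y"
     by (rule face_block_linear) (use k1 k in auto)
    have bc: "?b \<in> carrier ?Y" by (rule linearD(1)[OF bl zc])
    have fb: "signed ?Y (\<Sum>i<k. i) ?b = ev K A (n - k + 1) (p + k - 1) (opm K A d \<pi> (z @ x) * wd y)"
     using face_block_evw[OF zxy, of "[]" "z @ x" y k] lz k1 by simp
    have "?f (wrapped_tuple n k q) = signed ?Y (sum_list (wrapped_tuple n k q)) (signed ?Y (q * (k - 1))
      (signed ?Y (n * q + pw par (x @ y) * pw par z) ?b))"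
     unfolding face_wrapped[OF q k] t linear_signed[OF bl cyc_X_module cyc_X_module zc] ..
    also have "... = signed ?Y (sum_list (wrapped_tuple n k q) + (q * (k - 1) + (n * q + pw par (x @ y) * pw par z))) ?b"
     unfolding signed_signed[OF cyc_X_module bc] ..
    also have "... = signed ?Y (pw par (x @ y) * pw par z + (\<Sum>i<k. i)) ?b"
     by (rule signed_cong) (use sum_list_wrapped[OF q k] in \<open>auto simp del: pw_par\<close>)
    also have "... = signed ?Y (pw par (x @ y) * pw par z) (ev K A (n - k + 1) (p + k - 1) (opm K A d \<pi> (z @ x) * wd y))"
     unfolding fb[symmetric] signed_signed[OF cyc_X_module bc] ..
    also have "... = ev K A (n - k + 1) (p + k - 1) (ks (pw par z * (pw par x + pw par y)) (opm K A d \<pi> (z @ x) * wd y))"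
     unfolding cyc_X_def ev_ks[OF A] by (rule signed_cong) (auto simp: mult.commute)
    finally show "?f (wrapped_tuple n k q) = ev K A (n - k + 1) (p + k - 1) (let z = drop (n + 1 - q) w; x = take (k + 1 - q) w; y = take (n - k) (drop (k + 1 - q) w)
   in ks (pw par z * (pw par x + pw par y)) (opm K A d \<pi> (z @ x) * wd y))"
     unfolding Let_def x_def y_def z_def .
   qed (auto simp: cyc_X_def intro: ev_closed[OF A])
   finally show ?thesis using True unfolding wblocks_def ev_sum[OF A] cyc_X_def by simp
  next
   case False
   then show ?thesis by (simp only: if_False Y.finsum_empty)
  qed
  finally show ?thesis unfolding rhs .
 qed
qed

end

section \<open>The relations of algebras and morphisms\<close>

definition eqc :: "'k ring => ('k, 'a) graded_module => (nat \<times> 'a) chain => (nat \<times> 'a) chain => bool" where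
 "eqc K A c c' \<longleftrightarrow> c - c' \<in> Null K A"

context
 fixes K :: "'k ring" and A :: "('k, 'a) graded_module"
 assumes A: "graded K A"
begin

lemmas NI = chain_idealD[OF Null_ideal[OF A]]

lemma eqc_refl: "eqc K A c c" by (simp add: eqc_def NI(1))

lemma eqc_sym: "eqc K A c c' ==> eqc K A c' c"
 unfolding eqc_def using NI(4) by fastforce

lemma eqc_trans: "eqc K A c c' ==> eqc K A c' c'' ==> eqc K A c c''"
 unfolding eqc_def using NI(2)[of "c - c'" "c' - c''"] by simp

lemma eqc_add: "eqc K A c c' ==> eqc K A e e' ==> eqc K A (c + e) (c' + e')"
 unfolding eqc_def using NI(2)[of "c - c'" "e - e'"] by (simp add: algebra_simps)

lemma eqc_diff: "eqc K A c c' ==> eqc K A e e' ==> eqc K A (c - e) (c' - e')"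
 unfolding eqc_def using NI(3)[of "c - c'" "e - e'"] by (simp add: algebra_simps)

lemma eqc_ks: "eqc K A c c' ==> eqc K A (ks n c) (ks n c')"
 unfolding eqc_def using NI(5)[of "c - c'" n] by (simp add: ks_arith)

lemma eqc_sum: "(!!i. i \<in> S ==> eqc K A (f i) (g i)) ==> eqc K A (sum f S) (sum g S)"
 unfolding eqc_def sum_subtractf[symmetric] by (rule chain_ideal_sum[OF Null_ideal[OF A]])

text \<open>This and the lemmas after it turn the relations, which are equations in some
  \<open>A q\<close>, into congruences between chains.\<close>

lemma letter_add: "a \<in> carrier (A q) ==> b \<in> carrier (A q) ==>
  eqc K A (wd [(q, a \<oplus>\<^bsub>A q\<^esub> b)]) (wd [(q, a)] + wd [(q, b)])"
 unfolding eqc_def Null_def mem_Collect_eq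
proof (intro allI)
 fix u v r p assume ab: "a \<in> carrier (A q)" "b \<in> carrier (A q)"
 interpret T: module K "tensor_power K A r p" by (rule tensor_module[OF A])
 show "ev K A r p (wd u * (wd [(q, a \<oplus>\<^bsub>A q\<^esub> b)] - (wd [(q, a)] + wd [(q, b)])) * wd v) = \<zero>\<^bsub>tensor_power K A r p\<^esub>"
  unfolding right_diff_distrib left_diff_distrib distrib_left distrib_right ev_diff[OF A] ev_add[OF A]
   linearD(2)[OF ev_letter_linear[OF A] ab] a_minus_def
  by (rule T.r_neg) (intro T.a_closed ev_closed[OF A])
qed

lemma letter_zero: "eqc K A (wd [(q, \<zero>\<^bsub>A q\<^esub>)]) 0"
 unfolding eqc_def Null_def mem_Collect_eq diff_zero
 using linear_zero[OF ev_letter_linear[OF A] gradedD(1)[OF A] tensor_module[OF A]] by blast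

lemma letter_neg: "a \<in> carrier (A q) ==> eqc K A (wd [(q, \<ominus>\<^bsub>A q\<^esub> a)]) (- wd [(q, a)])"
proof -
 assume a: "a \<in> carrier (A q)"
 interpret M: module K "A q" by (rule gradedD(1)[OF A])
 have "eqc K A (wd [(q, \<ominus>\<^bsub>A q\<^esub> a)] + wd [(q, a)]) 0"
  using eqc_trans[OF eqc_sym[OF letter_add[OF M.a_inv_closed[OF a] a]]] letter_zero[of q] a by (simp add: M.l_neg)
 then show ?thesis by (simp add: eqc_def)
qed

lemma letter_diff: "a \<in> carrier (A q) ==> b \<in> carrier (A q) ==>
  eqc K A (wd [(q, a \<ominus>\<^bsub>A q\<^esub> b)]) (wd [(q, a)] - wd [(q, b)])"
proof -
 assume ab: "a \<in> carrier (A q)" "b \<in> carrier (A q)"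
 interpret M: module K "A q" by (rule gradedD(1)[OF A])
 show ?thesis
  unfolding a_minus_def
  using eqc_trans[OF letter_add[OF ab(1) M.a_inv_closed[OF ab(2)]] eqc_add[OF eqc_refl letter_neg[OF ab(2)]]] by simp
qed

lemma letter_signed: "a \<in> carrier (A q) ==> eqc K A (wd [(q, signed (A q) s a)]) (ks s (wd [(q, a)]))"
 by (auto simp: signed_def ks_def eqc_refl letter_neg)

lemma letter_finsum:
 assumes "finite S" "!!i. i \<in> S ==> f i \<in> carrier (A q)"
 shows "eqc K A (wd [(q, \<Oplus>\<^bsub>A q\<^esub>i\<in>S. f i)]) (\<Sum>i\<in>S. wd [(q, f i)])"
 using assms
proof (induction S)
 interpret M: module K "A q" by (rule gradedD(1)[OF A])
 {
  case empty
  then show ?case using letter_zero by simp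
 next
  case (insert i S)
  then have c: "f \<in> S \<rightarrow> carrier (A q)" "f i \<in> carrier (A q)" by auto
  have "eqc K A (wd [(q, f i \<oplus>\<^bsub>A q\<^esub> (\<Oplus>\<^bsub>A q\<^esub>i\<in>S. f i))]) (wd [(q, f i)] + (\<Sum>i\<in>S. wd [(q, f i)]))"
   using insert c by (intro eqc_trans[OF letter_add eqc_add[OF eqc_refl]]) (auto intro: M.finsum_closed)
  then show ?case using insert c by (simp add: M.finsum_insert)
 }
qed

lemma letter_signed_finsum:
 assumes "finite S" "!!i. i \<in> S ==> f i \<in> carrier (A q)" "!!i. i \<in> S ==> eqc K A (wd [(q, f i)]) (g i)"
 shows "eqc K A (wd [(q, \<Oplus>\<^bsub>A q\<^esub>i\<in>S. signed (A q) (s i) (f i))]) (\<Sum>i\<in>S. ks (s i) (g i))"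
 using assms
 by (intro eqc_trans[OF letter_finsum eqc_sum] signed_closed[OF gradedD(1)[OF A]] eqc_trans[OF letter_signed eqc_ks]) auto

end

text \<open>The hypothesis says that an operation lowers the suspended degree by one.\<close>

lemma sign_insert:
 assumes "fst l + 2 = word_degree x + length x"
 shows "even (pw par u + thx x + thx (u @ l # v)) = even (thx (u @ x @ v) + length x * pw par u + length v)"
proof -
 have 1: "thx (u @ l # v) = thx u + (length v * (fst l + 1) + thx v) + (length v + 1) * (word_degree u + length u)"
  by (simp add: thx_append)
 have 2: "thx (u @ x @ v) = thx u + (thx x + thx v + length v * (word_degree x + length x)) +
   (length x + length v) * (word_degree u + length u)"
  by (simp add: thx_append)
 show ?thesis
  unfolding 1 2 assms[symmetric] pw_par by (simp add: even_mult_iff) argo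
qed

definition inner_letter :: "'k ring => ('k, 'a) graded_module
   => (nat => nat => ('k, 'a) tensor => 'a) => 'a hword => nat \<times> 'a" where
 "inner_letter K A \<pi> x = (word_degree x + (length x - 2), \<pi> (length x - 2) (word_degree x) (pure_tensor K A x))"

text \<open>Here \<open>g\<close> is an outer operation or morphism component stripped of its sign
  \<open>thx\<close>. This sum collects \<open>g\<close> after the differential, and
  \<open>outer_prod\<close> collects \<open>g\<close> after an inner operation, indexed by
  \<open>m\<close> and \<open>t\<close> as in the relations; \<open>N + 1 - m\<close> is the number
  of inputs of \<open>\<pi> (N - 1 - m)\<close>.\<close>

definition outer_diff where
 "outer_diff d g w = (\<Sum>i<length w. if 0 < fst (w ! i) then
   ks (pw par (take i w) + (length w - 1 - i)) (g (w[i := (fst (w ! i) - 1, d (fst (w ! i)) (snd (w ! i)))])) else 0)"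

definition outer_prod where
 "outer_prod K A \<pi> N g w = (\<Sum>m<N. \<Sum>t\<in>{1..length w - (N - m)}.
   ks ((N + 1 - m) * pw par (take (t - 1) w) + (length w - (t - 1) - (N + 1 - m)))
    (g (take (t - 1) w @ inner_letter K A \<pi> (take (N + 1 - m) (drop (t - 1) w)) # drop (t - 1 + (N + 1 - m)) w)))"

text \<open>The sign \<open>thx\<close> of the whole word is common to all terms and factors out;
  what remains is close to the signs of the relations.\<close>

lemma ext_outer_term:
 assumes o: "!!w'. c \<le> length w' ==> oo w' = ks (thx w') (g w')"
  and x: "x ~= []" and c: "c \<le> length u + 1 + length v"
 shows "ext oo (ks (pw par u) (wd u * opm K A d \<pi> x * wd v)) = ks (thx (u @ x @ v))
  (if length x = 1 then (if fst (hd x) = 0 then 0 else ks (pw par u + length v) (g (u @ (fst (hd x) - 1, d (fst (hd x)) (snd (hd x))) # v)))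
   else ks (length x * pw par u + length v) (g (u @ inner_letter K A \<pi> x # v)))"
proof (cases "length x = 1")
 case True
 then obtain l where l: "x = [l]" by (auto simp: length_Suc_conv)
 show ?thesis
 proof (cases "fst l = 0")
  case False
  let ?l = "(fst l - 1, d (fst l) (snd l))"
  have "even (pw par u + thx (u @ ?l # v)) = even (thx (u @ x @ v) + (pw par u + length v))"
   using sign_insert[of ?l x u v] False by (simp add: l; argo)
  note e = this
  have "ext oo (ks (pw par u) (wd u * opm K A d \<pi> x * wd v)) = ks (pw par u + thx (u @ ?l # v)) (g (u @ ?l # v))"
   using False c by (simp add: l opm_def dletter_def wd_append[symmetric] o del: pw_par)
  also have "... = ks (thx (u @ x @ v) + (pw par u + length v)) (g (u @ ?l # v))"
   by (rule ks_cong[OF e refl])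
  finally show ?thesis using False by (simp add: l del: pw_par)
 qed (simp add: l opm_def dletter_def)
next
 case False
 let ?l = "inner_letter K A \<pi> x"
 have x2: "2 \<le> length x" using x False by (cases x) (auto simp: Suc_le_eq)
 have "even (pw par u + thx x + thx (u @ ?l # v)) = even (thx (u @ x @ v) + (length x * pw par u + length v))"
  using sign_insert[of ?l x u v] x2 by (simp add: inner_letter_def; argo?)
 note e = this
 have "ext oo (ks (pw par u) (wd u * opm K A d \<pi> x * wd v)) = ks (pw par u + thx x + thx (u @ ?l # v)) (g (u @ ?l # v))"
  using False x c by (simp add: opm_def inner_letter_def[symmetric] wd_append[symmetric] o del: pw_par)
 also have "... = ks (thx (u @ x @ v) + (length x * pw par u + length v)) (g (u @ ?l # v))"
  by (rule ks_cong[OF e refl])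
 finally show ?thesis using False by (simp del: pw_par)
qed

text \<open>The terms of \<open>delta\<close> are sorted by the number \<open>j\<close> of letters
  taken: \<open>j = 1\<close> is the differential, and \<open>2 \<le> j \<le> N + 1\<close> gives
  the composites with \<open>m = N + 1 - j\<close>. For \<open>c = 2\<close> there remains
  \<open>j = N + 2\<close>, the operation on the whole word, after which only the differential can
  act.\<close>

lemma ext_outer_delta:
 assumes o: "!!w'. c \<le> length w' ==> oo w' = ks (thx w') (g w')"
  and w: "length w = N + c" and c: "c = 1 \<or> c = 2"
 shows "ext oo (delta par (opm K A d \<pi>) w) = ks (thx w) (outer_diff d g w + outer_prod K A \<pi> N g w) +
  (if c = 2 then ext oo (opm K A d \<pi> w) else 0)"
proof -
 let ?L = "N + c"
 let ?h = "%i j. ext oo (ks (pw par (take i w)) (wd (take i w) * opm K A d \<pi> (take j (drop i w)) * wd (drop (i + j) w)))"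
 have "ext oo (delta par (opm K A d \<pi>) w) = (\<Sum>(i, j)\<in>{(i, j). i + j \<le> ?L}. ?h i j)"
  unfolding delta_def SS_SS_sum ext_sum w by (intro sum.cong) auto
 also have "... = (\<Sum>(j, i)\<in>(SIGMA j:{..?L}. {..?L - j}). ?h i j)"
  by (rule sum.reindex_bij_witness[of _ "%(j, i). (i, j)" "%(i, j). (j, i)"]) auto
 also have "... = (\<Sum>j\<le>?L. \<Sum>i\<le>?L - j. ?h i j)"
  by (rule sum.Sigma[symmetric]) auto
 also have "... = (\<Sum>i\<le>?L. ?h i 0) + ((\<Sum>i\<le>?L - 1. ?h i 1) + (\<Sum>j\<in>{2..?L}. \<Sum>i\<le>?L - j. ?h i j))"
 proof -
  have "{..?L} = insert 0 (insert 1 {2..?L})" using c by auto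
  then show ?thesis by simp
 qed
 also have "(\<Sum>i\<le>?L. ?h i 0) = 0" by (simp add: opm_def)
 also have "(\<Sum>i\<le>?L - 1. ?h i 1) = ks (thx w) (outer_diff d g w)"
 proof -
  have "{..?L - 1} = {..<length w}" using w c by auto
  moreover have "?h i 1 = ks (thx w) (if 0 < fst (w ! i) then
   ks (pw par (take i w) + (length w - 1 - i)) (g (w[i := (fst (w ! i) - 1, d (fst (w ! i)) (snd (w ! i)))])) else 0)"
   if i: "i < length w" for i
  proof -
   have t: "take 1 (drop i w) = [w ! i]" "take i w @ [w ! i] @ drop (i + 1) w = w"
    using i by (simp_all add: take_Suc_conv_app_nth hd_drop_conv_nth take_Suc id_take_nth_drop[symmetric])
   have "c \<le> length (take i w) + 1 + length (drop (i + 1) w)" using i w by auto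
   from ext_outer_term[OF o _ this, of "[w ! i]" K A d \<pi>] show ?thesis
    unfolding t upd_split[OF i] using i by (auto simp: min_def simp del: pw_par)
  qed
  ultimately show ?thesis unfolding outer_diff_def ks_sum by simp
 qed
 also have "(\<Sum>j\<in>{2..?L}. \<Sum>i\<le>?L - j. ?h i j) = ks (thx w) (outer_prod K A \<pi> N g w) +
  (if c = 2 then ext oo (opm K A d \<pi> w) else 0)"
 proof -
  have "(\<Sum>j\<in>{2..?L}. \<Sum>i\<le>?L - j. ?h i j) = (\<Sum>j\<in>{2..N + 1}. \<Sum>i\<le>?L - j. ?h i j) + (if c = 2 then ?h 0 ?L else 0)"
  proof (cases "c = 2")
   case True
   then have "{2..?L} = insert ?L {2..N + 1}" by auto
   then show ?thesis using True by (simp add: add.commute)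
  qed (use c in auto)
  moreover have "?h 0 ?L = ext oo (opm K A d \<pi> w)" using w by simp
  moreover have "(\<Sum>j\<in>{2..N + 1}. \<Sum>i\<le>?L - j. ?h i j) = ks (thx w) (outer_prod K A \<pi> N g w)"
  proof -
   have "(\<Sum>j\<in>{2..N + 1}. \<Sum>i\<le>?L - j. ?h i j) = (\<Sum>m<N. \<Sum>i\<le>?L - (N + 1 - m). ?h i (N + 1 - m))"
    by (rule sum.reindex_bij_witness[of _ "%m. N + 1 - m" "%j. N + 1 - j"]) auto
   also have "... = (\<Sum>m<N. \<Sum>t\<in>{1..?L - (N - m)}. ?h (t - 1) (N + 1 - m))"
   proof (rule sum.cong[OF refl])
    fix m assume "m \<in> {..<N}"
    then show "(\<Sum>i\<le>?L - (N + 1 - m). ?h i (N + 1 - m)) = (\<Sum>t\<in>{1..?L - (N - m)}. ?h (t - 1) (N + 1 - m))"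
     using c by (intro sum.reindex_bij_witness[of _ "%t. t - 1" Suc]) auto
   qed
   also have "... = ks (thx w) (outer_prod K A \<pi> N g w)"
    unfolding outer_prod_def ks_sum w
   proof (intro sum.cong refl)
    fix m t assume m: "m \<in> {..<N}" and t: "t \<in> {1..?L - (N - m)}"
    let ?x = "take (N + 1 - m) (drop (t - 1) w)"
    have tm: "t - 1 + (N + 1 - m) \<le> length w" using m t c w by auto
    then have lx: "length ?x = N + 1 - m" using m by auto
    have split: "take (t - 1) w @ ?x @ drop (t - 1 + (N + 1 - m)) w = w"
     by (metis add.commute append_take_drop_id drop_drop)
    have lv: "length (drop (t - 1 + (N + 1 - m)) w) = ?L - (t - 1) - (N + 1 - m)" using w by simp
    have "c \<le> length (take (t - 1) w) + 1 + length (drop (t - 1 + (N + 1 - m)) w)"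
     using tm w m by auto
    from ext_outer_term[OF o _ this, of ?x K A d \<pi>]
    show "?h (t - 1) (N + 1 - m) = ks (thx w) (ks ((N + 1 - m) * pw par (take (t - 1) w) + (?L - (t - 1) - (N + 1 - m)))
      (g (take (t - 1) w @ inner_letter K A \<pi> ?x # drop (t - 1 + (N + 1 - m)) w)))"
     unfolding split lv lx using m lx by (auto simp del: pw_par)
   qed
   finally show ?thesis .
  qed
  ultimately show ?thesis by (simp only:)
 qed
 finally show ?thesis by (simp add: ks_arith add_ac)
qed

section \<open>Compositions and the blocks of a morphism\<close>

lemma finite_compositions: "finite (compositions s r)"
proof (rule finite_subset[OF _ finite_lists_length_eq[of "{..s}" r]])
 show "compositions s r \<subseteq> {xs. set xs \<subseteq> {..s} \<and> length xs = r}"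
  by (auto simp: compositions_def dest: member_le_sum_list)
qed simp

lemma sum_compositions_Suc:
 fixes F :: "nat list => 'b::comm_monoid_add"
 shows "sum F (compositions s (Suc r)) = (\<Sum>n\<le>s. \<Sum>ns\<in>compositions (s - n) r. F (n # ns))"
proof -
 have "(\<Sum>n\<le>s. \<Sum>ns\<in>compositions (s - n) r. F (n # ns)) = (\<Sum>(n, ns)\<in>(SIGMA n:{..s}. compositions (s - n) r). F (n # ns))"
  by (rule sum.Sigma) (auto simp: finite_compositions)
 also have "... = sum F (compositions s (Suc r))"
  by (rule sum.reindex_bij_witness[of _ "%ns. (hd ns, tl ns)" "%(n, ns). n # ns"])
   (auto simp: compositions_def length_Suc_conv)
 finally show ?thesis ..
qed

lemma eps_Nil [simp]: "eps [] = 0" and eps_Cons [simp]: "eps (n # ns) = (n + 1) * sum_list ns + eps ns"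
 by (simp_all add: eps_def sum.lessThan_Suc_shift del: sum.lessThan_Suc)

primrec block_thx :: "nat list => 'a hword => nat" where
 "block_thx [] w = 0"
| "block_thx (n # ns) w = thx (take (n + 1) w) + block_thx ns (drop (n + 1) w)"

lemma morphism_factors_simps [simp]:
 "morphism_factors f [] = []" "morphism_factors f (n # ns) = (n + 1, n, f n) # morphism_factors f ns"
 "length (morphism_factors f ns) = length ns"
 "factors_arity (morphism_factors f ns) = sum_list ns + length ns"
 "factors_degree (morphism_factors f ns) = sum_list ns"
 by (simp_all add: morphism_factors_def, induction ns, auto simp: morphism_factors_def, induction ns, auto simp: morphism_factors_def)

lemma morphism_factors_ok: "(!!n. f n \<in> graded_maps K A B (n + 1) n) ==> factors_ok K A B (morphism_factors f ns)"
 by (induction ns) auto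

lemma length_factors_apply [simp]: "length (factors_apply K A Ph w) = length Ph"
 by (induction K A Ph w rule: factors_apply.induct) auto

text \<open>The origin of the exponent \<open>eps\<close>: together with the Koszul exponent it is
  the discrepancy between the suspension signs of the separate blocks, of the resulting word and of
  \<open>w\<close>.\<close>

lemma block_sign:
 assumes "length w = sum_list ns + length ns"
 shows "even (block_thx ns w + thx (factors_apply K A (morphism_factors f ns) w) + thx w +
  koszul_exponent (morphism_factors f ns) w + eps ns)"
 using assms
proof (induction ns arbitrary: w)
 case (Cons n ns)
 define x where "x = take (n + 1) w"
 define y where "y = drop (n + 1) w"
 have w: "w = x @ y" and lx: "length x = n + 1" and ly: "length y = sum_list ns + length ns"
  using Cons.prems by (simp_all add: x_def y_def)
 have tx: "thx w = thx x + thx y + (sum_list ns + length ns) * (word_degree x + (n + 1))"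
  unfolding w thx_append lx ly ..
 from Cons.IH[OF ly] show ?case
  unfolding tx
  by (simp add: x_def[symmetric, simplified] y_def[symmetric, simplified] lx even_mult_iff) argo
qed simp

text \<open>Since empty blocks contribute nothing, a cut of \<open>w\<close> into \<open>r\<close>
  blocks amounts to the list of the block lengths diminished by one, whose sum is
  \<open>s\<close>.\<close>

lemma tens_pow_compositions:
 assumes "length w = s + r"
 shows "tens_pow (mop K A f) r w = (\<Sum>ns\<in>compositions s r.
  ks (block_thx ns w) (wd (factors_apply K A (morphism_factors f ns) w)))"
 using assms
proof (induction r arbitrary: s w)
 case 0
 have "compositions s 0 = (if s = 0 then {[]} else {})" by (auto simp: compositions_def)
 then show ?case using 0 by (cases "s = 0") auto
next
 case (Suc r)
 have m0: "mop K A f [] = 0" by (simp add: mop_def)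
 have "tens_pow (mop K A f) (Suc r) w = (\<Sum>i\<le>length w. mop K A f (take i w) * tens_pow (mop K A f) r (drop i w))"
  by (simp add: SS_sum)
 also have "... = (\<Sum>i\<in>{1..s + 1}. mop K A f (take i w) * tens_pow (mop K A f) r (drop i w))"
 proof (rule sum.mono_neutral_right)
  show "\<forall>i\<in>{..length w} - {1..s + 1}. mop K A f (take i w) * tens_pow (mop K A f) r (drop i w) = 0"
  proof
   fix i assume i: "i \<in> {..length w} - {1..s + 1}"
   show "mop K A f (take i w) * tens_pow (mop K A f) r (drop i w) = 0"
   proof (cases "i = 0")
    case False
    then have "length (drop i w) < r" using i Suc.prems by auto
    then show ?thesis using tens_pow_eq_0[where Ph = "mop K A f", OF m0] by simp
   qed (simp add: m0)
  qed
 qed (use Suc.prems in auto)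
 also have "... = (\<Sum>n\<le>s. mop K A f (take (n + 1) w) * tens_pow (mop K A f) r (drop (n + 1) w))"
  by (rule sum.reindex_bij_witness[of _ "%n. n + 1" "%i. i - 1"]) auto
 also have "... = (\<Sum>n\<le>s. \<Sum>ns\<in>compositions (s - n) r.
   ks (block_thx (n # ns) w) (wd (factors_apply K A (morphism_factors f (n # ns)) w)))"
 proof (rule sum.cong[OF refl])
  fix n assume n: "n \<in> {..s}"
  have l: "length (take (n + 1) w) = n + 1" "length (drop (n + 1) w) = s - n + r" using n Suc.prems by auto
  let ?l = "(word_degree (take (n + 1) w) + n, f n (word_degree (take (n + 1) w)) (pure_tensor K A (take (n + 1) w)))"
  have "take (n + 1) w ~= []" using l(1) by auto
  then have "mop K A f (take (n + 1) w) = ks (thx (take (n + 1) w)) (wd [?l])"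
   unfolding mop_def l(1) by simp
  note mm = this
  show "mop K A f (take (n + 1) w) * tens_pow (mop K A f) r (drop (n + 1) w) =
   (\<Sum>ns\<in>compositions (s - n) r. ks (block_thx (n # ns) w) (wd (factors_apply K A (morphism_factors f (n # ns)) w)))"
   unfolding Suc.IH[OF l(2)] sum_distrib_left mm
  proof (rule sum.cong[OF refl])
   fix ns
   let ?F = "factors_apply K A (morphism_factors f ns) (drop (n + 1) w)"
   have fa: "factors_apply K A (morphism_factors f (n # ns)) w = ?l # ?F" by simp
   have "wd (?l # ?F) = wd [?l] * wd ?F" using wd_append[of "[?l]" ?F] by simp
   then show "ks (thx (take (n + 1) w)) (wd [?l]) * ks (block_thx ns (drop (n + 1) w)) (wd ?F) =
    ks (block_thx (n # ns) w) (wd (factors_apply K A (morphism_factors f (n # ns)) w))"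
    by (simp only: fa block_thx.simps ks_mult ks_simps add_ac)
  qed
 qed
 also have "... = (\<Sum>ns\<in>compositions s (Suc r). ks (block_thx ns w) (wd (factors_apply K A (morphism_factors f ns) w)))"
  by (rule sum_compositions_Suc[symmetric])
 finally show ?case .
qed

text \<open>\<open>c\<close> is the number of inputs of an outer map of degree 0: 2 for operations,
  1 for morphisms.\<close>

definition outer_letter :: "'k ring => ('k, 'a) graded_module => nat
   => (nat => nat => ('k, 'a) tensor => 'b) => 'a hword => nat \<times> 'b" where
 "outer_letter K A c \<phi> w = (word_degree w + (length w - c), \<phi> (length w - c) (word_degree w) (pure_tensor K A w))"

context
 fixes K :: "'k ring" and A :: "('k, 'a) graded_module" and B :: "('k, 'b) graded_module"
  and d :: "nat => 'a => 'a" and \<pi> :: "nat => nat => ('k, 'a) tensor => 'a"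
  and c :: nat and \<phi> :: "nat => nat => ('k, 'a) tensor => 'b"
 assumes A: "graded K A" and B: "graded K B" and d: "differential_module K A d"
  and \<pi>: "!!n. \<pi> n \<in> graded_maps K A A (n + 2) n"
  and c: "c = 1 \<or> c = 2"
  and \<phi>: "!!n. \<phi> n \<in> graded_maps K A B (n + c) n"
begin

text \<open>The sign of the differential term in the relations agrees with the suspended signs up to
  the factor \<open>(-1)^c\<close>, which is the same for all positions.\<close>

lemma eqc_outer_diff:
 assumes w: "w \<in> hw A (N + c) p" and p: "0 < p"
 shows "eqc K B (wd [(p + N - 1, signed (B (p + N - 1)) (N + 1) (\<phi> N (p - 1) (tensor_differential K A d (N + c) p (pure_tensor K A w))))])
   (ks c (outer_diff d (%w'. wd [outer_letter K A c \<phi> w']) w))"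
proof -
 let ?T = "tensor_power K A (N + c) (p - 1)" and ?q = "p + N - 1"
 note T = tensor_module[OF A]
 let ?u = "%i. w[i := (fst (w ! i) - 1, d (fst (w ! i)) (snd (w ! i)))]"
 let ?S = "{i. i < length w \<and> 0 < fst (w ! i)}"
 have len: "length w = N + c" using w by (simp add: hw_iff)
 have hw: "?u i \<in> hw A (N + c) (p - 1)" if "i \<in> ?S" for i using that d_update_hw[OF A d w] by blast
 have fl: "\<phi> N (p - 1) \<in> linear_maps K ?T (B ?q)" using graded_mapsD[OF \<phi>[of N], of "p - 1"] p by simp
 have fc: "\<phi> N (p - 1) (pure_tensor K A (?u i)) \<in> carrier (B ?q)" if "i \<in> ?S" for i
  by (rule linearD(1)[OF fl pure_closed[OF A hw[OF that]]])
 have td: "tensor_differential K A d (N + c) p (pure_tensor K A w) =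
  (\<Oplus>\<^bsub>?T\<^esub>i\<in>?S. signed ?T (word_degree (take i w)) (pure_tensor K A (?u i)))"
  unfolding tensor_differential_def Let_def
  by (rule tensor_lift_pure[OF A T tensor_differential_multilinear[OF A d] w])
 interpret M: module K "B ?q" by (rule gradedD(1)[OF B])
 have "\<phi> N (p - 1) (tensor_differential K A d (N + c) p (pure_tensor K A w)) =
  (\<Oplus>\<^bsub>B ?q\<^esub>i\<in>?S. \<phi> N (p - 1) (signed ?T (word_degree (take i w)) (pure_tensor K A (?u i))))"
  unfolding td
  by (rule linear_finsum[OF fl T gradedD(1)[OF B]]) (intro signed_closed[OF T] pure_closed[OF A] hw)
 also have "... = (\<Oplus>\<^bsub>B ?q\<^esub>i\<in>?S. signed (B ?q) (word_degree (take i w)) (\<phi> N (p - 1) (pure_tensor K A (?u i))))"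
 proof (rule M.finsum_cong'[OF refl])
  show "(%i. signed (B ?q) (word_degree (take i w)) (\<phi> N (p - 1) (pure_tensor K A (?u i)))) \<in> ?S \<rightarrow> carrier (B ?q)"
   by (intro Pi_I signed_closed[OF gradedD(1)[OF B]] fc)
  fix i assume "i \<in> ?S"
  then show "\<phi> N (p - 1) (signed ?T (word_degree (take i w)) (pure_tensor K A (?u i))) =
   signed (B ?q) (word_degree (take i w)) (\<phi> N (p - 1) (pure_tensor K A (?u i)))"
   by (intro linear_signed[OF fl T gradedD(1)[OF B]] pure_closed[OF A] hw)
 qed
 finally have eq: "\<phi> N (p - 1) (tensor_differential K A d (N + c) p (pure_tensor K A w)) =
  (\<Oplus>\<^bsub>B ?q\<^esub>i\<in>?S. signed (B ?q) (word_degree (take i w)) (\<phi> N (p - 1) (pure_tensor K A (?u i))))" .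
 have "eqc K B (wd [(?q, \<phi> N (p - 1) (tensor_differential K A d (N + c) p (pure_tensor K A w)))])
   (\<Sum>i\<in>?S. ks (word_degree (take i w)) (wd [outer_letter K A c \<phi> (?u i)]))"
  unfolding eq
 proof (rule letter_signed_finsum[OF B _ fc])
  fix i assume i: "i \<in> ?S"
  have "outer_letter K A c \<phi> (?u i) = (?q, \<phi> N (p - 1) (pure_tensor K A (?u i)))"
   using hw[OF i] p by (simp add: outer_letter_def hw_iff)
  then show "eqc K B (wd [(?q, \<phi> N (p - 1) (pure_tensor K A (?u i)))]) (wd [outer_letter K A c \<phi> (?u i)])"
   by (simp add: eqc_refl[OF B])
 qed simp_all
 then have "eqc K B (wd [(?q, signed (B ?q) (N + 1) (\<phi> N (p - 1) (tensor_differential K A d (N + c) p (pure_tensor K A w))))])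
   (ks (N + 1) (\<Sum>i\<in>?S. ks (word_degree (take i w)) (wd [outer_letter K A c \<phi> (?u i)])))"
  by (intro eqc_trans[OF B letter_signed[OF B] eqc_ks[OF B]] linearD(1)[OF fl]
   linearD(1)[OF tensor_diff_linear[OF A d]] pure_closed[OF A w])
 also have "ks (N + 1) (\<Sum>i\<in>?S. ks (word_degree (take i w)) (wd [outer_letter K A c \<phi> (?u i)])) =
  ks c (outer_diff d (%w'. wd [outer_letter K A c \<phi> w']) w)"
 proof -
  have "ks (N + 1) (\<Sum>i\<in>?S. ks (word_degree (take i w)) (wd [outer_letter K A c \<phi> (?u i)])) =
   (\<Sum>i\<in>?S. ks c (ks (pw par (take i w) + (length w - 1 - i)) (wd [outer_letter K A c \<phi> (?u i)])))"
   unfolding ks_sum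
  proof (rule sum.cong[OF refl])
   fix i assume "i \<in> ?S"
   then have "i < N + c" using len by simp
   then obtain j where "N + c = i + 1 + j" using less_iff_Suc_add[of i "N + c"] by auto
   then show "ks (N + 1) (ks (word_degree (take i w)) (wd [outer_letter K A c \<phi> (?u i)])) =
    ks c (ks (pw par (take i w) + (length w - 1 - i)) (wd [outer_letter K A c \<phi> (?u i)]))"
    unfolding ks_simps len using len c by (intro ks_cong refl) (auto; presburger)
  qed
  also have "... = ks c (outer_diff d (%w'. wd [outer_letter K A c \<phi> w']) w)"
   unfolding outer_diff_def ks_sum by (rule sum.mono_neutral_cong_left) auto
  finally show ?thesis .
 qed
 finally show ?thesis .
qed

text \<open>The signs in \<open>t\<close> and \<open>m\<close> of the relations agree with the
  suspended ones up to the factor \<open>(-1)^(c+1)\<close>. It is opposite to that of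
  \<open>eqc_outer_diff\<close> because these terms stand on the other side of the relation.\<close>

lemma eqc_outer_prod:
 assumes w: "w \<in> hw A (N + c) p"
 shows "eqc K B (wd [(p + N - 1, \<Oplus>\<^bsub>B (p + N - 1)\<^esub>m\<in>{..<N}. \<Oplus>\<^bsub>B (p + N - 1)\<^esub>t\<in>{1..m + c}.
      signed (B (p + N - 1)) (t * (N - m) + N)
       (\<phi> m (p + (N - 1 - m))
        (tensor_map K A A
         (insert_factor K A (t - 1) (N - 1 - m + 2, N - 1 - m, \<pi> (N - 1 - m)) (m + c - t))
         p (pure_tensor K A w))))])
   (ks (c + 1) (outer_prod K A \<pi> N (%w'. wd [outer_letter K A c \<phi> w']) w))"
proof -
 let ?q = "p + N - 1"
 have len: "length w = N + c" and val: "valid A w" and deg: "word_degree w = p" using w by (simp_all add: hw_iff)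
 interpret M: module K "B ?q" by (rule gradedD(1)[OF B])
 let ?X = "%m t. \<phi> m (p + (N - 1 - m)) (tensor_map K A A
         (insert_factor K A (t - 1) (N - 1 - m + 2, N - 1 - m, \<pi> (N - 1 - m)) (m + c - t)) p (pure_tensor K A w))"
 let ?w' = "%m t. take (t - 1) w @ inner_letter K A \<pi> (take (N + 1 - m) (drop (t - 1) w)) # drop (t - 1 + (N + 1 - m)) w"
 have main: "?X m t \<in> carrier (B ?q) \<and> eqc K B (wd [(?q, ?X m t)])
   (ks ((N - 1 - m) * word_degree (take (t - 1) w)) (wd [outer_letter K A c \<phi> (?w' m t)]))"
  if m: "m < N" and t: "t \<in> {1..m + c}" for m t
 proof -
  define u where "u = take (t - 1) w"
  define x where "x = take (N + 1 - m) (drop (t - 1) w)"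
  define v where "v = drop (t - 1 + (N + 1 - m)) w"
  have le: "t - 1 + (N + 1 - m) \<le> length w" using m t len c by auto
  have lu: "length u = t - 1" and lx: "length x = N - 1 - m + 2" and lv: "length v = m + c - t"
   using le m t len by (auto simp: u_def x_def v_def)
  have split: "w = u @ x @ v"
   unfolding u_def x_def v_def by (metis add.commute append_take_drop_id drop_drop)
  have vals: "valid A u" "valid A x" "valid A v" using val unfolding split by auto
  have r: "m + c = length u + length v + 1" using lu lv t by auto
  have \<pi>': "\<pi> (N - 1 - m) \<in> graded_maps K A A (length x) (N - 1 - m)" using \<pi>[of "N - 1 - m"] lx by simp
  have xhw: "x \<in> hw A (N - 1 - m + 2) (word_degree x)" using vals lx by (simp add: hw_iff)
  have il: "inner_letter K A \<pi> x = (word_degree x + (N - 1 - m), \<pi> (N - 1 - m) (word_degree x) (pure_tensor K A x))"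
   by (simp add: inner_letter_def lx)
  have w': "u @ inner_letter K A \<pi> x # v \<in> hw A (m + c) (p + (N - 1 - m))"
   using vals r deg graded_pure_closed[OF A \<pi> xhw] unfolding split il by (simp add: hw_iff)
  have fl: "\<phi> m (p + (N - 1 - m)) \<in> linear_maps K (tensor_power K A (m + c) (p + (N - 1 - m))) (B ?q)"
   using graded_mapsD[OF \<phi>[of m], of "p + (N - 1 - m)"] m by simp
  have X: "?X m t = signed (B ?q) ((N - 1 - m) * word_degree u) (\<phi> m (p + (N - 1 - m)) (pure_tensor K A (u @ inner_letter K A \<pi> x # v)))"
   using tensor_map_insert[OF A \<pi>' vals(1,3,2) _ r, of p] deg
    linear_signed[OF fl tensor_module[OF A] gradedD(1)[OF B] pure_closed[OF A w']]
   unfolding split[symmetric] lu lx lv il by simp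
  have pc: "\<phi> m (p + (N - 1 - m)) (pure_tensor K A (u @ inner_letter K A \<pi> x # v)) \<in> carrier (B ?q)"
   by (rule linearD(1)[OF fl pure_closed[OF A w']])
  have ol: "outer_letter K A c \<phi> (u @ inner_letter K A \<pi> x # v) = (?q, \<phi> m (p + (N - 1 - m)) (pure_tensor K A (u @ inner_letter K A \<pi> x # v)))"
  proof -
   have "length (u @ inner_letter K A \<pi> x # v) = m + c" "word_degree (u @ inner_letter K A \<pi> x # v) = p + (N - 1 - m)"
    using w' by (simp_all only: hw_iff)
   then show ?thesis using m unfolding outer_letter_def by simp
  qed
  show ?thesis
   unfolding X u_def[symmetric] x_def[symmetric] v_def[symmetric] ol
   by (intro conjI signed_closed[OF gradedD(1)[OF B]] pc letter_signed[OF B])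
 qed
 have "eqc K B (wd [(?q, \<Oplus>\<^bsub>B ?q\<^esub>m\<in>{..<N}. \<Oplus>\<^bsub>B ?q\<^esub>t\<in>{1..m + c}. signed (B ?q) (t * (N - m) + N) (?X m t))])
  (\<Sum>m<N. \<Sum>t\<in>{1..m + c}. ks (t * (N - m) + N) (ks ((N - 1 - m) * word_degree (take (t - 1) w)) (wd [outer_letter K A c \<phi> (?w' m t)])))"
 proof (rule eqc_trans[OF B letter_finsum[OF B] eqc_sum[OF B letter_signed_finsum[OF B]]])
  fix m assume "m \<in> {..<N}"
  then show "(\<Oplus>\<^bsub>B ?q\<^esub>t\<in>{1..m + c}. signed (B ?q) (t * (N - m) + N) (?X m t)) \<in> carrier (B ?q)"
   using main by (intro M.finsum_closed Pi_I signed_closed[OF gradedD(1)[OF B]]) auto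
 qed (use main in auto)
 also have "(\<Sum>m<N. \<Sum>t\<in>{1..m + c}. ks (t * (N - m) + N) (ks ((N - 1 - m) * word_degree (take (t - 1) w)) (wd [outer_letter K A c \<phi> (?w' m t)]))) =
  ks (c + 1) (outer_prod K A \<pi> N (%w'. wd [outer_letter K A c \<phi> w']) w)"
  unfolding outer_prod_def ks_sum
 proof (rule sum.cong[OF refl])
  fix m assume m: "m \<in> {..<N}"
  then obtain k where N: "N = m + 1 + k" using less_iff_Suc_add[of m N] by auto
  show "(\<Sum>t\<in>{1..m + c}. ks (t * (N - m) + N) (ks ((N - 1 - m) * word_degree (take (t - 1) w)) (wd [outer_letter K A c \<phi> (?w' m t)]))) =
   (\<Sum>t\<in>{1..length w - (N - m)}. ks (c + 1) (ks ((N + 1 - m) * pw par (take (t - 1) w) + (length w - (t - 1) - (N + 1 - m))) (wd [outer_letter K A c \<phi> (?w' m t)])))"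
  proof (rule sum.cong)
   show "{1..m + c} = {1..length w - (N - m)}" using m len by auto
   fix t assume t: "t \<in> {1..length w - (N - m)}"
   then have "t \<le> m + c" "1 \<le> t" using m len by auto
   then obtain i j where ij: "t = i + 1" "m + c = i + 1 + j"
    using le_Suc_ex[of t "m + c"] le_Suc_ex[of 1 t] by auto
   have l: "length w = N + c" "length (take i w) = i" using len ij N by auto
   have e: "length w - (t - 1) - (N + 1 - m) = j" using l ij N by auto
   have "even (t * (N - m) + N + (N - 1 - m) * word_degree (take (t - 1) w)) =
    even (c + 1 + ((N + 1 - m) * pw par (take (t - 1) w) + j))"
   proof -
    have "even m = even (c + i + 1 + j)" using ij(2) by presburger
    moreover have "N - m = k + 1" "N - 1 - m = k" "N + 1 - m = k + 2" "t - 1 = i" using N ij by auto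
    ultimately show ?thesis using l(2) ij(1) N by (simp add: even_mult_iff) argo
   qed
   then show "ks (t * (N - m) + N) (ks ((N - 1 - m) * word_degree (take (t - 1) w)) (wd [outer_letter K A c \<phi> (?w' m t)])) =
    ks (c + 1) (ks ((N + 1 - m) * pw par (take (t - 1) w) + (length w - (t - 1) - (N + 1 - m))) (wd [outer_letter K A c \<phi> (?w' m t)]))"
    unfolding ks_simps e by (rule ks_cong) simp
  qed
 qed
 finally show ?thesis .
qed

end

text \<open>The counterpart of the case \<open>p = 0\<close> in the relations, where the
  differential term is replaced by 0.\<close>

lemma outer_diff_0:
 assumes "word_degree w = 0"
 shows "outer_diff d g w = 0"
 unfolding outer_diff_def
proof (rule sum.neutral, rule ballI)
 fix i assume "i \<in> {..<length w}"
 then have "fst (w ! i) \<le> word_degree w"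
  using elem_le_sum_list[of i "map fst w"] by (simp add: word_degree_def)
 then show "(if 0 < fst (w ! i) then
   ks (pw par (take i w) + (length w - 1 - i)) (g (w[i := (fst (w ! i) - 1, d (fst (w ! i)) (snd (w ! i)))])) else 0) = 0"
  using assms by simp
qed

lemma diff_moduleD:
 assumes "differential_module K A d"
 shows "module K (A n)" "d n \<in> linear_maps K (A n) (A (n - 1))"
  "a \<in> carrier (A 0) ==> d 0 a = \<zero>\<^bsub>A 0\<^esub>" "a \<in> carrier (A n) ==> d (n - 1) (d n a) = \<zero>\<^bsub>A (n - 1 - 1)\<^esub>"
 using assms unfolding differential_module_def by blast+

lemma opm_outer: "2 \<le> length w ==> opm K A d \<pi> w = ks (thx w) (wd [outer_letter K A 2 \<pi> w])"
 by (auto simp: opm_def outer_letter_def)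

lemma mop_outer: "1 \<le> length w ==> mop K A f w = ks (thx w) (wd [outer_letter K A 1 f w])"
 by (auto simp: mop_def outer_letter_def)

lemma eqc_outer_diff':
 assumes "graded K A" "graded K B" "differential_module K A d" "!!n. \<pi> n \<in> graded_maps K A A (n + 2) n"
  "c = 1 \<or> c = 2" "!!n. \<phi> n \<in> graded_maps K A B (n + c) n" and w: "w \<in> hw A (N + c) p"
 shows "eqc K B (wd [(p + N - 1, if p = 0 then \<zero>\<^bsub>B (p + N - 1)\<^esub> else
   signed (B (p + N - 1)) (N + 1) (\<phi> N (p - 1) (tensor_differential K A d (N + c) p (pure_tensor K A w))))])
   (ks c (outer_diff d (%w'. wd [outer_letter K A c \<phi> w']) w))"
proof (cases "p = 0")
 case True
 then show ?thesis using w letter_zero[OF assms(2)] by (simp add: outer_diff_0 hw_iff)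
next
 case False
 show ?thesis
  unfolding if_not_P[OF False] by (rule eqc_outer_diff[OF assms]) (use False in simp)
qed

lemma opm_opm:
 assumes "2 \<le> length w" "length w = N + 2" "word_degree w = p"
 shows "ext (opm K A d \<pi>) (ks (thx w) (wd [(p + N, a)])) = ks (thx w) (dletter d (p + N, a))"
 by (simp add: opm_def)

lemma outer_diff_closed:
 assumes A: "graded K A" and d: "differential_module K A d" and \<phi>: "!!n. \<phi> n \<in> graded_maps K A B (n + c) n"
  and B: "graded K B" and w: "w \<in> hw A (N + c) p"
 shows "(if p = 0 then \<zero>\<^bsub>B (p + N - 1)\<^esub> else
   signed (B (p + N - 1)) (N + 1) (\<phi> N (p - 1) (tensor_differential K A d (N + c) p (pure_tensor K A w)))) \<in> carrier (B (p + N - 1))"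
proof -
 interpret M: module K "B (p + N - 1)" by (rule gradedD(1)[OF B])
 have "\<phi> N (p - 1) (tensor_differential K A d (N + c) p (pure_tensor K A w)) \<in> carrier (B (p + N - 1))" if "p ~= 0"
  using linearD(1)[OF graded_mapsD[OF \<phi>[of N], of "p - 1"] linearD(1)[OF tensor_diff_linear[OF A d] pure_closed[OF A w]]] that
  by simp
 moreover have "\<zero>\<^bsub>B n\<^esub> \<in> carrier (B n)" for n
  using gradedD(1)[OF B, of n] by (simp add: module_def abelian_group_def abelian_monoid.zero_closed)
 ultimately show ?thesis
  by (cases "p = 0") (simp_all only: if_True if_False refl signed_closed[OF gradedD(1)[OF B]] simp_thms)
qed

text \<open>On one letter this is the square of \<open>d\<close>; on \<open>N + 2\<close> letters it
  is the relation with index \<open>N\<close>, up to the sign \<open>thx w\<close>.\<close>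

lemma A_infinity_algebra_relation:
 assumes A: "graded K A" and inf: "A_infinity_algebra K A d \<pi>" and w: "valid A w" "w ~= []"
 shows "eqc K A (ext (opm K A d \<pi>) (delta par (opm K A d \<pi>) w)) 0"
proof (cases "length w = 1")
 have d: "differential_module K A d" using inf by (simp add: A_infinity_algebra_def)
 case True
 then obtain q a where l: "w = [(q, a)]" by (metis (no_types, opaque_lifting) One_nat_def length_0_conv length_Suc_conv surj_pair)
 have a: "a \<in> carrier (A q)" using w by (simp add: l)
 have "delta par (opm K A d \<pi>) w = dletter d (q, a)"
  by (simp add: l delta_def SS_Cons opm_def)
 moreover have "eqc K A (ext (opm K A d \<pi>) (dletter d (q, a))) 0"
  using diff_moduleD(4)[OF d a] letter_zero[OF A, of "q - 1 - 1"] eqc_refl[OF A, of 0]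
  by (auto simp: dletter_def opm_def)
 ultimately show ?thesis by simp
next
 have d: "differential_module K A d" and \<pi>: "!!n. \<pi> n \<in> graded_maps K A A (n + 2) n"
  using inf by (simp_all add: A_infinity_algebra_def)
 case False
 with w(2) have len2: "2 \<le> length w" by (cases w) (auto simp: Suc_le_eq)
 then obtain N where N: "length w = N + 2" by (metis add.commute le_Suc_ex)
 define p where "p = word_degree w"
 have hw: "w \<in> hw A (N + 2) p" using N w by (simp add: hw_iff p_def)
 let ?q = "p + N - 1" and ?x = "pure_tensor K A w" and ?o = "opm K A d \<pi>" and ?g = "%w'. wd [outer_letter K A 2 \<pi> w']"
 interpret M: module K "A ?q" by (rule gradedD(1)[OF A])
 note \<pi>2 = \<pi>
 define X where "X = (if p = 0 then \<zero>\<^bsub>A ?q\<^esub> else signed (A ?q) (N + 1) (\<pi> N (p - 1) (tensor_differential K A d (N + 2) p ?x)))"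
 define E where "E = (\<Oplus>\<^bsub>A ?q\<^esub>m\<in>{..<N}. \<Oplus>\<^bsub>A ?q\<^esub>t\<in>{1..m + 2}. signed (A ?q) (t * (N - m) + N)
   (\<pi> m (p + (N - 1 - m)) (tensor_map K A A (insert_factor K A (t - 1) (N - 1 - m + 2, N - 1 - m, \<pi> (N - 1 - m)) (m + 2 - t)) p ?x)))"
 have xc: "?x \<in> carrier (tensor_power K A (N + 2) p)" by (rule pure_closed[OF A hw])
 have Dc: "d (p + N) (\<pi> N p ?x) \<in> carrier (A ?q)"
  by (rule linearD(1)[OF diff_moduleD(2)[OF d] graded_pure_closed[OF A \<pi> hw]])
 have Xc: "X \<in> carrier (A ?q)" unfolding X_def by (rule outer_diff_closed[OF A d \<pi> A hw])
 have rel: "d (p + N) (\<pi> N p ?x) \<oplus>\<^bsub>A ?q\<^esub> X = E"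
  using inf xc unfolding A_infinity_algebra_def Let_def X_def E_def by blast
 have eX: "eqc K A (wd [(?q, X)]) (outer_diff d ?g w)"
  using eqc_outer_diff'[OF A A d \<pi> _ \<pi>2 hw] unfolding X_def by (simp add: ks_def)
 have eE: "eqc K A (wd [(?q, E)]) (- outer_prod K A \<pi> N ?g w)"
  using eqc_outer_prod[OF A A d \<pi> _ \<pi>2 hw] unfolding E_def by (simp add: ks_def)
 have main: "eqc K A (outer_diff d ?g w + outer_prod K A \<pi> N ?g w + dletter d (p + N, \<pi> N p ?x)) 0"
 \<comment> \<open>For \<open>p + N = 0\<close> the relation belongs to degree -1, which the
   truncated index represents by degree 0. In this case all three chains are zero and the relation
   is not consulted.\<close>
 proof (cases "p + N = 0")
  case True
  then show ?thesis using hw eqc_refl[OF A, of 0] by (simp add: outer_diff_0 hw_iff outer_prod_def dletter_def)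
 next
  case False
  then have dl: "dletter d (p + N, \<pi> N p ?x) = wd [(?q, d (p + N) (\<pi> N p ?x))]" by (simp only: dletter_def fst_conv snd_conv False if_False)
  have "eqc K A (wd [(?q, E)]) (wd [(?q, d (p + N) (\<pi> N p ?x))] + wd [(?q, X)])"
   unfolding rel[symmetric] by (rule letter_add[OF A Dc Xc])
  from eqc_trans[OF A eqc_sym[OF A this] eE]
  have "eqc K A (wd [(?q, d (p + N) (\<pi> N p ?x))] + wd [(?q, X)]) (- outer_prod K A \<pi> N ?g w)" .
  from eqc_trans[OF A eqc_add[OF A eqc_refl[OF A] eqc_sym[OF A eX]] this] show ?thesis
   unfolding dl by (simp add: eqc_def add_ac)
 qed
 have "ext ?o (delta par ?o w) = ks (thx w) (outer_diff d ?g w + outer_prod K A \<pi> N ?g w) + ext ?o (?o w)"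
  using ext_outer_delta[of 2 ?o ?g w N K A d \<pi>] N by (simp add: opm_outer)
 also have "ext ?o (?o w) = ks (thx w) (dletter d (p + N, \<pi> N p ?x))"
  using opm_opm[OF len2 N p_def[symmetric]] len2 N by (simp add: opm_outer outer_letter_def p_def)
 finally show ?thesis using eqc_ks[OF A main, of "thx w"] by (simp add: ks_arith)
qed

text \<open>\<open>bar\<close> is sorted by the number of blocks: one block gives the differential
  of \<open>f N\<close>, and \<open>m + 2\<close> blocks give the terms with
  \<open>\<pi>' m\<close>. The terms with \<open>\<pi>\<close> come from
  \<open>delta\<close>.\<close>

lemma A_infinity_morphism_relation:
 assumes A: "graded K A" and B: "graded K B" and d: "differential_module K A d"
  and \<pi>: "!!n. \<pi> n \<in> graded_maps K A A (n + 2) n" and d': "differential_module K B d'"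
  and \<pi>': "!!n. \<pi>' n \<in> graded_maps K B B (n + 2) n"
  and mor: "A_infinity_morphism K A d \<pi> B d' \<pi>' f" and w: "valid A w" "w ~= []"
 shows "eqc K B (ext (opm K B d' \<pi>') (bar (mop K A f) w)) (ext (mop K A f) (delta par (opm K A d \<pi>) w))"
proof -
 have f: "!!n. f n \<in> graded_maps K A B (n + 1) n" using mor by (simp add: A_infinity_morphism_def)
 obtain N where N: "length w = N + 1" using w(2) by (cases w) auto
 define p where "p = word_degree w"
 have hw: "w \<in> hw A (N + 1) p" using N w by (simp add: hw_iff p_def)
 let ?q = "p + N - 1" and ?x = "pure_tensor K A w" and ?g = "%w'. wd [outer_letter K A 1 f w']"
 let ?o = "opm K B d' \<pi>'" and ?Ph = "mop K A f"
 note Bq = gradedD(1)[OF B, of ?q]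
 interpret M: module K "B ?q" by (rule Bq)
 note f1 = f
 define D where "D = d' (p + N) (f N p ?x)"
 define X where "X = (if p = 0 then \<zero>\<^bsub>B ?q\<^esub> else signed (B ?q) (N + 1) (f N (p - 1) (tensor_differential K A d (N + 1) p ?x)))"
 define E3 where "E3 = (\<Oplus>\<^bsub>B ?q\<^esub>m\<in>{..<N}. \<Oplus>\<^bsub>B ?q\<^esub>t\<in>{1..m + 1}. signed (B ?q) (t * (N - m) + N)
   (f m (p + (N - 1 - m)) (tensor_map K A A (insert_factor K A (t - 1) (N - 1 - m + 2, N - 1 - m, \<pi> (N - 1 - m)) (m + 1 - t)) p ?x)))"
 let ?Y = "%m ns. \<pi>' m (p + (N - 1 - m)) (tensor_map K A B (morphism_factors f ns) p ?x)"
 define E4 where "E4 = (\<Oplus>\<^bsub>B ?q\<^esub>m\<in>{..<N}. \<Oplus>\<^bsub>B ?q\<^esub>ns\<in>compositions (N - 1 - m) (m + 2). signed (B ?q) (eps ns) (?Y m ns))"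
 have xc: "?x \<in> carrier (tensor_power K A (N + 1) p)" by (rule pure_closed[OF A hw])
 have rel: "D \<oplus>\<^bsub>B ?q\<^esub> X = E3 \<ominus>\<^bsub>B ?q\<^esub> E4"
  using mor xc unfolding A_infinity_morphism_def Let_def D_def X_def E3_def E4_def by blast
 have Dc: "D \<in> carrier (B ?q)" unfolding D_def
  by (rule linearD(1)[OF diff_moduleD(2)[OF d'] graded_pure_closed[OF A f hw]])
 have Xc: "X \<in> carrier (B ?q)" unfolding X_def by (rule outer_diff_closed[OF A d f B hw])
 have eX: "eqc K B (wd [(?q, X)]) (- outer_diff d ?g w)"
  using eqc_outer_diff'[OF A B d \<pi> _ f1 hw] unfolding X_def by (simp add: ks_def)
 have eE3: "eqc K B (wd [(?q, E3)]) (outer_prod K A \<pi> N ?g w)"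
  using eqc_outer_prod[OF A B d \<pi> _ f1 hw] unfolding E3_def by (simp add: ks_def)
 define G where "G = (%m ns. ks (koszul_exponent (morphism_factors f ns) w)
   (wd [(?q, \<pi>' m (p + (N - 1 - m)) (pure_tensor K B (factors_apply K A (morphism_factors f ns) w)))]))"
 have Y: "?Y m ns \<in> carrier (B ?q) \<and> eqc K B (wd [(?q, ?Y m ns)]) (G m ns)"
  and Gx: "ext ?o (ks (block_thx ns w) (wd (factors_apply K A (morphism_factors f ns) w))) = ks (thx w) (ks (eps ns) (G m ns))"
  if m: "m < N" and ns: "ns \<in> compositions (N - 1 - m) (m + 2)" for m ns
 proof -
  let ?F = "factors_apply K A (morphism_factors f ns) w"
  have l: "length ns = m + 2" "sum_list ns = N - 1 - m" using ns by (simp_all add: compositions_def)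
  have lw: "length w = sum_list ns + length ns" using l m N by simp
  have ok: "factors_ok K A B (morphism_factors f ns)" by (rule morphism_factors_ok[OF f])
  have F: "?F \<in> hw B (m + 2) (p + (N - 1 - m))"
   using factors_apply_hw[OF A ok _ w(1)] lw l by (simp add: p_def)
  have hw': "w \<in> hw A (factors_arity (morphism_factors f ns)) p" using hw lw N by simp
  have t: "tensor_map K A B (morphism_factors f ns) p ?x =
   signed (tensor_power K B (m + 2) (p + (N - 1 - m))) (koszul_exponent (morphism_factors f ns) w) (pure_tensor K B ?F)"
   using tensor_map_pure[OF A B ok hw'] l by simp
  have lin: "\<pi>' m (p + (N - 1 - m)) \<in> linear_maps K (tensor_power K B (m + 2) (p + (N - 1 - m))) (B ?q)"
   using graded_mapsD[OF \<pi>'[of m], of "p + (N - 1 - m)"] m by simp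
  have pc: "\<pi>' m (p + (N - 1 - m)) (pure_tensor K B ?F) \<in> carrier (B ?q)"
   by (rule linearD(1)[OF lin pure_closed[OF B F]])
  have Yeq: "?Y m ns = signed (B ?q) (koszul_exponent (morphism_factors f ns) w) (\<pi>' m (p + (N - 1 - m)) (pure_tensor K B ?F))"
   unfolding t by (rule linear_signed[OF lin tensor_module[OF B] Bq pure_closed[OF B F]])
  show "?Y m ns \<in> carrier (B ?q) \<and> eqc K B (wd [(?q, ?Y m ns)]) (G m ns)"
   unfolding Yeq G_def using letter_signed[OF B pc] signed_closed[OF Bq pc] by blast
  have FF: "length ?F = m + 2" "word_degree ?F = p + (N - 1 - m)" using F by (simp_all only: hw_iff)
  have "?o ?F = ks (thx ?F) (wd [outer_letter K B 2 \<pi>' ?F])" by (rule opm_outer) (simp only: FF)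
  also have "outer_letter K B 2 \<pi>' ?F = (?q, \<pi>' m (p + (N - 1 - m)) (pure_tensor K B ?F))"
   unfolding outer_letter_def FF using m by simp
  finally have oF: "?o ?F = ks (thx ?F) (wd [(?q, \<pi>' m (p + (N - 1 - m)) (pure_tensor K B ?F))])" .
  have "even (block_thx ns w + thx ?F) = even (thx w + (eps ns + koszul_exponent (morphism_factors f ns) w))"
   using block_sign[OF lw, of K A f] by simp argo
  then show "ext ?o (ks (block_thx ns w) (wd ?F)) = ks (thx w) (ks (eps ns) (G m ns))"
   unfolding G_def ext_ks ext_wd oF ks_simps by (rule ks_cong) (rule refl)
 qed
 have eE4: "eqc K B (wd [(?q, E4)]) (\<Sum>m<N. \<Sum>ns\<in>compositions (N - 1 - m) (m + 2). ks (eps ns) (G m ns))"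
  unfolding E4_def
 proof (rule eqc_trans[OF B letter_finsum[OF B] eqc_sum[OF B letter_signed_finsum[OF B]]])
  fix m assume "m \<in> {..<N}"
  then show "(\<Oplus>\<^bsub>B ?q\<^esub>ns\<in>compositions (N - 1 - m) (m + 2). signed (B ?q) (eps ns) (?Y m ns)) \<in> carrier (B ?q)"
   using Y by (intro M.finsum_closed Pi_I signed_closed[OF Bq]) auto
 qed (use Y in \<open>auto simp: finite_compositions\<close>)
 have E3c: "E3 \<in> carrier (B ?q)" unfolding E3_def
 proof (intro M.finsum_closed Pi_I signed_closed[OF Bq])
  fix m t assume m: "m \<in> {..<N}" and t: "t \<in> {1..m + 1}"
  have lin: "f m (p + (N - 1 - m)) \<in> linear_maps K (tensor_power K A (m + 1) (p + (N - 1 - m))) (B ?q)"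
   using graded_mapsD[OF f[of m], of "p + (N - 1 - m)"] m by simp
  have ok: "factors_ok K A A (insert_factor K A (t - 1) (N - 1 - m + 2, N - 1 - m, \<pi> (N - 1 - m)) (m + 1 - t))"
   by (rule insert_factor_ok[OF A \<pi>])
  have ar: "factors_arity (insert_factor K A (t - 1) (N - 1 - m + 2, N - 1 - m, \<pi> (N - 1 - m)) (m + 1 - t)) = N + 1"
   using m t by (simp add: insert_factor_simps)
  have ln: "length (insert_factor K A (t - 1) (N - 1 - m + 2, N - 1 - m, \<pi> (N - 1 - m)) (m + 1 - t)) = m + 1"
   using m t by (simp add: insert_factor_simps)
  have dg: "factors_degree (insert_factor K A (t - 1) (N - 1 - m + 2, N - 1 - m, \<pi> (N - 1 - m)) (m + 1 - t)) = N - 1 - m"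
   by (simp add: insert_factor_simps)
  show "f m (p + (N - 1 - m)) (tensor_map K A A (insert_factor K A (t - 1) (N - 1 - m + 2, N - 1 - m, \<pi> (N - 1 - m)) (m + 1 - t)) p ?x) \<in> carrier (B ?q)"
   using linearD(1)[OF lin linearD(1)[OF tensor_map_linear[OF A A ok, of p, unfolded ar ln dg] xc]] .
 qed
 have E4c: "E4 \<in> carrier (B ?q)" unfolding E4_def
  using Y by (intro M.finsum_closed Pi_I signed_closed[OF Bq]) auto
 define S4 where "S4 = (\<Sum>m<N. \<Sum>ns\<in>compositions (N - 1 - m) (m + 2). ks (eps ns) (G m ns))"
 have main: "eqc K B (dletter d' (p + N, f N p ?x) + S4) (outer_diff d ?g w + outer_prod K A \<pi> N ?g w)"
 proof (cases "p + N = 0")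
  case True
  then show ?thesis using hw eqc_refl[OF B, of 0] by (simp add: outer_diff_0 hw_iff outer_prod_def dletter_def S4_def)
 next
  case False
  then have dl: "dletter d' (p + N, f N p ?x) = wd [(?q, D)]" by (simp only: dletter_def fst_conv snd_conv False if_False D_def)
  have 1: "eqc K B (wd [(?q, E3)] - wd [(?q, E4)]) (wd [(?q, D)] + wd [(?q, X)])"
   by (rule eqc_trans[OF B eqc_sym[OF B letter_diff[OF B E3c E4c]]]) (unfold rel[symmetric], rule letter_add[OF B Dc Xc])
  have 2: "eqc K B (outer_prod K A \<pi> N ?g w - S4) (wd [(?q, D)] - outer_diff d ?g w)"
   using eqc_trans[OF B eqc_sym[OF B eqc_diff[OF B eE3 eE4]] eqc_trans[OF B 1 eqc_add[OF B eqc_refl[OF B] eX]]]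
   by (simp add: S4_def)
  show ?thesis
   unfolding dl using eqc_sym[OF B 2] by (simp add: eqc_def algebra_simps)
 qed
 have "ext ?o (bar ?Ph w) = ext ?o (?Ph w) + (\<Sum>m<N. ext ?o (tens_pow ?Ph (m + 2) w))"
 proof -
  \<comment> \<open>The summand without blocks vanishes because \<open>w\<close> is
    nonempty.\<close>
  have "{..length w} = insert 0 (insert 1 {2..N + 1})" using N by auto
  then have "bar ?Ph w = tens_pow ?Ph 0 w + (tens_pow ?Ph 1 w + (\<Sum>r\<in>{2..N + 1}. tens_pow ?Ph r w))"
   by (simp add: bar_def)
  moreover have "(\<Sum>r\<in>{2..N + 1}. tens_pow ?Ph r w) = (\<Sum>m<N. tens_pow ?Ph (m + 2) w)"
  proof (rule sum.reindex_bij_witness[of _ "%m. m + 2" "%r. r - 2"])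
   fix r assume "r \<in> {2..N + 1}"
   then show "tens_pow ?Ph (r - 2 + 2) w = tens_pow ?Ph r w" by (simp only: atLeastAtMost_iff le_add_diff_inverse2)
  qed auto
  moreover have "tens_pow ?Ph 1 w = ?Ph w"
  proof -
   have "tens_pow ?Ph 1 w = SS w (%x y. if y = [] then ?Ph x else 0)"
    unfolding One_nat_def by (simp, rule SS_congI) simp
   also have "... = ?Ph w + SS w (%x y. if y = [] then 0 else if y = [] then ?Ph x else 0)"
    by (subst SS_right_Nil) simp
   also have "SS w (%x y. if y = [] then 0 else if y = [] then ?Ph x else 0) = 0"
    by (rule trans[OF SS_congI SS_zero]) simp
   finally show ?thesis by simp
  qed
  ultimately show ?thesis using w(2) by (simp add: ext_arith ext_sum)
 qed
 also have "ext ?o (?Ph w) = ks (thx w) (dletter d' (p + N, f N p ?x))"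
  using N by (auto simp: mop_def opm_def p_def)
 also have "(\<Sum>m<N. ext ?o (tens_pow ?Ph (m + 2) w)) = ks (thx w) S4"
  unfolding S4_def ks_sum
 proof (rule sum.cong[OF refl])
  fix m assume m: "m \<in> {..<N}"
  then have lw: "length w = (N - 1 - m) + (m + 2)" using N by auto
  show "ext ?o (tens_pow ?Ph (m + 2) w) = (\<Sum>ns\<in>compositions (N - 1 - m) (m + 2). ks (thx w) (ks (eps ns) (G m ns)))"
   unfolding tens_pow_compositions[OF lw] ext_sum by (rule sum.cong[OF refl]) (use m in \<open>auto intro!: Gx[simplified]\<close>)
 qed
 finally have L: "ext ?o (bar ?Ph w) = ks (thx w) (dletter d' (p + N, f N p ?x) + S4)" by (simp only: ks_arith)
 have R: "ext ?Ph (delta par (opm K A d \<pi>) w) = ks (thx w) (outer_diff d ?g w + outer_prod K A \<pi> N ?g w)"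
  using ext_outer_delta[of 1 ?Ph ?g w N K A d \<pi>] N by (simp add: mop_outer)
 show ?thesis unfolding L R by (rule eqc_ks[OF B main])
qed

text \<open>The relation for \<open>N = 0\<close> says that \<open>\<mu>\<close> is a chain map, the
  one for \<open>N = 1\<close> that it is associative; for \<open>N \<ge> 2\<close> every term
  contains a vanishing operation.\<close>

lemma assoc_as_A_infinity_algebra:
 assumes A: "graded K A" and a: "assoc_differential_algebra K A d \<mu>"
 shows "A_infinity_algebra K A d (assoc_as_A_infinity A \<mu>)"
proof -
 let ?\<pi> = "assoc_as_A_infinity A \<mu>"
 have d: "differential_module K A d" and \<mu>: "\<mu> \<in> graded_maps K A A 2 0"
  and ch: "!!p x. x \<in> carrier (tensor_power K A 2 p) ==> d p (\<mu> p x) = \<mu> (p - 1) (tensor_differential K A d 2 p x)"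
  and as: "!!p x. x \<in> carrier (tensor_power K A 3 p) ==>
    \<mu> p (tensor_map K A A (insert_factor K A 0 (2, 0, \<mu>) 1) p x) =
    \<mu> p (tensor_map K A A (insert_factor K A 1 (2, 0, \<mu>) 0) p x)"
  using a unfolding assoc_differential_algebra_def by blast+
 have p0: "?\<pi> 0 = \<mu>" by (simp add: assoc_as_A_infinity_def fun_eq_iff)
 have pn: "?\<pi> n p x = \<zero>\<^bsub>A (p + n)\<^esub>" if "n ~= 0" for n p x using that by (simp add: assoc_as_A_infinity_def)
 have \<pi>: "?\<pi> n \<in> graded_maps K A A (n + 2) n" for n
 proof (cases "n = 0")
  case True
  then show ?thesis using \<mu> by (simp add: p0 numeral_2_eq_2)
 next
  case False
  show ?thesis
   unfolding graded_maps_def assoc_as_A_infinity_def mem_Collect_eq if_not_P[OF False]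
   by (intro allI zero_linear gradedD(1)[OF A])
 qed
 \<comment> \<open>Here the inner operation vanishes. A tensor product of maps is known by its
   values on pure tensors, so its vanishing is checked on words, where one factor becomes 0.\<close>
 have Z: "\<mu> (p + (N - 1)) (tensor_map K A A (insert_factor K A (t - 1) (N + 1, N - 1, ?\<pi> (N - 1)) (2 - t)) p x) = \<zero>\<^bsub>A (p + (N - 1))\<^esub>"
  if N: "2 \<le> N" and t: "t \<in> {1..2}" and x: "x \<in> carrier (tensor_power K A (N + 2) p)" for N p t x
 proof -
  let ?F = "insert_factor K A (t - 1) (N + 1, N - 1, ?\<pi> (N - 1)) (2 - t)"
  let ?T = "tensor_power K A 2 (p + (N - 1))"
  have \<pi>N: "?\<pi> (N - 1) \<in> graded_maps K A A (N + 1) (N - 1)" using \<pi>[of "N - 1"] N by (simp add: eval_nat_numeral)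
  have F: "factors_arity ?F = N + 2" "length ?F = 2" "factors_degree ?F = N - 1" using t by (auto simp: insert_factor_simps)
  have lin: "tensor_map K A A ?F p \<in> linear_maps K (tensor_power K A (N + 2) p) ?T"
   using tensor_map_linear[OF A A insert_factor_ok[OF A \<pi>N, of "t - 1" "2 - t"], of p] unfolding F .
  have "tensor_map K A A ?F p x = \<zero>\<^bsub>?T\<^esub>"
  proof (rule tensor_linear_eqI[OF A tensor_module[OF A] lin zero_linear[OF tensor_module[OF A]] _ x])
   fix w assume w: "w \<in> hw A (N + 2) p"
   define u where "u = take (t - 1) w"
   define y where "y = take (N + 1) (drop (t - 1) w)"
   define v where "v = drop (t - 1 + (N + 1)) w"
   have s: "w = u @ y @ v" unfolding u_def y_def v_def by (metis add.commute append_take_drop_id drop_drop)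
   have l: "length u = t - 1" "length y = N + 1" "length v = 2 - t"
    using w t by (auto simp: u_def y_def v_def hw_iff)
   have v: "valid A u" "valid A y" "valid A v" using w unfolding s by (auto simp: hw_iff)
   have r: "2 = length u + length v + 1" using l t by auto
   have \<pi>y: "?\<pi> (N - 1) \<in> graded_maps K A A (length y) (N - 1)" using \<pi>N l by simp
   have dg: "word_degree (u @ y @ v) = p" using w unfolding s by (simp add: hw_iff)
   have "tensor_map K A A ?F p (pure_tensor K A w) = signed ?T ((N - 1) * word_degree u)
     (pure_tensor K A (u @ (word_degree y + (N - 1), ?\<pi> (N - 1) (word_degree y) (pure_tensor K A y)) # v))"
    using tensor_map_insert[OF A \<pi>y v(1,3,2) dg r] unfolding s l .
   also have "?\<pi> (N - 1) (word_degree y) (pure_tensor K A y) = \<zero>\<^bsub>A (word_degree y + (N - 1))\<^esub>" using N by (intro pn) simp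
   also have "pure_tensor K A (u @ (word_degree y + (N - 1), \<zero>\<^bsub>A (word_degree y + (N - 1))\<^esub>) # v) = \<zero>\<^bsub>?T\<^esub>"
    by (rule linear_zero[OF pure_slot_linear[OF A r[symmetric] _ v(1,3)] gradedD(1)[OF A] tensor_module[OF A]])
     (use dg in simp)
   finally show "tensor_map K A A ?F p (pure_tensor K A w) = \<zero>\<^bsub>?T\<^esub>" by (simp add: signed_zero[OF tensor_module[OF A]])
  qed
  then show ?thesis
   using linear_zero[OF graded_mapsD[OF \<mu>, of "p + (N - 1)"] tensor_module[OF A] gradedD(1)[OF A]] by simp
 qed
 show ?thesis
  unfolding A_infinity_algebra_def
 proof (intro conjI allI ballI)
  show "differential_module K A d" by (rule d)
  show "?\<pi> n \<in> graded_maps K A A (n + 2) n" for n by (rule \<pi>)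
  fix N p x assume x: "x \<in> carrier (tensor_power K A (N + 2) p)"
  interpret M: module K "A (p + N - 1)" by (rule gradedD(1)[OF A])
  let ?M = "A (p + N - 1)"
  have td: "tensor_differential K A d (N + 2) p x \<in> carrier (tensor_power K A (N + 2) (p - 1))"
   by (rule linearD(1)[OF tensor_diff_linear[OF A d] x])
  consider "N = 0" | "1 \<le> N" by linarith
  then have "d (p + N) (?\<pi> N p x) \<oplus>\<^bsub>?M\<^esub> (if p = 0 then \<zero>\<^bsub>?M\<^esub> else
    signed ?M (N + 1) (?\<pi> N (p - 1) (tensor_differential K A d (N + 2) p x))) =
   (\<Oplus>\<^bsub>?M\<^esub>m\<in>{..<N}. \<Oplus>\<^bsub>?M\<^esub>t\<in>{1..m + 2}. signed ?M (t * (N - m) + N)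
       (?\<pi> m (p + (N - 1 - m)) (tensor_map K A A
         (insert_factor K A (t - 1) (N - 1 - m + 2, N - 1 - m, ?\<pi> (N - 1 - m)) (m + 2 - t)) p x)))"
  proof cases
   case 1
   have x2: "x \<in> carrier (tensor_power K A 2 p)" using x 1 by (simp add: numeral_2_eq_2)
   have mc: "\<mu> p x \<in> carrier (A p)" using linearD(1)[OF graded_mapsD[OF \<mu>] x2] by simp
   have dc: "d p (\<mu> p x) \<in> carrier (A (p - 1))" by (rule linearD(1)[OF diff_moduleD(2)[OF d] mc])
   have z: "(\<Oplus>\<^bsub>A n\<^esub>m\<in>{}. h m) = \<zero>\<^bsub>A n\<^esub>" "\<zero>\<^bsub>A n\<^esub> \<oplus>\<^bsub>A n\<^esub> \<zero>\<^bsub>A n\<^esub> = \<zero>\<^bsub>A n\<^esub>" for n and h :: "nat => _"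
   proof -
    interpret P: module K "A n" by (rule gradedD(1)[OF A])
    show "(\<Oplus>\<^bsub>A n\<^esub>m\<in>{}. h m) = \<zero>\<^bsub>A n\<^esub>" "\<zero>\<^bsub>A n\<^esub> \<oplus>\<^bsub>A n\<^esub> \<zero>\<^bsub>A n\<^esub> = \<zero>\<^bsub>A n\<^esub>" by simp_all
   qed
   show ?thesis
   proof (cases "p = 0")
    case True
    then show ?thesis using 1 diff_moduleD(3)[OF d, of "\<mu> 0 x"] mc by (simp add: p0 z)
   next
    case False
    have "d p (\<mu> p x) \<oplus>\<^bsub>A (p - 1)\<^esub> \<ominus>\<^bsub>A (p - 1)\<^esub> d p (\<mu> p x) = \<zero>\<^bsub>A (p - 1)\<^esub>"
     by (rule abelian_group.r_neg[OF module.axioms(2)[OF gradedD(1)[OF A]] dc])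
    then show ?thesis using 1 False ch[OF x2] by (simp add: p0 signed_def numeral_2_eq_2 z)
   qed
  next
   case 2
   have dz: "d (p + N) \<zero>\<^bsub>A (p + N)\<^esub> = \<zero>\<^bsub>?M\<^esub>"
    using linear_zero[OF diff_moduleD(2)[OF d, of "p + N"]] gradedD(1)[OF A] by simp
   have pz: "p ~= 0 ==> A (p - 1 + N) = ?M" by (cases p) auto
   have "(\<Oplus>\<^bsub>?M\<^esub>t\<in>{1..m + 2}. signed ?M (t * (N - m) + N)
       (?\<pi> m (p + (N - 1 - m)) (tensor_map K A A
         (insert_factor K A (t - 1) (N - 1 - m + 2, N - 1 - m, ?\<pi> (N - 1 - m)) (m + 2 - t)) p x))) = \<zero>\<^bsub>?M\<^esub>"
    if m: "m \<in> {..<N}" for m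
   \<comment> \<open>The two terms \<open>t = 1\<close> and \<open>t = 2\<close> are the two
     bracketings, with opposite signs.\<close>
   proof (cases "N = 1")
    case True
    with m have m0: "m = 0" by simp
    interpret P: module K "A p" by (rule gradedD(1)[OF A])
    have x3: "x \<in> carrier (tensor_power K A 3 p)" using x True by (simp add: numeral_3_eq_3)
    define h where "h t = signed (A p) (t + 1) (\<mu> p (tensor_map K A A (insert_factor K A (t - 1) (2, 0, \<mu>) (2 - t)) p x))" for t :: nat
    let ?a = "\<mu> p (tensor_map K A A (insert_factor K A 0 (2, 0, \<mu>) 1) p x)"
    have "tensor_map K A A (insert_factor K A 0 (2, 0, \<mu>) 1) p \<in> linear_maps K (tensor_power K A 3 p) (tensor_power K A 2 p)"
     using tensor_map_linear[OF A A insert_factor_ok[OF A \<mu>, of 0 1], of p]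
     by (simp add: insert_factor_simps eval_nat_numeral)
    then have ac: "?a \<in> carrier (A p)"
     using linearD(1)[OF graded_mapsD[OF \<mu>, of p] linearD(1)[OF _ x3]] by simp
    have h: "h 1 = ?a" "h 2 = \<ominus>\<^bsub>A p\<^esub> ?a" using as[OF x3] by (simp_all add: h_def signed_def)
    have "{1..2 :: nat} = {1, 2}" by auto
    then have "(\<Oplus>\<^bsub>A p\<^esub>t\<in>{1..2}. h t) = h 1 \<oplus>\<^bsub>A p\<^esub> h 2"
     using ac by (simp add: P.finsum_insert h[simplified])
    also have "... = \<zero>\<^bsub>A p\<^esub>" unfolding h by (rule P.r_neg[OF ac])
    finally show ?thesis unfolding h_def True m0 by (simp add: p0 numeral_2_eq_2)
   next
    case False
    then have N2: "2 \<le> N" using 2 by simp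
    show ?thesis
    proof (rule M.add.finprod_one_eqI)
    fix t assume t: "t \<in> {1..m + 2}"
    have "?\<pi> m (p + (N - 1 - m)) (tensor_map K A A
         (insert_factor K A (t - 1) (N - 1 - m + 2, N - 1 - m, ?\<pi> (N - 1 - m)) (m + 2 - t)) p x) = \<zero>\<^bsub>?M\<^esub>"
    proof (cases "m = 0")
     case True
     have "N - 1 + 2 = N + 1" using N2 by simp
     then show ?thesis using Z[OF N2 _ x, of t] t N2 True by (simp add: p0 del: add_2_eq_Suc')
    next
     case False
     then show ?thesis using m by (simp add: pn)
    qed
    then show "signed ?M (t * (N - m) + N) (?\<pi> m (p + (N - 1 - m)) (tensor_map K A A
         (insert_factor K A (t - 1) (N - 1 - m + 2, N - 1 - m, ?\<pi> (N - 1 - m)) (m + 2 - t)) p x)) = \<zero>\<^bsub>?M\<^esub>"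
     by (simp add: signed_zero[OF gradedD(1)[OF A]])
   qed
   qed
   then have "(\<Oplus>\<^bsub>?M\<^esub>m\<in>{..<N}. \<Oplus>\<^bsub>?M\<^esub>t\<in>{1..m + 2}. signed ?M (t * (N - m) + N)
       (?\<pi> m (p + (N - 1 - m)) (tensor_map K A A
         (insert_factor K A (t - 1) (N - 1 - m + 2, N - 1 - m, ?\<pi> (N - 1 - m)) (m + 2 - t)) p x))) = \<zero>\<^bsub>?M\<^esub>"
    by (rule M.add.finprod_one_eqI)
   moreover have "(if p = 0 then \<zero>\<^bsub>?M\<^esub> else signed ?M (N + 1) (?\<pi> N (p - 1) (tensor_differential K A d (N + 2) p x))) = \<zero>\<^bsub>?M\<^esub>"
    using 2 pz by (simp add: pn signed_zero[OF gradedD(1)[OF A]])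
   moreover have "d (p + N) (?\<pi> N p x) = \<zero>\<^bsub>?M\<^esub>" using 2 dz by (simp add: pn)
   ultimately show ?thesis by (simp only: M.l_zero[OF M.zero_closed])
  qed
  then show "let M = A (p + N - 1) in
    d (p + N) (?\<pi> N p x) \<oplus>\<^bsub>M\<^esub>
     (if p = 0 then \<zero>\<^bsub>M\<^esub> else signed M (N + 1) (?\<pi> N (p - 1) (tensor_differential K A d (N + 2) p x))) =
    (\<Oplus>\<^bsub>M\<^esub>m\<in>{..<N}. \<Oplus>\<^bsub>M\<^esub>t\<in>{1..m + 2}. signed M (t * (N - m) + N)
       (?\<pi> m (p + (N - 1 - m)) (tensor_map K A A
         (insert_factor K A (t - 1) (N - 1 - m + 2, N - 1 - m, ?\<pi> (N - 1 - m)) (m + 2 - t)) p x)))"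
   unfolding Let_def .
 qed
qed

section \<open>Linear maps induced by operators on words\<close>

text \<open>A word of length \<open>k + 1\<close> and degree \<open>n - k\<close> has suspended
  degree \<open>n + 1\<close>, so one chain with \<open>gch A (n + 1)\<close> represents all
  components of \<open>Xbar K A n\<close> at once. The bound on the length records that the
  operators never lengthen words.\<close>

definition gch :: "('k, 'a) graded_module => nat => nat => (nat \<times> 'a) chain => bool" where
 "gch A n m c \<longleftrightarrow> (\<forall>w \<in> wkeys c. valid A w \<and> pw par w = n \<and> length w \<le> m)"

lemma gch_simps [simp]: "gch A n m 0" "gch A n m (ks i c) \<longleftrightarrow> gch A n m c"
 "gch A n m (wd w) \<longleftrightarrow> valid A w \<and> pw par w = n \<and> length w \<le> m"
 "gch A n m (- c) \<longleftrightarrow> gch A n m c"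
 by (simp_all add: gch_def del: pw_par)

lemma gch_1 [simp]: "gch A 0 m 1"
 using gch_simps(3)[of A 0 m "[]"] by simp

lemma gch_mono: "gch A n m c ==> m \<le> m' ==> gch A n m' c"
 unfolding gch_def by (meson order_trans)

lemma gch_add: "gch A n m c ==> gch A n m d ==> gch A n m (c + d)"
 using keys_add[of c d] unfolding gch_def by blast

lemma gch_diff: "gch A n m c ==> gch A n m d ==> gch A n m (c - d)"
 using gch_add[of A n m c "- d"] by simp

lemma gch_sum: "(!!i. i \<in> S ==> gch A n m (f i)) ==> gch A n m (sum f S)"
 by (induction S rule: infinite_finite_induct) (auto intro: gch_add)

lemma gch_mult:
 assumes c: "gch A n m c" and d: "gch A n' m' d"
 shows "gch A (n + n') (m + m') (c * d)"
 unfolding gch_def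
proof
 fix t assume "t \<in> wkeys (c * d)"
 then obtain u v where "t = u @ v" "u \<in> wkeys c" "v \<in> wkeys d" by (rule keys_mult_append)
 then show "valid A t \<and> pw par t = n + n' \<and> length t \<le> m + m'"
  using c d unfolding gch_def by fastforce
qed

lemma gch_SS: "(!!x y. x @ y = w ==> gch A n m (f x y)) ==> gch A n m (SS w f)"
 unfolding SS_def by (rule gch_sum) auto

lemma gch_ext:
 assumes "gch A n m c" "!!w. valid A w ==> pw par w = n ==> length w \<le> m ==> gch B n' m' (f w)"
 shows "gch B n' m' (ext f c)"
 using keys_frag_extend[of f c] assms unfolding gch_def by blast

lemma gch_induct [consumes 1, case_names zero wd diff]:
 assumes "gch A n m c" "P 0" "!!w. valid A w ==> pw par w = n ==> length w \<le> m ==> P (wd w)"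
  "!!a b. P a ==> P b ==> P (a - b)"
 shows "P c"
proof -
 have "wkeys c \<subseteq> {w. valid A w \<and> pw par w = n \<and> length w \<le> m}" using assms(1) by (auto simp: gch_def)
 then show ?thesis
  by (induction c rule: frag_induction) (use assms(2-4) in \<open>auto simp: wd_def\<close>)
qed

lemma length_le_pw: "length w \<le> pw par w"
 by simp

lemma rot_gch: "valid A w ==> gch A (pw par w) (length w) (rot par w)"
 by (cases w rule: rev_cases) (auto simp: rot_def par_def)

lemma nrm_gch: "valid A w ==> gch A (pw par w) (length w) (nrm par w)"
 unfolding nrm_def by (intro gch_SS) (auto simp: wd_append[symmetric])

context
 fixes K :: "'k ring" and A :: "('k, 'a) graded_module"
  and d :: "nat => 'a => 'a" and \<pi> :: "nat => nat => ('k, 'a) tensor => 'a"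
 assumes A: "graded K A" and d: "differential_module K A d"
  and \<pi>: "!!n. \<pi> n \<in> graded_maps K A A (n + 2) n"
begin

lemma opm_gch:
 assumes "valid A x" "x ~= []"
 shows "gch A (pw par x - 1) 1 (opm K A d \<pi> x)"
proof (cases "length x = 1")
 case True
 then obtain q a where x: "x = [(q, a)]" by (metis (no_types, opaque_lifting) One_nat_def length_0_conv length_Suc_conv surj_pair)
 then show ?thesis
  using assms linearD(1)[OF d_linear[OF A d, of q], of a]
  by (auto simp: opm_def dletter_def par_def)
next
 case False
 with assms(2) have l: "2 \<le> length x" by (cases x) (auto simp: Suc_le_eq)
 then obtain n where n: "length x = n + 2" by (metis add.commute le_Suc_ex)
 have "\<pi> n (word_degree x) (pure_tensor K A x) \<in> carrier (A (word_degree x + n))"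
  by (rule graded_pure_closed[OF A \<pi>]) (use n assms in \<open>simp add: hw_iff\<close>)
 then show ?thesis using n assms(2) by (simp add: opm_def par_def)
qed

lemma delta_gch:
 assumes "valid A w"
 shows "gch A (pw par w - 1) (length w) (delta par (opm K A d \<pi>) w)"
 unfolding delta_def
proof (intro gch_SS)
 fix u r x v assume e: "u @ r = w" "x @ v = r"
 then have v: "valid A u" "valid A x" "valid A v" and w: "w = u @ x @ v" using assms by auto
 show "gch A (pw par w - 1) (length w) (ks (pw par u) (wd u * opm K A d \<pi> x * wd v))"
 proof (cases "x = []")
  case False
  have "gch A (pw par u + (pw par x - 1) + pw par v) (length u + 1 + length v) (wd u * opm K A d \<pi> x * wd v)"
   by (intro gch_mult opm_gch v False) (use v in simp_all)
  moreover have "pw par u + (pw par x - 1) + pw par v = pw par w - 1" using False by (cases x) (auto simp: w par_def)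
  moreover have "length u + 1 + length v \<le> length w" using False by (cases x) (auto simp: w)
  ultimately show ?thesis using gch_mono by (simp del: pw_par)
 qed (simp add: opm_def)
qed

lemma hoch_gch:
 assumes "valid A w"
 shows "gch A (pw par w - 1) (length w) (hoch par (opm K A d \<pi>) w)"
 unfolding hoch_def
proof (intro gch_add delta_gch assms)
 show "gch A (pw par w - 1) (length w) (wrap par (opm K A d \<pi>) w)"
  unfolding wrap_def
 proof (intro gch_SS)
  fix x r y z assume e: "x @ r = w" "y @ z = r"
  then have v: "valid A x" "valid A y" "valid A z" and w: "w = x @ y @ z" using assms by auto
  show "gch A (pw par w - 1) (length w) (if x = [] \<or> z = [] then 0 else
    ks (pw par z * (pw par x + pw par y)) (opm K A d \<pi> (z @ x) * wd y))"
  proof (cases "x = [] \<or> z = []")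
   case False
   have "gch A (pw par (z @ x) - 1 + pw par y) (1 + length y) (opm K A d \<pi> (z @ x) * wd y)"
    by (intro gch_mult opm_gch) (use v False in simp_all)
   moreover have "pw par (z @ x) - 1 + pw par y = pw par w - 1" using False by (cases x) (auto simp: w par_def)
   moreover have "1 + length y \<le> length w" using False by (cases x) (auto simp: w)
   ultimately show ?thesis using gch_mono False by (simp del: pw_par)
  qed simp
 qed
qed

end

context
 fixes K :: "'k ring" and A :: "('k, 'a) graded_module" and B :: "('k, 'b) graded_module"
  and f :: "nat => nat => ('k, 'a) tensor => 'b"
 assumes A: "graded K A" and f: "!!n. f n \<in> graded_maps K A B (n + 1) n"
begin

lemma mop_gch:
 assumes "valid A x"
 shows "gch B (pw par x) 1 (mop K A f x)"
proof (cases "x = []")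
 case False
 then obtain n where n: "length x = n + 1" by (cases x) auto
 have "f n (word_degree x) (pure_tensor K A x) \<in> carrier (B (word_degree x + n))"
  by (rule graded_pure_closed[OF A f]) (use n assms in \<open>simp add: hw_iff\<close>)
 then show ?thesis using n by (auto simp: mop_def par_def)
qed (simp add: mop_def)

lemma bar_gch: "valid A w ==> gch B (pw par w) (length w) (bar (mop K A f) w)"
proof (induction w rule: length_induct)
 case (1 w)
 have m0: "mop K A f [] = 0" by (simp add: mop_def)
 show ?case
 proof (cases "w = []")
  case False
  show ?thesis
   unfolding bar_rec[where Ph = "mop K A f", OF m0 False]
  proof (rule gch_SS)
   fix x y assume w: "x @ y = w"
   show "gch B (pw par w) (length w) (mop K A f x * bar (mop K A f) y)"
   proof (cases "x = []")
    case False
    have "length y < length w" "valid A y" "valid A x" using w 1(2) False by auto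
    then have "gch B (pw par x + pw par y) (1 + length y) (mop K A f x * bar (mop K A f) y)"
     using 1(1) by (intro gch_mult mop_gch) blast+
    moreover have "1 + length y \<le> length w" using False w by (cases x) auto
    moreover have "pw par x + pw par y = pw par w" unfolding w[symmetric] by simp
    ultimately show ?thesis using gch_mono by (simp del: pw_par)
   qed (simp add: m0)
  qed
 qed (simp add: bar_def)
qed

lemma cbar_gch:
 assumes "valid A w"
 shows "gch B (pw par w) (length w) (cbar par (mop K A f) w)"
 unfolding cbar_def CY_def
proof (intro gch_SS)
 fix x r y z assume e: "x @ r = w" "y @ z = r"
 then have v: "valid A x" "valid A y" "valid A z" and w: "w = x @ y @ z" using assms by auto
 show "gch B (pw par w) (length w) (if x = [] then 0 else
   ks (pw par z * (pw par x + pw par y)) (mop K A f (z @ x) * bar (mop K A f) y))"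
 proof (cases "x = []")
  case False
  have "gch B (pw par (z @ x) + pw par y) (1 + length y) (mop K A f (z @ x) * bar (mop K A f) y)"
   by (intro gch_mult mop_gch bar_gch) (use v in simp_all)
  moreover have "1 + length y \<le> length w" using False by (cases x) (auto simp: w)
  moreover have "pw par (z @ x) + pw par y = pw par w" by (simp add: w)
  ultimately show ?thesis using gch_mono False by (simp del: pw_par)
 qed simp
qed

end

text \<open>The arbitrary factors \<open>L\<close> and \<open>R\<close> make the notion stable under
  products of chains, as the recursions for \<open>bar\<close> and \<open>cbar\<close>
  require.\<close>

definition slin :: "'k ring => ('k, 'a) graded_module => ('k, 'b) graded_module => nat
   => ('a => (nat \<times> 'b) chain) => bool" where
 "slin K A B q G \<longleftrightarrow> (\<forall>L R r p. (%a. ev K B r p (L * G a * R)) \<in> linear_maps K (A q) (tensor_power K B r p))"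

definition slot_linear :: "'k ring => ('k, 'a) graded_module => ('k, 'b) graded_module
   => ('a hword => (nat \<times> 'b) chain) => bool" where
 "slot_linear K A B f \<longleftrightarrow> (\<forall>u q v. valid A u --> valid A v --> slin K A B q (%a. f (u @ (q, a) # v)))"

text \<open>The sign \<open>ks (sgx w)\<close> undoes the one in \<open>evw\<close>, so that an
  evaluated word is sent to the evaluation of its value.\<close>

definition word_lift :: "'k ring => ('k, 'a) graded_module => ('k, 'b) graded_module
   => ('a hword => (nat \<times> 'b) chain) => nat => nat => ('k, 'a) tensor => ('k, 'b) tensor" where
 "word_lift K A B f r' p' = tensor_lift K (tensor_power K B r' p') (%w. ev K B r' p' (ks (sgx w) (f w)))"

context
 fixes K :: "'k ring" and A :: "('k, 'a) graded_module" and B :: "('k, 'b) graded_module"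
 assumes A: "graded K A" and B: "graded K B"
begin

lemma slin_zero: "slin K A B q (%a. 0)"
 unfolding slin_def by (simp add: ev_zero[OF B]) (intro allI zero_linear tensor_module[OF B])

lemma slin_add: "slin K A B q G ==> slin K A B q G' ==> slin K A B q (%a. G a + G' a)"
 unfolding slin_def distrib_left distrib_right ev_add[OF B] by (intro allI add_linear tensor_module[OF B]; blast)

lemma slin_sum: "(!!i. i \<in> S ==> slin K A B q (G i)) ==> slin K A B q (%a. \<Sum>i\<in>S. G i a)"
 by (induction S rule: infinite_finite_induct) (auto simp: slin_zero intro: slin_add)

lemma slin_ks: "slin K A B q G ==> slin K A B q (%a. ks n (G a))"
 unfolding slin_def ks_mult ev_ks[OF B]
 using linear_comp[OF _ signed_linear[OF tensor_module[OF B]]] by blast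

lemma slin_mult: "slin K A B q G ==> slin K A B q (%a. G a * c)" "slin K A B q G ==> slin K A B q (%a. c * G a)"
proof -
 assume G: "slin K A B q G"
 have 1: "L * (G a * c) * R = L * G a * (c * R)" and 2: "L * (c * G a) * R = (L * c) * G a * R" for L R a
  by (simp_all add: mult.assoc)
 show "slin K A B q (%a. G a * c)" "slin K A B q (%a. c * G a)"
  using G unfolding slin_def 1 2 by blast+
qed

lemma slin_SS: "(!!x y. x @ y = w ==> slin K A B q (%a. G a x y)) ==> slin K A B q (%a. SS w (G a))"
 unfolding SS_def case_prod_unfold by (rule slin_sum) auto

lemma slin_letter:
 assumes \<phi>: "\<phi> \<in> linear_maps K (A q) (B q')"
 shows "slin K A B q (%a. wd [(q', \<phi> a)])"
 unfolding slin_def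
proof (intro allI)
 fix L R r p
 note T = tensor_module[OF B]
 have words: "(%a. ev K B r p (wd u * wd [(q', \<phi> a)] * wd v)) \<in> linear_maps K (A q) (tensor_power K B r p)" for u v
  by (rule linear_comp[OF \<phi> ev_letter_linear[OF B]])
 have left: "(%a. ev K B r p (L * wd [(q', \<phi> a)] * wd v)) \<in> linear_maps K (A q) (tensor_power K B r p)" for v
  by (induction L rule: chain_induct)
   (simp_all add: ev_zero[OF B] zero_linear[OF T] words left_diff_distrib ev_diff[OF B] minus_linear[OF T])
 show "(%a. ev K B r p (L * wd [(q', \<phi> a)] * R)) \<in> linear_maps K (A q) (tensor_power K B r p)"
  by (induction R rule: chain_induct)
   (simp_all add: ev_zero[OF B] zero_linear[OF T] left right_diff_distrib ev_diff[OF B] minus_linear[OF T])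
qed

lemma slot_linear_mop:
 assumes f: "!!n. f n \<in> graded_maps K A B (n + 1) n"
 shows "slot_linear K A B (mop K A f)"
 unfolding slot_linear_def
proof (intro allI impI)
 fix u v :: "'a hword" and q assume uv: "valid A u" "valid A v"
 let ?n = "length u + length v" and ?p = "word_degree u + q + word_degree v"
 have m: "mop K A f (u @ (q, a) # v) = ks (thx (u @ (q, undefined) # v))
   (wd [(?p + ?n, f ?n ?p (pure_tensor K A (u @ (q, a) # v)))])" for a
  by (simp add: mop_def thx_append add.assoc)
 have "(%a. f ?n ?p (pure_tensor K A (u @ (q, a) # v))) \<in> linear_maps K (A q) (B (?p + ?n))"
  by (rule linear_comp[OF pure_slot_linear[OF A _ _ uv] graded_mapsD[OF f]]) simp_all
 then show "slin K A B q (%a. mop K A f (u @ (q, a) # v))"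
  unfolding m by (intro slin_ks slin_letter)
qed

context
 fixes Ph :: "'a hword => (nat \<times> 'b) chain"
 assumes Ph: "slot_linear K A B Ph" and Ph0: "Ph [] = 0"
begin

text \<open>The first block either ends before the varied letter, and induction handles the rest, or
  contains it.\<close>

lemma slot_linear_bar: "slot_linear K A B (bar Ph)"
 unfolding slot_linear_def
proof (intro allI impI)
 fix u v :: "'a hword" and q assume "valid A u" "valid A v"
 then show "slin K A B q (%a. bar Ph (u @ (q, a) # v))"
 proof (induction u rule: length_induct)
  case (1 u)
  have b: "bar Ph (u @ (q, a) # v) = SS u (%x y. Ph x * bar Ph (y @ (q, a) # v)) + SS v (%x y. Ph (u @ (q, a) # x) * bar Ph y)" for a
   by (subst bar_rec[where Ph = Ph]) (simp_all add: Ph0 SS_mid)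
  show ?case
   unfolding b
  proof (intro slin_add slin_SS)
   fix x y assume w: "x @ y = u"
   show "slin K A B q (%a. Ph x * bar Ph (y @ (q, a) # v))"
   proof (cases "x = []")
    case False
    then have "length y < length u" using w by auto
    then show ?thesis by (intro slin_mult(2) 1(1)[rule_format]) (use w 1 in auto)
   qed (simp add: Ph0 slin_zero)
  next
   fix x y assume w: "x @ y = v"
   then show "slin K A B q (%a. Ph (u @ (q, a) # x) * bar Ph y)"
    using Ph 1(2,3) unfolding slot_linear_def by (intro slin_mult(1)) auto
  qed
 qed
qed

lemma slot_linear_cbar: "slot_linear K A B (cbar par Ph)"
 unfolding slot_linear_def
proof (intro allI impI)
 fix u v :: "'a hword" and q assume uv: "valid A u" "valid A v"
 \<comment> \<open>A sign may depend on the degree of the varied letter but not on its vector; in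
   this form the independence is visible.\<close>
 have pq: "pw par (x @ (q, a) # y) = word_degree x + q + word_degree y + (length x + length y + 1)" for x y and a :: 'a
  by (simp add: par_def)
 note b = slot_linear_bar
 show "slin K A B q (%a. cbar par Ph (u @ (q, a) # v))"
  unfolding cbar_def CY_def SS_mid pq
 \<comment> \<open>The varied letter lies in \<open>z\<close>, in \<open>y\<close> or in
   \<open>x\<close>, in this order.\<close>
 proof (intro slin_add slin_SS)
  fix x r y z assume e: "x @ r = u" "y @ z = r"
  have *: "slin K A B q (%a. Ph ((z @ (q, a) # v) @ x) * bar Ph y)"
   using Ph[unfolded slot_linear_def, rule_format, of z "v @ x" q] e uv by (intro slin_mult(1)) auto
  show "slin K A B q (%a. if x = [] then 0 else
    ks ((word_degree z + q + word_degree v + (length z + length v + 1)) * (pw par x + pw par y)) (Ph ((z @ (q, a) # v) @ x) * bar Ph y))"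
  proof (cases "x = []")
   case True
   show ?thesis unfolding if_P[OF True] by (rule slin_zero)
  next
   case False
   show ?thesis unfolding if_not_P[OF False] by (rule slin_ks[OF *])
  qed
 next
  fix x r y z assume e: "x @ r = u" "y @ z = v"
  have *: "slin K A B q (%a. Ph (z @ x) * bar Ph (r @ (q, a) # y))"
   using b[unfolded slot_linear_def, rule_format, of r y q] e uv by (intro slin_mult(2)) auto
  show "slin K A B q (%a. if x = [] then 0 else
    ks (pw par z * (pw par x + (word_degree r + q + word_degree y + (length r + length y + 1)))) (Ph (z @ x) * bar Ph (r @ (q, a) # y)))"
  proof (cases "x = []")
   case True
   show ?thesis unfolding if_P[OF True] by (rule slin_zero)
  next
   case False
   show ?thesis unfolding if_not_P[OF False] by (rule slin_ks[OF *])
  qed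
 next
  fix x r y z assume e: "x @ r = v" "y @ z = r"
  have *: "slin K A B q (%a. Ph (z @ u @ (q, a) # x) * bar Ph y)"
   using Ph[unfolded slot_linear_def, rule_format, of "z @ u" x q] e uv by (intro slin_mult(1)) auto
  show "slin K A B q (%a. if u @ (q, a) # x = [] then 0 else
    ks (pw par z * (word_degree u + q + word_degree x + (length u + length x + 1) + pw par y)) (Ph (z @ u @ (q, a) # x) * bar Ph y))"
   using slin_ks[OF *] by simp
 qed
qed

end

context
 fixes f :: "'a hword => (nat \<times> 'b) chain"
 assumes f: "slot_linear K A B f"
begin

lemma word_lift_multilinear:
 "multilinear K A r p (tensor_power K B r' p') (%w. ev K B r' p' (ks (sgx w) (f w)))"
proof (rule multilinear_slotI[OF A ev_closed[OF B]])
 fix us vs :: "'a hword" and i assume v: "valid A us" "valid A vs"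
 obtain m where s: "!!a. sgx (us @ (i, a) # vs) = m"
  by (rule that[of "sgx (us @ (i, undefined) # vs)"]) (simp add: sgx_append)
 have "slin K A B i (%a. ks m (f (us @ (i, a) # vs)))"
  by (rule slin_ks[OF f[unfolded slot_linear_def, rule_format, OF v]])
 from this[unfolded slin_def, rule_format, of r' p' 1 1]
 have lin: "(%a. ev K B r' p' (ks m (f (us @ (i, a) # vs)))) \<in> linear_maps K (A i) (tensor_power K B r' p')"
  by (simp only: mult_1_left mult_1_right)
 show "\<exists>\<beta>\<in>linear_maps K (A i) (tensor_power K B r' p'). \<forall>a\<in>carrier (A i).
   ev K B r' p' (ks (sgx (us @ (i, a) # vs)) (f (us @ (i, a) # vs))) = \<beta> a"
  unfolding s by (rule bexI[OF _ lin]) (rule ballI, rule refl)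
qed

lemma word_lift_linear: "word_lift K A B f r' p' \<in> linear_maps K (tensor_power K A r p) (tensor_power K B r' p')"
 unfolding word_lift_def by (rule tensor_lift_linear[OF A tensor_module[OF B] word_lift_multilinear])

lemma word_lift_evw:
 assumes w: "w \<in> hw A r p"
 shows "word_lift K A B f r' p' (evw K A r p w) = ev K B r' p' (f w)"
proof -
 have "word_lift K A B f r' p' (pure_tensor K A w) = ev K B r' p' (ks (sgx w) (f w))"
  unfolding word_lift_def by (rule tensor_lift_pure[OF A tensor_module[OF B] word_lift_multilinear w])
 then have "word_lift K A B f r' p' (evw K A r p w) = signed (tensor_power K B r' p') (sgx w) (signed (tensor_power K B r' p') (sgx w) (ev K B r' p' (f w)))"
  unfolding evw_hw[OF A w]
  using linear_signed[OF word_lift_linear tensor_module[OF A] tensor_module[OF B] pure_closed[OF A w], of r' p' "sgx w"]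
  by (simp add: ev_ks[OF B])
 also have "... = ev K B r' p' (f w)"
  unfolding signed_signed[OF tensor_module[OF B] ev_closed[OF B]] by (simp add: signed_def)
 finally show ?thesis .
qed

end

text \<open>A form of \<open>operator_ev\<close> for chains of mixed length: the component of length
  \<open>k + 1\<close> is fed to \<open>F k\<close>, and a word meets only the map for its own
  length.\<close>

lemma sum_operator_ev:
 assumes S: "finite S"
  and lin: "!!k. k \<in> S ==> k \<le> n ==> F k \<in> linear_maps K (tensor_power K A (k + 1) (n - k)) (tensor_power K B r' p')"
  and Sn: "S \<subseteq> {..n}"
  and word: "!!k w. k \<in> S ==> w \<in> hw A (k + 1) (n - k) ==> F k (evw K A (k + 1) (n - k) w) = ev K B r' p' (f w)"
  and other: "!!w. valid A w ==> pw par w = n + 1 ==> length w - 1 \<notin> S ==> ev K B r' p' (f w) = \<zero>\<^bsub>tensor_power K B r' p'\<^esub>"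
  and c: "gch A (n + 1) m c"
 shows "(\<Oplus>\<^bsub>tensor_power K B r' p'\<^esub>k\<in>S. F k (ev K A (k + 1) (n - k) c)) = ev K B r' p' (ext f c)"
proof -
 let ?T = "tensor_power K B r' p'"
 note TB = tensor_module[OF B, of r' p'] and TA = tensor_module[OF A]
 interpret T: module K ?T by (rule TB)
 have lin': "F k \<in> linear_maps K (tensor_power K A (k + 1) (n - k)) ?T" if "k \<in> S" for k using lin that Sn by blast
 have cl: "F k (ev K A (k + 1) (n - k) c) \<in> carrier ?T" if "k \<in> S" for k c
  by (rule linearD(1)[OF lin'[OF that] ev_closed[OF A]])
 show ?thesis
  using c
 proof (induction rule: gch_induct)
  case zero
  have "F k (ev K A (k + 1) (n - k) 0) = \<zero>\<^bsub>?T\<^esub>" if "k \<in> S" for k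
   unfolding ev_zero[OF A] by (rule linear_zero[OF lin'[OF that] TA TB])
  then show ?case by (simp add: ev_zero[OF B] T.add.finprod_one_eqI)
 next
  case (wd w)
  have z: "F k (ev K A (k + 1) (n - k) (wd w)) = \<zero>\<^bsub>?T\<^esub>" if "k \<in> S" "k ~= length w - 1" for k
  proof -
   have "length w ~= k + 1" using that by auto
   then have "ev K A (k + 1) (n - k) (wd w) = \<zero>\<^bsub>tensor_power K A (k + 1) (n - k)\<^esub>"
    by (intro ev_eq_0[OF A]) (simp add: hw_iff)
   then show ?thesis using linear_zero[OF lin'[OF that(1)] TA TB] by simp
  qed
  have ne: "w ~= []" using wd(2) by auto
  show ?case
  proof (cases "length w - 1 \<in> S")
   case True
   have hw: "w \<in> hw A (length w - 1 + 1) (n - (length w - 1))"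
    using wd ne by (cases w) (auto simp: hw_iff par_def)
   have "(\<Oplus>\<^bsub>?T\<^esub>k\<in>S. F k (ev K A (k + 1) (n - k) (wd w))) =
    (\<Oplus>\<^bsub>?T\<^esub>k\<in>{length w - 1}. F k (ev K A (k + 1) (n - k) (wd w)))"
    by (rule T.add.finprod_mono_neutral_cong_right) (use S True z cl in auto)
   also have "... = F (length w - 1) (ev K A (length w - 1 + 1) (n - (length w - 1)) (wd w))"
    using cl[OF True] by (subst T.finsum_insert) auto
   also have "... = ev K B r' p' (f w)" unfolding ev_wd[OF A] by (rule word[OF True hw])
   finally show ?thesis by simp
  next
   case False
   then have "(\<Oplus>\<^bsub>?T\<^esub>k\<in>S. F k (ev K A (k + 1) (n - k) (wd w))) = \<zero>\<^bsub>?T\<^esub>"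
    using z by (intro T.add.finprod_one_eqI) auto
   then show ?thesis using other[OF wd(1,2) False] by simp
  qed
 next
  case (diff a b)
  have "(\<Oplus>\<^bsub>?T\<^esub>k\<in>S. F k (ev K A (k + 1) (n - k) (a - b))) =
   (\<Oplus>\<^bsub>?T\<^esub>k\<in>S. F k (ev K A (k + 1) (n - k) a) \<oplus>\<^bsub>?T\<^esub> F k (ev K A (k + 1) (n - k) (- b)))"
  proof (rule T.finsum_cong'[OF refl])
   fix k assume k: "k \<in> S"
   have "ev K A (k + 1) (n - k) (a - b) = ev K A (k + 1) (n - k) a \<oplus>\<^bsub>tensor_power K A (k + 1) (n - k)\<^esub> ev K A (k + 1) (n - k) (- b)"
    using ev_add[OF A, of "k + 1" "n - k" a "- b"] by simp
   then show "F k (ev K A (k + 1) (n - k) (a - b)) = F k (ev K A (k + 1) (n - k) a) \<oplus>\<^bsub>?T\<^esub> F k (ev K A (k + 1) (n - k) (- b))"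
    using linearD(2)[OF lin'[OF k] ev_closed[OF A] ev_closed[OF A]] by simp
  qed (use cl in auto)
  also have "... = (\<Oplus>\<^bsub>?T\<^esub>k\<in>S. F k (ev K A (k + 1) (n - k) a)) \<oplus>\<^bsub>?T\<^esub> (\<Oplus>\<^bsub>?T\<^esub>k\<in>S. F k (ev K A (k + 1) (n - k) (- b)))"
   by (rule T.finsum_addf) (use cl in auto)
  also have "(\<Oplus>\<^bsub>?T\<^esub>k\<in>S. F k (ev K A (k + 1) (n - k) (- b))) = \<ominus>\<^bsub>?T\<^esub> ev K B r' p' (ext f b)"
  proof -
   have "F k (ev K A (k + 1) (n - k) (- b)) = \<ominus>\<^bsub>?T\<^esub> F k (ev K A (k + 1) (n - k) b)" if "k \<in> S" for k
    unfolding ev_minus[OF A] by (rule linear_neg[OF lin'[OF that] TA TB ev_closed[OF A]])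
   then have "(\<Oplus>\<^bsub>?T\<^esub>k\<in>S. F k (ev K A (k + 1) (n - k) (- b))) = (\<Oplus>\<^bsub>?T\<^esub>k\<in>S. \<ominus>\<^bsub>?T\<^esub> F k (ev K A (k + 1) (n - k) b))"
    by (intro T.finsum_cong'[OF refl]) (use cl in auto)
   also have "... = \<ominus>\<^bsub>?T\<^esub> (\<Oplus>\<^bsub>?T\<^esub>k\<in>S. F k (ev K A (k + 1) (n - k) b))"
    using linear_finsum[OF neg_linear[OF TB id_linear] TB TB, of S "%k. F k (ev K A (k + 1) (n - k) b)"] cl by simp
   finally show ?thesis using diff.IH(2) by simp
  qed
  finally show ?case
   using diff.IH(1) by (simp add: ext_arith ev_diff[OF B] a_minus_def)
 qed
qed

end

section \<open>The total complex\<close>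

lemma direct_sum_carrier: "finite I ==> carrier (direct_sum I M) = (\<Pi>\<^sub>E i\<in>I. carrier (M i))"
 by (simp add: direct_sum_def)

lemma direct_sum_simps:
 "\<zero>\<^bsub>direct_sum I M\<^esub> = (\<lambda>i\<in>I. \<zero>\<^bsub>M i\<^esub>)" "x \<oplus>\<^bsub>direct_sum I M\<^esub> y = (\<lambda>i\<in>I. x i \<oplus>\<^bsub>M i\<^esub> y i)"
 "c \<odot>\<^bsub>direct_sum I M\<^esub> x = (\<lambda>i\<in>I. c \<odot>\<^bsub>M i\<^esub> x i)"
 by (simp_all add: direct_sum_def)

lemma finsum_singleton:
 assumes M: "module K M" and h: "h k \<in> carrier M"
 shows "(\<Oplus>\<^bsub>M\<^esub>i\<in>{k}. h i) = h k"
proof -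
 interpret M: module K M by (rule M)
 show ?thesis using h by simp
qed

lemma smult_linear:
 assumes M: "module K M" and c: "c \<in> carrier K"
 shows "(%x. c \<odot>\<^bsub>M\<^esub> x) \<in> linear_maps K M M"
proof -
 interpret M: module K M by (rule M)
 show ?thesis
  by (rule linearI) (use c in \<open>simp_all add: M.smult_r_distr M.smult_assoc1[symmetric] M.m_comm\<close>)
qed

context
 fixes K :: "'k ring" and I :: "nat set" and M :: "nat => ('k, 'a) module"
 assumes K: "cring K" and I: "finite I" and M: "!!i. i \<in> I ==> module K (M i)"
begin

lemma direct_sum_module: "module K (direct_sum I M)"
proof (rule moduleI[OF K])
 {
  fix i assume "i \<in> I"
  then interpret N: module K "M i" by (rule M)
  note N.a_closed N.zero_closed N.a_assoc N.a_comm N.a_lcomm N.l_zero N.r_zero N.l_neg N.r_neg N.a_inv_closed N.smult_closed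
   N.smult_l_distr N.smult_r_distr N.smult_assoc1 N.smult_one
 }
 note m = this
 show "abelian_group (direct_sum I M)"
 proof (rule abelian_groupI)
  fix x assume x: "x \<in> carrier (direct_sum I M)"
  show "\<exists>y\<in>carrier (direct_sum I M). y \<oplus>\<^bsub>direct_sum I M\<^esub> x = \<zero>\<^bsub>direct_sum I M\<^esub>"
   by (rule bexI[of _ "\<lambda>i\<in>I. \<ominus>\<^bsub>M i\<^esub> x i"])
    (use x in \<open>auto simp: direct_sum_carrier[OF I] direct_sum_simps m PiE_iff intro!: restrict_ext\<close>)
  show "\<zero>\<^bsub>direct_sum I M\<^esub> \<oplus>\<^bsub>direct_sum I M\<^esub> x = x"
   using x by (auto simp: direct_sum_carrier[OF I] direct_sum_simps m PiE_iff extensional_def restrict_def fun_eq_iff)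
 qed (auto simp: direct_sum_carrier[OF I] direct_sum_simps m PiE_iff intro!: restrict_ext)
qed (use I in \<open>auto simp: direct_sum_carrier direct_sum_simps PiE_iff extensional_def restrict_def fun_eq_iff
 module.smult_closed[OF M] module.smult_l_distr[OF M] module.smult_r_distr[OF M] module.smult_assoc1[OF M] module.smult_one[OF M]\<close>)

lemma direct_sum_proj_linear: "i \<in> I ==> (%x. x i) \<in> linear_maps K (direct_sum I M) (M i)"
 by (rule linearI) (auto simp: direct_sum_carrier[OF I] direct_sum_simps PiE_iff)

lemma direct_sum_restrict_linear:
 assumes "!!i. i \<in> I ==> F i \<in> linear_maps K N (M i)"
 shows "(%x. \<lambda>i\<in>I. F i x) \<in> linear_maps K N (direct_sum I M)"
 by (rule linearI)
  (auto simp: direct_sum_carrier[OF I] direct_sum_simps PiE_iff linearD[OF assms] intro!: restrict_ext)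

lemma direct_sum_uminus:
 assumes x: "x \<in> carrier (direct_sum I M)"
 shows "\<ominus>\<^bsub>direct_sum I M\<^esub> x = (\<lambda>i\<in>I. \<ominus>\<^bsub>M i\<^esub> x i)"
proof -
 interpret S: module K "direct_sum I M" by (rule direct_sum_module)
 have "\<ominus>\<^bsub>direct_sum I M\<^esub> x = (\<lambda>i\<in>I. (\<ominus>\<^bsub>direct_sum I M\<^esub> x) i)"
  using S.a_inv_closed[OF x] by (auto simp: direct_sum_carrier[OF I] PiE_iff extensional_restrict)
 also have "... = (\<lambda>i\<in>I. \<ominus>\<^bsub>M i\<^esub> x i)"
  by (intro restrict_ext linear_neg[OF direct_sum_proj_linear direct_sum_module M x])
 finally show ?thesis .
qed

end

lemma keys_nrm: "t \<in> wkeys (nrm p w) ==> length t = length w"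
 unfolding nrm_def by (erule keys_SS) (auto simp: wd_append[symmetric] split: if_splits)

lemma keys_rot: "t \<in> wkeys (rot p w) ==> length t = length w"
 by (cases w rule: rev_cases) (auto simp: rot_def wd_Nil[symmetric] simp del: wd_Nil)

section \<open>Chains that represent elements of the bicomplex\<close>

definition XEV :: "'k ring => ('k, 'a) graded_module => nat => (nat \<times> 'a) chain => nat => ('k, 'a) tensor" where
 "XEV K A n c = (\<lambda>k\<in>{0..n}. ev K A (k + 1) (n - k) c)"

definition TEV :: "'k ring => ('k, 'a) graded_module => nat => (nat => (nat \<times> 'a) chain)
   => nat => nat => ('k, 'a) tensor" where
 "TEV K A s c = (\<lambda>n\<in>{0..s}. XEV K A n (c n))"

definition tch :: "('k, 'a) graded_module => (nat => (nat \<times> 'a) chain) => bool" where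
 "tch A c \<longleftrightarrow> (\<forall>n. gch A (n + 1) (n + 1) (c n))"

definition D1h :: "nat => (nat \<times> 'a) chain => (nat \<times> 'a) chain" where
 "D1h m c = (if odd m then c - ext (rot par) c else ext (nrm par) c)"

definition D2h :: "('a hword => (nat \<times> 'a) chain) => nat => (nat \<times> 'a) chain => (nat \<times> 'a) chain" where
 "D2h \<omega> m c = (if even m then ext (hoch par \<omega>) c else - ext (delta par \<omega>) c)"

definition Dh :: "('a hword => (nat \<times> 'a) chain) => nat => (nat => (nat \<times> 'a) chain) => nat => (nat \<times> 'a) chain" where
 "Dh \<omega> s c n = D1h (s - n) (c n) + D2h \<omega> (s - 1 - n) (c (n + 1))"

context
 fixes K :: "'k ring" and A :: "('k, 'a) graded_module"
 assumes A: "graded K A"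
begin

lemma single_operator_ev:
 assumes F: "F \<in> linear_maps K (cyc_X K A k (n - k)) (cyc_X K A k (n - k))" and k: "k \<le> n"
  and word: "!!w. w \<in> hw A (k + 1) (n - k) ==> F (evw K A (k + 1) (n - k) w) = ev K A (k + 1) (n - k) (f w)"
  and len: "!!w t. t \<in> wkeys (f w) ==> length t = length w"
  and c: "gch A (n + 1) m c"
 shows "F (ev K A (k + 1) (n - k) c) = ev K A (k + 1) (n - k) (ext f c)"
proof -
 interpret T: module K "tensor_power K A (k + 1) (n - k)" by (rule tensor_module[OF A])
 have "(\<Oplus>\<^bsub>tensor_power K A (k + 1) (n - k)\<^esub>k'\<in>{k}. F (ev K A (k' + 1) (n - k') c)) = ev K A (k + 1) (n - k) (ext f c)"
 proof (rule sum_operator_ev[OF A A _ _ _ _ _ c])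
  show "ev K A (k + 1) (n - k) (f w) = \<zero>\<^bsub>tensor_power K A (k + 1) (n - k)\<^esub>"
   if "valid A w" "pw par w = n + 1" "length w - 1 \<notin> {k}" for w
   by (rule ev_eq_0[OF A]) (use that len in \<open>fastforce simp: hw_iff\<close>)
 qed (use F k word in \<open>auto simp: cyc_X_def\<close>)
 moreover have "F (ev K A (k + 1) (n - k) c) \<in> carrier (tensor_power K A (k + 1) (n - k))"
  using linearD(1)[OF F] ev_closed[OF A] unfolding cyc_X_def by blast
 ultimately show ?thesis by (simp only: finsum_singleton[OF tensor_module[OF A]])
qed

lemma Xbar_module: "module K (Xbar K A n)"
 unfolding Xbar_def cyc_X_def by (rule direct_sum_module[OF gradedD(2)[OF A]]) (simp_all add: tensor_module[OF A])

lemma Tot_module: "module K (cyc_Tot K A s)"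
 unfolding cyc_Tot_def by (rule direct_sum_module[OF gradedD(2)[OF A]]) (simp_all add: Xbar_module)

lemma Xbar_proj_linear: "k \<le> n ==> (%x. x k) \<in> linear_maps K (Xbar K A n) (cyc_X K A k (n - k))"
 unfolding Xbar_def by (rule direct_sum_proj_linear[OF gradedD(2)[OF A]]) (simp_all add: cyc_X_def tensor_module[OF A])

lemma Tot_proj_linear: "n \<le> s ==> (%x. x n) \<in> linear_maps K (cyc_Tot K A s) (Xbar K A n)"
 unfolding cyc_Tot_def by (rule direct_sum_proj_linear[OF gradedD(2)[OF A]]) (simp_all add: Xbar_module)

lemma Xbar_restrict_linear:
 "(!!k. k \<le> n ==> F k \<in> linear_maps K N (cyc_X K A k (n - k))) ==>
  (%x. \<lambda>k\<in>{0..n}. F k x) \<in> linear_maps K N (Xbar K A n)"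
 unfolding Xbar_def by (rule direct_sum_restrict_linear[OF gradedD(2)[OF A]]) (simp_all add: cyc_X_def tensor_module[OF A])

lemma Tot_restrict_linear:
 "(!!n. n \<le> s ==> F n \<in> linear_maps K N (Xbar K A n)) ==>
  (%x. \<lambda>n\<in>{0..s}. F n x) \<in> linear_maps K N (cyc_Tot K A s)"
 unfolding cyc_Tot_def by (rule direct_sum_restrict_linear[OF gradedD(2)[OF A]]) (simp_all add: Xbar_module)

lemma Xbar_carrier: "x \<in> carrier (Xbar K A n) \<longleftrightarrow> x \<in> extensional {0..n} \<and> (\<forall>k\<le>n. x k \<in> carrier (cyc_X K A k (n - k)))"
 by (auto simp: Xbar_def direct_sum_carrier PiE_iff)

lemma Tot_carrier: "x \<in> carrier (cyc_Tot K A s) \<longleftrightarrow> x \<in> extensional {0..s} \<and> (\<forall>n\<le>s. x n \<in> carrier (Xbar K A n))"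
 by (auto simp: cyc_Tot_def direct_sum_carrier PiE_iff)

lemma XEV_closed: "XEV K A n c \<in> carrier (Xbar K A n)"
 by (simp add: Xbar_carrier XEV_def cyc_X_def ev_closed[OF A, unfolded Suc_eq_plus1[symmetric]] Suc_eq_plus1[symmetric] del: Suc_eq_plus1)

lemma XEV_add: "XEV K A n (c + c') = XEV K A n c \<oplus>\<^bsub>Xbar K A n\<^esub> XEV K A n c'"
 unfolding XEV_def Xbar_def direct_sum_simps by (rule restrict_ext) (simp add: ev_add[OF A] cyc_X_def)

lemma XEV_minus: "XEV K A n (- c) = \<ominus>\<^bsub>Xbar K A n\<^esub> XEV K A n c"
proof -
 have "\<ominus>\<^bsub>Xbar K A n\<^esub> XEV K A n c = (\<lambda>k\<in>{0..n}. \<ominus>\<^bsub>cyc_X K A k (n - k)\<^esub> XEV K A n c k)"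
  using XEV_closed[of n c] unfolding Xbar_def
  by (intro direct_sum_uminus[OF gradedD(2)[OF A]]) (simp_all add: cyc_X_def tensor_module[OF A])
 also have "... = XEV K A n (- c)"
  unfolding XEV_def by (rule restrict_ext) (simp add: ev_minus[OF A] cyc_X_def)
 finally show ?thesis ..
qed

lemma XEV_diff: "XEV K A n (c - c') = XEV K A n c \<ominus>\<^bsub>Xbar K A n\<^esub> XEV K A n c'"
 using XEV_add[of n c "- c'"] by (simp add: XEV_minus a_minus_def)

lemma XEV_cong: "eqc K A c c' ==> XEV K A n c = XEV K A n c'"
 unfolding XEV_def eqc_def by (intro restrict_ext ev_cong_Null[OF A])

lemma TEV_cong: "(!!n. n \<le> s ==> eqc K A (c n) (c' n)) ==> TEV K A s c = TEV K A s c'"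
 unfolding TEV_def by (intro restrict_ext XEV_cong) simp

lemma TEV_zero: "TEV K A s (%n. 0) = \<zero>\<^bsub>cyc_Tot K A s\<^esub>"
 unfolding TEV_def XEV_def cyc_Tot_def Xbar_def direct_sum_simps by (intro restrict_ext) (simp add: ev_zero[OF A] cyc_X_def)

text \<open>Integral coefficients suffice because a scalar can be absorbed into the first letter;
  the length \<open>r + 1\<close> guarantees that there is one.\<close>

lemma ev_surj:
 assumes x: "x \<in> carrier (tensor_power K A (r + 1) p)"
 shows "\<exists>c. hch A (r + 1) p c \<and> x = ev K A (r + 1) p c"
 using x
proof (induction rule: tensor_power_induct[OF A, consumes 1, case_names pure zero add smult])
 case (pure w)
 then show ?case by (intro exI[of _ "ks (sgx w) (wd w)"] conjI ev_wd_pure[OF A]) simp_all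
next
 case zero
 then show ?case by (intro exI[of _ 0]) (simp add: ev_zero[OF A])
next
 case (add x y)
 then obtain c c' where c: "hch A (r + 1) p c" "hch A (r + 1) p c'" "x = ev K A (r + 1) p c" "y = ev K A (r + 1) p c'" by blast
 have "hch A (r + 1) p (c + c')" using c(1,2) keys_add[of c c'] unfolding hch_def by blast
 then show ?case using c(3,4) ev_add[OF A] by metis
next
 case (smult s x)
 then obtain c where c: "hch A (r + 1) p c" "x = ev K A (r + 1) p c" by blast
 define h where "h w = wd ((fst (hd w), s \<odot>\<^bsub>A (fst (hd w))\<^esub> snd (hd w)) # tl w)" for w :: "'a hword"
 have hw: "(fst (hd w), s \<odot>\<^bsub>A (fst (hd w))\<^esub> snd (hd w)) # tl w \<in> hw A (r + 1) p \<and>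
   s \<odot>\<^bsub>tensor_power K A (r + 1) p\<^esub> evw K A (r + 1) p w = ev K A (r + 1) p (h w)" if w: "w \<in> hw A (r + 1) p" for w
 proof -
  obtain q a v where wq: "w = (q, a) # v" using w by (cases w) (auto simp: hw_iff)
  have 1: "(q, s \<odot>\<^bsub>A q\<^esub> a) # v \<in> hw A (r + 1) p"
   using w smult(1) module.smult_closed[OF gradedD(1)[OF A]] by (auto simp: wq hw_iff)
  have "pure_tensor K A ((q, s \<odot>\<^bsub>A q\<^esub> a) # v) = s \<odot>\<^bsub>tensor_power K A (r + 1) p\<^esub> pure_tensor K A w"
   using multilinearD(3)[OF pure_tensor_multilinear[OF A], of "[]" q a v "r + 1" p s] w smult(1) by (simp add: wq)
  then have "s \<odot>\<^bsub>tensor_power K A (r + 1) p\<^esub> evw K A (r + 1) p w = ev K A (r + 1) p (h w)"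
   unfolding evw_hw[OF A w] h_def ev_wd[OF A]
   using signed_smult[OF tensor_module[OF A] pure_closed[OF A w] smult(1), of "sgx w"] evw_hw[OF A 1] by (simp add: wq)
  then show ?thesis using 1 by (simp add: wq)
 qed
 have "hch A (r + 1) p (ext h c)" by (rule hch_ext[OF c(1)]) (use hw in \<open>auto simp: h_def\<close>)
 moreover have "s \<odot>\<^bsub>tensor_power K A (r + 1) p\<^esub> x = ev K A (r + 1) p (ext h c)"
  unfolding c(2) by (rule operator_ev[OF A A smult_linear[OF tensor_module[OF A] smult(1)] _ c(1)]) (use hw in blast)
 ultimately show ?case by blast
qed

lemma XEV_surj:
 assumes x: "x \<in> carrier (Xbar K A n)"
 shows "\<exists>c. gch A (n + 1) (n + 1) c \<and> x = XEV K A n c"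
proof -
 have "\<forall>k\<in>{0..n}. \<exists>c. hch A (k + 1) (n - k) c \<and> x k = ev K A (k + 1) (n - k) c"
  using x ev_surj unfolding Xbar_carrier cyc_X_def by auto
 then obtain c where c: "!!k. k \<in> {0..n} ==> hch A (k + 1) (n - k) (c k) \<and> x k = ev K A (k + 1) (n - k) (c k)" by metis
 \<comment> \<open>Evaluation separates lengths, so representatives of the components can simply be
   added.\<close>
 let ?c = "\<Sum>k\<in>{0..n}. c k"
 have "ev K A (k + 1) (n - k) ?c = x k" if k: "k \<in> {0..n}" for k
 proof -
  interpret T: module K "tensor_power K A (k + 1) (n - k)" by (rule tensor_module[OF A])
  have z: "ev K A (k + 1) (n - k) (c i) = \<zero>\<^bsub>tensor_power K A (k + 1) (n - k)\<^esub>" if "i \<in> {0..n} - {k}" for i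
   by (rule ev_eq_0[OF A]) (use c[of i] that in \<open>auto simp: hch_def hw_iff\<close>)
  have "ev K A (k + 1) (n - k) ?c = (\<Oplus>\<^bsub>tensor_power K A (k + 1) (n - k)\<^esub>i\<in>{k}. ev K A (k + 1) (n - k) (c i))"
   unfolding ev_sum[OF A]
   by (rule T.add.finprod_mono_neutral_cong_right) (use k z ev_closed[OF A] in auto)
  then show ?thesis using c[OF k] by (simp only: finsum_singleton[OF tensor_module[OF A]] ev_closed[OF A])
 qed
 then have "x = XEV K A n ?c"
  using x unfolding XEV_def Xbar_carrier by (intro extensionalityI[of _ "{0..n}"]) auto
 moreover have "gch A (n + 1) (n + 1) ?c"
  by (rule gch_sum) (use c in \<open>fastforce simp: gch_def hch_def hw_iff\<close>)
 ultimately show ?thesis by blast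
qed

lemma TEV_surj:
 assumes x: "x \<in> carrier (cyc_Tot K A s)"
 shows "\<exists>c. tch A c \<and> x = TEV K A s c"
proof -
 have "\<forall>n\<in>{0..s}. \<exists>c. gch A (n + 1) (n + 1) c \<and> x n = XEV K A n c"
  using x XEV_surj unfolding Tot_carrier by auto
 then obtain c where c: "!!n. n \<in> {0..s} ==> gch A (n + 1) (n + 1) (c n) \<and> x n = XEV K A n (c n)" by metis
 let ?c = "%n. if n \<le> s then c n else 0"
 have "x = (\<lambda>n\<in>{0..s}. x n)" using x by (simp add: Tot_carrier extensional_restrict)
 also have "... = TEV K A s ?c" unfolding TEV_def by (rule restrict_ext) (use c in auto)
 finally have "x = TEV K A s ?c" .
 moreover have "tch A ?c" using c unfolding tch_def by auto
 ultimately show ?thesis by blast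
qed

lemma cyc_D1_linear: "cyc_D1 K A n m \<in> linear_maps K (Xbar K A n) (Xbar K A n)"
proof (cases "odd m")
 case True
 have "Xbar_T K A n \<in> linear_maps K (Xbar K A n) (Xbar K A n)"
  unfolding Xbar_T_def[abs_def]
  by (intro Xbar_restrict_linear linear_comp[OF Xbar_proj_linear cyc_T_linear[OF A]])
 then show ?thesis using True minus_linear[OF Xbar_module id_linear] by (simp add: cyc_D1_def[abs_def])
next
 case False
 have "Xbar_N K A n \<in> linear_maps K (Xbar K A n) (Xbar K A n)"
  unfolding Xbar_N_def[abs_def]
  by (intro Xbar_restrict_linear linear_comp[OF Xbar_proj_linear cyc_N_linear[OF A]])
 then show ?thesis using False by (simp add: cyc_D1_def[abs_def])
qed

lemma cyc_D1_XEV: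
 assumes c: "gch A (n + 1) m' c"
 shows "cyc_D1 K A n m (XEV K A n c) = XEV K A n (D1h m c)"
proof -
 have T: "Xbar_T K A n (XEV K A n c) = XEV K A n (ext (rot par) c)"
  unfolding Xbar_T_def XEV_def
 proof (rule restrict_ext)
  fix k assume k: "k \<in> {0..n}"
  have "cyc_T K A k (n - k) (ev K A (k + 1) (n - k) c) = ev K A (k + 1) (n - k) (ext (rot par) c)"
   by (rule single_operator_ev[OF cyc_T_linear[OF A] _ _ keys_rot c])
    (use k cyc_T_ev[OF A, of k "n - k" "wd w" for w] in \<open>auto simp: ev_wd[OF A, unfolded Suc_eq_plus1[symmetric]]\<close>)
  then show "cyc_T K A k (n - k) ((\<lambda>k\<in>{0..n}. ev K A (k + 1) (n - k) c) k) = ev K A (k + 1) (n - k) (ext (rot par) c)"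
   using k by simp
 qed
 have N: "Xbar_N K A n (XEV K A n c) = XEV K A n (ext (nrm par) c)"
  unfolding Xbar_N_def XEV_def
 proof (rule restrict_ext)
  fix k assume k: "k \<in> {0..n}"
  have "cyc_N K A k (n - k) (ev K A (k + 1) (n - k) c) = ev K A (k + 1) (n - k) (ext (nrm par) c)"
   by (rule single_operator_ev[OF cyc_N_linear[OF A] _ cyc_N_evw[OF A] keys_nrm c]) (use k in auto)
  then show "cyc_N K A k (n - k) ((\<lambda>k\<in>{0..n}. ev K A (k + 1) (n - k) c) k) = ev K A (k + 1) (n - k) (ext (nrm par) c)"
   using k by simp
 qed
 show ?thesis unfolding cyc_D1_def D1h_def T N by (simp add: XEV_diff)
qed

context
 fixes d :: "nat => 'a => 'a" and \<pi> :: "nat => nat => ('k, 'a) tensor => 'a"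
 assumes d: "differential_module K A d" and \<pi>: "!!n. \<pi> n \<in> graded_maps K A A (n + 2) n"
begin

lemma cyc_d_linear':
 assumes "l \<le> n" "l \<le> k" "k \<le> n + 1"
 shows "cyc_d K A d \<pi> q (k - l) k (n + 1 - k) \<in> linear_maps K (cyc_X K A k (n + 1 - k)) (cyc_X K A l (n - l))"
proof -
 have "k - (k - l) = l" "n + 1 - k + (k - l) - 1 = n - l" using assms by auto
 then show ?thesis using cyc_d_linear[OF A \<pi> d, of "k - l" k q "n + 1 - k"] by simp
qed

lemma Xbar_b_linear: "Xbar_b K A d \<pi> q (n + 1) \<in> linear_maps K (Xbar K A (n + 1)) (Xbar K A n)"
proof -
 have "(%x. \<lambda>l\<in>{0..n}. \<Oplus>\<^bsub>cyc_X K A l (n - l)\<^esub>k\<in>{l..n + 1}. cyc_d K A d \<pi> q (k - l) k (n + 1 - k) (x k))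
  \<in> linear_maps K (Xbar K A (n + 1)) (Xbar K A n)"
  by (intro Xbar_restrict_linear finsum_linear[OF Xbar_module cyc_X_module[OF A \<pi>]]
   linear_comp[OF Xbar_proj_linear cyc_d_linear']) auto
 then show ?thesis unfolding Xbar_b_def[abs_def] by simp
qed

text \<open>A single operator on chains comprises all the maps \<open>d_q^k\<close>: from words of
  length \<open>k + 1\<close> to the component of length \<open>l + 1\<close> it is the one with
  upper index \<open>k - l\<close>.\<close>

lemma Xbar_b_XEV:
 assumes c: "gch A (n + 2) m c" and q: "q \<le> 1"
 shows "Xbar_b K A d \<pi> q (n + 1) (XEV K A (n + 1) c) =
  XEV K A n (ext (if q = 0 then hoch par (opm K A d \<pi>) else delta par (opm K A d \<pi>)) c)"
proof -
 let ?f = "if q = 0 then hoch par (opm K A d \<pi>) else delta par (opm K A d \<pi>)"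
 have "(\<Oplus>\<^bsub>cyc_X K A l (n - l)\<^esub>k\<in>{l..n + 1}. cyc_d K A d \<pi> q (k - l) k (n + 1 - k) (XEV K A (n + 1) c k)) =
  ev K A (l + 1) (n - l) (ext ?f c)" if l: "l \<in> {0..n}" for l
 proof -
  interpret T: module K "tensor_power K A (l + 1) (n - l)" by (rule tensor_module[OF A])
  have cl: "cyc_d K A d \<pi> q (k - l) k (n + 1 - k) (ev K A (k + 1) (n + 1 - k) c) \<in> carrier (tensor_power K A (l + 1) (n - l))"
   if "k \<in> {l..n + 1}" for k
   using linearD(1)[OF cyc_d_linear'[of l n k q, unfolded cyc_X_def] ev_closed[OF A]] l that by simp
  have "(\<Oplus>\<^bsub>cyc_X K A l (n - l)\<^esub>k\<in>{l..n + 1}. cyc_d K A d \<pi> q (k - l) k (n + 1 - k) (XEV K A (n + 1) c k)) =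
   (\<Oplus>\<^bsub>tensor_power K A (l + 1) (n - l)\<^esub>k\<in>{l..n + 1}. cyc_d K A d \<pi> q (k - l) k (n + 1 - k) (ev K A (k + 1) (n + 1 - k) c))"
   unfolding cyc_X_def by (rule T.finsum_cong'[OF refl]) (use cl in \<open>auto simp: XEV_def\<close>)
  also have "... = ev K A (l + 1) (n - l) (ext ?f c)"
  proof (rule sum_operator_ev[OF A A])
   show "gch A (n + 1 + 1) m c" using c by simp
   show "cyc_d K A d \<pi> q (k - l) k (n + 1 - k) \<in> linear_maps K (tensor_power K A (k + 1) (n + 1 - k)) (tensor_power K A (l + 1) (n - l))"
    if "k \<in> {l..n + 1}" for k
    using cyc_d_linear'[of l n k q, unfolded cyc_X_def] l that by simp
   show "cyc_d K A d \<pi> q (k - l) k (n + 1 - k) (evw K A (k + 1) (n + 1 - k) w) = ev K A (l + 1) (n - l) (?f w)"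
    if "k \<in> {l..n + 1}" "w \<in> hw A (k + 1) (n + 1 - k)" for k w
   proof -
    have "k - (k - l) = l" "n + 1 - k + (k - l) - 1 = n - l" using that l by auto
    then show ?thesis using cyc_d_evw[OF A \<pi> d that(2) _ q, of "k - l"] by simp
   qed
   show "ev K A (l + 1) (n - l) (?f w) = \<zero>\<^bsub>tensor_power K A (l + 1) (n - l)\<^esub>"
    if w: "valid A w" "pw par w = n + 1 + 1" "length w - 1 \<notin> {l..n + 1}" for w
   proof (rule ev_eq_0[OF A])
    fix t assume t: "t \<in> wkeys (?f w)"
    have "length w < l + 1" using w(2,3) length_le_pw[of w] by auto
    moreover have "length t \<le> length w"
     using t hoch_gch[OF A d \<pi> w(1)] delta_gch[OF A d \<pi> w(1)] unfolding gch_def by (cases "q = 0") auto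
    ultimately show "t \<notin> hw A (l + 1) (n - l)" by (auto simp: hw_iff)
   qed
  qed auto
  finally show ?thesis .
 qed
 then show ?thesis unfolding Xbar_b_def by (simp add: XEV_def cong: restrict_cong)
qed

lemma cyc_D2_linear: "cyc_D2 K A d \<pi> (n + 1) m \<in> linear_maps K (Xbar K A (n + 1)) (Xbar K A n)"
 using Xbar_b_linear[of 0 n] neg_linear[OF Xbar_module Xbar_b_linear[of 1 n]]
 by (cases "even m") (simp_all add: cyc_D2_def[abs_def])

lemma cyc_D2_XEV:
 assumes c: "gch A (n + 2) m' c"
 shows "cyc_D2 K A d \<pi> (n + 1) m (XEV K A (n + 1) c) = XEV K A n (D2h (opm K A d \<pi>) m c)"
 using Xbar_b_XEV[OF c, of 0] Xbar_b_XEV[OF c, of 1] by (simp add: cyc_D2_def D2h_def XEV_minus)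

lemma cyc_D_linear: "cyc_D K A d \<pi> s \<in> linear_maps K (cyc_Tot K A s) (cyc_Tot K A (s - 1))"
proof (cases s)
 case 0
 then show ?thesis using zero_linear[OF Tot_module] by (simp add: cyc_D_def[abs_def])
next
 case (Suc s')
 have "(%x. \<lambda>n\<in>{0..s'}. cyc_D1 K A n (s - n) (x n) \<oplus>\<^bsub>Xbar K A n\<^esub> cyc_D2 K A d \<pi> (n + 1) (s - 1 - n) (x (n + 1)))
  \<in> linear_maps K (cyc_Tot K A s) (cyc_Tot K A s')"
  by (intro Tot_restrict_linear add_linear[OF Xbar_module] linear_comp[OF Tot_proj_linear cyc_D1_linear]
   linear_comp[OF Tot_proj_linear cyc_D2_linear]) (use Suc in auto)
 then show ?thesis using Suc by (simp add: cyc_D_def[abs_def])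
qed

lemma cyc_D_TEV:
 assumes c: "tch A c" and s: "0 < s"
 shows "cyc_D K A d \<pi> s (TEV K A s c) = TEV K A (s - 1) (Dh (opm K A d \<pi>) s c)"
proof -
 have "cyc_D1 K A n (s - n) (TEV K A s c n) \<oplus>\<^bsub>Xbar K A n\<^esub> cyc_D2 K A d \<pi> (n + 1) (s - 1 - n) (TEV K A s c (n + 1)) =
  XEV K A n (Dh (opm K A d \<pi>) s c n)" if "n \<in> {0..s - 1}" for n
 proof -
  have g: "gch A (n + 1) (n + 1) (c n)" "gch A (n + 2) (n + 2) (c (n + 1))"
   using c[unfolded tch_def, rule_format, of n] c[unfolded tch_def, rule_format, of "n + 1"] by simp_all
  have "TEV K A s c n = XEV K A n (c n)" "TEV K A s c (n + 1) = XEV K A (n + 1) (c (n + 1))"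
   using that s by (auto simp: TEV_def)
  then show ?thesis by (simp only: cyc_D1_XEV[OF g(1)] cyc_D2_XEV[OF g(2)] Dh_def XEV_add)
 qed
 then show ?thesis using s unfolding cyc_D_def TEV_def by (simp cong: restrict_cong)
qed

lemma Dh_tch:
 assumes c: "tch A c"
 shows "tch A (Dh (opm K A d \<pi>) s c)"
 unfolding tch_def
proof
 fix n
 have g: "gch A (n + 1) (n + 1) (c n)" "gch A (n + 2) (n + 2) (c (n + 1))"
  using c[unfolded tch_def, rule_format, of n] c[unfolded tch_def, rule_format, of "n + 1"] by simp_all
 have "gch A (n + 1) (n + 1) (D1h (s - n) (c n))"
 proof -
  have "gch A (n + 1) (n + 1) (ext (rot par) (c n))"
   by (rule gch_ext[OF g(1)]) (use rot_gch gch_mono in metis)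
  moreover have "gch A (n + 1) (n + 1) (ext (nrm par) (c n))"
   by (rule gch_ext[OF g(1)]) (use nrm_gch gch_mono in metis)
  ultimately show ?thesis using g(1) by (simp add: D1h_def gch_diff)
 qed
 moreover have "gch A (n + 1) (n + 1) (D2h (opm K A d \<pi>) (s - 1 - n) (c (n + 1)))"
 proof -
  have "gch A (n + 1) (n + 1) (hoch par (opm K A d \<pi>) w)" "gch A (n + 1) (n + 1) (delta par (opm K A d \<pi>) w)"
   if "valid A w" "pw par w = n + 2" for w
  proof -
   have "gch A (n + 1) (length w) (hoch par (opm K A d \<pi>) w)" "gch A (n + 1) (length w) (delta par (opm K A d \<pi>) w)"
    using hoch_gch[OF A d \<pi> that(1)] delta_gch[OF A d \<pi> that(1)] unfolding that(2) by simp_all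
   then show "gch A (n + 1) (n + 1) (hoch par (opm K A d \<pi>) w)" "gch A (n + 1) (n + 1) (delta par (opm K A d \<pi>) w)"
    unfolding gch_def using length_le_pw by metis+
  qed
  then have "gch A (n + 1) (n + 1) (ext (hoch par (opm K A d \<pi>)) (c (n + 1)))"
   "gch A (n + 1) (n + 1) (ext (delta par (opm K A d \<pi>)) (c (n + 1)))"
   by (intro gch_ext[OF g(2)]; blast)+
  then show ?thesis by (simp add: D2h_def)
 qed
 ultimately show "gch A (n + 1) (n + 1) (Dh (opm K A d \<pi>) s c n)" unfolding Dh_def by (rule gch_add)
qed

end

end

section \<open>The total differential and the induced map on chains\<close>

lemma ext_nrm_rot: "ext (nrm p) (ext (rot p) c) = ext (nrm p) c"
 by (simp add: ext_ext nrm_rot(1))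

lemma ext_nrm_hoch: "ops p m ==> ext (nrm p) (ext (hoch p m) c) = ext (delta p m) (ext (nrm p) c)"
 by (simp add: ext_ext nrm_hoch)

lemma gch_nonempty: "gch A (n + 1) m c ==> w \<in> wkeys c ==> w ~= []"
 unfolding gch_def by fastforce

lemma ext_rot_nrm: "gch A (n + 1) m c ==> ext (rot par) (ext (nrm par) c) = ext (nrm par) c"
 unfolding ext_ext by (rule ext_cong) (simp add: nrm_rot(2) gch_nonempty del: pw_par)

lemma ext_hoch_rot:
 assumes "ops par m" "gch A (n + 1) m' c"
 shows "ext (hoch par m) c - ext (hoch par m) (ext (rot par) c) = ext (delta par m) c - ext (rot par) (ext (delta par m) c)"
 unfolding ext_ext ext_fun_diff[symmetric]
 by (rule ext_cong) (rule hoch_rot[OF assms(1) gch_nonempty[OF assms(2)]])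

lemma ext_cbar_rot:
 assumes "mors par par Ph" "gch A (n + 1) m c"
 shows "ext (cbar par Ph) c - ext (cbar par Ph) (ext (rot par) c) = ext (bar Ph) c - ext (rot par) (ext (bar Ph) c)"
 unfolding ext_ext ext_fun_diff[symmetric]
 by (rule ext_cong) (rule cbar_rot[OF assms(1) gch_nonempty[OF assms(2)]])

lemma ext_ideal:
 assumes I: "chain_ideal I" and c: "gch A n m c" and f: "!!w. valid A w ==> f w \<in> I"
 shows "ext f c \<in> I"
 using c by (induction rule: gch_induct) (auto simp: ext_arith f chain_idealD[OF I])

text \<open>The alternation fits the horizontal differentials: 1 - T leads from odd to even columns,
  compatibly by \<open>cbar_rot\<close>, and N from even to odd ones, compatibly by
  \<open>nrm_cbar\<close>.\<close>

definition PH :: "'k ring => ('k, 'a) graded_module => (nat => nat => ('k, 'a) tensor => 'b)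
   => nat => 'a hword => (nat \<times> 'b) chain" where
 "PH K A f j = (if even j then cbar par (mop K A f) else bar (mop K A f))"

text \<open>Only \<open>k' \<ge> k\<close> occurs because the induced map never lengthens words. The
  column of row \<open>n\<close> in total degree \<open>s\<close> is \<open>s - n\<close>.\<close>

definition cyc_phi :: "'k ring => ('k, 'a) graded_module => ('k, 'b) graded_module
   => (nat => nat => ('k, 'a) tensor => 'b) => nat => (nat => nat => ('k, 'a) tensor) => nat => nat => ('k, 'b) tensor" where
 "cyc_phi K A B f s x = (\<lambda>n\<in>{0..s}. \<lambda>k\<in>{0..n}. \<Oplus>\<^bsub>cyc_X K B k (n - k)\<^esub>k'\<in>{k..n}.
   word_lift K A B (PH K A f (s - n)) (k + 1) (n - k) (x n k'))"

lemma valid_subset: "valid A w ==> set x \<subseteq> set w ==> valid A x"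
 unfolding valid_def by blast

context
 fixes K :: "'k ring" and A :: "('k, 'a) graded_module"
  and d :: "nat => 'a => 'a" and \<pi> :: "nat => nat => ('k, 'a) tensor => 'a"
 assumes A: "graded K A" and inf: "A_infinity_algebra K A d \<pi>"
begin

lemma inf_d: "differential_module K A d" and inf_\<pi>: "\<pi> n \<in> graded_maps K A A (n + 2) n"
 using inf by (simp_all add: A_infinity_algebra_def)

lemma relation_Null: "valid A w ==> w ~= [] ==> ext (opm K A d \<pi>) (delta par (opm K A d \<pi>) w) \<in> Null K A"
 using A_infinity_algebra_relation[OF A inf] by (simp add: eqc_def)

text \<open>For even \<open>i\<close> the terms cancel by (1 - T)N = 0 and b(1 - T) = (1 - T)b', for
  odd \<open>i\<close> by N(1 - T) = 0 and Nb = b'N. What remains is the square of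
  \<open>hoch\<close> or of \<open>delta\<close>, which is null by the relations.\<close>

lemma Dh_Dh:
 assumes c: "tch A c" and s: "s = n + 2 + i"
 shows "eqc K A (Dh (opm K A d \<pi>) (s - 1) (Dh (opm K A d \<pi>) s c) n) 0"
proof -
 let ?o = "opm K A d \<pi>"
 have g: "gch A (n + 1) (n + 1) (c n)" "gch A (n + 1 + 1) (n + 1 + 1) (c (n + 1))" "gch A (n + 2 + 1) (n + 2 + 1) (c (n + 2))"
  using c unfolding tch_def by blast+
 have o: "ops par ?o" by (rule ops_opm)
 have N: "ext (hoch par ?o) (ext (hoch par ?o) (c (n + 2))) \<in> Null K A"
  "ext (delta par ?o) (ext (delta par ?o) (c (n + 2))) \<in> Null K A"
  unfolding ext_ext
  by (rule ext_ideal[OF Null_ideal[OF A] g(3)], rule hoch_hoch_ideal[OF o Null_ideal[OF A]], rule relation_Null, erule (1) valid_subset, assumption)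
   (rule ext_ideal[OF Null_ideal[OF A] g(3)], rule delta_delta_ideal[OF o Null_ideal[OF A]], rule relation_Null, erule (1) valid_subset, assumption)
 have e: "Dh ?o (s - 1) (Dh ?o s c) n = D1h (i + 1) (D1h (i + 2) (c n) + D2h ?o (i + 1) (c (n + 1))) +
  D2h ?o i (D1h (i + 1) (c (n + 1)) + D2h ?o i (c (n + 2)))"
  by (simp add: Dh_def s)
 show ?thesis
 proof (cases "even i")
  case True
  have "Dh ?o (s - 1) (Dh ?o s c) n = ext (hoch par ?o) (ext (hoch par ?o) (c (n + 2)))"
   unfolding e using True ext_rot_nrm[OF g(1)] ext_hoch_rot[OF o g(2)]
   by (simp add: D1h_def D2h_def ext_arith algebra_simps)
  then show ?thesis using N(1) by (simp add: eqc_def)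
 next
  case False
  have "Dh ?o (s - 1) (Dh ?o s c) n = ext (delta par ?o) (ext (delta par ?o) (c (n + 2)))"
   unfolding e using False by (simp add: D1h_def D2h_def ext_arith ext_nrm_rot ext_nrm_hoch[OF o])
  then show ?thesis using N(2) by (simp add: eqc_def)
 qed
qed

lemma cyc_D_cyc_D:
 assumes x: "x \<in> carrier (cyc_Tot K A s)"
 shows "cyc_D K A d \<pi> (s - 1) (cyc_D K A d \<pi> s x) = \<zero>\<^bsub>cyc_Tot K A (s - 1 - 1)\<^esub>"
proof (cases "s \<le> 1")
 case True
 then have "s - 1 = 0" "s - 1 - 1 = 0" by auto
 then show ?thesis by (simp add: cyc_D_def)
next
 case False
 obtain c where c: "tch A c" "x = TEV K A s c" using TEV_surj[OF A x] by blast
 have "cyc_D K A d \<pi> (s - 1) (cyc_D K A d \<pi> s x) = TEV K A (s - 1 - 1) (Dh (opm K A d \<pi>) (s - 1) (Dh (opm K A d \<pi>) s c))"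
  using False by (simp only: c(2) cyc_D_TEV[OF A inf_d inf_\<pi> c(1)] cyc_D_TEV[OF A inf_d inf_\<pi> Dh_tch[OF A inf_d inf_\<pi> c(1)]])
 also have "... = TEV K A (s - 1 - 1) (%n. 0)"
 proof (rule TEV_cong[OF A])
  fix n assume "n \<le> s - 1 - 1"
  then have "s = n + 2 + (s - n - 2)" using False by simp
  then show "eqc K A (Dh (opm K A d \<pi>) (s - 1) (Dh (opm K A d \<pi>) s c) n) 0" by (rule Dh_Dh[OF c(1)])
 qed
 finally show ?thesis by (simp add: TEV_zero[OF A])
qed

end

context
 fixes K :: "'k ring" and A :: "('k, 'a) graded_module" and B :: "('k, 'b) graded_module"
  and f :: "nat => nat => ('k, 'a) tensor => 'b"
 assumes A: "graded K A" and B: "graded K B"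
  and f: "!!n. f n \<in> graded_maps K A B (n + 1) n"
begin

lemma PH_slotwise: "slot_linear K A B (PH K A f j)"
proof -
 note m = slot_linear_mop[OF A B f]
 have "mop K A f [] = 0" by (simp add: mop_def)
 then show ?thesis
  using slot_linear_bar[OF A B m] slot_linear_cbar[OF A B m] by (simp add: PH_def)
qed

lemma PH_gch:
 assumes "valid A w"
 shows "gch B (pw par w) (length w) (PH K A f j w)"
 using bar_gch[OF A f assms] cbar_gch[OF A f assms] by (simp add: PH_def del: pw_par)

lemma cyc_phi_TEV:
 assumes c: "tch A c"
 shows "cyc_phi K A B f s (TEV K A s c) = TEV K B s (%n. ext (PH K A f (s - n)) (c n))"
 unfolding cyc_phi_def TEV_def XEV_def
proof (intro restrict_ext)
 fix n k assume nk: "n \<in> {0..s}" "k \<in> {0..n}"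
 let ?F = "word_lift K A B (PH K A f (s - n)) (k + 1) (n - k)"
 interpret T: module K "tensor_power K B (k + 1) (n - k)" by (rule tensor_module[OF B])
 have g: "gch A (n + 1) (n + 1) (c n)" using c unfolding tch_def by blast
 have lin: "?F \<in> linear_maps K (tensor_power K A (k' + 1) (n - k')) (tensor_power K B (k + 1) (n - k))" for k'
  by (rule word_lift_linear[OF A B PH_slotwise])
 have "(\<Oplus>\<^bsub>cyc_X K B k (n - k)\<^esub>k'\<in>{k..n}. ?F ((\<lambda>n\<in>{0..s}. \<lambda>k\<in>{0..n}. ev K A (k + 1) (n - k) (c n)) n k')) =
  (\<Oplus>\<^bsub>tensor_power K B (k + 1) (n - k)\<^esub>k'\<in>{k..n}. ?F (ev K A (k' + 1) (n - k') (c n)))"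
  unfolding cyc_X_def
  by (rule T.finsum_cong'[OF refl]) (use nk linearD(1)[OF lin ev_closed[OF A]] in auto)
 also have "... = ev K B (k + 1) (n - k) (ext (PH K A f (s - n)) (c n))"
 proof (rule sum_operator_ev[OF A B _ lin _ _ _ g])
  show "?F (evw K A (k' + 1) (n - k') w) = ev K B (k + 1) (n - k) (PH K A f (s - n) w)"
   if "w \<in> hw A (k' + 1) (n - k')" for k' w
   by (rule word_lift_evw[OF A B PH_slotwise that])
  show "ev K B (k + 1) (n - k) (PH K A f (s - n) w) = \<zero>\<^bsub>tensor_power K B (k + 1) (n - k)\<^esub>"
   if w: "valid A w" "pw par w = n + 1" "length w - 1 \<notin> {k..n}" for w
  proof (rule ev_eq_0[OF B])
   fix t assume t: "t \<in> wkeys (PH K A f (s - n) w)"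
   have "length w < k + 1" using w(2,3) length_le_pw[of w] by auto
   moreover have "length t \<le> length w" using t PH_gch[OF w(1)] unfolding gch_def by blast
   ultimately show "t \<notin> hw B (k + 1) (n - k)" by (auto simp: hw_iff)
  qed
 qed auto
 finally show "(\<Oplus>\<^bsub>cyc_X K B k (n - k)\<^esub>k'\<in>{k..n}. ?F ((\<lambda>n\<in>{0..s}. \<lambda>k\<in>{0..n}. ev K A (k + 1) (n - k) (c n)) n k')) =
  ev K B (k + 1) (n - k) (ext (PH K A f (s - n)) (c n))" .
qed

lemma cyc_phi_linear: "cyc_phi K A B f s \<in> linear_maps K (cyc_Tot K A s) (cyc_Tot K B s)"
 unfolding cyc_phi_def[abs_def]
proof (intro Tot_restrict_linear[OF B] Xbar_restrict_linear[OF B] finsum_linear[OF Tot_module[OF A]])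
 fix n k k' assume "n \<le> s" "k \<le> n" "k' \<in> {k..n}"
 then show "(%x. word_lift K A B (PH K A f (s - n)) (k + 1) (n - k) (x n k')) \<in> linear_maps K (cyc_Tot K A s) (cyc_X K B k (n - k))"
  using linear_comp[OF linear_comp[OF Tot_proj_linear[OF A, of n s] Xbar_proj_linear[OF A, of k' n, unfolded cyc_X_def]] word_lift_linear[OF A B PH_slotwise, where r = "k' + 1" and p = "n - k'"]]
  unfolding cyc_X_def by simp
qed (simp add: cyc_X_def tensor_module[OF B])

lemma Phh_tch: "tch A c ==> tch B (%n. ext (PH K A f (s - n)) (c n))"
 unfolding tch_def
proof
 fix n assume c: "\<forall>n. gch A (n + 1) (n + 1) (c n)"
 show "gch B (n + 1) (n + 1) (ext (PH K A f (s - n)) (c n))"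
 proof (rule gch_ext[OF c[rule_format]])
  fix w assume w: "valid A w" "pw par w = n + 1" "length w \<le> n + 1"
  show "gch B (n + 1) (n + 1) (PH K A f (s - n) w)" using gch_mono[OF PH_gch[OF w(1)] w(3)] unfolding w(2) .
 qed
qed

context
 fixes d \<pi> d' \<pi>'
 assumes infA: "A_infinity_algebra K A d \<pi>" and infB: "A_infinity_algebra K B d' \<pi>'"
  and mor: "A_infinity_morphism K A d \<pi> B d' \<pi>' f"
begin

text \<open>The horizontal parts commute on chains, by \<open>cbar_rot\<close> for even
  \<open>i\<close> and \<open>nrm_cbar\<close> for odd \<open>i\<close>; the vertical parts commute
  only modulo \<open>Null\<close>, by the morphism relation.\<close>

lemma Dh_Phh:
 assumes c: "tch A c" and s: "s = n + 1 + i"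
 shows "eqc K B (Dh (opm K B d' \<pi>') s (%n. ext (PH K A f (s - n)) (c n)) n)
  (ext (PH K A f (s - 1 - n)) (Dh (opm K A d \<pi>) s c n))"
proof -
 let ?o = "opm K A d \<pi>" and ?o' = "opm K B d' \<pi>'" and ?M = "mop K A f"
 have g: "gch A (n + 1) (n + 1) (c n)" "gch A (n + 1 + 1) (n + 1 + 1) (c (n + 1))"
  using c unfolding tch_def by blast+
 have o: "ops par ?o" "ops par ?o'" "mors par par ?M" by (rule ops_opm ops_opm mors_mop)+
 note I = Null_ideal[OF B]
 have rel: "ext ?o' (bar ?M w) - ext ?M (delta par ?o w) \<in> Null K B" if "valid A w" "w ~= []" for w
  using A_infinity_morphism_relation[OF A B inf_d[OF A infA] inf_\<pi>[OF A infA] inf_d[OF B infB] inf_\<pi>[OF B infB] mor that]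
  by (simp add: eqc_def)
 have N: "ext (hoch par ?o') (ext (cbar par ?M) (c (n + 1))) - ext (cbar par ?M) (ext (hoch par ?o) (c (n + 1))) \<in> Null K B"
  "ext (delta par ?o') (ext (bar ?M) (c (n + 1))) - ext (bar ?M) (ext (delta par ?o) (c (n + 1))) \<in> Null K B"
  unfolding ext_ext ext_fun_diff[symmetric]
  by (rule ext_ideal[OF I g(2)], rule hoch_cbar_ideal[OF o(3,1,2) I], rule rel, erule (1) valid_subset, assumption)
   (rule ext_ideal[OF I g(2)], rule delta_bar_ideal[OF o(3,1,2) I], rule rel, erule (1) valid_subset, assumption)
 have e: "Dh ?o' s (%n. ext (PH K A f (s - n)) (c n)) n =
   D1h (i + 1) (ext (PH K A f (i + 1)) (c n)) + D2h ?o' i (ext (PH K A f i) (c (n + 1)))"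
  "ext (PH K A f (s - 1 - n)) (Dh ?o s c n) = ext (PH K A f i) (D1h (i + 1) (c n) + D2h ?o i (c (n + 1)))"
  by (simp_all add: Dh_def s)
 show ?thesis
 proof (cases "even i")
  case True
  then show ?thesis
   unfolding e using N(1) ext_cbar_rot[OF o(3) g(1)]
   by (simp add: D1h_def D2h_def PH_def ext_arith eqc_def)
 next
  case False
  have nc: "ext (nrm par) (ext (cbar par ?M) (c n)) = ext (bar ?M) (ext (nrm par) (c n))"
   by (simp add: ext_ext nrm_cbar[OF o(3)])
  show ?thesis
   unfolding e using False chain_idealD(4)[OF I N(2)] nc
   by (simp add: D1h_def D2h_def PH_def ext_arith eqc_def)
 qed
qed

lemma cyc_phi_chain:
 assumes x: "x \<in> carrier (cyc_Tot K A s)"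
 shows "cyc_D K B d' \<pi>' s (cyc_phi K A B f s x) = cyc_phi K A B f (s - 1) (cyc_D K A d \<pi> s x)"
proof (cases "s = 0")
 case True
 then show ?thesis
  using linear_zero[OF cyc_phi_linear[of 0] Tot_module[OF A] Tot_module[OF B]] by (simp add: cyc_D_def)
next
 case False
 obtain c where c: "tch A c" "x = TEV K A s c" using TEV_surj[OF A x] by blast
 note dA = inf_d[OF A infA] inf_\<pi>[OF A infA] and dB = inf_d[OF B infB] inf_\<pi>[OF B infB]
 have "cyc_D K B d' \<pi>' s (cyc_phi K A B f s x) = TEV K B (s - 1) (Dh (opm K B d' \<pi>') s (%n. ext (PH K A f (s - n)) (c n)))"
  using False by (simp only: c(2) cyc_phi_TEV[OF c(1)] cyc_D_TEV[OF B dB Phh_tch[OF c(1)]])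
 also have "... = TEV K B (s - 1) (%n. ext (PH K A f (s - 1 - n)) (Dh (opm K A d \<pi>) s c n))"
 proof (rule TEV_cong[OF B])
  fix n assume "n \<le> s - 1"
  then have "s = n + 1 + (s - n - 1)" using False by simp
  then show "eqc K B (Dh (opm K B d' \<pi>') s (%n. ext (PH K A f (s - n)) (c n)) n)
   (ext (PH K A f (s - 1 - n)) (Dh (opm K A d \<pi>) s c n))" by (rule Dh_Phh[OF c(1)])
 qed
 also have "... = cyc_phi K A B f (s - 1) (cyc_D K A d \<pi> s x)"
  using False by (simp only: c(2) cyc_D_TEV[OF A dA c(1)] cyc_phi_TEV[OF Dh_tch[OF A dA c(1)]])
 finally show ?thesis .
qed

end

end

section \<open>Columns\<close>

definition lmap :: "'k ring => ('k, 'a) graded_module => (nat => nat => ('k, 'a) tensor => 'b) => nat \<times> 'a => nat \<times> 'b" where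
 "lmap K A f l = (fst l, f 0 (fst l) (pure_tensor K A [l]))"

definition hmap :: "'k ring => ('k, 'a) graded_module => (nat => nat => ('k, 'a) tensor => 'b) => nat \<times> 'a => nat \<times> 'b" where
 "hmap K A h l = (fst l + 1, h 0 (fst l) (pure_tensor K A [l]))"

text \<open>In a fixed suspended degree, shorter words have higher internal degree; these are the
  terms that do not count in the lowest step of the filtration.\<close>

definition shorter :: "nat => 'l chain => bool" where
 "shorter m c \<longleftrightarrow> (\<forall>t \<in> wkeys c. length t < m)"

lemma shorter_0 [simp]: "shorter m 0" and shorter_ks [simp]: "shorter m (ks n c) \<longleftrightarrow> shorter m c"
 by (simp_all add: shorter_def)

lemma shorter_add: "shorter m c ==> shorter m c' ==> shorter m (c + c')"
 using keys_add[of c c'] unfolding shorter_def by blast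

lemma shorter_SS: "(!!x y. x @ y = w ==> shorter m (f x y)) ==> shorter m (SS w f)"
 unfolding shorter_def by (metis keys_SS)

lemma shorter_letter: "shorter m c ==> shorter (m + 1) (wd [l] * c)"
 unfolding shorter_def by (auto elim!: keys_mult_append)

lemma gch_shorter: "gch A n m c ==> m < m' ==> shorter m' c"
 unfolding gch_def shorter_def by fastforce

lemma hch_mult:
 assumes "hch A r p c" "hch A r' p' c'"
 shows "hch A (r + r') (p + p') (c * c')"
 using assms unfolding hch_def by (fastforce elim!: keys_mult_append simp: hw_iff)

lemma hch_add: "hch A r p c ==> hch A r p c' ==> hch A r p (c + c')"
 using keys_add[of c c'] unfolding hch_def by blast

lemma hch_sum: "(!!i. i \<in> S ==> hch A r p (g i)) ==> hch A r p (sum g S)"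
 by (induction S rule: infinite_finite_induct) (auto intro: hch_add)

context
 fixes K :: "'k ring" and A :: "('k, 'a) graded_module" and B :: "('k, 'b) graded_module"
  and f :: "nat => nat => ('k, 'a) tensor => 'b"
 assumes A: "graded K A" and B: "graded K B"
  and f: "!!n. f n \<in> graded_maps K A B (n + 1) n"
begin

lemma letter_linear: "(%a. f 0 q (pure_tensor K A [(q, a)])) \<in> linear_maps K (A q) (B q)"
 using linear_comp[OF pure_slot_linear[OF A, of "[]" "[]" "0 + 1" q q] graded_mapsD[OF f[of 0], of q]] by simp

lemma lmap_valid: "valid A w ==> valid B (map (lmap K A f) w)"
 by (induction w) (auto simp: lmap_def linearD(1)[OF letter_linear])

lemma lmap_hw: "w \<in> hw A r p ==> map (lmap K A f) w \<in> hw B r p"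
proof -
 have "word_degree (map (lmap K A f) w) = word_degree w" by (induction w) (auto simp: lmap_def)
 then show "w \<in> hw A r p ==> map (lmap K A f) w \<in> hw B r p" by (simp add: hw_iff lmap_valid)
qed

text \<open>A block of two or more letters shortens the word, so full length is reached only if
  every block is a single letter.\<close>

lemma bar_top: "valid A w ==> shorter (length w) (bar (mop K A f) w - wd (map (lmap K A f) w))"
proof (induction w)
 case Nil
 then show ?case by (simp add: bar_def)
next
 case (Cons l w)
 let ?M = "mop K A f"
 have m0: "?M [] = 0" by (simp add: mop_def)
 have m1: "?M [l] = wd [lmap K A f l]" by (simp add: mop_def lmap_def)
 have "bar ?M (l # w) = ?M [l] * bar ?M w + SS w (%x y. if x = [] then 0 else ?M (l # x) * bar ?M y)"
  by (subst bar_rec[where Ph = ?M, OF m0]) (simp_all add: SS_Cons m0 SS_left_Nil[of w "%x y. ?M (l # x) * bar ?M y"])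
 then have e: "bar ?M (l # w) - wd (map (lmap K A f) (l # w)) =
  wd [lmap K A f l] * (bar ?M w - wd (map (lmap K A f) w)) + SS w (%x y. if x = [] then 0 else ?M (l # x) * bar ?M y)"
  using wd_append[of "[lmap K A f l]" "map (lmap K A f) w"] by (simp add: m1 right_diff_distrib)
 have "shorter (length w + 1) (SS w (%x y. if x = [] then 0 else ?M (l # x) * bar ?M y))"
 proof (rule shorter_SS)
  fix x y assume w: "x @ y = w"
  show "shorter (length w + 1) (if x = [] then 0 else ?M (l # x) * bar ?M y)"
  proof (cases "x = []")
   case False
   have v: "valid A (l # x)" "valid A y" using Cons.prems w by (cases l; auto)+
   have "1 + length y < length w + 1" using w False by auto
   then have "shorter (length w + 1) (?M (l # x) * bar ?M y)"
    by (rule gch_shorter[OF gch_mult[OF mop_gch[OF A f v(1)] bar_gch[OF A f v(2)]]])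
   then show ?thesis using False by simp
  qed simp
 qed
 moreover have "valid A w" using Cons.prems by (cases l) simp
 ultimately show ?case unfolding e using shorter_add[OF shorter_letter[OF Cons.IH]] by simp
qed

text \<open>The additional terms have a block that wraps around the end, hence has at least two
  letters.\<close>

lemma cbar_top:
 assumes "valid A w" "w ~= []"
 shows "shorter (length w) (cbar par (mop K A f) w - bar (mop K A f) w)"
proof -
 let ?M = "mop K A f"
 have m0: "?M [] = 0" by (simp add: mop_def)
 let ?G = "%x y z. if x = [] then 0 else ks (pw par z * (pw par x + pw par y)) (?M (z @ x) * bar ?M y)"
 have "cbar par ?M w = SS w (%x r. ?G x r [] + SS r (%y z. if z = [] then 0 else ?G x y z))"
  unfolding cbar_def CY_def by (rule SS_congI) (rule SS_right_Nil)
 also have "... = SS w (%x r. ?M x * bar ?M r) + SS w (%x r. SS r (%y z. if z = [] then 0 else ?G x y z))"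
  unfolding SS_add by (rule arg_cong2[where f = "(+)"], rule SS_congI) (simp_all add: m0)
 also have "SS w (%x r. ?M x * bar ?M r) = bar ?M w"
  by (rule bar_rec[where Ph = ?M, OF m0 assms(2), symmetric])
 finally have e: "cbar par ?M w - bar ?M w = SS w (%x r. SS r (%y z. if z = [] then 0 else ?G x y z))" by simp
 show ?thesis
  unfolding e
 proof (intro shorter_SS)
  fix x r y z assume w: "x @ r = w" "y @ z = r"
  show "shorter (length w) (if z = [] then 0 else ?G x y z)"
  proof (cases "z = [] \<or> x = []")
   case False
   have v: "valid A (z @ x)" "valid A y" using assms w by auto
   have "1 + length y < length w" using w False by (cases x; cases z) auto
   then have "shorter (length w) (?M (z @ x) * bar ?M y)"
    by (rule gch_shorter[OF gch_mult[OF mop_gch[OF A f v(1)] bar_gch[OF A f v(2)]]])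
   then show ?thesis by simp
  qed auto
 qed
qed

lemma shorter_ev: "shorter r c ==> ev K B r p c = \<zero>\<^bsub>tensor_power K B r p\<^esub>"
 by (rule ev_eq_0[OF B]) (auto simp: shorter_def hw_iff)

lemma ev_shorter_eq: "shorter r (c - c') ==> ev K B r p c = ev K B r p c'"
proof -
 interpret T: module K "tensor_power K B r p" by (rule tensor_module[OF B])
 assume "shorter r (c - c')"
 from shorter_ev[OF this, of p] show ?thesis
  using T.diff_zero_iff[OF ev_closed[OF B] ev_closed[OF B]] by (simp add: ev_diff[OF B] a_minus_def)
qed

text \<open>Even and odd columns have the same leading part, \<open>f_0\<close> on every letter; one
  argument then serves all columns.\<close>

lemma PH_top:
 assumes w: "w \<in> hw A r p" "0 < r"
 shows "ev K B r p' (PH K A f j w) = ev K B r p' (wd (map (lmap K A f) w))"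
proof -
 have v: "valid A w" "w ~= []" "length w = r" using w by (auto simp: hw_iff)
 show ?thesis
  using ev_shorter_eq[OF bar_top[OF v(1), unfolded v(3)], of p'] ev_shorter_eq[OF cbar_top[OF v(1,2), unfolded v(3)], of p']
  by (simp add: PH_def)
qed

lemma PH_lift_ev:
 assumes c: "hch A r p c" and r: "0 < r"
 shows "word_lift K A B (PH K A f j) r p (ev K A r p c) = ev K B r p (ext (%w. wd (map (lmap K A f) w)) c)"
 by (rule operator_ev[OF A B word_lift_linear[OF A B PH_slotwise[OF A B f]] _ c])
  (simp add: word_lift_evw[OF A B PH_slotwise[OF A B f]] PH_top r)

end

section \<open>Degree 0 parts of morphisms and homotopies\<close>

lemma tensor_differential_letter:
 assumes A: "graded K A" and d: "differential_module K A d" and a: "a \<in> carrier (A p)" and p: "0 < p"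
 shows "tensor_differential K A d 1 p (pure_tensor K A [(p, a)]) = pure_tensor K A [(p - 1, d p a)]"
proof -
 have 1: "[(p, a)] \<in> hw A 1 p" using a by (simp add: hw_iff)
 have 2: "[(p - 1, d p a)] \<in> hw A 1 (p - 1)" using linearD(1)[OF diff_moduleD(2)[OF d] a] by (simp add: hw_iff)
 show ?thesis
  using tensor_differential_evw[OF A d 1] p
  by (simp add: dletter_def ev_wd[OF A] evw_hw[OF A 1[simplified]] evw_hw[OF A 2[simplified]] signed_def)
qed

text \<open>The morphism relation for \<open>N = 0\<close>, in which both sums over \<open>m\<close>
  are empty.\<close>

lemma morphism_degree_0:
 assumes A: "graded K A" and B: "graded K B" and d: "differential_module K A d" and d': "differential_module K B d'"
  and mor: "A_infinity_morphism K A d \<pi> B d' \<pi>' f" and a: "a \<in> carrier (A p)" and p: "0 < p"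
 shows "d' p (f 0 p (pure_tensor K A [(p, a)])) = f 0 (p - 1) (pure_tensor K A [(p - 1, d p a)])"
proof -
 have f: "!!n. f n \<in> graded_maps K A B (n + 1) n" using mor by (simp add: A_infinity_morphism_def)
 interpret M: module K "B (p - 1)" by (rule gradedD(1)[OF B])
 have "pure_tensor K A [(p, a)] \<in> carrier (tensor_power K A (0 + 1) p)"
  by (rule pure_closed[OF A]) (use a in \<open>simp add: hw_iff\<close>)
 note mor[unfolded A_infinity_morphism_def Let_def, THEN conjunct2, rule_format, OF this]
 then have e: "d' p (f 0 p (pure_tensor K A [(p, a)])) \<oplus>\<^bsub>B (p - 1)\<^esub> \<ominus>\<^bsub>B (p - 1)\<^esub> f 0 (p - 1) (pure_tensor K A [(p - 1, d p a)]) = \<zero>\<^bsub>B (p - 1)\<^esub>"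
  using p tensor_differential_letter[where A = A, OF A d a p] by (simp add: signed_def M.minus_eq del: One_nat_def add: One_nat_def[symmetric])
 have c1: "d' p (f 0 p (pure_tensor K A [(p, a)])) \<in> carrier (B (p - 1))"
  by (rule linearD(1)[OF diff_moduleD(2)[OF d'] linearD(1)[OF letter_linear[OF A B f] a]])
 have c2: "f 0 (p - 1) (pure_tensor K A [(p - 1, d p a)]) \<in> carrier (B (p - 1))"
  by (rule linearD(1)[OF letter_linear[OF A B f] linearD(1)[OF diff_moduleD(2)[OF d] a]])
 show ?thesis using e M.diff_zero_iff[OF c1 c2] by simp
qed

text \<open>The homotopy relation for \<open>N = 0\<close>: \<open>h_0\<close> is a chain homotopy
  between \<open>g_0 f_0\<close> and the identity.\<close>

lemma homotopy_degree_0: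
 assumes A: "graded K A" and B: "graded K B" and d: "differential_module K A d"
  and f: "!!n. f n \<in> graded_maps K A B (n + 1) n" and g: "!!n. g n \<in> graded_maps K B A (n + 1) n"
  and hom: "A_infinity_homotopy K A d \<pi> A d \<pi> (A_infinity_comp K A B A g f) (A_infinity_id K A) h"
  and a: "a \<in> carrier (A p)"
 shows "d (p + 1) (h 0 p (pure_tensor K A [(p, a)])) \<oplus>\<^bsub>A p\<^esub>
   (if p = 0 then \<zero>\<^bsub>A p\<^esub> else h 0 (p - 1) (pure_tensor K A [(p - 1, d p a)])) =
  snd (lmap K B g (lmap K A f (p, a))) \<ominus>\<^bsub>A p\<^esub> a"
proof -
 interpret M: module K "A p" by (rule gradedD(1)[OF A])
 let ?x = "pure_tensor K A [(p, a)]"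
 have hw: "[(p, a)] \<in> hw A 1 p" using a by (simp add: hw_iff)
 have b: "f 0 p ?x \<in> carrier (B p)" by (rule linearD(1)[OF letter_linear[OF A B f] a])
 have gb: "g 0 p (pure_tensor K B [(p, f 0 p ?x)]) \<in> carrier (A p)" by (rule linearD(1)[OF letter_linear[OF B A g] b])
 have comp: "A_infinity_comp K A B A g f 0 p ?x = g 0 p (pure_tensor K B [(p, f 0 p ?x)])"
 proof -
  have c0: "compositions 0 1 = {[0]}" by (auto simp: compositions_def length_Suc_conv)
  have "tensor_map K A B (morphism_factors f [0]) p ?x = pure_tensor K B [(p, f 0 p ?x)]"
   using tensor_map_pure[OF A B morphism_factors_ok[OF f], where w = "[(p, a)]" and p = p and ns1 = "[0]"] hw by (simp add: signed_def)
  then show ?thesis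
   using gb by (simp add: A_infinity_comp_def c0[simplified] signed_def)
 qed
 have "?x \<in> carrier (tensor_power K A (0 + 1) p)" using pure_closed[OF A hw] by simp
 note hom[unfolded A_infinity_homotopy_def Let_def, THEN conjunct2, rule_format, OF this]
 then have E: "d (p + 1) (h 0 p ?x) \<oplus>\<^bsub>A p\<^esub>
   (if p = 0 then \<zero>\<^bsub>A p\<^esub> else signed (A p) 0 (h 0 (p - 1) (tensor_differential K A d 1 p ?x))) =
  A_infinity_comp K A B A g f 0 p ?x \<ominus>\<^bsub>A p\<^esub> A_infinity_id K A 0 p ?x \<oplus>\<^bsub>A p\<^esub> \<zero>\<^bsub>A p\<^esub> \<oplus>\<^bsub>A p\<^esub> \<zero>\<^bsub>A p\<^esub>"
  by (simp only: lessThan_0 M.finsum_empty add_0_right add_0_left)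
 have i: "A_infinity_id K A 0 p ?x = a" by (simp add: A_infinity_id_def unary_id_pure[OF A a])
 have l: "snd (lmap K B g (lmap K A f (p, a))) = g 0 p (pure_tensor K B [(p, f 0 p ?x)])" by (simp add: lmap_def)
 have c: "(if p = 0 then \<zero>\<^bsub>A p\<^esub> else signed (A p) 0 (h 0 (p - 1) (tensor_differential K A d 1 p ?x))) =
  (if p = 0 then \<zero>\<^bsub>A p\<^esub> else h 0 (p - 1) (pure_tensor K A [(p - 1, d p a)]))"
 proof (cases "p = 0")
  case False
  then have "0 < p" by simp
  from tensor_differential_letter[OF A d a this] show ?thesis by (simp only: signed_def even_zero if_True)
 qed simp
 show ?thesis
  using E unfolding comp i c l M.r_zero[OF M.minus_closed[OF gb a]] .
qed

text \<open>This makes the homotopy a linear map of tensor powers, as \<open>column_surj\<close>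
  requires.\<close>

lemma slot_linear_letter_htpy:
 fixes A :: "('k, 'a) graded_module" and P H :: "nat \<times> 'a => nat \<times> 'a"
 assumes A: "graded K A" and P: "!!q. (%a. snd (P (q, a))) \<in> linear_maps K (A q) (A q)" "!!l. fst (P l) = fst l"
  and H: "!!q. (%a. snd (H (q, a))) \<in> linear_maps K (A q) (A (q + 1))" "!!l. fst (H l) = fst l + 1"
 shows "slot_linear K A A (letter_htpy par P H)"
 unfolding slot_linear_def
proof (intro allI impI)
 fix u v :: "'a hword" and q
 show "slin K A A q (%a. letter_htpy par P H (u @ (q, a) # v))"
 proof (induction u)
  case Nil
  have e: "H (q, a) = (q + 1, snd (H (q, a)))" "P (q, a) = (q, snd (P (q, a)))" for a
   using H(2)[of "(q, a)"] P(2)[of "(q, a)"] by (metis fst_conv prod.collapse)+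
  have f: "letter_htpy par P H ([] @ (q, a) # v) = wd [(q + 1, snd (H (q, a)))] * wd v + ks (q + 1) (wd [(q, snd (P (q, a)))] * letter_htpy par P H v)" for a
   using wd_append[of "[H (q, a)]" v] e[of a] by (simp add: par_def)
  show ?case unfolding f by (intro slin_add[OF A A] slin_mult(1)[OF A A] slin_ks[OF A A] slin_letter[OF A A] H(1) P(1))
 next
  case (Cons l u)
  have f: "letter_htpy par P H ((l # u) @ (q, a) # v) = wd (H l # u) * (wd [(q, a)] * wd v) + ks (par l) (wd [P l] * letter_htpy par P H (u @ (q, a) # v))" for a
   using wd_append[of "H l # u" "(q, a) # v"] wd_append[of "[(q, a)]" v] by simp
  show ?case unfolding f
   by (intro slin_add[OF A A] slin_mult[OF A A] slin_ks[OF A A] slin_letter[OF A A id_linear] Cons.IH)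
 qed
qed

lemma letter_htpy_hch:
 assumes P: "!!q a. a \<in> carrier (A q) ==> snd (P (q, a)) \<in> carrier (A q)" "!!l. fst (P l) = fst l"
  and H: "!!q a. a \<in> carrier (A q) ==> snd (H (q, a)) \<in> carrier (A (q + 1))" "!!l. fst (H l) = fst l + 1"
 shows "valid A w ==> hch A (length w) (word_degree w + 1) (letter_htpy par P H w)"
proof (induction w)
 case (Cons l w)
 obtain q a where l: "l = (q, a)" by (cases l)
 have v: "a \<in> carrier (A q)" "valid A w" using Cons.prems l by auto
 obtain b c where b: "H l = (q + 1, b)" "b \<in> carrier (A (q + 1))" "P l = (q, c)" "c \<in> carrier (A q)"
  using P(1)[OF v(1)] H(1)[OF v(1)] P(2)[of l] H(2)[of l] l by (metis fst_conv prod.collapse)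
 have "hch A (length (l # w)) (word_degree (l # w) + 1) (wd (H l # w))"
  using b v by (simp add: l hw_iff)
 moreover have "hch A (1 + length w) (q + (word_degree w + 1)) (wd [P l] * letter_htpy par P H w)"
  using b by (intro hch_mult Cons.IH v) (simp add: hw_iff)
 ultimately have "hch A (length (l # w)) (word_degree (l # w) + 1) (wd (H l # w) + ks (par l) (wd [P l] * letter_htpy par P H w))"
  by (intro hch_add) (simp_all add: l add.assoc)
 then show ?case by simp
qed simp

context
 fixes K :: "'k ring" and A :: "('k, 'a) graded_module" and B :: "('k, 'b) graded_module"
  and d :: "nat => 'a => 'a" and \<pi> \<rho> f g h h'
 assumes A: "graded K A" and B: "graded K B" and d: "differential_module K A d"
  and f: "A_infinity_morphism K A d \<pi> B (zero_differential B) \<rho> f"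
  and g: "A_infinity_morphism K B (zero_differential B) \<rho> A d \<pi> g"
  and h: "A_infinity_homotopy K A d \<pi> A d \<pi> (A_infinity_comp K A B A g f) (A_infinity_id K A) h"
  and h': "A_infinity_homotopy K B (zero_differential B) \<rho> B (zero_differential B) \<rho> (A_infinity_comp K B A B f g) (A_infinity_id K B) h'"
begin

lemma zero_dm: "differential_module K B (zero_differential B)"
 unfolding differential_module_def zero_differential_def[abs_def]
 by (intro conjI allI ballI gradedD(1)[OF B] zero_linear) simp_all

lemma f_gm: "f n \<in> graded_maps K A B (n + 1) n" and g_gm: "g n \<in> graded_maps K B A (n + 1) n"
 and h_gm: "h n \<in> graded_maps K A A (n + 1) (n + 1)" and h'_gm: "h' n \<in> graded_maps K B B (n + 1) (n + 1)"
 using f g h h' by (simp_all add: A_infinity_morphism_def A_infinity_homotopy_def)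

lemma h_letter_linear: "(%a. h 0 q (pure_tensor K A [(q, a)])) \<in> linear_maps K (A q) (A (q + 1))"
 using linear_comp[OF pure_slot_linear[OF A, of "[]" "[]" "0 + 1" q q] graded_mapsD[OF h_gm[of 0], of q]] by simp

lemma f_d_zero: "a \<in> carrier (A q) ==> 0 < q ==> f 0 (q - 1) (pure_tensor K A [(q - 1, d q a)]) = \<zero>\<^bsub>B (q - 1)\<^esub>"
 using morphism_degree_0[OF A B d zero_dm f] by (simp add: zero_differential_def)

lemma d_g_zero:
 assumes b: "b \<in> carrier (B q)" and q: "0 < q"
 shows "d q (g 0 q (pure_tensor K B [(q, b)])) = \<zero>\<^bsub>A (q - 1)\<^esub>"
 using morphism_degree_0[OF B A zero_dm d g b q]
  linear_zero[OF letter_linear[OF B A g_gm] gradedD(1)[OF B] gradedD(1)[OF A], of "q - 1"]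
 by (simp add: zero_differential_def)

text \<open>The differential of \<open>B\<close> is zero, so both homotopy terms vanish and the two
  sides agree on the nose rather than up to homotopy.\<close>

lemma fg_id:
 assumes b: "b \<in> carrier (B q)"
 shows "lmap K A f (lmap K B g (q, b)) = (q, b)"
proof -
 interpret M: module K "B q" by (rule gradedD(1)[OF B])
 let ?c = "snd (lmap K A f (lmap K B g (q, b)))"
 have c: "?c \<in> carrier (B q)"
  unfolding lmap_def fst_conv snd_conv
  by (rule linearD(1)[OF letter_linear[OF A B f_gm] linearD(1)[OF letter_linear[OF B A g_gm] b]])
 have h'z: "h' 0 n (pure_tensor K B [(n, \<zero>\<^bsub>B n\<^esub>)]) = \<zero>\<^bsub>B (n + 1)\<^esub>" for n
  using linear_zero[OF linear_comp[OF pure_slot_linear[OF B, of "[]" "[]" "0 + 1" n n] graded_mapsD[OF h'_gm[of 0], of n]] gradedD(1)[OF B] gradedD(1)[OF B]]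
  by simp
 have "zero_differential B (q + 1) (h' 0 q (pure_tensor K B [(q, b)])) \<oplus>\<^bsub>B q\<^esub>
   (if q = 0 then \<zero>\<^bsub>B q\<^esub> else h' 0 (q - 1) (pure_tensor K B [(q - 1, zero_differential B q b)])) = \<zero>\<^bsub>B q\<^esub>"
 proof (cases "q = 0")
  case True
  then show ?thesis using M.l_zero[OF M.zero_closed] by (simp add: zero_differential_def)
 next
  case False
  then show ?thesis using h'z[of "q - 1"] by (simp add: zero_differential_def)
 qed
 then have "?c \<ominus>\<^bsub>B q\<^esub> b = \<zero>\<^bsub>B q\<^esub>"
  using homotopy_degree_0[OF B A zero_dm g_gm f_gm h' b] by simp
 then have "?c = b" using M.diff_zero_iff[OF c b] by (simp add: a_minus_def)
 then show ?thesis by (simp add: lmap_def)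
qed

abbreviation (input) "gf l \<equiv> lmap K B g (lmap K A f l)"

lemma gf_linear: "(%a. snd (gf (q, a))) \<in> linear_maps K (A q) (A q)"
 unfolding lmap_def fst_conv snd_conv
 by (rule linear_comp[OF letter_linear[OF A B f_gm] letter_linear[OF B A g_gm]])

text \<open>\<open>letter_htpy\<close> spreads \<open>h_0\<close> over words; what it requires of a
  single letter is \<open>homotopy_degree_0\<close>.\<close>

lemma letter_htpy_relation:
 assumes w: "valid A w"
 shows "ext (letter_diff par (dletter d)) (letter_htpy par (%l. gf l) (hmap K A h) w) +
  ext (letter_htpy par (%l. gf l) (hmap K A h)) (letter_diff par (dletter d) w) - (wd (map (%l. gf l) w) - wd w) \<in> Null K A"
proof (rule letter_htpy[OF Null_ideal[OF A]])
 show "lett par (par l + 1) (dletter d l)" for l :: "nat \<times> 'a"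
  by (auto simp: dletter_def par_def intro!: lett_wdI)
 show "even (par (hmap K A h l)) \<longleftrightarrow> odd (par l)" for l by (simp add: hmap_def par_def)
 show "even (par (gf l)) \<longleftrightarrow> even (par l)" for l by (simp add: lmap_def par_def)
 fix l assume "l \<in> set w"
 then obtain q a where l: "l = (q, a)" and a: "a \<in> carrier (A q)" using w by (cases l) (auto simp: valid_def)
 have fa: "f 0 q (pure_tensor K A [(q, a)]) \<in> carrier (B q)" by (rule linearD(1)[OF letter_linear[OF A B f_gm] a])
 have gz: "g 0 n (pure_tensor K B [(n, \<zero>\<^bsub>B n\<^esub>)]) = \<zero>\<^bsub>A n\<^esub>" for n
  by (rule linear_zero[OF letter_linear[OF B A g_gm] gradedD(1)[OF B] gradedD(1)[OF A]])
 \<comment> \<open>In positive degree both sides are the letter with vector 0, since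
   \<open>d g_0 = 0\<close> and \<open>f_0 d = 0\<close> for the zero differential of
   \<open>B\<close>; in degree 0 both sides are zero chains.\<close>
 show "dletter d (gf l) = ext (%t. wd (map (%l. gf l) t)) (dletter d l)"
  using d_g_zero[OF fa] f_d_zero[OF a] gz[of "q - 1"] by (auto simp: l dletter_def lmap_def)
 let ?b = "h 0 q (pure_tensor K A [(q, a)])"
 define c where "c = snd (gf (q, a))"
 have b: "d (q + 1) ?b \<in> carrier (A q)"
  using linearD(1)[OF diff_moduleD(2)[OF d] linearD(1)[OF h_letter_linear a]] by simp
 have c: "c \<in> carrier (A q)" unfolding c_def by (rule linearD(1)[OF gf_linear a])
 have gfl: "gf (q, a) = (q, c)" by (simp add: lmap_def c_def)
 let ?e = "if q = 0 then \<zero>\<^bsub>A q\<^esub> else h 0 (q - 1) (pure_tensor K A [(q - 1, d q a)])"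
 have e: "?e \<in> carrier (A q)"
 proof (cases "q = 0")
  case True
  interpret M: module K "A q" by (rule gradedD(1)[OF A])
  show ?thesis using True M.zero_closed by simp
 next
  case False
  then show ?thesis
   using linearD(1)[OF h_letter_linear linearD(1)[OF diff_moduleD(2)[OF d] a]] by simp
 qed
 have 1: "dletter d (hmap K A h l) = wd [(q, d (q + 1) ?b)]" by (simp add: l dletter_def hmap_def)
 have 2: "eqc K A (ext (%t. wd (map (hmap K A h) t)) (dletter d l)) (wd [(q, ?e)])"
  using eqc_sym[OF A letter_zero[OF A, of q]] eqc_refl[OF A] by (auto simp: l dletter_def hmap_def)
 have 3: "eqc K A (wd [(q, d (q + 1) ?b)] + wd [(q, ?e)]) (wd [gf l] - wd [l])"
  unfolding l gfl
  by (rule eqc_trans[OF A eqc_sym[OF A letter_add[OF A b e]]])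
   (unfold homotopy_degree_0[OF A B d f_gm g_gm h a, folded c_def], rule letter_diff[OF A c a])
 show "dletter d (hmap K A h l) + ext (%t. wd (map (hmap K A h) t)) (dletter d l) - (wd [gf l] - wd [l]) \<in> Null K A"
  using eqc_trans[OF A eqc_add[OF A eqc_refl[OF A] 2] 3] unfolding 1 eqc_def .
qed

lemma diff_hch: "w \<in> hw A r p ==> hch A r (p - 1) (letter_diff par (dletter d) w)"
 unfolding letter_diff_sum by (rule hch_sum) (use d_update_hw[OF A d] in auto)

lemma td_ev: "hch A r p c ==> tensor_differential K A d r p (ev K A r p c) = ev K A r (p - 1) (ext (letter_diff par (dletter d)) c)"
 by (rule operator_ev[OF A A tensor_diff_linear[OF A d] tensor_differential_evw[OF A d]])

text \<open>Applying \<open>f_0\<close> to every letter inverts the leading part of the induced map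
  and annihilates boundaries, because \<open>f_0 d = 0\<close>.\<close>

lemma column_inj:
 assumes x: "x \<in> carrier (tensor_power K B (k + 1) p)" and z: "z \<in> carrier (tensor_power K A (k + 1) (p + 1))"
  and eq: "word_lift K B A (PH K B g j) (k + 1) p x = tensor_differential K A d (k + 1) (p + 1) z"
 shows "x = \<zero>\<^bsub>tensor_power K B (k + 1) p\<^esub>"
proof -
 let ?Q = "word_lift K A B (PH K A f 0) (k + 1) p"
 obtain c where c: "hch B (k + 1) p c" "x = ev K B (k + 1) p c" using ev_surj[OF B x] by blast
 obtain e where e: "hch A (k + 1) (p + 1) e" "z = ev K A (k + 1) (p + 1) e" using ev_surj[OF A z] by blast
 have c': "hch A (k + 1) p (ext (%w. wd (map (lmap K B g) w)) c)"
  by (rule hch_ext[OF c(1)]) (use lmap_hw[OF B A g_gm] in auto)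
 have e': "hch A (k + 1) p (ext (letter_diff par (dletter d)) e)"
  by (rule hch_ext[OF e(1)]) (use diff_hch[of _ _ "p + 1"] in auto)
 have "ext (%w. wd (map (lmap K A f) w)) (ext (%w. wd (map (lmap K B g) w)) c) = ext wd c"
  unfolding ext_ext
 proof (rule ext_cong)
  fix w assume "w \<in> wkeys c"
  then have "valid B w" using c(1) by (auto simp: hch_def hw_iff)
  then have "map (lmap K A f) (map (lmap K B g) w) = w"
   by (induction w) (auto simp: fg_id)
  then show "ext (%w. wd (map (lmap K A f) w)) (wd (map (lmap K B g) w)) = wd w" by simp
 qed
 then have 1: "?Q (word_lift K B A (PH K B g j) (k + 1) p x) = x"
  unfolding c(2) using PH_lift_ev[OF B A g_gm c(1)] PH_lift_ev[OF A B f_gm c'] by simp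
 have "ext (%w. wd (map (lmap K A f) w)) (ext (letter_diff par (dletter d)) e) \<in> Null K B"
  unfolding ext_ext
  using e(1)
 proof (induction rule: hch_induct)
  case (wd w)
  have "wd (map (lmap K A f) (w[i := (fst (w ! i) - 1, d (fst (w ! i)) (snd (w ! i)))])) \<in> Null K B"
   if i: "i < length w" "0 < fst (w ! i)" for i
  proof -
   have "snd (w ! i) \<in> carrier (A (fst (w ! i)))" using wd i by (auto simp: hw_iff valid_def dest!: nth_mem)
   then have "lmap K A f (fst (w ! i) - 1, d (fst (w ! i)) (snd (w ! i))) = (fst (w ! i) - 1, \<zero>\<^bsub>B (fst (w ! i) - 1)\<^esub>)"
    using f_d_zero i(2) by (simp add: lmap_def)
   moreover have "wd [(fst (w ! i) - 1, \<zero>\<^bsub>B (fst (w ! i) - 1)\<^esub>)] \<in> Null K B"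
    using letter_zero[OF B] by (simp add: eqc_def)
   from chain_idealD(6)[OF Null_ideal[OF B] this, of "map (lmap K A f) (take i w)" "map (lmap K A f) (drop (Suc i) w)"]
   have "wd (map (lmap K A f) (take i w) @ [(fst (w ! i) - 1, \<zero>\<^bsub>B (fst (w ! i) - 1)\<^esub>)] @ map (lmap K A f) (drop (Suc i) w)) \<in> Null K B"
    by (simp only: wd_append mult.assoc)
   ultimately show ?thesis unfolding upd_split[OF i(1)] by simp
  qed
  then show ?case
   unfolding ext_wd letter_diff_sum ext_sum ext_ks
   by (intro chain_ideal_sum[OF Null_ideal[OF B]] chain_idealD(5)[OF Null_ideal[OF B]]) auto
 qed (auto simp: ext_arith chain_idealD[OF Null_ideal[OF B]])
 then have 2: "?Q (tensor_differential K A d (k + 1) (p + 1) z) = \<zero>\<^bsub>tensor_power K B (k + 1) p\<^esub>"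
  unfolding e(2) td_ev[OF e(1)] using PH_lift_ev[OF A B f_gm e', of 0] Null_ev[OF B] by simp
 show ?thesis using 1 2 unfolding eq by simp
qed

text \<open>For a cycle \<open>z\<close> the homotopy formula reads
  \<open>z = g_0 f_0 z - D (\<eta> z)\<close>, which yields \<open>u = f_0 z\<close> and
  \<open>v = - \<eta> z\<close>. In degree 0 every tensor is a cycle, so the condition on
  \<open>z\<close> is confined to \<open>0 < p\<close>.\<close>

lemma column_surj:
 assumes z: "z \<in> carrier (tensor_power K A (k + 1) p)"
  and dz: "0 < p ==> tensor_differential K A d (k + 1) p z = \<zero>\<^bsub>tensor_power K A (k + 1) (p - 1)\<^esub>"
 shows "\<exists>u \<in> carrier (tensor_power K B (k + 1) p). \<exists>v \<in> carrier (tensor_power K A (k + 1) (p + 1)).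
  z = word_lift K B A (PH K B g j) (k + 1) p u \<oplus>\<^bsub>tensor_power K A (k + 1) p\<^esub> tensor_differential K A d (k + 1) (p + 1) v"
proof -
 let ?T = "tensor_power K A (k + 1) p" and ?L = "word_lift K B A (PH K B g j) (k + 1) p"
 let ?\<eta> = "letter_htpy par (%l. gf l) (hmap K A h)" and ?\<delta> = "letter_diff par (dletter d)"
 interpret T: module K ?T by (rule tensor_module[OF A])
 interpret T': module K "tensor_power K A (k + 1) (p + 1)" by (rule tensor_module[OF A])
 obtain c where c: "hch A (k + 1) p c" "z = ev K A (k + 1) p c" using ev_surj[OF A z] by blast
 define u where "u = word_lift K A B (PH K A f 0) (k + 1) p z"
 have c': "hch B (k + 1) p (ext (%w. wd (map (lmap K A f) w)) c)"
  by (rule hch_ext[OF c(1)]) (use lmap_hw[OF A B f_gm] in auto)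
 have u: "u = ev K B (k + 1) p (ext (%w. wd (map (lmap K A f) w)) c)"
  unfolding u_def c(2) by (rule PH_lift_ev[OF A B f_gm c(1)]) simp
 have Lu: "?L u = ev K A (k + 1) p (ext (%w. wd (map (%l. gf l) w)) c)"
  unfolding u using PH_lift_ev[OF B A g_gm c', of j] by (simp add: ext_ext comp_def)
 have hm: "snd (hmap K A h (q, a)) = h 0 q (pure_tensor K A [(q, a)])" for q a by (simp add: hmap_def)
 have \<eta>w: "hch A (k + 1) (p + 1) (?\<eta> w)" if "w \<in> hw A (k + 1) p" for w
  using letter_htpy_hch[of A "%l. gf l" "hmap K A h" w] that linearD(1)[OF gf_linear] linearD(1)[OF h_letter_linear]
  by (simp add: hm hw_iff) (simp add: lmap_def hmap_def)
 have \<eta>: "hch A (k + 1) (p + 1) (ext ?\<eta> c)" by (rule hch_ext[OF c(1) \<eta>w])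
 define v where "v = ev K A (k + 1) (p + 1) (ext ?\<eta> c)"
 have tv: "tensor_differential K A d (k + 1) (p + 1) v = ev K A (k + 1) p (ext ?\<delta> (ext ?\<eta> c))"
  unfolding v_def using td_ev[OF \<eta>] by simp
 have 3: "ev K A (k + 1) p (ext ?\<eta> (ext ?\<delta> c)) = \<zero>\<^bsub>?T\<^esub>"
 proof (cases "p = 0")
  case True
  have "ext ?\<delta> c = ext (%w. 0) c"
  proof (rule ext_cong)
   fix w assume "w \<in> wkeys c"
   then have "word_degree w = 0" using c(1) True by (auto simp: hch_def hw_iff)
   then show "?\<delta> w = 0" by (induction w) (auto simp: dletter_def)
  qed
  then show ?thesis by (simp add: ev_zero[OF A])
 next
  case False
  \<comment> \<open>The boundary of \<open>z\<close> vanishes as a tensor, not as a chain. To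
    conclude that its image under \<open>\<eta>\<close> vanishes, \<open>\<eta>\<close> has to act
    as a linear map on tensors.\<close>
  have sl: "slot_linear K A A ?\<eta>"
   by (rule slot_linear_letter_htpy[OF A gf_linear _ h_letter_linear[folded hm]]) (simp_all add: lmap_def hmap_def)
  have d': "hch A (k + 1) (p - 1) (ext ?\<delta> c)" by (rule hch_ext[OF c(1) diff_hch])
  have "ev K A (k + 1) p (ext ?\<eta> (ext ?\<delta> c)) = word_lift K A A ?\<eta> (k + 1) p (ev K A (k + 1) (p - 1) (ext ?\<delta> c))"
   by (rule operator_ev[OF A A word_lift_linear[OF A A sl] word_lift_evw[OF A A sl] d', symmetric])
  also have "ev K A (k + 1) (p - 1) (ext ?\<delta> c) = \<zero>\<^bsub>tensor_power K A (k + 1) (p - 1)\<^esub>"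
   using dz False td_ev[OF c(1)] c(2) by simp
  also have "word_lift K A A ?\<eta> (k + 1) p \<zero>\<^bsub>tensor_power K A (k + 1) (p - 1)\<^esub> = \<zero>\<^bsub>?T\<^esub>"
   by (rule linear_zero[OF word_lift_linear[OF A A sl] tensor_module[OF A] tensor_module[OF A]])
  finally show ?thesis .
 qed
 have N: "ext ?\<delta> (ext ?\<eta> c) + ext ?\<eta> (ext ?\<delta> c) - (ext (%w. wd (map (%l. gf l) w)) c - c) \<in> Null K A"
  using c(1)
 proof (induction rule: hch_induct)
  case (wd w)
  then show ?case using letter_htpy_relation[of w] by (simp add: hw_iff)
 next
  case (diff a b)
  from chain_idealD(3)[OF Null_ideal[OF A] this] show ?case by (simp add: ext_arith algebra_simps)
 qed (simp add: chain_idealD[OF Null_ideal[OF A]])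
 let ?td = "tensor_differential K A d (k + 1) (p + 1)"
 have tvc: "?td v \<in> carrier ?T" unfolding tv by (rule ev_closed[OF A])
 have Luc: "?L u \<in> carrier ?T" unfolding Lu by (rule ev_closed[OF A])
 have "?td v \<oplus>\<^bsub>?T\<^esub> \<zero>\<^bsub>?T\<^esub> = ?L u \<ominus>\<^bsub>?T\<^esub> z"
  using ev_cong_Null[OF A N, of "k + 1" p] unfolding ev_add[OF A] ev_diff[OF A] 3 tv[symmetric] Lu[symmetric] c(2)[symmetric] .
 then have e: "?td v = ?L u \<ominus>\<^bsub>?T\<^esub> z" using tvc T.r_zero by simp
 have "z = ?L u \<oplus>\<^bsub>?T\<^esub> \<ominus>\<^bsub>?T\<^esub> ?td v"
  unfolding e using z Luc by (simp only: T.minus_eq T.minus_add T.minus_minus T.a_inv_closed T.r_neg2)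
 also have "\<ominus>\<^bsub>?T\<^esub> ?td v = ?td (\<ominus>\<^bsub>tensor_power K A (k + 1) (p + 1)\<^esub> v)"
  using linear_neg[OF tensor_diff_linear[OF A d, of "k + 1" "p + 1", simplified] tensor_module[OF A] tensor_module[OF A], of v] ev_closed[OF A]
  by (simp add: v_def)
 finally show ?thesis
  by (intro bexI[of _ u] bexI[of _ "\<ominus>\<^bsub>tensor_power K A (k + 1) (p + 1)\<^esub> v"])
   (simp_all only: u v_def ev_closed[OF B] ev_closed[OF A] T'.a_inv_closed)
qed

end

section \<open>Comparison of the total complexes\<close>

lemma (in abelian_group) minus_eqD: "x \<in> carrier G ==> a \<in> carrier G ==> x \<ominus> a = b ==> x = a \<oplus> b"
 by (metis a_inv_closed a_minus_def a_comm r_neg1 r_neg2 minus_closed)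

lemma module_group:
 assumes M: "module K M"
 shows "\<zero>\<^bsub>M\<^esub> \<in> carrier M" "x \<in> carrier M ==> y \<in> carrier M ==> x \<oplus>\<^bsub>M\<^esub> y \<in> carrier M"
  "x \<in> carrier M ==> y \<in> carrier M ==> x \<ominus>\<^bsub>M\<^esub> y \<in> carrier M"
  "x \<in> carrier M ==> x \<oplus>\<^bsub>M\<^esub> \<zero>\<^bsub>M\<^esub> = x" "x \<in> carrier M ==> x \<ominus>\<^bsub>M\<^esub> x = \<zero>\<^bsub>M\<^esub>"
  "x \<in> carrier M ==> y \<in> carrier M ==> x \<ominus>\<^bsub>M\<^esub> y = z ==> x = y \<oplus>\<^bsub>M\<^esub> z"
  "a \<in> carrier M ==> b \<in> carrier M ==> x \<in> carrier M ==> y \<in> carrier M ==>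
   a \<oplus>\<^bsub>M\<^esub> b \<oplus>\<^bsub>M\<^esub> (x \<oplus>\<^bsub>M\<^esub> y) = a \<oplus>\<^bsub>M\<^esub> x \<oplus>\<^bsub>M\<^esub> (b \<oplus>\<^bsub>M\<^esub> y)"
proof -
 interpret M: module K M by (rule M)
 show "\<zero>\<^bsub>M\<^esub> \<in> carrier M" "x \<in> carrier M ==> y \<in> carrier M ==> x \<oplus>\<^bsub>M\<^esub> y \<in> carrier M"
  "x \<in> carrier M ==> y \<in> carrier M ==> x \<ominus>\<^bsub>M\<^esub> y \<in> carrier M"
  "x \<in> carrier M ==> x \<oplus>\<^bsub>M\<^esub> \<zero>\<^bsub>M\<^esub> = x" "x \<in> carrier M ==> x \<ominus>\<^bsub>M\<^esub> x = \<zero>\<^bsub>M\<^esub>"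
  by (simp_all add: a_minus_def M.r_neg)
 show "x \<in> carrier M ==> y \<in> carrier M ==> x \<ominus>\<^bsub>M\<^esub> y = z ==> x = y \<oplus>\<^bsub>M\<^esub> z"
  by (rule M.minus_eqD)
 show "a \<in> carrier M ==> b \<in> carrier M ==> x \<in> carrier M ==> y \<in> carrier M ==>
   a \<oplus>\<^bsub>M\<^esub> b \<oplus>\<^bsub>M\<^esub> (x \<oplus>\<^bsub>M\<^esub> y) = a \<oplus>\<^bsub>M\<^esub> x \<oplus>\<^bsub>M\<^esub> (b \<oplus>\<^bsub>M\<^esub> y)"
  by (simp add: M.a_ac)
qed

lemma linear_minus:
 assumes "\<phi> \<in> linear_maps K M N" "module K M" "module K N" "x \<in> carrier M" "y \<in> carrier M"
 shows "\<phi> (x \<ominus>\<^bsub>M\<^esub> y) = \<phi> x \<ominus>\<^bsub>N\<^esub> \<phi> y"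
proof -
 interpret M: module K M by fact
 show ?thesis
  unfolding a_minus_def using assms(4,5) linearD(2)[OF assms(1)] linear_neg[OF assms(1-3)] by simp
qed

context
 fixes K :: "'k ring" and A :: "('k, 'a) graded_module"
 assumes A: "graded K A"
begin

lemma X_module: "module K (cyc_X K A k p)"
 unfolding cyc_X_def by (rule tensor_module[OF A])

lemma Tot_comp_linear: "n \<le> s ==> k \<le> n ==> (%x. x n k) \<in> linear_maps K (cyc_Tot K A s) (cyc_X K A k (n - k))"
 using linear_comp[OF Tot_proj_linear[OF A] Xbar_proj_linear[OF A]] .

lemma Tot_ext:
 assumes x: "x \<in> carrier (cyc_Tot K A s)" and y: "y \<in> carrier (cyc_Tot K A s)"
  and eq: "!!n k. n \<le> s ==> k \<le> n ==> x n k = y n k"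
 shows "x = y"
proof (rule extensionalityI[of _ "{0..s}"])
 show "x \<in> extensional {0..s}" "y \<in> extensional {0..s}" using x y by (simp_all add: Tot_carrier[OF A])
 fix n assume n: "n \<in> {0..s}"
 show "x n = y n"
  by (rule extensionalityI[of _ "{0..n}"]) (use x y n eq in \<open>auto simp: Tot_carrier[OF A] Xbar_carrier[OF A]\<close>)
qed

lemma Tot_family_closed:
 assumes "!!n k. n \<le> s ==> k \<le> n ==> F n k \<in> carrier (cyc_X K A k (n - k))"
 shows "(\<lambda>n\<in>{0..s}. \<lambda>k\<in>{0..n}. F n k) \<in> carrier (cyc_Tot K A s)"
 using assms by (auto simp: Tot_carrier[OF A] Xbar_carrier[OF A])

lemma Tot_zero_comp: "n \<le> s ==> k \<le> n ==> \<zero>\<^bsub>cyc_Tot K A s\<^esub> n k = \<zero>\<^bsub>cyc_X K A k (n - k)\<^esub>"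
 by (simp add: cyc_Tot_def Xbar_def direct_sum_simps)

lemma cyc_D1_comp_zero:
 assumes x: "x \<in> carrier (Xbar K A n)" and k: "k \<le> n" and z: "x k = \<zero>\<^bsub>cyc_X K A k (n - k)\<^esub>"
 shows "cyc_D1 K A n m x k = \<zero>\<^bsub>cyc_X K A k (n - k)\<^esub>"
proof -
 interpret X: module K "cyc_X K A k (n - k)" by (rule X_module)
 have N: "Xbar_N K A n x k = \<zero>\<^bsub>cyc_X K A k (n - k)\<^esub>"
  using k linear_zero[OF cyc_N_linear[OF A] X_module X_module] by (simp add: Xbar_N_def z)
 have Tc: "Xbar_T K A n x \<in> carrier (Xbar K A n)"
  using x linearD(1)[OF cyc_T_linear[OF A]] by (auto simp: Xbar_T_def Xbar_carrier[OF A])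
 have T: "Xbar_T K A n x k = \<zero>\<^bsub>cyc_X K A k (n - k)\<^esub>"
  using k linear_zero[OF cyc_T_linear[OF A] X_module X_module] by (simp add: Xbar_T_def z)
 have "(x \<ominus>\<^bsub>Xbar K A n\<^esub> Xbar_T K A n x) k = x k \<ominus>\<^bsub>cyc_X K A k (n - k)\<^esub> Xbar_T K A n x k"
  by (rule linear_minus[OF Xbar_proj_linear[OF A k] Xbar_module[OF A] X_module x Tc])
 then show ?thesis using N by (simp add: cyc_D1_def z T a_minus_def)
qed

context
 fixes d :: "nat => 'a => 'a" and \<pi> :: "nat => nat => ('k, 'a) tensor => 'a"
 assumes inf: "A_infinity_algebra K A d \<pi>"
begin

lemma cyc_D2_comp:
 assumes x: "x \<in> carrier (Xbar K A (n + 1))" and k: "k \<le> n"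
  and z: "!!k'. k < k' ==> k' \<le> n + 1 ==> x k' = \<zero>\<^bsub>cyc_X K A k' (n + 1 - k')\<^esub>"
 shows "cyc_D2 K A d \<pi> (n + 1) m x k = signed (cyc_X K A k (n - k)) m (tensor_differential K A d (k + 1) (n + 1 - k) (x k))"
proof -
 note dA = inf_d[OF A inf] inf_\<pi>[OF A inf]
 interpret X: module K "cyc_X K A k (n - k)" by (rule X_module)
 have xc: "x k' \<in> carrier (cyc_X K A k' (n + 1 - k'))" if "k' \<le> n + 1" for k' using x that by (simp add: Xbar_carrier[OF A])
 have b: "Xbar_b K A d \<pi> q (n + 1) x k = tensor_differential K A d (k + 1) (n + 1 - k) (x k)" for q
 proof -
  let ?F = "%k'. cyc_d K A d \<pi> q (k' - k) k' (n + 1 - k') (x k')"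
  have cl: "?F k' \<in> carrier (cyc_X K A k (n - k))" if "k' \<in> {k..n + 1}" for k'
   using linearD(1)[OF cyc_d_linear'[OF A dA k] xc] that by simp
  have "?F k' = \<zero>\<^bsub>cyc_X K A k (n - k)\<^esub>" if "k' \<in> {k..n + 1} - {k}" for k'
   using linear_zero[OF cyc_d_linear'[OF A dA k] X_module X_module] z[of k'] that by simp
  then have "(\<Oplus>\<^bsub>cyc_X K A k (n - k)\<^esub>k'\<in>{k..n + 1}. ?F k') = (\<Oplus>\<^bsub>cyc_X K A k (n - k)\<^esub>k'\<in>{k}. ?F k')"
   by (intro X.add.finprod_mono_neutral_cong_right) (use cl k in auto)
  also have "... = ?F k" by (rule finsum_singleton[OF X_module]) (rule cl, use k in simp)
  finally show ?thesis using k by (simp add: Xbar_b_def cyc_d_def)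
 qed
 have bc: "Xbar_b K A d \<pi> 1 (n + 1) x \<in> carrier (Xbar K A n)"
  by (rule linearD(1)[OF Xbar_b_linear[OF A dA] x])
 have "(\<ominus>\<^bsub>Xbar K A n\<^esub> Xbar_b K A d \<pi> 1 (n + 1) x) k = \<ominus>\<^bsub>cyc_X K A k (n - k)\<^esub> Xbar_b K A d \<pi> 1 (n + 1) x k"
  by (rule linear_neg[OF Xbar_proj_linear[OF A k] Xbar_module[OF A] X_module bc])
 then show ?thesis
  unfolding cyc_D2_def signed_def using b[of 0] b[of 1] by simp
qed

text \<open>In the lowest internal degree the total differential is the tensor differential up to
  sign: 1 - T and N preserve the component \<open>k\<close>, which is zero in row \<open>n\<close>,
  and operations on several letters come from \<open>k' > k\<close>, that is, from lower internal
  degree.\<close>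

lemma cyc_D_comp:
 assumes x: "x \<in> carrier (cyc_Tot K A s)" and s: "n < s" and k: "k \<le> n"
  and z: "x n k = \<zero>\<^bsub>cyc_X K A k (n - k)\<^esub>"
  and z': "!!k'. k < k' ==> k' \<le> n + 1 ==> x (n + 1) k' = \<zero>\<^bsub>cyc_X K A k' (n + 1 - k')\<^esub>"
 shows "cyc_D K A d \<pi> s x n k =
  signed (cyc_X K A k (n - k)) (s - 1 - n) (tensor_differential K A d (k + 1) (n + 1 - k) (x (n + 1) k))"
proof -
 note dA = inf_d[OF A inf] inf_\<pi>[OF A inf]
 interpret X: module K "cyc_X K A k (n - k)" by (rule X_module)
 have xn: "x n \<in> carrier (Xbar K A n)" "x (n + 1) \<in> carrier (Xbar K A (n + 1))" using x s by (simp_all add: Tot_carrier[OF A])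
 have 1: "cyc_D1 K A n (s - n) (x n) \<in> carrier (Xbar K A n)" by (rule linearD(1)[OF cyc_D1_linear[OF A] xn(1)])
 have 2: "cyc_D2 K A d \<pi> (n + 1) (s - 1 - n) (x (n + 1)) \<in> carrier (Xbar K A n)"
  by (rule linearD(1)[OF cyc_D2_linear[OF A dA] xn(2)])
 have c2: "cyc_D2 K A d \<pi> (n + 1) (s - 1 - n) (x (n + 1)) k \<in> carrier (cyc_X K A k (n - k))" using 2 k by (simp add: Xbar_carrier[OF A])
 have "cyc_D K A d \<pi> s x n = cyc_D1 K A n (s - n) (x n) \<oplus>\<^bsub>Xbar K A n\<^esub> cyc_D2 K A d \<pi> (n + 1) (s - 1 - n) (x (n + 1))"
  using s by (cases s) (simp_all add: cyc_D_def)
 then have "cyc_D K A d \<pi> s x n k = cyc_D1 K A n (s - n) (x n) k \<oplus>\<^bsub>cyc_X K A k (n - k)\<^esub> cyc_D2 K A d \<pi> (n + 1) (s - 1 - n) (x (n + 1)) k"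
  using linearD(2)[OF Xbar_proj_linear[OF A k] 1 2] by simp
 also have "... = cyc_D2 K A d \<pi> (n + 1) (s - 1 - n) (x (n + 1)) k"
  unfolding cyc_D1_comp_zero[OF xn(1) k z] by (rule X.l_zero[OF c2])
 also have "... = signed (cyc_X K A k (n - k)) (s - 1 - n) (tensor_differential K A d (k + 1) (n + 1 - k) (x (n + 1) k))"
  by (rule cyc_D2_comp[OF xn(2) k]) (rule z')
 finally show ?thesis .
qed

end

end

text \<open>Every summand contains a factor 0 and is null by multilinearity.\<close>

lemma tensor_differential_zero:
 assumes A: "graded K A" and d: "differential_module K A (zero_differential A)" and x: "x \<in> carrier (tensor_power K A r p)"
 shows "tensor_differential K A (zero_differential A) r p x = \<zero>\<^bsub>tensor_power K A r (p - 1)\<^esub>"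
proof (rule tensor_linear_eqI[OF A tensor_module[OF A] tensor_diff_linear[OF A d] zero_linear[OF tensor_module[OF A]] _ x])
 fix w assume w: "w \<in> hw A r p"
 let ?D = "tensor_differential K A (zero_differential A) r p" and ?T = "tensor_power K A r p"
 have "letter_diff par (dletter (zero_differential A)) w \<in> Null K A"
  unfolding letter_diff_sum
 proof (intro chain_ideal_sum[OF Null_ideal[OF A]] chain_idealD(5)[OF Null_ideal[OF A]])
  fix i assume "i \<in> {i. i < length w \<and> 0 < fst (w ! i)}"
  then have i: "i < length w" by simp
  have "wd [(fst (w ! i) - 1, \<zero>\<^bsub>A (fst (w ! i) - 1)\<^esub>)] \<in> Null K A"
   using letter_zero[OF A] by (simp add: eqc_def)
  from chain_idealD(6)[OF Null_ideal[OF A] this, of "take i w" "drop (Suc i) w"]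
  have "wd (take i w @ [(fst (w ! i) - 1, \<zero>\<^bsub>A (fst (w ! i) - 1)\<^esub>)] @ drop (Suc i) w) \<in> Null K A"
   by (simp only: wd_append mult.assoc)
  then show "wd (w[i := (fst (w ! i) - 1, zero_differential A (fst (w ! i)) (snd (w ! i)))]) \<in> Null K A"
   unfolding upd_split[OF i] zero_differential_def by simp
 qed
 then have "?D (evw K A r p w) = \<zero>\<^bsub>tensor_power K A r (p - 1)\<^esub>"
  unfolding tensor_differential_evw[OF A d w] by (rule Null_ev[OF A])
 then have "signed (tensor_power K A r (p - 1)) (sgx w) (?D (pure_tensor K A w)) = \<zero>\<^bsub>tensor_power K A r (p - 1)\<^esub>"
  unfolding evw_hw[OF A w]
   linear_signed[OF tensor_diff_linear[OF A d] tensor_module[OF A] tensor_module[OF A] pure_closed[OF A w]] .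
 then show "?D (pure_tensor K A w) = \<zero>\<^bsub>tensor_power K A r (p - 1)\<^esub>"
  using signed_signed[OF tensor_module[OF A] linearD(1)[OF tensor_diff_linear[OF A d] pure_closed[OF A w]], where e = "sgx w" and e' = "sgx w"]
  by (simp add: signed_zero[OF tensor_module[OF A]] signed_def[of _ "sgx w + sgx w"])
qed

context
 fixes K :: "'k ring" and A :: "('k, 'a) graded_module" and B :: "('k, 'b) graded_module"
  and d :: "nat => 'a => 'a" and \<pi> \<rho> f g h h'
 assumes A: "graded K A" and B: "graded K B"
  and infA: "A_infinity_algebra K A d \<pi>" and infB: "A_infinity_algebra K B (zero_differential B) \<rho>"
  and f: "A_infinity_morphism K A d \<pi> B (zero_differential B) \<rho> f"
  and g: "A_infinity_morphism K B (zero_differential B) \<rho> A d \<pi> g"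
  and h: "A_infinity_homotopy K A d \<pi> A d \<pi> (A_infinity_comp K A B A g f) (A_infinity_id K A) h"
  and h': "A_infinity_homotopy K B (zero_differential B) \<rho> B (zero_differential B) \<rho> (A_infinity_comp K B A B f g) (A_infinity_id K B) h'"
begin

abbreviation (input) "TA \<equiv> cyc_Tot K A"
abbreviation (input) "TB \<equiv> cyc_Tot K B"
abbreviation (input) "DA \<equiv> cyc_D K A d \<pi>"
abbreviation (input) "DB \<equiv> cyc_D K B (zero_differential B) \<rho>"
abbreviation (input) "Ph \<equiv> cyc_phi K B A g"

lemma g_gm': "g n \<in> graded_maps K B A (n + 1) n" using g by (simp add: A_infinity_morphism_def)

lemmas dA = inf_d[OF A infA] inf_\<pi>[OF A infA]
lemmas dB = inf_d[OF B infB] inf_\<pi>[OF B infB]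
lemmas DAl = cyc_D_linear[OF A dA]
lemmas DBl = cyc_D_linear[OF B dB]
lemmas Phl = cyc_phi_linear[OF B A g_gm']
lemmas PhD = cyc_phi_chain[OF B A g_gm' infB infA g]
lemmas DD_A = cyc_D_cyc_D[OF A infA]
lemmas DD_B = cyc_D_cyc_D[OF B infB]

lemma Phi_comp:
 assumes x: "x \<in> carrier (TB s)" and nk: "n \<le> s" "k \<le> n"
  and z: "!!k'. k < k' ==> k' \<le> n ==> x n k' = \<zero>\<^bsub>cyc_X K B k' (n - k')\<^esub>"
 shows "Ph s x n k = word_lift K B A (PH K B g (s - n)) (k + 1) (n - k) (x n k)"
proof -
 let ?L = "word_lift K B A (PH K B g (s - n)) (k + 1) (n - k)"
 interpret X: module K "cyc_X K A k (n - k)" by (rule X_module[OF A])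
 have lin: "?L \<in> linear_maps K (cyc_X K B k' (n - k')) (cyc_X K A k (n - k))" for k'
  unfolding cyc_X_def by (rule word_lift_linear[OF B A PH_slotwise[OF B A g_gm']])
 have cl: "?L (x n k') \<in> carrier (cyc_X K A k (n - k))" if "k' \<in> {k..n}" for k'
  by (rule linearD(1)[OF lin[of k']]) (use x nk that in \<open>simp add: Tot_carrier[OF B] Xbar_carrier[OF B]\<close>)
 have "(\<Oplus>\<^bsub>cyc_X K A k (n - k)\<^esub>k'\<in>{k..n}. ?L (x n k')) = (\<Oplus>\<^bsub>cyc_X K A k (n - k)\<^esub>k'\<in>{k}. ?L (x n k'))"
  by (rule X.add.finprod_mono_neutral_cong_right)
   (use cl nk z linear_zero[OF lin X_module[OF B] X_module[OF A]] in auto)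
 also have "... = ?L (x n k)" by (rule finsum_singleton[OF X_module[OF A]]) (rule cl, use nk in simp)
 finally show ?thesis using nk by (simp add: cyc_phi_def)
qed

text \<open>As the differential of \<open>B\<close> is zero, the total differential of its complex
  does not lower the internal degree. Hence the correction by \<open>u\<close> in
  \<open>comparison_step\<close> creates no new low components of \<open>x\<close>.\<close>

lemma DB_comp_zero:
 assumes x: "x \<in> carrier (TB s)" and nk: "n \<le> s - 1" "k \<le> n"
  and z: "0 < s ==> x n k = \<zero>\<^bsub>cyc_X K B k (n - k)\<^esub>"
  and z': "!!k'. 0 < s ==> k < k' ==> k' \<le> n + 1 ==> x (n + 1) k' = \<zero>\<^bsub>cyc_X K B k' (n + 1 - k')\<^esub>"
 shows "DB s x n k = \<zero>\<^bsub>cyc_X K B k (n - k)\<^esub>"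
proof (cases "s = 0")
 case True
 then show ?thesis using nk Tot_zero_comp[OF B, of n 0 k] by (simp add: cyc_D_def)
next
 case False
 have xk: "x (n + 1) k \<in> carrier (tensor_power K B (k + 1) (n + 1 - k))"
  using x nk False by (simp add: Tot_carrier[OF B] Xbar_carrier[OF B] cyc_X_def)
 have e: "n + 1 - k - 1 = n - k" by simp
 have "n < s" "0 < s" using nk False by auto
 from cyc_D_comp[OF B infB x this(1) nk(2) z[OF this(2)] z'[OF this(2)]] show ?thesis
  using tensor_differential_zero[OF B dB(1) xk] unfolding e cyc_X_def by (simp add: signed_zero[OF tensor_module[OF B]])
qed

text \<open>
  Components of internal degree \<open>n - k\<close> below \<open>i\<close> of \<open>y\<close> and below \<open>i - 1\<close> of \<open>x\<close> vanish, so that the lowest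
  components satisfy the equation of a single column and can be removed.
\<close>

lemma comparison_step:
 assumes x: "x \<in> carrier (TB (s - 1))" and y: "y \<in> carrier (TA s)" and s0: "s = 0 ==> x = \<zero>\<^bsub>TB (s - 1)\<^esub>"
  and Dx: "DB (s - 1) x = \<zero>\<^bsub>TB (s - 1 - 1)\<^esub>" and eq: "Ph (s - 1) x = DA s y"
  and yF: "!!n k. n \<le> s ==> k \<le> n ==> n - k < i ==> y n k = \<zero>\<^bsub>cyc_X K A k (n - k)\<^esub>"
  and xF: "!!n k. n \<le> s - 1 ==> k \<le> n ==> n - k + 1 < i ==> x n k = \<zero>\<^bsub>cyc_X K B k (n - k)\<^esub>"
 shows "\<exists>u \<in> carrier (TB s). \<exists>v \<in> carrier (TA (s + 1)).
  (\<forall>n k. n \<le> s --> k \<le> n --> n - k < i + 1 --> (y \<ominus>\<^bsub>TA s\<^esub> (Ph s u \<oplus>\<^bsub>TA s\<^esub> DA (s + 1) v)) n k = \<zero>\<^bsub>cyc_X K A k (n - k)\<^esub>) \<and>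
  (\<forall>n k. n \<le> s - 1 --> k \<le> n --> n - k + 1 < i + 1 --> (x \<ominus>\<^bsub>TB (s - 1)\<^esub> DB s u) n k = \<zero>\<^bsub>cyc_X K B k (n - k)\<^esub>)"
proof -
 let ?L = "%n k. word_lift K B A (PH K B g (s - n)) (k + 1) (n - k)"
 let ?d = "%n k. tensor_differential K A d (k + 1) (n + 1 - k)"
 have yc: "y n k \<in> carrier (cyc_X K A k (n - k))" if "n \<le> s" "k \<le> n" for n k
  using y that by (simp add: Tot_carrier[OF A] Xbar_carrier[OF A])
 have xc: "x n k \<in> carrier (cyc_X K B k (n - k))" if "n \<le> s - 1" "k \<le> n" for n k
  using x that by (simp add: Tot_carrier[OF B] Xbar_carrier[OF B])
 have tdl: "?d n k \<in> linear_maps K (cyc_X K A k (n + 1 - k)) (cyc_X K A k (n - k))" for n k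
  using tensor_diff_linear[OF A dA(1), of "k + 1" "n + 1 - k"] unfolding cyc_X_def by simp
 have Ll: "?L n k \<in> linear_maps K (cyc_X K B k (n - k)) (cyc_X K A k (n - k))" for n k
  unfolding cyc_X_def by (rule word_lift_linear[OF B A PH_slotwise[OF B A g_gm']])
 \<comment> \<open>The equation between \<open>x\<close> and \<open>y\<close> in internal degree
   \<open>i - 1\<close>, where only the leading parts of both maps survive.\<close>
 have key: "word_lift K B A (PH K B g (s - 1 - n)) (k + 1) (n - k) (x n k) =
   signed (cyc_X K A k (n - k)) (s - 1 - n) (?d n k (y (n + 1) k))"
  if n: "n < s" "k \<le> n" "n - k + 1 = i" for n k
 proof -
  have "Ph (s - 1) x n k = word_lift K B A (PH K B g (s - 1 - n)) (k + 1) (n - k) (x n k)"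
   by (rule Phi_comp[OF x]) (use n xF in auto)
  moreover have "DA s y n k = signed (cyc_X K A k (n - k)) (s - 1 - n) (?d n k (y (n + 1) k))"
   by (rule cyc_D_comp[OF A infA y n(1,2)]) (use n yF in auto)
  ultimately show ?thesis using eq by simp
 qed
 \<comment> \<open>By \<open>key\<close> the leading image of this component of \<open>x\<close> is
   a boundary in the tensor power, so \<open>column_inj\<close> applies; the sign is moved into the
   argument of the differential.\<close>
 have x0: "x n k = \<zero>\<^bsub>cyc_X K B k (n - k)\<^esub>" if n: "n \<le> s - 1" "k \<le> n" "n - k + 1 = i" for n k
 proof (cases "s = 0")
  case True
  then show ?thesis using s0 n Tot_zero_comp[OF B, of n "s - 1" k] by simp
 next
  case False
  then have ns: "n < s" using n by simp
  have nk: "n + 1 - k = (n - k) + 1" using n by simp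
  have yk: "y (n + 1) k \<in> carrier (cyc_X K A k (n + 1 - k))" using yc[of "n + 1" k] ns n by simp
  have e: "signed (cyc_X K A k (n - k)) (s - 1 - n) (?d n k (y (n + 1) k)) =
   ?d n k (signed (cyc_X K A k (n + 1 - k)) (s - 1 - n) (y (n + 1) k))"
   by (rule linear_signed[OF tdl X_module[OF A] X_module[OF A] yk, symmetric])
  show ?thesis
   using column_inj[OF A B dA(1) f g h h', of "x n k" k "n - k" "signed (cyc_X K A k (n + 1 - k)) (s - 1 - n) (y (n + 1) k)" "s - 1 - n"]
    key[OF ns n(2,3)] xc[OF n(1,2)] signed_closed[OF X_module[OF A] yk] unfolding e unfolding nk cyc_X_def by blast
 qed
 \<comment> \<open>With \<open>x\<close> zero in internal degree \<open>i - 1\<close>,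
   \<open>key\<close> makes the components of \<open>y\<close> in internal degree \<open>i\<close>
   cycles of the tensor power.\<close>
 have dy0: "tensor_differential K A d (k + 1) (n - k) (y n k) = \<zero>\<^bsub>tensor_power K A (k + 1) (n - k - 1)\<^esub>"
  if n: "n \<le> s" "k \<le> n" "n - k = i" "0 < n - k" for n k
 proof -
  obtain n' where n': "n = n' + 1" using n by (cases n) auto
  have nn: "n' < s" "k \<le> n'" "n' - k + 1 = i" "n' \<le> s - 1" using n n' by auto
  have "signed (cyc_X K A k (n' - k)) (s - 1 - n') (?d n' k (y (n' + 1) k)) = \<zero>\<^bsub>cyc_X K A k (n' - k)\<^esub>"
   unfolding key[OF nn(1-3), symmetric] x0[OF nn(4,2,3)] unfolding cyc_X_def
   by (rule linear_zero[OF word_lift_linear[OF B A PH_slotwise[OF B A g_gm']] tensor_module[OF B] tensor_module[OF A]])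
  then have "signed (cyc_X K A k (n' - k)) (s - 1 - n') (signed (cyc_X K A k (n' - k)) (s - 1 - n') (?d n' k (y (n' + 1) k))) = \<zero>\<^bsub>cyc_X K A k (n' - k)\<^esub>"
   by (simp only: signed_zero[OF X_module[OF A]])
  then have "?d n' k (y (n' + 1) k) = \<zero>\<^bsub>cyc_X K A k (n' - k)\<^esub>"
   unfolding signed_signed[OF X_module[OF A] linearD(1)[OF tdl yc[of "n' + 1" k, OF n(1)[unfolded n'] n(2)[unfolded n']]]]
   by (simp add: signed_def)
  then show ?thesis unfolding n' cyc_X_def using nn by simp
 qed
 have "\<exists>U V. U \<in> carrier (cyc_X K B k (n - k)) \<and> V \<in> carrier (cyc_X K A k (n + 1 - k)) \<and>
   y n k = ?L n k U \<oplus>\<^bsub>cyc_X K A k (n - k)\<^esub> ?d n k V" if n: "n \<le> s" "k \<le> n" "n - k = i" for n k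
 proof -
  have nk: "n + 1 - k = (n - k) + 1" using n by simp
  show ?thesis
   using column_surj[OF A B dA(1) f g h h' yc[OF n(1,2), unfolded cyc_X_def], where j = "s - n"] dy0[OF n] unfolding cyc_X_def nk by blast
 qed
 then have "\<exists>U V. \<forall>n k. n \<le> s --> k \<le> n --> n - k = i --> U n k \<in> carrier (cyc_X K B k (n - k)) \<and> V n k \<in> carrier (cyc_X K A k (n + 1 - k)) \<and>
   y n k = ?L n k (U n k) \<oplus>\<^bsub>cyc_X K A k (n - k)\<^esub> ?d n k (V n k)"
  by metis
 then obtain U V where UV: "!!n k. n \<le> s ==> k \<le> n ==> n - k = i ==> U n k \<in> carrier (cyc_X K B k (n - k))"
  "!!n k. n \<le> s ==> k \<le> n ==> n - k = i ==> V n k \<in> carrier (cyc_X K A k (n + 1 - k))"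
  "!!n k. n \<le> s ==> k \<le> n ==> n - k = i ==> y n k = ?L n k (U n k) \<oplus>\<^bsub>cyc_X K A k (n - k)\<^esub> ?d n k (V n k)"
  by blast
 have zc: "\<zero>\<^bsub>cyc_X K A k p\<^esub> \<in> carrier (cyc_X K A k p)" "\<zero>\<^bsub>cyc_X K B k p\<^esub> \<in> carrier (cyc_X K B k p)" for k p
  using X_module[OF A, of k p] X_module[OF B, of k p] by (simp_all add: module_def abelian_group_def abelian_monoid.zero_closed)
 define u where "u = (\<lambda>n\<in>{0..s}. \<lambda>k\<in>{0..n}. if n - k = i then U n k else \<zero>\<^bsub>cyc_X K B k (n - k)\<^esub>)"
 \<comment> \<open>\<open>V n k\<close> has internal degree one higher than the component
   \<open>(n, k)\<close> and therefore sits in row \<open>n + 1\<close>. Its sign cancels the one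
   that \<open>cyc_D_comp\<close> puts before the tensor differential.\<close>
 define v where "v = (\<lambda>n\<in>{0..s + 1}. \<lambda>k\<in>{0..n}. if k < n \<and> n - k = i + 1
   then signed (cyc_X K A k (n - k)) (s - (n - 1)) (V (n - 1) k) else \<zero>\<^bsub>cyc_X K A k (n - k)\<^esub>)"
 have u: "u \<in> carrier (TB s)"
  unfolding u_def by (rule Tot_family_closed[OF B]) (use UV(1) zc in auto)
 have v: "v \<in> carrier (TA (s + 1))"
  unfolding v_def
 proof (rule Tot_family_closed[OF A])
  fix n k assume n: "n \<le> s + 1" "k \<le> n"
  have "V (n - 1) k \<in> carrier (cyc_X K A k (n - k))" if "k < n" "n - k = i + 1"
   using UV(2)[of "n - 1" k] that n by auto
  then show "(if k < n \<and> n - k = i + 1 then signed (cyc_X K A k (n - k)) (s - (n - 1)) (V (n - 1) k) else \<zero>\<^bsub>cyc_X K A k (n - k)\<^esub>) \<in> carrier (cyc_X K A k (n - k))"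
   using signed_closed[OF X_module[OF A]] zc by auto
 qed
 have u0: "u n k = \<zero>\<^bsub>cyc_X K B k (n - k)\<^esub>" if "n \<le> s" "k \<le> n" "n - k < i" for n k using that by (simp add: u_def)
 have v0: "v n k = \<zero>\<^bsub>cyc_X K A k (n - k)\<^esub>" if "n \<le> s + 1" "k \<le> n" "n - k < i + 1" for n k using that by (simp add: v_def)
 have Phu: "Ph s u n k = ?L n k (u n k)" if "n \<le> s" "k \<le> n" "n - k \<le> i" for n k
  by (rule Phi_comp[OF u that(1,2)]) (use that u0 in auto)
 have Dv: "DA (s + 1) v n k = signed (cyc_X K A k (n - k)) (s - n) (?d n k (v (n + 1) k))" if "n \<le> s" "k \<le> n" "n - k \<le> i" for n k
  using cyc_D_comp[OF A infA v, of n k] that v0 by auto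
 have Pc: "Ph s u \<in> carrier (TA s)" by (rule linearD(1)[OF Phl u])
 have Dc: "DA (s + 1) v \<in> carrier (TA s)" using linearD(1)[OF DAl v] by simp
 interpret TA: module K "TA s" by (rule Tot_module[OF A])
 have comp: "(y \<ominus>\<^bsub>TA s\<^esub> (Ph s u \<oplus>\<^bsub>TA s\<^esub> DA (s + 1) v)) n k =
  y n k \<ominus>\<^bsub>cyc_X K A k (n - k)\<^esub> (Ph s u n k \<oplus>\<^bsub>cyc_X K A k (n - k)\<^esub> DA (s + 1) v n k)" if "n \<le> s" "k \<le> n" for n k
  using linear_minus[OF Tot_comp_linear[OF A that] Tot_module[OF A] X_module[OF A] y TA.a_closed[OF Pc Dc]]
   linearD(2)[OF Tot_comp_linear[OF A that] Pc Dc] by simp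
 have goal1: "(y \<ominus>\<^bsub>TA s\<^esub> (Ph s u \<oplus>\<^bsub>TA s\<^esub> DA (s + 1) v)) n k = \<zero>\<^bsub>cyc_X K A k (n - k)\<^esub>"
  if n: "n \<le> s" "k \<le> n" "n - k < i + 1" for n k
 proof -
  interpret X: module K "cyc_X K A k (n - k)" by (rule X_module[OF A])
  have ni: "n - k \<le> i" using n by simp
  show ?thesis
  proof (cases "n - k = i")
   case True
   have nk: "n + 1 - k = i + 1" "k < n + 1" using True n by auto
   have un: "u n k = U n k" using n True by (simp add: u_def)
   have vn: "v (n + 1) k = signed (cyc_X K A k (n + 1 - k)) (s - n) (V n k)" using n nk by (simp add: v_def)
   have Vc: "V n k \<in> carrier (cyc_X K A k (n + 1 - k))" by (rule UV(2)[OF n(1,2) True])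
   have dV: "?d n k (V n k) \<in> carrier (cyc_X K A k (n - k))" by (rule linearD(1)[OF tdl Vc])
   have "DA (s + 1) v n k = ?d n k (V n k)"
    unfolding Dv[OF n(1,2) ni] vn linear_signed[OF tdl X_module[OF A] X_module[OF A] Vc] signed_signed[OF X_module[OF A] dV]
    by (simp add: signed_def)
   then have "Ph s u n k \<oplus>\<^bsub>cyc_X K A k (n - k)\<^esub> DA (s + 1) v n k = y n k"
    unfolding Phu[OF n(1,2) ni] un UV(3)[OF n(1,2) True] by simp
   then show ?thesis unfolding comp[OF n(1,2)] using X.r_neg[OF yc[OF n(1,2)]] by (simp add: a_minus_def)
  next
   case False
   then have ni': "n - k < i" using ni by simp
   have vz: "v (n + 1) k = \<zero>\<^bsub>cyc_X K A k (n + 1 - k)\<^esub>" by (rule v0) (use n ni' in auto)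
   show ?thesis
    unfolding comp[OF n(1,2)] Phu[OF n(1,2) ni] Dv[OF n(1,2) ni] u0[OF n(1,2) ni'] yF[OF n(1,2) ni'] vz
     linear_zero[OF Ll X_module[OF B] X_module[OF A]] linear_zero[OF tdl X_module[OF A] X_module[OF A]] signed_zero[OF X_module[OF A]]
    by (simp add: a_minus_def)
  qed
 qed
 have Duc: "DB s u \<in> carrier (TB (s - 1))" by (rule linearD(1)[OF DBl u])
 have goal2: "(x \<ominus>\<^bsub>TB (s - 1)\<^esub> DB s u) n k = \<zero>\<^bsub>cyc_X K B k (n - k)\<^esub>"
  if n: "n \<le> s - 1" "k \<le> n" "n - k + 1 < i + 1" for n k
 proof -
  interpret X: module K "cyc_X K B k (n - k)" by (rule X_module[OF B])
  have xz: "x n k = \<zero>\<^bsub>cyc_X K B k (n - k)\<^esub>" using n xF x0 by (cases "n - k + 1 = i") auto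
  have "DB s u n k = \<zero>\<^bsub>cyc_X K B k (n - k)\<^esub>"
   by (rule DB_comp_zero[OF u n(1,2)]) (use n u0 in auto)
  then show ?thesis
   using linear_minus[OF Tot_comp_linear[OF B n(1,2)] Tot_module[OF B] X_module[OF B] x Duc] by (simp add: xz a_minus_def)
 qed
 show ?thesis
  by (intro bexI[OF _ u] bexI[OF _ v] conjI allI impI goal1 goal2)
qed

lemma DA_Suc_linear: "DA (s + 1) \<in> linear_maps K (TA (s + 1)) (TA s)"
 using DAl[of "s + 1"] by simp

text \<open>Acyclicity of the mapping cone, with its signs removed; it contains injectivity and
  surjectivity on homology. For \<open>s = 0\<close> the index \<open>s - 1\<close> denotes degree 0
  instead of degree -1, hence the requirement that \<open>x\<close> be zero there.\<close>

lemma comparison: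
 assumes "x \<in> carrier (TB (s - 1))" "y \<in> carrier (TA s)" "s = 0 ==> x = \<zero>\<^bsub>TB (s - 1)\<^esub>"
  "DB (s - 1) x = \<zero>\<^bsub>TB (s - 1 - 1)\<^esub>" "Ph (s - 1) x = DA s y"
 shows "\<exists>u \<in> carrier (TB s). \<exists>v \<in> carrier (TA (s + 1)). x = DB s u \<and> y = Ph s u \<oplus>\<^bsub>TA s\<^esub> DA (s + 1) v"
proof -
 note mA = Tot_module[OF A] and mB = Tot_module[OF B]
 note GA = module_group[OF Tot_module[OF A]] and GB = module_group[OF Tot_module[OF B]]
 define P where "P i x y \<longleftrightarrow> x \<in> carrier (TB (s - 1)) \<and> y \<in> carrier (TA s) \<and> (s = 0 --> x = \<zero>\<^bsub>TB (s - 1)\<^esub>) \<and>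
  DB (s - 1) x = \<zero>\<^bsub>TB (s - 1 - 1)\<^esub> \<and> Ph (s - 1) x = DA s y \<and>
  (\<forall>n k. n \<le> s --> k \<le> n --> n - k < i --> y n k = \<zero>\<^bsub>cyc_X K A k (n - k)\<^esub>) \<and>
  (\<forall>n k. n \<le> s - 1 --> k \<le> n --> n - k + 1 < i --> x n k = \<zero>\<^bsub>cyc_X K B k (n - k)\<^esub>)" for i x y
 define Q where "Q x y \<longleftrightarrow> (\<exists>u \<in> carrier (TB s). \<exists>v \<in> carrier (TA (s + 1)). x = DB s u \<and> y = Ph s u \<oplus>\<^bsub>TA s\<^esub> DA (s + 1) v)" for x y
 \<comment> \<open>Internal degrees do not exceed the total degree, so at filtration index
   \<open>s + 1\<close> nothing is left.\<close>
 have base: "Q x y" if P: "P (s + 1) x y" for x y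
 proof -
  note p = P[unfolded P_def]
  have y: "y = \<zero>\<^bsub>TA s\<^esub>"
  proof (rule Tot_ext[OF A _ GA(1)])
   show "y \<in> carrier (TA s)" using p by blast
   fix n k assume n: "n \<le> s" "k \<le> n"
   then have "n - k < s + 1" by simp
   then have "y n k = \<zero>\<^bsub>cyc_X K A k (n - k)\<^esub>" using p n by blast
   then show "y n k = \<zero>\<^bsub>TA s\<^esub> n k" by (simp only: Tot_zero_comp[OF A n])
  qed
  have x: "x = \<zero>\<^bsub>TB (s - 1)\<^esub>"
  proof (cases "s = 0")
   case True
   then show ?thesis using p by blast
  next
   case False
   show ?thesis
   proof (rule Tot_ext[OF B _ GB(1)])
    show "x \<in> carrier (TB (s - 1))" using p by blast
    fix n k assume n: "n \<le> s - 1" "k \<le> n"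
    then have "n - k + 1 < s + 1" using False by simp
    then have "x n k = \<zero>\<^bsub>cyc_X K B k (n - k)\<^esub>" using p n by blast
    then show "x n k = \<zero>\<^bsub>TB (s - 1)\<^esub> n k" by (simp only: Tot_zero_comp[OF B n])
   qed
  qed
  have "DB s \<zero>\<^bsub>TB s\<^esub> = x" unfolding x by (rule linear_zero[OF DBl mB mB])
  moreover have "Ph s \<zero>\<^bsub>TB s\<^esub> \<oplus>\<^bsub>TA s\<^esub> DA (s + 1) \<zero>\<^bsub>TA (s + 1)\<^esub> = y"
   unfolding y linear_zero[OF Phl mB mA] linear_zero[OF DA_Suc_linear mA mA] by (rule GA(4)[OF GA(1)])
  ultimately show "Q x y"
   unfolding Q_def by (intro bexI[OF _ GB(1)] bexI[OF _ GA(1)] conjI) (rule sym, assumption)+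
 qed
 \<comment> \<open>Subtract the corrections of \<open>comparison_step\<close>, solve for the
   remainder, and add the corrections back.\<close>
 have step: "Q x y" if P: "P i x y" and IH: "!!x y. P (i + 1) x y ==> Q x y" for i x y
 proof -
  note p = P[unfolded P_def]
  have x: "x \<in> carrier (TB (s - 1))" and y: "y \<in> carrier (TA s)" and s0: "s = 0 ==> x = \<zero>\<^bsub>TB (s - 1)\<^esub>"
   and Dx: "DB (s - 1) x = \<zero>\<^bsub>TB (s - 1 - 1)\<^esub>" and eq: "Ph (s - 1) x = DA s y" using p by blast+
  have yF: "!!n k. n \<le> s ==> k \<le> n ==> n - k < i ==> y n k = \<zero>\<^bsub>cyc_X K A k (n - k)\<^esub>" using p by blast
  have xF: "!!n k. n \<le> s - 1 ==> k \<le> n ==> n - k + 1 < i ==> x n k = \<zero>\<^bsub>cyc_X K B k (n - k)\<^esub>" using p by blast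
  have "\<exists>u \<in> carrier (TB s). \<exists>v \<in> carrier (TA (s + 1)).
    (\<forall>n k. n \<le> s --> k \<le> n --> n - k < i + 1 --> (y \<ominus>\<^bsub>TA s\<^esub> (Ph s u \<oplus>\<^bsub>TA s\<^esub> DA (s + 1) v)) n k = \<zero>\<^bsub>cyc_X K A k (n - k)\<^esub>) \<and>
    (\<forall>n k. n \<le> s - 1 --> k \<le> n --> n - k + 1 < i + 1 --> (x \<ominus>\<^bsub>TB (s - 1)\<^esub> DB s u) n k = \<zero>\<^bsub>cyc_X K B k (n - k)\<^esub>)"
   by (rule comparison_step[OF x y s0 Dx eq yF xF])
  then obtain u v where u: "u \<in> carrier (TB s)" and v: "v \<in> carrier (TA (s + 1))"
   and F: "\<forall>n k. n \<le> s --> k \<le> n --> n - k < i + 1 --> (y \<ominus>\<^bsub>TA s\<^esub> (Ph s u \<oplus>\<^bsub>TA s\<^esub> DA (s + 1) v)) n k = \<zero>\<^bsub>cyc_X K A k (n - k)\<^esub>"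
    "\<forall>n k. n \<le> s - 1 --> k \<le> n --> n - k + 1 < i + 1 --> (x \<ominus>\<^bsub>TB (s - 1)\<^esub> DB s u) n k = \<zero>\<^bsub>cyc_X K B k (n - k)\<^esub>"
   by (elim bexE conjE)
  let ?x = "x \<ominus>\<^bsub>TB (s - 1)\<^esub> DB s u" and ?y = "y \<ominus>\<^bsub>TA s\<^esub> (Ph s u \<oplus>\<^bsub>TA s\<^esub> DA (s + 1) v)"
  have Pc: "Ph s u \<in> carrier (TA s)" by (rule linearD(1)[OF Phl u])
  have Dc: "DA (s + 1) v \<in> carrier (TA s)" by (rule linearD(1)[OF DA_Suc_linear v])
  have Duc: "DB s u \<in> carrier (TB (s - 1))" by (rule linearD(1)[OF DBl u])
  note S = GA(2)[OF Pc Dc]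
  have z: "?x = \<zero>\<^bsub>TB (s - 1)\<^esub>" if s: "s = 0"
  proof -
   have "DB s u = \<zero>\<^bsub>TB (s - 1)\<^esub>" unfolding s by (simp add: cyc_D_def)
   then show ?thesis unfolding s0[OF s] using GB(5)[OF GB(1)] by (simp only:)
  qed
  have Dx': "DB (s - 1) ?x = \<zero>\<^bsub>TB (s - 1 - 1)\<^esub>"
   unfolding linear_minus[OF DBl mB mB x Duc] Dx DD_B[OF u] by (rule GB(5)[OF GB(1)])
  have D2: "DA s (DA (s + 1) v) = \<zero>\<^bsub>TA (s - 1)\<^esub>" using DD_A[OF v] unfolding add_diff_cancel_right' .
  have eq': "Ph (s - 1) ?x = DA s ?y"
   unfolding linear_minus[OF Phl mB mA x Duc] linear_minus[OF DAl mA mA y S]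
    linearD(2)[OF DAl Pc Dc] PhD[OF u] D2 eq GA(4)[OF linearD(1)[OF Phl Duc]] ..
  have "P (i + 1) ?x ?y"
   unfolding P_def by (intro conjI impI GB(3)[OF x Duc] GA(3)[OF y S] z Dx' eq' F)
  then have "Q ?x ?y" by (rule IH)
  then obtain u' v' where u': "u' \<in> carrier (TB s)" and v': "v' \<in> carrier (TA (s + 1))"
   and e: "?x = DB s u'" "?y = Ph s u' \<oplus>\<^bsub>TA s\<^esub> DA (s + 1) v'" unfolding Q_def by (elim bexE conjE)
  have P': "Ph s u' \<in> carrier (TA s)" by (rule linearD(1)[OF Phl u'])
  have D': "DA (s + 1) v' \<in> carrier (TA s)" by (rule linearD(1)[OF DA_Suc_linear v'])
  have 1: "x = DB s (u \<oplus>\<^bsub>TB s\<^esub> u')"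
   unfolding linearD(2)[OF DBl u u'] by (rule GB(6)[OF x Duc e(1)])
  have "y = (Ph s u \<oplus>\<^bsub>TA s\<^esub> DA (s + 1) v) \<oplus>\<^bsub>TA s\<^esub> (Ph s u' \<oplus>\<^bsub>TA s\<^esub> DA (s + 1) v')"
   by (rule GA(6)[OF y S e(2)])
  also have "... = Ph s (u \<oplus>\<^bsub>TB s\<^esub> u') \<oplus>\<^bsub>TA s\<^esub> DA (s + 1) (v \<oplus>\<^bsub>TA (s + 1)\<^esub> v')"
   unfolding linearD(2)[OF Phl u u'] linearD(2)[OF DA_Suc_linear v v'] by (rule GA(7)[OF Pc Dc P' D'])
  finally have 2: "y = Ph s (u \<oplus>\<^bsub>TB s\<^esub> u') \<oplus>\<^bsub>TA s\<^esub> DA (s + 1) (v \<oplus>\<^bsub>TA (s + 1)\<^esub> v')" .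
  show "Q x y"
   unfolding Q_def by (rule bexI[OF _ GB(2)[OF u u']], rule bexI[OF _ GA(2)[OF v v']]) (rule conjI[OF 1 2])
 qed
 \<comment> \<open>Downward induction on the filtration index \<open>s + 1 - j\<close>; beyond
   \<open>j = s + 1\<close> the truncated difference stays 0 and the claim repeats itself.\<close>
 have "P (s + 1 - j) x y ==> Q x y" for j x y
 proof (induct j arbitrary: x y)
  case 0
  then show ?case using base by simp
 next
  case (Suc j)
  show ?case
  proof (cases "j \<le> s")
   case True
   then have "s + 1 - j = s + 1 - Suc j + 1" by simp
   then show ?thesis using step[OF Suc(2)] Suc(1) by simp
  next
   case False
   then have "s + 1 - j = s + 1 - Suc j" by simp
   then show ?thesis using Suc by simp
  qed
 qed
 from this[of "s + 1" x y] have "P 0 x y ==> Q x y" by simp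
 moreover have "P 0 x y" unfolding P_def using assms by simp
 ultimately show ?thesis unfolding Q_def by blast
qed

end

section \<open>Homology\<close>

text \<open>Negation is defined through the carrier, so restricting the carrier changes the term;
  uniqueness of inverses shows that the value is the same.\<close>

lemma submodule_uminus:
 assumes V: "module K V" and Z: "submodule Z K V" and x: "x \<in> Z"
 shows "\<ominus>\<^bsub>V\<lparr>carrier := Z\<rparr>\<^esub> x = \<ominus>\<^bsub>V\<^esub> x"
proof -
 interpret V: module K V by (rule V)
 interpret W: module K "V\<lparr>carrier := Z\<rparr>" by (rule submodule.submodule_is_module[OF Z V])
 have n: "\<ominus>\<^bsub>V\<^esub> x \<in> Z" by (rule V.submoduleE(3)[OF Z x])
 have xV: "x \<in> carrier V" using V.submoduleE(1)[OF Z] x by blast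
 show ?thesis
  by (rule W.minus_equality) (use n x V.l_neg[OF xV] in simp_all)
qed

definition cycles :: "('k, 'a) graded_module => (nat => 'a => 'a) => nat => 'a set" where
 "cycles V d n = {a \<in> carrier (V n). d n a = \<zero>\<^bsub>V (n - 1)\<^esub>}"

definition boundaries :: "('k, 'a) graded_module => (nat => 'a => 'a) => nat => 'a set" where
 "boundaries V d n = d (n + 1) ` carrier (V (n + 1))"

definition hclass :: "('k, 'a) graded_module => (nat => 'a => 'a) => nat => 'a => 'a set" where
 "hclass V d n x = boundaries V d n +>\<^bsub>(V n)\<lparr>carrier := cycles V d n\<rparr>\<^esub> x"

lemma homology_eq: "homology V d n = quotient_module ((V n)\<lparr>carrier := cycles V d n\<rparr>) (boundaries V d n)"
 by (simp add: homology_def cycles_def boundaries_def)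

context
 fixes K :: "'k ring" and V :: "('k, 'a) graded_module" and d :: "nat => 'a => 'a"
 assumes D: "differential_module K V d"
begin

lemma d_linear_suc: "d (n + 1) \<in> linear_maps K (V (n + 1)) (V n)"
 using diff_moduleD(2)[OF D, of "n + 1"] by simp

lemma cycles_submodule: "submodule (cycles V d n) K (V n)"
 unfolding cycles_def by (rule linear_kernel_submodule[OF diff_moduleD(2,1,1)[OF D]])

lemma cycles_module: "module K ((V n)\<lparr>carrier := cycles V d n\<rparr>)"
 by (rule submodule.submodule_is_module[OF cycles_submodule diff_moduleD(1)[OF D]])

lemma boundaries_subset: "boundaries V d n \<subseteq> cycles V d n"
proof
 fix x assume "x \<in> boundaries V d n"
 then obtain a where a: "a \<in> carrier (V (n + 1))" "x = d (n + 1) a" by (auto simp: boundaries_def)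
 then show "x \<in> cycles V d n"
  using linearD(1)[OF d_linear_suc a(1)] diff_moduleD(4)[OF D a(1)] by (simp add: cycles_def)
qed

lemma boundaries_submodule: "submodule (boundaries V d n) K ((V n)\<lparr>carrier := cycles V d n\<rparr>)"
proof -
 interpret Z: module K "(V n)\<lparr>carrier := cycles V d n\<rparr>" by (rule cycles_module)
 interpret V: module K "V n" by (rule diff_moduleD(1)[OF D])
 interpret V': module K "V (n + 1)" by (rule diff_moduleD(1)[OF D])
 note M = diff_moduleD(1)[OF D]
 note l = linearD[OF d_linear_suc]
 show ?thesis
 proof (rule Z.submoduleI)
  show "boundaries V d n \<subseteq> carrier ((V n)\<lparr>carrier := cycles V d n\<rparr>)" using boundaries_subset by simp
  show "\<zero>\<^bsub>(V n)\<lparr>carrier := cycles V d n\<rparr>\<^esub> \<in> boundaries V d n"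
   using linear_zero[OF d_linear_suc M M] V'.zero_closed unfolding boundaries_def by (auto intro!: rev_image_eqI)
  fix x assume x: "x \<in> boundaries V d n"
  then obtain a where a: "a \<in> carrier (V (n + 1))" "x = d (n + 1) a" by (auto simp: boundaries_def)
  have "\<ominus>\<^bsub>V n\<^esub> x = d (n + 1) (\<ominus>\<^bsub>V (n + 1)\<^esub> a)" unfolding a(2) by (rule linear_neg[OF d_linear_suc M M a(1), symmetric])
  then show "\<ominus>\<^bsub>(V n)\<lparr>carrier := cycles V d n\<rparr>\<^esub> x \<in> boundaries V d n"
   using submodule_uminus[OF M cycles_submodule subsetD[OF boundaries_subset x]] V'.a_inv_closed[OF a(1)]
   unfolding boundaries_def by (auto intro!: rev_image_eqI)
  {
   fix y assume "y \<in> boundaries V d n"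
   then obtain b where b: "b \<in> carrier (V (n + 1))" "y = d (n + 1) b" by (auto simp: boundaries_def)
   show "x \<oplus>\<^bsub>(V n)\<lparr>carrier := cycles V d n\<rparr>\<^esub> y \<in> boundaries V d n"
    using l(2)[OF a(1) b(1)] V'.a_closed[OF a(1) b(1)] a(2) b(2) unfolding boundaries_def by (auto intro!: rev_image_eqI)
  }
  fix c assume c: "c \<in> carrier K"
  show "c \<odot>\<^bsub>(V n)\<lparr>carrier := cycles V d n\<rparr>\<^esub> x \<in> boundaries V d n"
   using l(3)[OF c a(1)] V'.smult_closed[OF c a(1)] a(2) unfolding boundaries_def by (auto intro!: rev_image_eqI)
 qed
qed

lemma homology_module: "module K (homology V d n)"
 unfolding homology_eq by (rule quotient_module_module[OF cycles_module boundaries_submodule])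

lemma homology_carrier: "X \<in> carrier (homology V d n) \<longleftrightarrow> (\<exists>x \<in> cycles V d n. X = hclass V d n x)"
 unfolding homology_eq hclass_def using quotient_carrier[OF cycles_module boundaries_submodule] by simp

lemma hclass_eq_iff:
 assumes x: "x \<in> cycles V d n" and y: "y \<in> cycles V d n"
 shows "hclass V d n x = hclass V d n y \<longleftrightarrow> (\<exists>a \<in> carrier (V (n + 1)). x \<ominus>\<^bsub>V n\<^esub> y = d (n + 1) a)"
proof -
 have "x \<ominus>\<^bsub>(V n)\<lparr>carrier := cycles V d n\<rparr>\<^esub> y = x \<ominus>\<^bsub>V n\<^esub> y"
  unfolding a_minus_def submodule_uminus[OF diff_moduleD(1)[OF D] cycles_submodule y] by simp
 then show ?thesis
  unfolding hclass_def using quotient_eq_iff[OF cycles_module boundaries_submodule, of x n y] x y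
  by (auto simp: boundaries_def)
qed

lemma hclass_add:
 "x \<in> cycles V d n ==> y \<in> cycles V d n ==>
  hclass V d n x \<oplus>\<^bsub>homology V d n\<^esub> hclass V d n y = hclass V d n (x \<oplus>\<^bsub>V n\<^esub> y)"
 unfolding homology_eq hclass_def using quotient_add[OF cycles_module boundaries_submodule, of x n y] by simp

lemma hclass_smult:
 "c \<in> carrier K ==> x \<in> cycles V d n ==>
  c \<odot>\<^bsub>homology V d n\<^esub> hclass V d n x = hclass V d n (c \<odot>\<^bsub>V n\<^esub> x)"
 unfolding homology_eq hclass_def using quotient_smult[OF cycles_module boundaries_submodule, of c x n] by simp

lemma cycles_closed:
 "x \<in> cycles V d n ==> x \<in> carrier (V n)"
 "x \<in> cycles V d n ==> y \<in> cycles V d n ==> x \<oplus>\<^bsub>V n\<^esub> y \<in> cycles V d n"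
 "x \<in> cycles V d n ==> y \<in> cycles V d n ==> x \<ominus>\<^bsub>V n\<^esub> y \<in> cycles V d n"
 "c \<in> carrier K ==> x \<in> cycles V d n ==> c \<odot>\<^bsub>V n\<^esub> x \<in> cycles V d n"
 using module.submoduleE[OF diff_moduleD(1)[OF D] cycles_submodule] unfolding a_minus_def by blast+

end

lemma homology_isomorphism:
 assumes V: "differential_module K V d" and W: "differential_module K W d'"
  and \<phi>: "!!n. \<phi> n \<in> linear_maps K (V n) (W n)"
  and chain: "!!n x. x \<in> carrier (V n) ==> d' n (\<phi> n x) = \<phi> (n - 1) (d n x)"
  and inj: "!!n x y. x \<in> carrier (V n) ==> y \<in> carrier (W (n + 1)) ==> d n x = \<zero>\<^bsub>V (n - 1)\<^esub> ==> \<phi> n x = d' (n + 1) y ==>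
   \<exists>u \<in> carrier (V (n + 1)). x = d (n + 1) u"
  and surj: "!!n y. y \<in> carrier (W n) ==> d' n y = \<zero>\<^bsub>W (n - 1)\<^esub> ==>
   \<exists>u \<in> carrier (V n). \<exists>v \<in> carrier (W (n + 1)). d n u = \<zero>\<^bsub>V (n - 1)\<^esub> \<and> y = \<phi> n u \<oplus>\<^bsub>W n\<^esub> d' (n + 1) v"
 shows "graded_isomorphic K (homology V d) (homology W d')"
proof -
 note Vm = diff_moduleD(1)[OF V] and Wm = diff_moduleD(1)[OF W]
 \<comment> \<open>A homology class is a set, so the induced map is defined on a chosen
   representative. The chain map property makes the class of its image independent of the
   choice.\<close>
 define \<Psi> where "\<Psi> n X = hclass W d' n (\<phi> n (SOME x. x \<in> cycles V d n \<and> X = hclass V d n x))" for n X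
 have cyc: "\<phi> n x \<in> cycles W d' n" if "x \<in> cycles V d n" for n x
  using that chain linearD(1)[OF \<phi>] linear_zero[OF \<phi> Vm Wm] by (simp add: cycles_def)
 have diff: "\<phi> n (x \<ominus>\<^bsub>V n\<^esub> y) = \<phi> n x \<ominus>\<^bsub>W n\<^esub> \<phi> n y" if "x \<in> cycles V d n" "y \<in> cycles V d n" for n x y
  by (rule linear_minus[OF \<phi> Vm Wm]) (use that in \<open>simp_all add: cycles_def\<close>)
 have \<Psi>: "\<Psi> n (hclass V d n x) = hclass W d' n (\<phi> n x)" if x: "x \<in> cycles V d n" for n x
 proof -
  define y where "y = (SOME y. y \<in> cycles V d n \<and> hclass V d n x = hclass V d n y)"
  have y: "y \<in> cycles V d n" "hclass V d n x = hclass V d n y"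
   using someI[of "%y. y \<in> cycles V d n \<and> hclass V d n x = hclass V d n y" x] x unfolding y_def by blast+
  then obtain a where a: "a \<in> carrier (V (n + 1))" "x \<ominus>\<^bsub>V n\<^esub> y = d (n + 1) a"
   using hclass_eq_iff[OF V x y(1)] by blast
  have "\<phi> n x \<ominus>\<^bsub>W n\<^esub> \<phi> n y = d' (n + 1) (\<phi> (n + 1) a)"
   using diff[OF x y(1)] a(2) chain[OF a(1)] by simp
  then have "hclass W d' n (\<phi> n x) = hclass W d' n (\<phi> n y)"
   using hclass_eq_iff[OF W cyc[OF x] cyc[OF y(1)]] linearD(1)[OF \<phi> a(1)] by blast
  then show ?thesis unfolding \<Psi>_def y_def by simp
 qed
 have lin: "\<Psi> n \<in> linear_maps K (homology V d n) (homology W d' n)" for n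
 proof (rule linearI)
  fix X assume "X \<in> carrier (homology V d n)"
  then obtain x where x: "x \<in> cycles V d n" "X = hclass V d n x" using homology_carrier[OF V] by blast
  show "\<Psi> n X \<in> carrier (homology W d' n)" unfolding x(2) \<Psi>[OF x(1)] using homology_carrier[OF W] cyc[OF x(1)] by blast
  show "\<Psi> n (c \<odot>\<^bsub>homology V d n\<^esub> X) = c \<odot>\<^bsub>homology W d' n\<^esub> \<Psi> n X" if c: "c \<in> carrier K" for c
   unfolding x(2) hclass_smult[OF V c x(1)] \<Psi>[OF x(1)] \<Psi>[OF cycles_closed(4)[OF V c x(1)]]
    linearD(3)[OF \<phi> c cycles_closed(1)[OF V x(1)]] hclass_smult[OF W c cyc[OF x(1)]] ..
  fix Y assume "Y \<in> carrier (homology V d n)"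
  then obtain y where y: "y \<in> cycles V d n" "Y = hclass V d n y" using homology_carrier[OF V] by blast
  show "\<Psi> n (X \<oplus>\<^bsub>homology V d n\<^esub> Y) = \<Psi> n X \<oplus>\<^bsub>homology W d' n\<^esub> \<Psi> n Y"
   unfolding x(2) y(2) hclass_add[OF V x(1) y(1)] \<Psi>[OF x(1)] \<Psi>[OF y(1)] \<Psi>[OF cycles_closed(2)[OF V x(1) y(1)]]
    linearD(2)[OF \<phi> cycles_closed(1)[OF V x(1)] cycles_closed(1)[OF V y(1)]] hclass_add[OF W cyc[OF x(1)] cyc[OF y(1)]] ..
 qed
 have "bij_betw (\<Psi> n) (carrier (homology V d n)) (carrier (homology W d' n))" for n
 proof (rule bij_betwI')
  fix X Y assume "X \<in> carrier (homology V d n)" "Y \<in> carrier (homology V d n)"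
  then obtain x y where x: "x \<in> cycles V d n" "X = hclass V d n x" and y: "y \<in> cycles V d n" "Y = hclass V d n y"
   unfolding homology_carrier[OF V] by (elim bexE)
  show "(\<Psi> n X = \<Psi> n Y) = (X = Y)"
  proof
   assume "\<Psi> n X = \<Psi> n Y"
   then obtain b where b: "b \<in> carrier (W (n + 1))" "\<phi> n x \<ominus>\<^bsub>W n\<^esub> \<phi> n y = d' (n + 1) b"
    unfolding x(2) y(2) \<Psi>[OF x(1)] \<Psi>[OF y(1)] using hclass_eq_iff[OF W cyc[OF x(1)] cyc[OF y(1)]] by blast
   have z: "x \<ominus>\<^bsub>V n\<^esub> y \<in> cycles V d n" by (rule cycles_closed(3)[OF V x(1) y(1)])
   have "\<exists>u \<in> carrier (V (n + 1)). x \<ominus>\<^bsub>V n\<^esub> y = d (n + 1) u"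
    by (rule inj[OF _ b(1)]) (use z b(2) diff[OF x(1) y(1)] in \<open>simp_all add: cycles_def\<close>)
   then show "X = Y" unfolding x(2) y(2) hclass_eq_iff[OF V x(1) y(1)] .
  qed simp
 next
  fix X assume "X \<in> carrier (homology V d n)"
  then show "\<Psi> n X \<in> carrier (homology W d' n)" by (rule linearD(1)[OF lin])
 next
  fix Y assume "Y \<in> carrier (homology W d' n)"
  then obtain y where y: "y \<in> cycles W d' n" "Y = hclass W d' n y" using homology_carrier[OF W] by blast
  then obtain u v where u: "u \<in> carrier (V n)" "v \<in> carrier (W (n + 1))" "d n u = \<zero>\<^bsub>V (n - 1)\<^esub>" "y = \<phi> n u \<oplus>\<^bsub>W n\<^esub> d' (n + 1) v"
   using surj[of y n] unfolding cycles_def by blast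
  interpret W: module K "W n" by (rule Wm)
  have uc: "u \<in> cycles V d n" using u by (simp add: cycles_def)
  have c: "\<phi> n u \<in> carrier (W n)" "d' (n + 1) v \<in> carrier (W n)"
   by (rule linearD(1)[OF \<phi> u(1)], rule linearD(1)[OF d_linear_suc[OF W] u(2)])
  have "y \<ominus>\<^bsub>W n\<^esub> \<phi> n u = d' (n + 1) v \<oplus>\<^bsub>W n\<^esub> \<phi> n u \<oplus>\<^bsub>W n\<^esub> \<ominus>\<^bsub>W n\<^esub> \<phi> n u"
   unfolding u(4) a_minus_def W.a_comm[OF c] ..
  also have "... = d' (n + 1) v \<oplus>\<^bsub>W n\<^esub> (\<phi> n u \<oplus>\<^bsub>W n\<^esub> \<ominus>\<^bsub>W n\<^esub> \<phi> n u)"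
   by (rule W.a_assoc[OF c(2,1) W.a_inv_closed[OF c(1)]])
  also have "... = d' (n + 1) v" by (simp only: W.r_neg[OF c(1)] W.r_zero[OF c(2)])
  finally have "y \<ominus>\<^bsub>W n\<^esub> \<phi> n u = d' (n + 1) v" .
  then have "Y = \<Psi> n (hclass V d n u)"
   unfolding y(2) \<Psi>[OF uc] using hclass_eq_iff[OF W y(1) cyc[OF uc]] u(2) by blast
  then show "\<exists>X \<in> carrier (homology V d n). Y = \<Psi> n X" using homology_carrier[OF V] uc by blast
 qed
 then show ?thesis
  unfolding graded_isomorphic_def by (intro exI[of _ \<Psi>] allI conjI lin)
qed

lemma graded_isomorphic_sym:
 assumes V: "!!n. module K (V n)" and W: "!!n. module K (W n)" and iso: "graded_isomorphic K V W"
 shows "graded_isomorphic K W V"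
proof -
 obtain \<phi> where \<phi>: "!!n. \<phi> n \<in> linear_maps K (V n) (W n)" and bij: "!!n. bij_betw (\<phi> n) (carrier (V n)) (carrier (W n))"
  using iso unfolding graded_isomorphic_def by blast
 have "inv_into (carrier (V n)) (\<phi> n) \<in> linear_maps K (W n) (V n) \<and>
   bij_betw (inv_into (carrier (V n)) (\<phi> n)) (carrier (W n)) (carrier (V n))" for n
 proof
  interpret V: module K "V n" by (rule V)
  let ?i = "inv_into (carrier (V n)) (\<phi> n)"
  note l = linearD[OF \<phi>[of n]]
  show b: "bij_betw ?i (carrier (W n)) (carrier (V n))" by (rule bij_betw_inv_into[OF bij])
  have i: "?i y \<in> carrier (V n)" "\<phi> n (?i y) = y" if "y \<in> carrier (W n)" for y
   using that b bij_betw_inv_into_right[OF bij] by (auto dest: bij_betwE)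
  have inv: "?i y = x" if "x \<in> carrier (V n)" "\<phi> n x = y" for x y
   using that bij_betw_inv_into_left[OF bij] by blast
  show "?i \<in> linear_maps K (W n) (V n)"
   by (rule linearI) (auto simp: i l intro!: inv)
 qed
 note inv = this
 show ?thesis
  unfolding graded_isomorphic_def by (rule exI[of _ "%n. inv_into (carrier (V n)) (\<phi> n)"]) (rule allI, rule inv)
qed

lemma Tot_differential_module:
 assumes A: "graded K A" and inf: "A_infinity_algebra K A d \<pi>"
 shows "differential_module K (cyc_Tot K A) (cyc_D K A d \<pi>)"
 unfolding differential_module_def
 by (intro conjI allI ballI Tot_module[OF A] cyc_D_linear[OF A inf_d[OF A inf] inf_\<pi>[OF A inf]] cyc_D_cyc_D[OF A inf])
  (simp_all add: cyc_D_def)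

theorem corollary3p2:
 fixes K :: "'k ring"
  and A :: "nat \<Rightarrow> ('k, 'a) module"
  and d :: "nat \<Rightarrow> 'a \<Rightarrow> 'a"
  and \<mu> :: "nat \<Rightarrow> ('k, 'a) tensor \<Rightarrow> 'a"
  and \<rho> :: "nat \<Rightarrow> nat \<Rightarrow> ('k, 'a set) tensor \<Rightarrow> 'a set"
 assumes "field K"
  and "assoc_differential_algebra K A d \<mu>"
  and "A_infinity_algebra_of_homologies K A d (assoc_as_A_infinity A \<mu>) \<rho>"
 shows "graded_isomorphic K
  (cyclic_homology K A d (assoc_as_A_infinity A \<mu>))
  (cyclic_homology K (homology A d) (zero_differential (homology A d)) \<rho>)"
proof -
 let ?\<pi> = "assoc_as_A_infinity A \<mu>" and ?H = "homology A d"
 let ?z = "zero_differential ?H"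
 have K: "cring K" using assms(1) by (simp add: field_def domain_def)
 have d: "differential_module K A d" using assms(2) by (simp add: assoc_differential_algebra_def)
 have A: "graded K A" using K diff_moduleD(1)[OF d] by (simp add: graded_def)
 have infA: "A_infinity_algebra K A d ?\<pi>" by (rule assoc_as_A_infinity_algebra[OF A assms(2)])
 have B: "graded K ?H" using K homology_module[OF d] by (simp add: graded_def)
 from assms(3) obtain f g h h' where infB: "A_infinity_algebra K ?H ?z \<rho>"
  and f: "A_infinity_morphism K A d ?\<pi> ?H ?z \<rho> f" and g: "A_infinity_morphism K ?H ?z \<rho> A d ?\<pi> g"
  and h: "A_infinity_homotopy K A d ?\<pi> A d ?\<pi> (A_infinity_comp K A ?H A g f) (A_infinity_id K A) h"
  and h': "A_infinity_homotopy K ?H ?z \<rho> ?H ?z \<rho> (A_infinity_comp K ?H A ?H f g) (A_infinity_id K ?H) h'"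
  unfolding A_infinity_algebra_of_homologies_def A_infinity_homotopy_equivalence_def Let_def by blast
 have gm: "\<And>n. g n \<in> graded_maps K ?H A (n + 1) n" using g by (simp add: A_infinity_morphism_def)
 note cmp = comparison[OF A B infA infB f g h h']
 note TA = Tot_differential_module[OF A infA] and TB = Tot_differential_module[OF B infB]
 note \<phi> = cyc_phi_linear[OF B A gm]
 \<comment> \<open>The induced map goes from the complex of the homologies to that of
   \<open>A\<close>, so the isomorphism is inverted at the end.\<close>
 have "graded_isomorphic K (homology (cyc_Tot K ?H) (cyc_D K ?H ?z \<rho>)) (homology (cyc_Tot K A) (cyc_D K A d ?\<pi>))"
 proof (rule homology_isomorphism[OF TB TA \<phi>])
  show "cyc_D K A d ?\<pi> n (cyc_phi K ?H A g n x) = cyc_phi K ?H A g (n - 1) (cyc_D K ?H ?z \<rho> n x)"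
   if "x \<in> carrier (cyc_Tot K ?H n)" for n x
   by (rule cyc_phi_chain[OF B A gm infB infA g that])
  \<comment> \<open>Injectivity: the statement about \<open>x\<close> in the comparison at
    \<open>s = n + 1\<close>.\<close>
  show "\<exists>u \<in> carrier (cyc_Tot K ?H (n + 1)). x = cyc_D K ?H ?z \<rho> (n + 1) u"
   if "x \<in> carrier (cyc_Tot K ?H n)" "y \<in> carrier (cyc_Tot K A (n + 1))" "cyc_D K ?H ?z \<rho> n x = \<zero>\<^bsub>cyc_Tot K ?H (n - 1)\<^esub>"
    "cyc_phi K ?H A g n x = cyc_D K A d ?\<pi> (n + 1) y" for n x y
   using cmp[of x "n + 1" y] that by auto
  show "\<exists>u \<in> carrier (cyc_Tot K ?H n). \<exists>v \<in> carrier (cyc_Tot K A (n + 1)).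
    cyc_D K ?H ?z \<rho> n u = \<zero>\<^bsub>cyc_Tot K ?H (n - 1)\<^esub> \<and> y = cyc_phi K ?H A g n u \<oplus>\<^bsub>cyc_Tot K A n\<^esub> cyc_D K A d ?\<pi> (n + 1) v"
   if y: "y \<in> carrier (cyc_Tot K A n)" "cyc_D K A d ?\<pi> n y = \<zero>\<^bsub>cyc_Tot K A (n - 1)\<^esub>" for n y
  proof -
   note TBm = diff_moduleD(1)[OF TB] and TAm = diff_moduleD(1)[OF TA]
   interpret T: module K "cyc_Tot K ?H (n - 1)" by (rule TBm)
   \<comment> \<open>Surjectivity: the comparison at \<open>s = n\<close> with \<open>x = 0\<close>,
     which makes \<open>u\<close> a cycle.\<close>
   have "\<exists>u \<in> carrier (cyc_Tot K ?H n). \<exists>v \<in> carrier (cyc_Tot K A (n + 1)). \<zero>\<^bsub>cyc_Tot K ?H (n - 1)\<^esub> = cyc_D K ?H ?z \<rho> n u \<and>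
     y = cyc_phi K ?H A g n u \<oplus>\<^bsub>cyc_Tot K A n\<^esub> cyc_D K A d ?\<pi> (n + 1) v"
    by (rule cmp[OF T.zero_closed y(1)])
     (simp_all add: y(2) linear_zero[OF diff_moduleD(2)[OF TB] TBm TBm] linear_zero[OF \<phi> TBm TAm])
   then show ?thesis by metis
  qed
 qed
 then show ?thesis
  unfolding cyclic_homology_def
  by (rule graded_isomorphic_sym[OF homology_module[OF TB] homology_module[OF TA]])
qed

end
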